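(* Let $Q$ be $\mathbb R^n$ or $\mathbb Z^n$, let $V\in\mathrm{Pers}_{\mathrm{fp}}(Q)$ and let $Z\in\mathcal Z(Q)$. Assume that $\operatorname{Im}Z$ is nonnegative (i.e. $\operatorname{Im}Z([W])\geqslant0$ for all $W\in\mathrm{Pers}_{\mathrm{fp}}(Q)$). Then, with $Q^2_+=\{(x,y)\in Q^2: x\leqslant y\}$, the HN filtered rank invariant \[s^\bullet_{Z,V}\colon Q_+^2\times\mathbb R\to\mathbb Z,\qquad (x,y,\theta)\mapsto s^\theta_{Z,V}(x,y)\] is a semialgebraically constructible function.
   Context: Persistence modules. Fix a field $\mathbb{F}$. $Q=\mathbb R^n$ or $\mathbb Z^n$ with product order. $\mathrm{Pers}(Q)$ is the category of functors $V\colon Q\to\mathrm{Vect}_{\mathbb F}$ with all $V_q$ finite-dimensional; $\underline{\dim}_V\colon q\mapsto\dim V_q$. $\mathrm{Pers}_{\mathrm{fp}}(Q)$ is the (abelian) full subcategory of discretisable (equivalently finitely presentable) modules, i.e. those isomorphic to a left Kan extension $f_*U$ of some $U\in\mathrm{Pers}(P)$ along an order-preserving map $f\colon P\to Q$ with $P$ finite. Stability. For an abelian category $\mathcal A$, a stability condition is a group homomorphism $Z\colon K(\mathcal A)\to\mathbb C$ sending nonzero objects to $\{\operatorname{Re} z>0\}$. The slope of $V\ne0$ is $\mu_Z(V)=\operatorname{Im}Z([V])/\operatorname{Re}Z([V])$; $V\neq0$ is $Z$-semistable if $\mu_Z(W)\leqslant\mu_Z(V)$ for all nonzero subobjects $W$.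 An HN filtration of $V\neq0$ is a finite filtration $0=V^0\subsetneq\dots\subsetneq V^\ell=V$ with $Z$-semistable quotients $V^j/V^{j-1}$ of strictly decreasing slopes (unique when it exists). Write $\langle V,Z\rangle^\theta:=V^i$ where $\mu_Z(V^i/V^{i-1})\geqslant\theta>\mu_Z(V^{i+1}/V^i)$ (conventions $\mu_Z(V^0/V^{-1})=+\infty$, $\mu_Z(V^{\ell+1}/V^\ell)=-\infty$), and $\langle0,Z\rangle^\theta=0$. A stability condition over $Q$ is one on $\mathrm{Pers}_{\mathrm{fp}}(Q)$. Grid functions. A cube is a product of intervals (order-convex subsets). A grid function is a product $G=G_1\times\dots\times G_n\colon P=P_1\times\dots\times P_n\hookrightarrow Q$ where $P$ is a cube of $\mathbb Z^n$, each $G_i$ is strictly increasing, and $G_i(t)\to\pm\infty$ as $t\to\pm\infty$ if $P_i$ is unbounded in that direction. It is finite if $P$ is. $\lfloor q\rfloor_G=\max\{p: G(p)\leqslant q\}\in P\cup\{-\infty\}$ ($-\infty$ if the set is empty), $\mathrm{cub}_G(p)=\{q:\lfloor q\rfloor_G=p\}$; for $p\in P$ it is a product $\prod_i[a_i,b_i)$, $b_i\leqslant\infty$. A function $a\colon Q\to\mathbb R$ is $G$-discretisable if $a(q)=a'(\lfloor q\rfloor_G)$ for some $a'\colon P\to\mathbb R$ (with $a'(-\infty)=0$). A refinement of $G$ is a grid function $G'$ with $G=G'\circ g$ for some order-preserving $g$; it is an extension if $\operatorname{Im}G=\operatorname{Im}G'\cap c$ for some cube $c$ of $Q$. Integrals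 are for Lebesgue measure (counting measure for $\mathbb Z^n$). For a nonempty bounded cube $c$, $\delta_c(h)=\int_ch/\int_c1$, the integral being $\dim c$-dimensional, where $\dim c$ is the number of coordinates in which the projection of $c$ has nonempty interior ($\delta_{\{x\}}$ is evaluation at $x$). The faces of a bounded $\prod_i[a_i,b_i)$ are the products $\prod J_i$ with $J_i\in\{[a_i,b_i),\{a_i\},\{b_i\}\}$. $\mathcal Z(Q)$. For $G$ a finite grid function, $\mathcal Z^{\mathrm{step}}(G)$ is the set of stability conditions of the form $Z([V])=\int_Q(b+\sqrt{-1}a)\,\underline{\dim}_V$ with $a,b\colon Q\to\mathbb R$ discretisable by an extension of $G$, $a$ null on all unbounded $\mathrm{cub}_G(x)$, $x\in P\cup\{-\infty\}$, and $b$ strictly positive and integrable. $\mathcal Z(G)$ is the set of stability conditions of the form $[V]\mapsto Z([V])+\sqrt{-1}\sum_c\lambda_c\delta_c(\underline{\dim}_V)$ with $Z\in\mathcal Z^{\mathrm{step}}(G)$, the sum over faces $c$ of the bounded cubes $\mathrm{cub}_G(x)$, $x\in P$, and $\lambda_c\geqslant0$. $\mathcal Z(Q)=\bigcup_{G\text{ finite}}\mathcal Z(G)$. For $Z\in\mathcal Z(Q)$, HN filtrations along $Z$ of nonzero modules in $\mathrm{Pers}_{\mathrm{fp}}(Q)$ exist. HN filtered rank invariant. For $x\in Q$, $(T_x^*V)_y=V_{x+y}$. For $x\leqslant y$ in $Q$ and $\theta\in\mathbb R$, $s_{Z,V}^\theta(x,y)=\operatorname{rank}\big((\langle T_x^*V,Z\rangle^\theta)_{0}\to(\langle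 T_x^*V,Z\rangle^\theta)_{y-x}\big)$. Semialgebraically constructible. For a subset $X\subset\mathbb R^N$, a function $\phi\colon X\to\mathbb Z$ is semialgebraically constructible if it is a finite sum $\phi=\sum_im_i\mathbb 1_{X_i}$ with $m_i\in\mathbb Z$ and each $X_i$ a semialgebraic subset of $X$, i.e. the intersection of $X$ with a semialgebraic subset of $\mathbb R^N$. Here $X=Q^2_+\times\mathbb R\subset\mathbb R^{2n+1}$. *)

theory Defs
  imports "HOL-Analysis.Analysis" "HOL-Algebra.Free_Abelian_Groups"
begin

section \<open>Semialgebraic sets and constructible functions\<close>

inductive semialgebraic :: "'a::euclidean_space set \<Rightarrow> bool" where
  pos: "real_polynomial_function p \<Longrightarrow> semialgebraic {x. p x > 0}"
| compl: "semialgebraic S \<Longrightarrow> semialgebraic (- S)"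
| inter: "semialgebraic S \<Longrightarrow> semialgebraic T \<Longrightarrow> semialgebraic (S \<inter> T)"
| union: "semialgebraic S \<Longrightarrow> semialgebraic T \<Longrightarrow> semialgebraic (S \<union> T)"

definition semialgebraically_constructible ::
    "'a::euclidean_space set \<Rightarrow> ('a \<Rightarrow> int) \<Rightarrow> bool" where
  "semialgebraically_constructible X \<phi> \<longleftrightarrow>
     (\<exists>(k::nat) (m :: nat \<Rightarrow> int) (S :: nat \<Rightarrow> 'a set).
        (\<forall>i<k. semialgebraic (S i)) \<and>
        (\<forall>x\<in>X. \<phi> x = (\<Sum>i<k. m i * indicator (X \<inter> S i) x)))"


section \<open>The posets \<open>\<real>\<^sup>n\<close> and \<open>\<int>\<^sup>n\<close>, cubes and grid functions\<close>

text \<open>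
  Both posets are treated uniformly as the set \<open>K\<^sup>n\<close> of vectors with coordinates in
  \<open>K\<close>, where \<open>K\<close> is \<open>UNIV\<close> or \<open>\<int>\<close>. The library order on \<open>real ^ 'n\<close> is the product order.
\<close>

definition index_space :: "real set \<Rightarrow> (real ^ 'n) set" where
  "index_space K = {q. \<forall>i. q $ i \<in> K}"

definition index_measure :: "real set \<Rightarrow> (real ^ 'n) measure" where
  "index_measure K = (if K = UNIV then lborel else count_space (index_space K))"

definition order_convex_in :: "'a::linorder set \<Rightarrow> 'a set \<Rightarrow> bool" where
  "order_convex_in K I \<longleftrightarrow>
     I \<subseteq> K \<and> (\<forall>x\<in>I. \<forall>y\<in>I. \<forall>z\<in>K. x \<le> z \<and> z \<le> y \<longrightarrow> z \<in> I)"

definition is_cube :: "real set \<Rightarrow> (real ^ 'n) set \<Rightarrow> bool" where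
  "is_cube K c \<longleftrightarrow>
     (\<exists>I. (\<forall>i. order_convex_in K (I i)) \<and> c = {q. \<forall>i. q $ i \<in> I i})"

text \<open>
  A grid function \<open>G = \<Prod>i. G\<^sub>i\<close> is stored as its family of coordinate intervals \<open>P\<^sub>i \<subseteq> \<int>\<close> and
  its family of coordinate functions; values of \<open>G\<^sub>i\<close> outside \<open>P\<^sub>i\<close> are irrelevant.
\<close>

record 'n grid =
  grid_axis :: "'n \<Rightarrow> int set"
  grid_fun :: "'n \<Rightarrow> int \<Rightarrow> real"

definition grid_dom :: "'n::finite grid \<Rightarrow> (int ^ 'n) set" where
  "grid_dom G = {p. \<forall>i. p $ i \<in> grid_axis G i}"

definition grid_map :: "'n::finite grid \<Rightarrow> int ^ 'n \<Rightarrow> real ^ 'n" where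
  "grid_map G p = (\<chi> i. grid_fun G i (p $ i))"

definition is_grid :: "real set \<Rightarrow> 'n::finite grid \<Rightarrow> bool" where
  "is_grid K G \<longleftrightarrow>
     (\<forall>i. order_convex_in UNIV (grid_axis G i) \<and>
          grid_fun G i ` grid_axis G i \<subseteq> K \<and>
          strict_mono_on (grid_axis G i) (grid_fun G i) \<and>
          (\<not> bdd_above (grid_axis G i) \<longrightarrow> filterlim (grid_fun G i) at_top at_top) \<and>
          (\<not> bdd_below (grid_axis G i) \<longrightarrow> filterlim (grid_fun G i) at_bot at_bot))"

text \<open>\<open>None\<close> plays the role of \<open>-\<infinity>\<close>.\<close>

definition grid_floor :: "'n::finite grid \<Rightarrow> real ^ 'n \<Rightarrow> (int ^ 'n) option" where
  "grid_floor G q =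
     (if \<exists>p\<in>grid_dom G. grid_map G p \<le> q
      then Some (GREATEST p. p \<in> grid_dom G \<and> grid_map G p \<le> q) else None)"

definition cub :: "real set \<Rightarrow> 'n::finite grid \<Rightarrow> (int ^ 'n) option \<Rightarrow> (real ^ 'n) set" where
  "cub K G p = {q \<in> index_space K. grid_floor G q = p}"

definition discretisable_by :: "real set \<Rightarrow> 'n::finite grid \<Rightarrow> (real ^ 'n \<Rightarrow> real) \<Rightarrow> bool" where
  "discretisable_by K G a \<longleftrightarrow>
     (\<exists>a'. a' None = 0 \<and> (\<forall>q\<in>index_space K. a q = a' (grid_floor G q)))"

definition is_refinement :: "real set \<Rightarrow> 'n::finite grid \<Rightarrow> 'n grid \<Rightarrow> bool" where
  "is_refinement K G G' \<longleftrightarrow> is_grid K G' \<and>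
     (\<exists>g. g ` grid_dom G \<subseteq> grid_dom G' \<and> mono_on (grid_dom G) g \<and>
          (\<forall>p\<in>grid_dom G. grid_map G p = grid_map G' (g p)))"

definition is_extension :: "real set \<Rightarrow> 'n::finite grid \<Rightarrow> 'n grid \<Rightarrow> bool" where
  "is_extension K G G' \<longleftrightarrow> is_refinement K G G' \<and>
     (\<exists>c. is_cube K c \<and> grid_map G ` grid_dom G = grid_map G' ` grid_dom G' \<inter> c)"

text \<open>
  Only meaningful for \<open>c = \<Prod>i. [a\<^sub>i, b\<^sub>i)\<close> bounded and nonempty, which determines \<open>a\<close> and \<open>b\<close>.
\<close>

definition faces :: "real set \<Rightarrow> (real ^ 'n) set \<Rightarrow> (real ^ 'n) set set" where
  "faces K c = {{q. \<forall>i. q $ i \<in> J i} | J a b.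
     a \<in> index_space K \<and> b \<in> index_space K \<and> (\<forall>i. a $ i < b $ i) \<and>
     c = {q. \<forall>i. q $ i \<in> {a $ i..<b $ i} \<inter> K} \<and>
     (\<forall>i. J i \<in> {{a $ i..<b $ i} \<inter> K, {a $ i}, {b $ i}})}"

text \<open>
  The \<open>dim c\<close>-dimensional integral over a cube \<open>c\<close>: coordinates in which the projection of
  \<open>c\<close> has nonempty interior (relative to \<open>K\<close>) carry Lebesgue resp. counting measure; in the
  others the projection is a single point, which gets unit mass.
\<close>

definition axis_measure :: "real set \<Rightarrow> real set \<Rightarrow> real measure" where
  "axis_measure K J =
     (if (top_of_set K) interior_of J \<noteq> {}
      then (if K = UNIV then lborel else count_space K) else count_space J)"

definition cube_integral :: "real set \<Rightarrow> (real ^ 'n) set \<Rightarrow> (real ^ 'n \<Rightarrow> real) \<Rightarrow> real" where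
  "cube_integral K c h =
     (\<integral>t. indicator c (\<chi> i. t i) * h (\<chi> i. t i)
        \<partial>(\<Pi>\<^sub>M i\<in>UNIV. axis_measure K ((\<lambda>q. q $ i) ` c)))"

definition cube_average :: "real set \<Rightarrow> (real ^ 'n) set \<Rightarrow> (real ^ 'n \<Rightarrow> real) \<Rightarrow> real" where
  "cube_average K c h = cube_integral K c h / cube_integral K c (\<lambda>_. 1)"


section \<open>Persistence modules\<close>

record ('q, 'v) pmod =
  fib :: "'q \<Rightarrow> 'v set"
  tr :: "'q \<Rightarrow> 'q \<Rightarrow> 'v \<Rightarrow> 'v"

definition pullback :: "('p \<Rightarrow> 'q) \<Rightarrow> ('q, 'v) pmod \<Rightarrow> ('p, 'v) pmod" where
  "pullback f V = \<lparr>fib = (\<lambda>p. fib V (f p)), tr = (\<lambda>p p'. tr V (f p) (f p'))\<rparr>"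

text \<open>
  The spaces \<open>V\<^sub>q\<close> are finite-dimensional subspaces of one ambient vector space, which is
  arbitrary except for being infinite-dimensional, so that every pointwise finite-dimensional
  functor is isomorphic to one of this form. Values of \<open>fib\<close> and \<open>tr\<close> off the poset, and of
  \<open>tr\<close> off the fibres, are irrelevant.
\<close>

locale persistence = vector_space scale
  for scale :: "'f::field \<Rightarrow> 'v::ab_group_add \<Rightarrow> 'v" +
  fixes K :: "real set"
  assumes infinite_dimensional: "finite B \<Longrightarrow> span B \<noteq> UNIV"
    and real_or_int: "K = UNIV \<or> K = \<int>"
begin

definition linear_between :: "'v set \<Rightarrow> 'v set \<Rightarrow> ('v \<Rightarrow> 'v) \<Rightarrow> bool" where
  "linear_between A B f \<longleftrightarrow> f ` A \<subseteq> B \<and>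
     (\<forall>x\<in>A. \<forall>y\<in>A. f (x + y) = f x + f y) \<and> (\<forall>c. \<forall>x\<in>A. f (scale c x) = scale c (f x))"

definition pers_over :: "'q set \<Rightarrow> ('q \<Rightarrow> 'q \<Rightarrow> bool) \<Rightarrow> ('q, 'v) pmod set" where
  "pers_over S R = {V.
     (\<forall>p\<in>S. \<exists>B. finite B \<and> fib V p = span B) \<and>
     (\<forall>p\<in>S. \<forall>q\<in>S. R p q \<longrightarrow> linear_between (fib V p) (fib V q) (tr V p q)) \<and>
     (\<forall>p\<in>S. \<forall>v\<in>fib V p. tr V p p v = v) \<and>
     (\<forall>p\<in>S. \<forall>q\<in>S. \<forall>r\<in>S. R p q \<and> R q r \<longrightarrow>
        (\<forall>v\<in>fib V p. tr V q r (tr V p q v) = tr V p r v))}"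

definition hom_over ::
    "'q set \<Rightarrow> ('q \<Rightarrow> 'q \<Rightarrow> bool) \<Rightarrow> ('q, 'v) pmod \<Rightarrow> ('q, 'v) pmod \<Rightarrow> ('q \<Rightarrow> 'v \<Rightarrow> 'v) set" where
  "hom_over S R V W = {\<phi>.
     (\<forall>p\<in>S. linear_between (fib V p) (fib W p) (\<phi> p)) \<and>
     (\<forall>p\<in>S. \<forall>q\<in>S. R p q \<longrightarrow> (\<forall>v\<in>fib V p. \<phi> q (tr V p q v) = tr W p q (\<phi> p v)))}"

definition Pers :: "(real ^ 'n, 'v) pmod set" where
  "Pers = pers_over (index_space K) (\<le>)"

definition Hom :: "(real ^ 'n, 'v) pmod \<Rightarrow> (real ^ 'n, 'v) pmod \<Rightarrow> (real ^ 'n \<Rightarrow> 'v \<Rightarrow> 'v) set" where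
  "Hom = hom_over (index_space K) (\<le>)"

text \<open>
  \<open>V\<close> is a left Kan extension of the module \<open>U\<close> over the poset \<open>(P, r)\<close> along \<open>f\<close>, by its
  universal property: every \<open>\<psi> : U \<rightarrow> f\<^sup>*W\<close> factors uniquely through the unit \<open>\<eta> : U \<rightarrow> f\<^sup>*V\<close>.
\<close>

definition is_left_kan_extension ::
    "nat set \<Rightarrow> (nat \<times> nat) set \<Rightarrow> (nat \<Rightarrow> real ^ 'n) \<Rightarrow> (nat, 'v) pmod
      \<Rightarrow> (real ^ 'n, 'v) pmod \<Rightarrow> bool" where
  "is_left_kan_extension P r f U V \<longleftrightarrow> V \<in> Pers \<and>
     (\<exists>\<eta> \<in> hom_over P (\<lambda>p p'. (p, p') \<in> r) U (pullback f V).
        \<forall>W \<in> Pers. \<forall>\<psi> \<in> hom_over P (\<lambda>p p'. (p, p') \<in> r) U (pullback f W).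
          \<exists>\<phi> \<in> Hom V W.
            (\<forall>p\<in>P. \<forall>u\<in>fib U p. \<phi> (f p) (\<eta> p u) = \<psi> p u) \<and>
            (\<forall>\<phi>' \<in> Hom V W. (\<forall>p\<in>P. \<forall>u\<in>fib U p. \<phi>' (f p) (\<eta> p u) = \<psi> p u) \<longrightarrow>
               (\<forall>q\<in>index_space K. \<forall>v\<in>fib V q. \<phi>' q v = \<phi> q v)))"

text \<open>Every finite poset is isomorphic to one whose elements are natural numbers.\<close>

definition Pers_fp :: "(real ^ 'n, 'v) pmod set" where
  "Pers_fp = {V. \<exists>P r f U.
     finite P \<and> partial_order_on P r \<and>
     f ` P \<subseteq> index_space K \<and> (\<forall>(p, p') \<in> r. f p \<le> f p') \<and>
     U \<in> pers_over P (\<lambda>p p'. (p, p') \<in> r) \<and> is_left_kan_extension P r f U V}"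

definition is_zero :: "(real ^ 'n, 'v) pmod \<Rightarrow> bool" where
  "is_zero V \<longleftrightarrow> (\<forall>q\<in>index_space K. fib V q = {0})"

definition dim_fun :: "(real ^ 'n, 'v) pmod \<Rightarrow> real ^ 'n \<Rightarrow> nat" where
  "dim_fun V q = dim (fib V q)"

text \<open>Exactness in \<open>Pers_fp\<close> is pointwise exactness.\<close>

definition short_exact ::
    "(real ^ 'n, 'v) pmod \<Rightarrow> (real ^ 'n, 'v) pmod \<Rightarrow> (real ^ 'n, 'v) pmod
      \<Rightarrow> (real ^ 'n \<Rightarrow> 'v \<Rightarrow> 'v) \<Rightarrow> (real ^ 'n \<Rightarrow> 'v \<Rightarrow> 'v) \<Rightarrow> bool" where
  "short_exact A B C \<iota> \<pi> \<longleftrightarrow>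
     A \<in> Pers_fp \<and> B \<in> Pers_fp \<and> C \<in> Pers_fp \<and> \<iota> \<in> Hom A B \<and> \<pi> \<in> Hom B C \<and>
     (\<forall>q\<in>index_space K. inj_on (\<iota> q) (fib A q) \<and>
        \<iota> q ` fib A q = {v \<in> fib B q. \<pi> q v = 0} \<and> \<pi> q ` fib B q = fib C q)"


subsection \<open>Grothendieck group and stability conditions\<close>

definition K_relations :: "((real ^ 'n, 'v) pmod \<Rightarrow>\<^sub>0 int) set" where
  "K_relations = generate (free_Abelian_group Pers_fp)
     {frag_of B - (frag_of A + frag_of C) | A B C. \<exists>\<iota> \<pi>. short_exact A B C \<iota> \<pi>}"

definition K_group :: "((real ^ 'n, 'v) pmod \<Rightarrow>\<^sub>0 int) set monoid" where
  "K_group = free_Abelian_group Pers_fp Mod K_relations"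

definition K_class :: "(real ^ 'n, 'v) pmod \<Rightarrow> ((real ^ 'n, 'v) pmod \<Rightarrow>\<^sub>0 int) set" where
  "K_class V = K_relations #>\<^bsub>free_Abelian_group Pers_fp\<^esub> frag_of V"

definition stability_condition :: "(((real ^ 'n, 'v) pmod \<Rightarrow>\<^sub>0 int) set \<Rightarrow> complex) \<Rightarrow> bool" where
  "stability_condition Z \<longleftrightarrow>
     Z \<in> hom K_group \<lparr>carrier = UNIV, monoid.mult = (+), one = 0\<rparr> \<and>
     (\<forall>V\<in>Pers_fp. \<not> is_zero V \<longrightarrow> Re (Z (K_class V)) > 0)"

definition slope ::
    "(((real ^ 'n, 'v) pmod \<Rightarrow>\<^sub>0 int) set \<Rightarrow> complex) \<Rightarrow> (real ^ 'n, 'v) pmod \<Rightarrow> real" where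
  "slope Z V = Im (Z (K_class V)) / Re (Z (K_class V))"

text \<open>
  Subobjects in \<open>Pers_fp\<close>, represented by their families of fibres. The underlying submodule has
  to be finitely presentable itself, which is not automatic.
\<close>

definition subobjects :: "(real ^ 'n, 'v) pmod \<Rightarrow> (real ^ 'n \<Rightarrow> 'v set) set" where
  "subobjects V = {W. V\<lparr>fib := W\<rparr> \<in> Pers_fp \<and> (\<forall>q\<in>index_space K. W q \<subseteq> fib V q)}"

definition semistable ::
    "(((real ^ 'n, 'v) pmod \<Rightarrow>\<^sub>0 int) set \<Rightarrow> complex) \<Rightarrow> (real ^ 'n, 'v) pmod \<Rightarrow> bool" where
  "semistable Z V \<longleftrightarrow> V \<in> Pers_fp \<and> \<not> is_zero V \<and>
     (\<forall>W\<in>subobjects V. \<not> is_zero (V\<lparr>fib := W\<rparr>) \<longrightarrow> slope Z (V\<lparr>fib := W\<rparr>) \<le> slope Z V)"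

text \<open>
  \<open>F j\<close> is \<open>V\<^sup>j\<close> and \<open>C j\<close> is the quotient \<open>V\<^sup>j\<^sup>+\<^sup>1/V\<^sup>j\<close>, i.e. a cokernel of the inclusion.
\<close>

definition is_HN_filtration ::
    "(((real ^ 'n, 'v) pmod \<Rightarrow>\<^sub>0 int) set \<Rightarrow> complex) \<Rightarrow> (real ^ 'n, 'v) pmod \<Rightarrow> nat
      \<Rightarrow> (nat \<Rightarrow> real ^ 'n \<Rightarrow> 'v set) \<Rightarrow> (nat \<Rightarrow> (real ^ 'n, 'v) pmod) \<Rightarrow> bool" where
  "is_HN_filtration Z V l F C \<longleftrightarrow>
     (\<forall>j\<le>l. F j \<in> subobjects V) \<and>
     (\<forall>q\<in>index_space K. F 0 q = {0} \<and> F l q = fib V q) \<and>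
     (\<forall>j<l. (\<forall>q\<in>index_space K. F j q \<subseteq> F (Suc j) q) \<and>
            (\<exists>q\<in>index_space K. F j q \<noteq> F (Suc j) q) \<and>
            (\<exists>\<pi>. short_exact (V\<lparr>fib := F j\<rparr>) (V\<lparr>fib := F (Suc j)\<rparr>) (C j) (\<lambda>q v. v) \<pi>) \<and>
            semistable Z (C j)) \<and>
     (\<forall>j. Suc j < l \<longrightarrow> slope Z (C (Suc j)) < slope Z (C j))"

text \<open>
  The fibres of \<open>\<langle>V,Z\<rangle>\<^sup>\<theta>\<close>; on the poset the choice is unique, as HN filtrations are.
\<close>

definition HN_truncation ::
    "(((real ^ 'n, 'v) pmod \<Rightarrow>\<^sub>0 int) set \<Rightarrow> complex) \<Rightarrow> (real ^ 'n, 'v) pmod \<Rightarrow> real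
      \<Rightarrow> real ^ 'n \<Rightarrow> 'v set" where
  "HN_truncation Z V \<theta> =
     (if is_zero V then (\<lambda>_. {0})
      else SOME W. \<exists>l F C i. is_HN_filtration Z V l F C \<and> i \<le> l \<and> W = F i \<and>
             (i = 0 \<or> slope Z (C (i - 1)) \<ge> \<theta>) \<and> (i = l \<or> \<theta> > slope Z (C i)))"

definition HN_rank ::
    "(((real ^ 'n, 'v) pmod \<Rightarrow>\<^sub>0 int) set \<Rightarrow> complex) \<Rightarrow> (real ^ 'n, 'v) pmod
      \<Rightarrow> real ^ 'n \<Rightarrow> real ^ 'n \<Rightarrow> real \<Rightarrow> nat" where
  "HN_rank Z V x y \<theta> =
     (let T = pullback (\<lambda>z. x + z) V in dim (tr T 0 (y - x) ` HN_truncation Z T \<theta> 0))"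


subsection \<open>The stability conditions \<open>\<Z>(Q)\<close>\<close>

definition step_stability ::
    "'n::finite grid \<Rightarrow> (((real ^ 'n, 'v) pmod \<Rightarrow>\<^sub>0 int) set \<Rightarrow> complex) set" where
  "step_stability G = {Z. stability_condition Z \<and>
     (\<exists>G' a b. is_extension K G G' \<and> discretisable_by K G' a \<and> discretisable_by K G' b \<and>
        (\<forall>x \<in> insert None (Some ` grid_dom G).
           \<not> bounded (cub K G x) \<longrightarrow> (\<forall>q\<in>cub K G x. a q = 0)) \<and>
        (\<forall>q\<in>index_space K. b q > 0) \<and> integrable (index_measure K) b \<and>
        (\<forall>V\<in>Pers_fp. Z (K_class V) =
           (\<integral>q. (complex_of_real (b q) + \<i> * complex_of_real (a q)) * of_nat (dim_fun V q)
              \<partial>index_measure K)))}"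

definition grid_faces :: "'n::finite grid \<Rightarrow> (real ^ 'n) set set" where
  "grid_faces G = (\<Union>p \<in> {p \<in> grid_dom G. bounded (cub K G (Some p))}. faces K (cub K G (Some p)))"

definition grid_stability ::
    "'n::finite grid \<Rightarrow> (((real ^ 'n, 'v) pmod \<Rightarrow>\<^sub>0 int) set \<Rightarrow> complex) set" where
  "grid_stability G = {Z. stability_condition Z \<and>
     (\<exists>Z'\<in>step_stability G. \<exists>w. (\<forall>c\<in>grid_faces G. w c \<ge> 0) \<and>
        (\<forall>V\<in>Pers_fp. Z (K_class V) = Z' (K_class V) +
           \<i> * complex_of_real
             (\<Sum>c\<in>grid_faces G. w c * cube_average K c (\<lambda>q. real (dim_fun V q)))))}"

definition stability_space :: "(((real ^ 'n, 'v) pmod \<Rightarrow>\<^sub>0 int) set \<Rightarrow> complex) set" where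
  "stability_space = (\<Union>G \<in> {G. is_grid K G \<and> finite (grid_dom G)}. grid_stability G)"

end

end

theory Submission
  imports Defs
begin

text \<open>
  The Harder--Narasimhan truncation of slope \<open>\<theta>\<close> of a module \<open>T\<close> is the largest subobject on which the
  height \<open>Im Z - \<theta> Re Z\<close> is maximal (lemma \<open>HN_truncation_largest_max\<close>). This turns a statement about
  filtrations into one about a parametric optimisation problem, whose solutions are locally constant
  on the pieces of a finite semialgebraic partition provided that, up to reparametrisation, only finitely
  many dimension vectors compete and that their heights depend on the parameters in a piecewise
  polynomial way.

  Finitely presentable modules are those that live on a finite set of levels in each coordinate
  (\<open>Pers_fp_iff\<close>), and an element of the space of stability conditions is on such modules a combination
  of products of one-dimensional averages (\<open>stability_space_formula\<close>). The difficulty is that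
  subobjects may live on arbitrary other levels. A level \<open>s\<close> that belongs neither to \<open>T\<close> nor to \<open>Z\<close>
  can be moved between its neighbours \<open>e\<close> and \<open>e'\<close>, and the height is affine in its position, except
  that faces may make it jump up when \<open>e\<close> is reached, as they carry nonnegative weight. So the height
  does not decrease if the level is moved to one of its neighbours and disappears there
  (\<open>remove_level\<close>). Outside a box around the support of the imaginary part nothing is worth
  its real part, as \<open>\<theta> > 0\<close> (\<open>clip_to_box\<close>). Hence the maximisers live on the common levels
  of \<open>T\<close> and \<open>Z\<close> (\<open>reduce_to_levels\<close>), and there are finitely many possible charges. For \<open>\<theta> \<le> 0\<close> the
  truncation is all of \<open>T\<close>, by nonnegativity of the imaginary part.

  For the translates \<open>T x\<close> of a fixed module \<open>V\<close>, the levels of \<open>T x\<close> move linearly with \<open>x\<close> against those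
  of \<open>Z\<close>. Once it is known which cells of the two grids meet, the submodules in question are families of
  subspaces of fibres of \<open>V\<close> indexed by the meeting cells, independently of \<open>x\<close>, and their heights are
  sums of dimensions with weights that are piecewise polynomial in \<open>(x, \<theta>)\<close> (\<open>realise_height\<close>).
  Finitely many sign conditions on such sums decide all comparisons of heights, and so determine the
  family of the largest maximiser (\<open>fam_le\<close>). Together with the cell of \<open>y\<close> they determine the rank
  (\<open>rank_cong\<close>).
\<close>

section \<open>Semialgebraic sets and piecewise polynomial functions\<close>

lemma semialgebraic_UNIV: "semialgebraic (UNIV :: 'a::euclidean_space set)"
proof -
  have "semialgebraic {x::'a. (\<lambda>_. 1) x > (0::real)}"
    by (rule semialgebraic.pos) (rule real_polynomial_function.intros)
  then show ?thesis by simp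
qed

lemma semialgebraic_INT:
  "finite I \<Longrightarrow> (\<And>i. i \<in> I \<Longrightarrow> semialgebraic (S i)) \<Longrightarrow> semialgebraic (\<Inter>i\<in>I. S i)"
  by (induction I rule: finite_induct) (auto intro: semialgebraic_UNIV semialgebraic.inter)

lemma semialgebraic_UN:
  assumes "finite I" "\<And>i. i \<in> I \<Longrightarrow> semialgebraic (S i)"
  shows "semialgebraic (\<Union>i\<in>I. S i)"
proof -
  have "(\<Union>i\<in>I. S i) = - (\<Inter>i\<in>I. - S i)" by auto
  then show ?thesis using assms by (metis semialgebraic.compl semialgebraic_INT)
qed

lemma semialgebraic_Collect_ball:
  "finite I \<Longrightarrow> (\<And>i. i \<in> I \<Longrightarrow> semialgebraic {z. P i z}) \<Longrightarrow> semialgebraic {z. \<forall>i\<in>I. P i z}"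
  using semialgebraic_INT[of I "\<lambda>i. {z. P i z}"] by (simp add: INTER_eq)

text \<open>
  The pieces on which a function is given by one formula are cut out by the way the levels of two
  grids interleave. Rather than computing its values, it is enough to know that the function is
  determined by finitely many yes/no questions with semialgebraic answers.
\<close>

lemma constructible_if_determined:
  fixes X :: "'a::euclidean_space set"
  assumes fin: "finite \<S>" and sa: "\<And>S. S \<in> \<S> \<Longrightarrow> semialgebraic S"
    and det: "\<And>z z'. z \<in> X \<Longrightarrow> z' \<in> X \<Longrightarrow> (\<And>S. S \<in> \<S> \<Longrightarrow> z \<in> S \<longleftrightarrow> z' \<in> S) \<Longrightarrow> \<phi> z = \<phi> z'"
  shows "semialgebraically_constructible X \<phi>"
proof -
  define piece where "piece A = (\<Inter>S\<in>A. S) \<inter> (\<Inter>S\<in>\<S> - A. - S)" for A :: "'a set set"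
  define val where "val A = \<phi> (SOME z. z \<in> X \<inter> piece A)" for A
  have sap: "semialgebraic (piece A)" if "A \<subseteq> \<S>" for A
    unfolding piece_def
    by (intro semialgebraic.inter semialgebraic_INT semialgebraic.compl)
       (use that fin sa in \<open>auto intro: finite_subset\<close>)
  obtain g where g: "bij_betw g {..<card (Pow \<S>)} (Pow \<S>)"
    using ex_bij_betw_nat_finite[of "Pow \<S>"] fin by (auto simp: atLeast0LessThan)
  have *: "\<phi> z = (\<Sum>i<card (Pow \<S>). val (g i) * indicator (X \<inter> piece (g i)) z)" if z: "z \<in> X" for z
  proof -
    define A where "A = {S \<in> \<S>. z \<in> S}"
    have A: "A \<in> Pow \<S>" "z \<in> piece A" by (auto simp: A_def piece_def)
    have un: "A' = A" if "A' \<in> Pow \<S>" "z \<in> piece A'" for A'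
      using that by (auto simp: A_def piece_def)
    have "(SOME z. z \<in> X \<inter> piece A) \<in> X \<inter> piece A"
      by (rule someI[of "\<lambda>z. z \<in> X \<inter> piece A" z]) (use A z in auto)
    then have v: "val A = \<phi> z" unfolding val_def
      by (intro det) (use z in \<open>auto simp: A_def piece_def\<close>)
    have "(\<Sum>i<card (Pow \<S>). val (g i) * indicator (X \<inter> piece (g i)) z)
        = (\<Sum>A'\<in>Pow \<S>. val A' * indicator (X \<inter> piece A') z)"
      by (rule sum.reindex_bij_betw[OF g])
    also have "\<dots> = (\<Sum>A'\<in>{A}. val A' * indicator (X \<inter> piece A') z)"
    proof (rule sum.mono_neutral_right)
      show "\<forall>A'\<in>Pow \<S> - {A}. val A' * indicator (X \<inter> piece A') z = 0"
      proof
        fix A' assume "A' \<in> Pow \<S> - {A}"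
        then have "z \<notin> piece A'" using un by blast
        then show "val A' * indicator (X \<inter> piece A') z = 0" by simp
      qed
    qed (use fin A in simp_all)
    finally show ?thesis using v z A by simp
  qed
  have gs: "g i \<subseteq> \<S>" if "i < card (Pow \<S>)" for i
    using bij_betwE[OF g] that by auto
  show ?thesis unfolding semialgebraically_constructible_def
    by (rule exI[of _ "card (Pow \<S>)"], rule exI[of _ "val \<circ> g"], rule exI[of _ "piece \<circ> g"])
       (use sap gs * in auto)
qed

text \<open>
  Piecewise polynomial functions suffice for the weights below, and their closure under sums and
  products does not need projections of semialgebraic sets.
\<close>

definition piecewise_polynomial :: "('a::euclidean_space \<Rightarrow> real) \<Rightarrow> bool" where
  "piecewise_polynomial g \<longleftrightarrow>
     (\<exists>\<P>. finite \<P> \<and> (\<forall>z. \<exists>A\<in>\<P>. z \<in> fst A) \<and>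
        (\<forall>A\<in>\<P>. semialgebraic (fst A) \<and> real_polynomial_function (snd A) \<and> (\<forall>z\<in>fst A. g z = snd A z)))"

lemma piecewise_polynomialE:
  assumes "piecewise_polynomial g"
  obtains \<P> where "finite \<P>" "\<And>z. \<exists>A\<in>\<P>. z \<in> fst A"
    "\<And>A. A \<in> \<P> \<Longrightarrow> semialgebraic (fst A)" "\<And>A. A \<in> \<P> \<Longrightarrow> real_polynomial_function (snd A)"
    "\<And>A z. A \<in> \<P> \<Longrightarrow> z \<in> fst A \<Longrightarrow> g z = snd A z"
  using assms unfolding piecewise_polynomial_def by metis

lemma piecewise_polynomial_polynomial:
  "real_polynomial_function p \<Longrightarrow> piecewise_polynomial p"
  unfolding piecewise_polynomial_def
  by (rule exI[of _ "{(UNIV, p)}"]) (simp add: semialgebraic_UNIV)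

lemma piecewise_polynomial_const: "piecewise_polynomial (\<lambda>_. c)"
  by (intro piecewise_polynomial_polynomial real_polynomial_function.intros)

lemma piecewise_polynomial_linear: "bounded_linear g \<Longrightarrow> piecewise_polynomial g"
  by (intro piecewise_polynomial_polynomial real_polynomial_function.intros)

lemma piecewise_polynomial_combine:
  fixes g h :: "'a::euclidean_space \<Rightarrow> real"
  assumes g: "piecewise_polynomial g" and h: "piecewise_polynomial h"
    and op: "\<And>p q :: 'a \<Rightarrow> real. real_polynomial_function p \<Longrightarrow> real_polynomial_function q \<Longrightarrow>
                real_polynomial_function (\<lambda>z. op (p z) (q z))"
  shows "piecewise_polynomial (\<lambda>z. op (g z) (h z))"
proof -
  obtain \<P> where P: "finite \<P>" "\<And>z. \<exists>A\<in>\<P>. z \<in> fst A"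
    "\<And>A. A \<in> \<P> \<Longrightarrow> semialgebraic (fst A)" "\<And>A. A \<in> \<P> \<Longrightarrow> real_polynomial_function (snd A)"
    "\<And>A z. A \<in> \<P> \<Longrightarrow> z \<in> fst A \<Longrightarrow> g z = snd A z"
    using g by (rule piecewise_polynomialE) blast
  obtain \<R> where R: "finite \<R>" "\<And>z. \<exists>A\<in>\<R>. z \<in> fst A"
    "\<And>A. A \<in> \<R> \<Longrightarrow> semialgebraic (fst A)" "\<And>A. A \<in> \<R> \<Longrightarrow> real_polynomial_function (snd A)"
    "\<And>A z. A \<in> \<R> \<Longrightarrow> z \<in> fst A \<Longrightarrow> h z = snd A z"
    using h by (rule piecewise_polynomialE) blast
  let ?F = "\<lambda>A B. (fst A \<inter> fst B, \<lambda>z. op (snd A z) (snd B z))"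
  have cov: "\<exists>C\<in>{?F A B | A B. A \<in> \<P> \<and> B \<in> \<R>}. z \<in> fst C" for z
  proof -
    obtain A B where "A \<in> \<P>" "z \<in> fst A" "B \<in> \<R>" "z \<in> fst B" using P(2)[of z] R(2)[of z] by blast
    then show ?thesis by (intro bexI[of _ "?F A B"] CollectI exI[of _ A] exI[of _ B]) simp_all
  qed
  show ?thesis unfolding piecewise_polynomial_def
  proof (intro exI conjI allI ballI)
    show "finite {?F A B | A B. A \<in> \<P> \<and> B \<in> \<R>}"
      by (rule finite_image_set2) (use P(1) R(1) in simp_all)
    fix z show "\<exists>C\<in>{?F A B | A B. A \<in> \<P> \<and> B \<in> \<R>}. z \<in> fst C" by (rule cov)
  next
    fix C assume "C \<in> {?F A B | A B. A \<in> \<P> \<and> B \<in> \<R>}"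
    then obtain A B where C: "C = ?F A B" "A \<in> \<P>" "B \<in> \<R>" by blast
    show "semialgebraic (fst C)"
      using semialgebraic.inter[OF P(3)[OF C(2)] R(3)[OF C(3)]] C(1) by simp
    show "real_polynomial_function (snd C)"
      using op[of "snd A" "snd B"] P(4)[OF C(2)] R(4)[OF C(3)] C(1) by simp
    fix z assume "z \<in> fst C"
    then show "op (g z) (h z) = snd C z" using P(5)[OF C(2)] R(5)[OF C(3)] C(1) by simp
  qed
qed

lemma piecewise_polynomial_add:
  "piecewise_polynomial g \<Longrightarrow> piecewise_polynomial h \<Longrightarrow> piecewise_polynomial (\<lambda>z. g z + h z)"
  by (rule piecewise_polynomial_combine) (auto intro: real_polynomial_function.intros)

lemma piecewise_polynomial_mult:
  "piecewise_polynomial g \<Longrightarrow> piecewise_polynomial h \<Longrightarrow> piecewise_polynomial (\<lambda>z. g z * h z)"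
  by (rule piecewise_polynomial_combine) (auto intro: real_polynomial_function.intros)

lemma piecewise_polynomial_diff:
  "piecewise_polynomial g \<Longrightarrow> piecewise_polynomial h \<Longrightarrow> piecewise_polynomial (\<lambda>z. g z - h z)"
  by (rule piecewise_polynomial_combine) (auto intro: real_polynomial_function_diff)

lemma piecewise_polynomial_sum:
  "finite I \<Longrightarrow> (\<And>i. i \<in> I \<Longrightarrow> piecewise_polynomial (g i)) \<Longrightarrow>
     piecewise_polynomial (\<lambda>z. \<Sum>i\<in>I. g i z)"
  by (induction I rule: finite_induct) (auto intro: piecewise_polynomial_const piecewise_polynomial_add)

lemma piecewise_polynomial_prod:
  "finite I \<Longrightarrow> (\<And>i. i \<in> I \<Longrightarrow> piecewise_polynomial (g i)) \<Longrightarrow>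
     piecewise_polynomial (\<lambda>z. \<Prod>i\<in>I. g i z)"
  by (induction I rule: finite_induct) (auto intro: piecewise_polynomial_const piecewise_polynomial_mult)

lemma semialgebraic_pos:
  assumes "piecewise_polynomial g" shows "semialgebraic {z. g z > 0}"
proof -
  obtain \<P> where P: "finite \<P>" "\<And>z. \<exists>A\<in>\<P>. z \<in> fst A"
    "\<And>A. A \<in> \<P> \<Longrightarrow> semialgebraic (fst A)" "\<And>A. A \<in> \<P> \<Longrightarrow> real_polynomial_function (snd A)"
    "\<And>A z. A \<in> \<P> \<Longrightarrow> z \<in> fst A \<Longrightarrow> g z = snd A z"
    using assms by (rule piecewise_polynomialE) blast
  have "{z. g z > 0} = (\<Union>A\<in>\<P>. fst A \<inter> {z. snd A z > 0})" (is "?L = ?R")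
  proof (intro equalityI subsetI)
    fix z assume z: "z \<in> ?L"
    obtain A where "A \<in> \<P>" "z \<in> fst A" using P(2) by blast
    then show "z \<in> ?R" using P(5) z by auto
  qed (use P(5) in auto)
  moreover have "semialgebraic (\<Union>A\<in>\<P>. fst A \<inter> {z. snd A z > 0})"
    by (intro semialgebraic_UN semialgebraic.inter semialgebraic.pos P)
  ultimately show ?thesis by simp
qed

lemma semialgebraic_less:
  assumes "piecewise_polynomial g" "piecewise_polynomial h" shows "semialgebraic {z. g z < h z}"
  using semialgebraic_pos[OF piecewise_polynomial_diff[OF assms(2,1)]] by simp

lemma semialgebraic_le:
  assumes "piecewise_polynomial g" "piecewise_polynomial h" shows "semialgebraic {z. g z \<le> h z}"
proof -
  have "{z. g z \<le> h z} = - {z. h z < g z}" by auto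
  then show ?thesis using semialgebraic.compl[OF semialgebraic_less[OF assms(2,1)]] by simp
qed

lemma piecewise_polynomial_if:
  assumes g: "piecewise_polynomial g" and h: "piecewise_polynomial h" and S: "semialgebraic {z. c z}"
  shows "piecewise_polynomial (\<lambda>z. if c z then g z else h z)"
proof -
  obtain \<P> where P: "finite \<P>" "\<And>z. \<exists>A\<in>\<P>. z \<in> fst A"
    "\<And>A. A \<in> \<P> \<Longrightarrow> semialgebraic (fst A)" "\<And>A. A \<in> \<P> \<Longrightarrow> real_polynomial_function (snd A)"
    "\<And>A z. A \<in> \<P> \<Longrightarrow> z \<in> fst A \<Longrightarrow> g z = snd A z"
    using g by (rule piecewise_polynomialE) blast
  obtain \<R> where R: "finite \<R>" "\<And>z. \<exists>A\<in>\<R>. z \<in> fst A"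
    "\<And>A. A \<in> \<R> \<Longrightarrow> semialgebraic (fst A)" "\<And>A. A \<in> \<R> \<Longrightarrow> real_polynomial_function (snd A)"
    "\<And>A z. A \<in> \<R> \<Longrightarrow> z \<in> fst A \<Longrightarrow> h z = snd A z"
    using h by (rule piecewise_polynomialE) blast
  let ?A = "(\<lambda>A. (fst A \<inter> {z. c z}, snd A)) ` \<P> \<union> (\<lambda>A. (fst A \<inter> - {z. c z}, snd A)) ` \<R>"
  show ?thesis unfolding piecewise_polynomial_def
  proof (intro exI conjI allI ballI)
    show "finite ?A" using P(1) R(1) by blast
    fix z show "\<exists>A\<in>?A. z \<in> fst A"
    proof -
      obtain A B where "A \<in> \<P>" "z \<in> fst A" "B \<in> \<R>" "z \<in> fst B" using P(2)[of z] R(2)[of z] by blast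
      then show ?thesis
        using bexI[of "\<lambda>A. z \<in> fst A" "(fst A \<inter> {z. c z}, snd A)" ?A]
          bexI[of "\<lambda>A. z \<in> fst A" "(fst B \<inter> - {z. c z}, snd B)" ?A] by (cases "c z") simp_all
    qed
  next
    fix C assume C: "C \<in> ?A"
    have "semialgebraic (fst A \<inter> {z. c z})" if "A \<in> \<P>" for A
      using semialgebraic.inter[OF P(3)[OF that] S] .
    moreover have "semialgebraic (fst A \<inter> - {z. c z})" if "A \<in> \<R>" for A
      using semialgebraic.inter[OF R(3)[OF that] semialgebraic.compl[OF S]] .
    ultimately show "semialgebraic (fst C)" using C by auto
    show "real_polynomial_function (snd C)" using C P(4) R(4) by auto
    fix z assume "z \<in> fst C"
    then show "(if c z then g z else h z) = snd C z" using C P(5) R(5) by auto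
  qed
qed

lemma piecewise_polynomial_max:
  assumes "piecewise_polynomial g" "piecewise_polynomial h"
  shows "piecewise_polynomial (\<lambda>z. max (g z) (h z))"
  using piecewise_polynomial_if[OF assms(2,1) semialgebraic_le[OF assms]] by (simp add: max_def)

lemma piecewise_polynomial_min:
  assumes "piecewise_polynomial g" "piecewise_polynomial h"
  shows "piecewise_polynomial (\<lambda>z. min (g z) (h z))"
  using piecewise_polynomial_if[OF assms(1,2) semialgebraic_le[OF assms]] by (simp add: min_def)

lemma piecewise_polynomial_Min:
  "finite I \<Longrightarrow> I \<noteq> {} \<Longrightarrow> (\<And>i. i \<in> I \<Longrightarrow> piecewise_polynomial (g i)) \<Longrightarrow>
     piecewise_polynomial (\<lambda>z. Min ((\<lambda>i. g i z) ` I))"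
  by (induction I rule: finite_ne_induct) (auto intro!: piecewise_polynomial_min)

section \<open>Finite-dimensional subspaces\<close>

context persistence
begin

interpretation endo: vector_space_pair scale scale
  by unfold_locales

definition findim :: "'v set \<Rightarrow> bool" where
  "findim A \<longleftrightarrow> (\<exists>B. finite B \<and> A = span B)"

lemma findim_subspace: "findim A \<Longrightarrow> subspace A"
  unfolding findim_def by (auto simp: subspace_span)

lemma findim_basis:
  assumes "findim A"
  obtains B where "finite B" "B \<subseteq> A" "independent B" "A = span B" "card B = dim A"
proof -
  obtain B where B: "B \<subseteq> A" "independent B" "A \<subseteq> span B" "card B = dim A"
    using basis_exists by blast
  obtain C where C: "finite C" "A = span C" using assms findim_def by auto
  have "finite B" using independent_span_bound[OF C(1) B(2)] B(1) C(2) by auto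
  moreover have "A = span B" using B span_minimal[OF B(1) findim_subspace[OF assms]] by auto
  ultimately show thesis using that B by blast
qed

lemma findim_subset:
  assumes "findim A" "subspace A'" "A' \<subseteq> A" shows "findim A'"
proof -
  obtain B where B: "B \<subseteq> A'" "independent B" "A' \<subseteq> span B" using basis_exists by metis
  obtain C where C: "finite C" "A = span C" using assms findim_def by auto
  have "finite B" using independent_span_bound[OF C(1) B(2)] B(1) C(2) assms by auto
  moreover have "A' = span B" using B span_minimal[OF B(1) assms(2)] by auto
  ultimately show ?thesis unfolding findim_def by auto
qed

lemma dim_mono_findim:
  assumes "findim A" "A' \<subseteq> A" shows "dim A' \<le> dim A"
proof -
  obtain B where "finite B" "A = span B" "card B = dim A" using findim_basis[OF assms(1)] by metis
  then show ?thesis using dim_le_card[of A' B] assms by auto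
qed

text \<open>
  Maps are linear on fibres only; extending them to the whole space gives access to the results on
  linear maps and dimensions.
\<close>

lemma linear_between_extends:
  assumes "subspace A" "linear_between A A' f"
  obtains g where "Vector_Spaces.linear scale scale g" "\<And>x. x \<in> A \<Longrightarrow> g x = f x"
proof -
  obtain B where B: "B \<subseteq> A" "independent B" "A \<subseteq> span B" using basis_exists by metis
  have AB: "A = span B" using B span_minimal[OF B(1) assms(1)] by auto
  define g where "g = endo.construct B f"
  have lin: "Vector_Spaces.linear scale scale g"
    unfolding g_def by (rule endo.linear_construct[OF B(2)])
  have gb: "g b = f b" if "b \<in> B" for b
    unfolding g_def by (rule endo.construct_basis[OF B(2) that])
  have f: "f (x + y) = f x + f y" "f (scale c x) = scale c (f x)" if "x \<in> A" "y \<in> A" for x y c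
    using assms(2) that unfolding linear_between_def by auto
  have f0: "f 0 = 0" using f(2)[of 0 0 0] assms(1) by (auto simp: subspace_def)
  have "g x = f x" if "x \<in> A" for x
  proof -
    have "x \<in> span B" using that AB by auto
    then have "x \<in> A \<and> g x = f x"
    proof (induction rule: span_induct_alt)
      case base
      then show ?case using f0 assms(1) endo.linear_0[OF lin] by (auto simp: subspace_def)
    next
      case (step c x y)
      then have "x \<in> A" "y \<in> A" using B by auto
      moreover have "scale c x \<in> A" using \<open>x \<in> A\<close> assms(1) by (auto simp: subspace_def)
      ultimately show ?case
        using f step gb[of x] assms(1) endo.linear_add[OF lin] endo.linear_scale[OF lin]
        by (auto simp: subspace_def)
    qed
    then show ?thesis by simp
  qed
  then show thesis using that lin by blast
qed

lemma linear_between_image: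
  assumes "findim A" "linear_between A A' f"
  shows "findim (f ` A)"
proof -
  obtain g where g: "Vector_Spaces.linear scale scale g" "\<And>x. x \<in> A \<Longrightarrow> g x = f x"
    using linear_between_extends[OF findim_subspace[OF assms(1)] assms(2)] by metis
  obtain C where C: "finite C" "A = span C" using assms findim_def by auto
  have "f ` A = g ` span C" using g C by auto
  then have "f ` A = span (g ` C)" using endo.linear_span_image[OF g(1)] by auto
  then show ?thesis unfolding findim_def using C by auto
qed

lemma dim_linear_image:
  assumes "findim A" "linear_between A A' f" "inj_on f A"
  shows "dim (f ` A) = dim A"
proof -
  obtain g where g: "Vector_Spaces.linear scale scale g" "\<And>x. x \<in> A \<Longrightarrow> g x = f x"
    using linear_between_extends[OF findim_subspace[OF assms(1)] assms(2)] by metis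
  obtain B where B: "finite B" "B \<subseteq> A" "independent B" "A = span B" "card B = dim A"
    using findim_basis[OF assms(1)] by metis
  have inj: "inj_on g (span B)" using assms(3) g(2) B(4) inj_on_cong by metis
  have "independent (g ` B)"
    using endo.linear_independent_injective_image[OF g(1) B(3) inj] .
  moreover have "f ` A = g ` span B" using g B(4) by auto
  then have "f ` A = span (g ` B)" using endo.linear_span_image[OF g(1)] by auto
  ultimately have "dim (f ` A) = card (g ` B)" using dim_span_eq_card_independent by auto
  also have "\<dots> = card B" using inj span_superset[of B] by (intro card_image) (auto intro: inj_on_subset)
  finally show ?thesis using B by simp
qed

text \<open>
  Quotients are realised inside the given vector space, as complements: the map below is the
  projection of \<open>B\<close> along \<open>A\<close> onto some complement of \<open>A\<close>.
\<close>

lemma projection_exists: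
  assumes "findim B" "subspace A" "A \<subseteq> B"
  shows "\<exists>f. linear_between B B f \<and> (\<forall>v\<in>B. f v = 0 \<longleftrightarrow> v \<in> A) \<and>
    (\<forall>v\<in>B. v - f v \<in> A) \<and> (\<forall>v\<in>B. f (f v) = f v)"
proof -
  obtain SA where SA: "finite SA" "SA \<subseteq> A" "independent SA" "A = span SA"
    using findim_basis[OF findim_subset[OF assms]] by metis
  obtain SB where SB: "SA \<subseteq> SB" "SB \<subseteq> B" "independent SB" "B \<subseteq> span SB"
    using maximal_independent_subset_extend[of SA B] SA assms(3) by blast
  have B: "B = span SB" using SB span_minimal[OF SB(2) findim_subspace[OF assms(1)]] by auto
  define g where "g = endo.construct SB (\<lambda>b. if b \<in> SA then 0 else b)"
  have lin: "Vector_Spaces.linear scale scale g"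
    unfolding g_def by (rule endo.linear_construct[OF SB(3)])
  have gb: "g b = (if b \<in> SA then 0 else b)" if "b \<in> SB" for b
    unfolding g_def by (rule endo.construct_basis[OF SB(3) that])
  have gA: "g v = 0" if "v \<in> A" for v
  proof -
    have "v \<in> span SA" using that SA by auto
    then show ?thesis
    proof (induction rule: span_induct_alt)
      case base then show ?case using endo.linear_0[OF lin] by simp
    next
      case (step c x y)
      then show ?case using gb[of x] SB(1) endo.linear_add[OF lin] endo.linear_scale[OF lin] by auto
    qed
  qed
  have gd: "v - g v \<in> A" if "v \<in> B" for v
  proof -
    have "v \<in> span SB" using that B by auto
    then show ?thesis
    proof (induction rule: span_induct_alt)
      case base then show ?case using endo.linear_0[OF lin] assms(2) by (simp add: subspace_def)
    next
      case (step c x y)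
      have "x - g x \<in> A" using gb[OF step(1)] assms(2) SA(2) by (auto simp: subspace_def)
      then have "scale c (x - g x) + (y - g y) \<in> A" using step assms(2) by (simp add: subspace_def)
      moreover have "scale c x + y - g (scale c x + y) = scale c (x - g x) + (y - g y)"
        by (simp add: endo.linear_add[OF lin] endo.linear_scale[OF lin] scale_right_diff_distrib)
      ultimately show ?case by (simp only:)
    qed
  qed
  have sB: "subspace B" using assms(1) by (rule findim_subspace)
  have gB: "g v \<in> B" if "v \<in> B" for v
    using subspace_diff[OF sB that, of "v - g v"] gd[OF that] assms(3) by auto
  show ?thesis
  proof (intro exI[of _ g] conjI ballI)
    show "linear_between B B g" unfolding linear_between_def
      using gB endo.linear_add[OF lin] endo.linear_scale[OF lin] by auto
    fix v assume v: "v \<in> B"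
    show "g v = 0 \<longleftrightarrow> v \<in> A" using gA gd[OF v] by auto
    show "v - g v \<in> A" using gd[OF v] .
    show "g (g v) = g v" using gA[OF gd[OF v]] endo.linear_diff[OF lin, of v "g v"] by simp
  qed
qed

lemma linear_betweenD:
  assumes "linear_between A B f"
  shows "x \<in> A \<Longrightarrow> f x \<in> B" "x \<in> A \<Longrightarrow> y \<in> A \<Longrightarrow> f (x + y) = f x + f y"
    "x \<in> A \<Longrightarrow> f (scale c x) = scale c (f x)"
  using assms unfolding linear_between_def by auto

lemma linear_between_diff:
  assumes "linear_between A B f" "subspace A" "x \<in> A" "y \<in> A"
  shows "f (x - y) = f x - f y"
proof -
  have "x - y \<in> A" using assms by (simp add: subspace_diff)
  then have "f ((x - y) + y) = f (x - y) + f y" using linear_betweenD(2)[OF assms(1) _ assms(4)] by blast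
  then show ?thesis by simp
qed

lemma linear_between_0:
  assumes "linear_between A B f" "subspace A" shows "f 0 = 0"
  using linear_between_diff[OF assms, of 0 0] assms(2) by (simp add: subspace_0)

lemma linear_between_mono:
  "linear_between A B f \<Longrightarrow> A' \<subseteq> A \<Longrightarrow> f ` A' \<subseteq> B' \<Longrightarrow> linear_between A' B' f"
  unfolding linear_between_def by blast

lemma linear_between_comp:
  "linear_between A B f \<Longrightarrow> linear_between B C g \<Longrightarrow> linear_between A C (\<lambda>v. g (f v))"
  unfolding linear_between_def by (auto simp: image_subset_iff)

lemma subspace_linear_image:
  assumes "linear_between A B f" "subspace A" shows "subspace (f ` A)"
  unfolding subspace_def
proof (intro conjI ballI allI)
  show "0 \<in> f ` A" using linear_between_0[OF assms] subspace_0[OF assms(2)] by (metis imageI)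
next
  fix x y assume "x \<in> f ` A" "y \<in> f ` A"
  then obtain u v where "u \<in> A" "v \<in> A" "x = f u" "y = f v" by blast
  then show "x + y \<in> f ` A" using linear_betweenD(2)[OF assms(1)] subspace_add[OF assms(2)] by (metis imageI)
next
  fix c x assume "x \<in> f ` A"
  then obtain u where "u \<in> A" "x = f u" by blast
  then show "scale c x \<in> f ` A" using linear_betweenD(3)[OF assms(1)] subspace_scale[OF assms(2)] by (metis imageI)
qed

lemma subspace_linear_preimage:
  assumes "linear_between A B f" "subspace A" "subspace C" shows "subspace {v \<in> A. f v \<in> C}"
  using assms linear_between_0[OF assms(1,2)] linear_betweenD(2,3)[OF assms(1)]
  unfolding subspace_def by auto

lemma findim_zero: "findim {0}"
  unfolding findim_def by (rule exI[of _ "{}"]) simp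

lemma findim_image_of_subspace:
  assumes "linear_between A B f" "findim A" "subspace A'" "A' \<subseteq> A" shows "findim (f ` A')"
  using linear_between_image[OF findim_subset[OF assms(2-4)] linear_between_mono[OF assms(1,4) order_refl]] .

end

section \<open>Levels and cells\<close>

text \<open>
  A finite grid is given by a finite set \<open>E i\<close> of levels in each coordinate. Its cells are the
  classes of \<open>same E\<close>; a module or function lives on the grid if it does not change within cells
  and vanishes outside \<open>above E\<close>. Levels, unlike grid functions, can be united.
\<close>

definition same :: "('n \<Rightarrow> real set) \<Rightarrow> real ^ 'n \<Rightarrow> real ^ 'n \<Rightarrow> bool" where
  "same E p q \<longleftrightarrow> (\<forall>i. \<forall>e\<in>E i. e \<le> q $ i \<longleftrightarrow> e \<le> p $ i)"

definition above :: "('n \<Rightarrow> real set) \<Rightarrow> real ^ 'n \<Rightarrow> bool" where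
  "above E q \<longleftrightarrow> (\<forall>i. \<exists>e\<in>E i. e \<le> q $ i)"

text \<open>
  The least point of the cell of \<open>q\<close>, if \<open>above E q\<close>; in a coordinate without a level below \<open>q\<close> the
  value is the unspecified maximum of the empty set.
\<close>

definition flr :: "('n \<Rightarrow> real set) \<Rightarrow> real ^ 'n \<Rightarrow> real ^ 'n" where
  "flr E q = (\<chi> i. Max {e \<in> E i. e \<le> q $ i})"

definition pts :: "('n \<Rightarrow> real set) \<Rightarrow> (real ^ 'n) set" where
  "pts E = {p. \<forall>i. p $ i \<in> E i}"

definition levels :: "real set \<Rightarrow> ('n \<Rightarrow> real set) \<Rightarrow> bool" where
  "levels K E \<longleftrightarrow> (\<forall>i. finite (E i) \<and> E i \<subseteq> K)"

lemma levels_finite: "levels K E \<Longrightarrow> finite (E i)"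
  and levels_subset: "levels K E \<Longrightarrow> e \<in> E i \<Longrightarrow> e \<in> K"
  unfolding levels_def by auto

lemma levels_Un: "levels K E \<Longrightarrow> levels K F \<Longrightarrow> levels K (\<lambda>i. E i \<union> F i)"
  unfolding levels_def by auto

lemma same_sym: "same E p q \<Longrightarrow> same E q p"
  unfolding same_def by auto

lemma same_trans: "same E p q \<Longrightarrow> same E q r \<Longrightarrow> same E p r"
  unfolding same_def by auto

lemma same_mono: "same F p q \<Longrightarrow> (\<And>i. E i \<subseteq> F i) \<Longrightarrow> same E p q"
  unfolding same_def by blast

lemma above_mono: "above E p \<Longrightarrow> p \<le> q \<Longrightarrow> above E q"
  unfolding above_def less_eq_vec_def by (meson order_trans)

lemma above_same: "same E p q \<Longrightarrow> above E p \<longleftrightarrow> above E q"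
  unfolding above_def same_def by auto

lemma above_subset: "above E q \<Longrightarrow> (\<And>i. E i \<subseteq> F i) \<Longrightarrow> above F q"
  unfolding above_def by blast

lemma finite_pts: fixes E :: "'n::finite \<Rightarrow> real set" assumes "levels K E" shows "finite (pts E)"
proof -
  have "pts E \<subseteq> vec_lambda ` (PiE UNIV E)"
  proof
    fix p assume "p \<in> pts E"
    then have "vec_nth p \<in> PiE UNIV E" by (auto simp: pts_def)
    moreover have "p = vec_lambda (vec_nth p)" by simp
    ultimately show "p \<in> vec_lambda ` (PiE UNIV E)" by blast
  qed
  moreover have "finite (PiE UNIV E)" using assms by (intro finite_PiE) (auto simp: levels_def)
  ultimately show ?thesis using finite_subset finite_imageI by blast
qed

lemma pts_index_space: "levels K E \<Longrightarrow> p \<in> pts E \<Longrightarrow> p \<in> index_space K"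
  unfolding pts_def index_space_def levels_def by blast

lemma above_pts: "p \<in> pts E \<Longrightarrow> above E p"
  unfolding above_def pts_def by blast

lemma flr_coord:
  assumes "levels K E" "above E q"
  shows "flr E q $ i \<in> E i" "flr E q $ i \<le> q $ i" "e \<in> E i \<Longrightarrow> e \<le> q $ i \<Longrightarrow> e \<le> flr E q $ i"
proof -
  let ?S = "{e \<in> E i. e \<le> q $ i}"
  have "finite ?S" "?S \<noteq> {}" using assms by (auto simp: levels_def above_def)
  then have "Max ?S \<in> ?S" "\<forall>e\<in>?S. e \<le> Max ?S" using Max_in[of ?S] Max_ge[of ?S] by blast+
  moreover have "flr E q $ i = Max ?S" by (simp add: flr_def)
  ultimately show "flr E q $ i \<in> E i" "flr E q $ i \<le> q $ i" "e \<in> E i \<Longrightarrow> e \<le> q $ i \<Longrightarrow> e \<le> flr E q $ i"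
    by auto
qed

lemma flr_pts: "levels K E \<Longrightarrow> above E q \<Longrightarrow> flr E q \<in> pts E"
  using flr_coord(1) by (auto simp: pts_def)

lemma flr_le: "levels K E \<Longrightarrow> above E q \<Longrightarrow> flr E q \<le> q"
  using flr_coord(2) by (auto simp: less_eq_vec_def)

lemma flr_greatest:
  assumes "levels K E" "p \<in> pts E" "p \<le> q" shows "p \<le> flr E q"
proof -
  have "above E q" using above_mono[OF above_pts[OF assms(2)] assms(3)] .
  then show ?thesis using flr_coord(3)[OF assms(1)] assms(2,3) by (auto simp: less_eq_vec_def pts_def)
qed

lemma same_flr: assumes "levels K E" "above E q" shows "same E (flr E q) q"
  unfolding same_def
proof (intro allI ballI iffI)
  fix i e assume "e \<in> E i" "e \<le> q $ i" then show "e \<le> flr E q $ i" using flr_coord(3)[OF assms] by blast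
next
  fix i e assume "e \<in> E i" "e \<le> flr E q $ i" then show "e \<le> q $ i" using flr_coord(2)[OF assms, of i] by simp
qed

lemma flr_cong: "same E p q \<Longrightarrow> flr E p = flr E q"
  unfolding same_def flr_def by (auto intro!: arg_cong[where f=vec_lambda] arg_cong[where f=Max])

lemma flr_of_pts: assumes "levels K E" "p \<in> pts E" shows "flr E p = p"
  using flr_le[OF assms(1) above_pts[OF assms(2)]] flr_greatest[OF assms order_refl] by (rule order_antisym)

lemma flr_index_space: "levels K E \<Longrightarrow> above E q \<Longrightarrow> flr E q \<in> index_space K"
  using flr_pts pts_index_space by blast

lemma flr_mono:
  assumes "levels K E" "above E p" "p \<le> q" shows "flr E p \<le> flr E q"
  using flr_greatest[OF assms(1) flr_pts[OF assms(1,2)]] flr_le[OF assms(1,2)] assms(3) by (meson order_trans)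

lemma flr_eqI:
  assumes "levels K E" "p \<in> pts E" "same E p q" shows "flr E q = p"
  using flr_cong[OF assms(3)] flr_of_pts[OF assms(1,2)] by simp

lemma above_flr: "levels K E \<Longrightarrow> above E q \<Longrightarrow> above E (flr E q)"
  using flr_pts above_pts by blast

section \<open>Finitely presentable modules\<close>

context persistence
begin

abbreviation IS :: "(real ^ 'n) set" where "IS \<equiv> index_space K"

lemma K_add: "x \<in> K \<Longrightarrow> y \<in> K \<Longrightarrow> x + y \<in> K"
  and K_diff: "x \<in> K \<Longrightarrow> y \<in> K \<Longrightarrow> x - y \<in> K"
  and K_0: "0 \<in> K" and K_1: "1 \<in> K"
  using real_or_int by auto

lemma IS_add: "x \<in> IS \<Longrightarrow> y \<in> IS \<Longrightarrow> x + y \<in> IS"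
  and IS_0: "0 \<in> IS"
  using K_add K_diff K_0 by (auto simp: index_space_def)

lemma Pers_findim: "V \<in> Pers \<Longrightarrow> q \<in> IS \<Longrightarrow> findim (fib V q)"
  unfolding Pers_def pers_over_def findim_def by auto

lemma Pers_subspace: "V \<in> Pers \<Longrightarrow> q \<in> IS \<Longrightarrow> subspace (fib V q)"
  by (rule findim_subspace[OF Pers_findim])

lemma Pers_linear: "V \<in> Pers \<Longrightarrow> p \<in> IS \<Longrightarrow> q \<in> IS \<Longrightarrow> p \<le> q \<Longrightarrow>
   linear_between (fib V p) (fib V q) (tr V p q)"
  unfolding Pers_def pers_over_def by auto

lemma Pers_tr: "V \<in> Pers \<Longrightarrow> p \<in> IS \<Longrightarrow> q \<in> IS \<Longrightarrow> p \<le> q \<Longrightarrow> v \<in> fib V p \<Longrightarrow> tr V p q v \<in> fib V q"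
  using Pers_linear linear_betweenD(1) by blast

lemma Pers_id: "V \<in> Pers \<Longrightarrow> p \<in> IS \<Longrightarrow> v \<in> fib V p \<Longrightarrow> tr V p p v = v"
  unfolding Pers_def pers_over_def by auto

lemma Pers_comp: "V \<in> Pers \<Longrightarrow> p \<in> IS \<Longrightarrow> q \<in> IS \<Longrightarrow> r \<in> IS \<Longrightarrow> p \<le> q \<Longrightarrow> q \<le> r \<Longrightarrow> v \<in> fib V p \<Longrightarrow>
   tr V q r (tr V p q v) = tr V p r v"
  unfolding Pers_def pers_over_def by simp

lemma PersI:
  assumes "\<And>q. q \<in> IS \<Longrightarrow> findim (fib V q)"
    "\<And>p q. p \<in> IS \<Longrightarrow> q \<in> IS \<Longrightarrow> p \<le> q \<Longrightarrow> linear_between (fib V p) (fib V q) (tr V p q)"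
    "\<And>p v. p \<in> IS \<Longrightarrow> v \<in> fib V p \<Longrightarrow> tr V p p v = v"
    "\<And>p q r v. p \<in> IS \<Longrightarrow> q \<in> IS \<Longrightarrow> r \<in> IS \<Longrightarrow> p \<le> q \<Longrightarrow> q \<le> r \<Longrightarrow> v \<in> fib V p \<Longrightarrow>
       tr V q r (tr V p q v) = tr V p r v"
  shows "V \<in> Pers"
  unfolding Pers_def pers_over_def using assms
  by (intro CollectI conjI ballI impI) (simp_all add: findim_def)

text \<open>
  The reformulation of finite presentability that is used throughout: it speaks of the module alone,
  and levels can be added at will.
\<close>

definition adapted :: "('n \<Rightarrow> real set) \<Rightarrow> (real ^ 'n, 'v) pmod \<Rightarrow> bool" where
  "adapted E V \<longleftrightarrow> (\<forall>q\<in>IS. \<not> above E q \<longrightarrow> fib V q = {0}) \<and>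
     (\<forall>p\<in>IS. \<forall>q\<in>IS. p \<le> q \<and> same E p q \<longrightarrow> bij_betw (tr V p q) (fib V p) (fib V q))"

lemma adapted_zero: "adapted E V \<Longrightarrow> q \<in> IS \<Longrightarrow> \<not> above E q \<Longrightarrow> fib V q = {0}"
  unfolding adapted_def by simp

lemma adapted_bij: "adapted E V \<Longrightarrow> p \<in> IS \<Longrightarrow> q \<in> IS \<Longrightarrow> p \<le> q \<Longrightarrow> same E p q \<Longrightarrow>
    bij_betw (tr V p q) (fib V p) (fib V q)"
  unfolding adapted_def by simp

lemma adapted_mono:
  assumes "adapted E V" "\<And>i. E i \<subseteq> F i" shows "adapted F V"
  unfolding adapted_def
proof (intro conjI ballI impI)
  fix q assume "q \<in> IS" "\<not> above F q"
  then show "fib V q = {0}" using adapted_zero[OF assms(1)] above_subset[of E q F] assms(2) by metis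
next
  fix p q assume "p \<in> IS" "q \<in> IS" "p \<le> q \<and> same F p q"
  then show "bij_betw (tr V p q) (fib V p) (fib V q)"
    using adapted_bij[OF assms(1)] same_mono[of F p q E] assms(2) by metis
qed

lemma adapted_if_flr:
  assumes V: "V \<in> Pers" and E: "levels K E"
    and zero: "\<And>q. q \<in> IS \<Longrightarrow> \<not> above E q \<Longrightarrow> fib V q = {0}"
    and bij: "\<And>q. q \<in> IS \<Longrightarrow> above E q \<Longrightarrow> bij_betw (tr V (flr E q) q) (fib V (flr E q)) (fib V q)"
  shows "adapted E V"
  unfolding adapted_def
proof (intro conjI ballI impI)
  fix p q assume pq: "p \<in> IS" "q \<in> IS" "p \<le> q \<and> same E p q"
  show "bij_betw (tr V p q) (fib V p) (fib V q)"
  proof (cases "above E p")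
    case False
    then have "\<not> above E q" using above_same pq by blast
    then have "fib V p = {0}" "fib V q = {0}" using False zero pq by auto
    moreover have "tr V p q 0 = 0"
      using linear_between_0[OF Pers_linear[OF V] Pers_subspace[OF V]] pq by blast
    ultimately show ?thesis by (simp add: bij_betw_def)
  next
    case True
    then have q: "above E q" using above_same pq by blast
    have g: "flr E p = flr E q" using flr_cong pq by blast
    let ?g = "flr E p"
    have g': "?g \<in> IS" "?g \<le> p" using flr_index_space[OF E True] flr_le[OF E True] by auto
    have b1: "bij_betw (tr V ?g p) (fib V ?g) (fib V p)" using bij[OF pq(1) True] .
    have b2: "bij_betw (tr V ?g q) (fib V ?g) (fib V q)" using bij[OF pq(2) q] g by simp
    have "bij_betw (\<lambda>v. tr V p q (tr V ?g p v)) (fib V ?g) (fib V q)"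
      using b2 Pers_comp[OF V g'(1) pq(1,2) g'(2)] pq(3) by (simp cong: bij_betw_cong)
    then have "bij_betw (tr V p q \<circ> tr V ?g p) (fib V ?g) (fib V q)" by (simp add: o_def)
    then show ?thesis using bij_betw_comp_iff[OF b1] by blast
  qed
qed (use zero in blast)

text \<open>
  If \<open>V\<close> is a left Kan extension along \<open>f\<close>, the coordinates of the image of \<open>f\<close> can serve as levels. The
  module \<open>V'\<close> that has over each cell the fibre of \<open>V\<close> at its corner receives the same maps from the
  given diagram and maps to \<open>V\<close>. The universal property gives a map from \<open>V\<close> to \<open>V'\<close>, and its uniqueness
  part makes the composite on \<open>V\<close> the identity. At the corners \<open>V\<close> and \<open>V'\<close> agree, so that the transport
  from the corner to a point of its cell is inverse to the map to \<open>V'\<close> there.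
\<close>

lemma fp_imp_adapted:
  fixes V :: "(real ^ 'n, 'v) pmod"
  assumes "V \<in> Pers_fp" shows "\<exists>E. levels K E \<and> adapted E V"
proof -
  obtain P r f U where P: "finite P" "f ` P \<subseteq> IS" "U \<in> pers_over P (\<lambda>p p'. (p, p') \<in> r)"
    "is_left_kan_extension P r f U V"
    using assms unfolding Pers_fp_def by blast
  let ?R = "\<lambda>p p'. (p, p') \<in> r"
  have V: "V \<in> Pers" using P(4) unfolding is_left_kan_extension_def by blast
  obtain \<eta> where \<eta>: "\<eta> \<in> hom_over P ?R U (pullback f V)"
    and univ': "\<forall>W\<in>Pers. \<forall>\<psi>\<in>hom_over P ?R U (pullback f W).
          \<exists>\<phi> \<in> Hom V W. (\<forall>p\<in>P. \<forall>u\<in>fib U p. \<phi> (f p) (\<eta> p u) = \<psi> p u) \<and>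
            (\<forall>\<phi>' \<in> Hom V W. (\<forall>p\<in>P. \<forall>u\<in>fib U p. \<phi>' (f p) (\<eta> p u) = \<psi> p u) \<longrightarrow>
               (\<forall>q\<in>IS. \<forall>v\<in>fib V q. \<phi>' q v = \<phi> q v))"
    using P(4)[unfolded is_left_kan_extension_def, THEN conjunct2] by (rule bexE)
  note univ = univ'[rule_format]
  define E where "E i = (\<lambda>p. f p $ i) ` P" for i
  have E: "levels K E" using P(1,2) unfolding levels_def E_def index_space_def by auto
  have fpts: "f p \<in> pts E" if "p \<in> P" for p using that unfolding pts_def E_def by auto
  define V' where "V' = \<lparr>fib = \<lambda>q. if above E q then fib V (flr E q) else {0},
    tr = \<lambda>p q v. if above E p then tr V (flr E p) (flr E q) v else 0\<rparr>"
  have fib': "fib V' q = (if above E q then fib V (flr E q) else {0})" for q by (simp add: V'_def)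
  have tr': "tr V' p q = (\<lambda>v. if above E p then tr V (flr E p) (flr E q) v else 0)" for p q
    by (simp add: V'_def)
  note fi = flr_index_space[OF E] and fm = flr_mono[OF E] and fl = flr_le[OF E]
  have V': "V' \<in> Pers"
  proof (rule PersI)
    fix q :: "real ^ 'n" assume "q \<in> IS" then show "findim (fib V' q)"
      using Pers_findim[OF V fi] findim_zero by (auto simp: fib')
  next
    fix p q :: "real ^ 'n" assume pq: "p \<in> IS" "q \<in> IS" "p \<le> q"
    show "linear_between (fib V' p) (fib V' q) (tr V' p q)"
    proof (cases "above E p")
      case True
      then show ?thesis using Pers_linear[OF V fi fi fm] above_mono[OF True pq(3)] pq
        by (auto simp: fib' tr')
    next
      case False
      have "0 \<in> fib V' q" using subspace_0[OF Pers_subspace[OF V fi]] by (auto simp: fib')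
      then show ?thesis using False by (auto simp: fib' tr' linear_between_def)
    qed
  next
    fix p :: "real ^ 'n" and v assume "p \<in> IS" "v \<in> fib V' p"
    then show "tr V' p p v = v" using Pers_id[OF V fi] by (auto simp: fib' tr' split: if_splits)
  next
    fix p q r :: "real ^ 'n" and v assume a: "p \<in> IS" "q \<in> IS" "r \<in> IS" "p \<le> q" "q \<le> r" "v \<in> fib V' p"
    show "tr V' q r (tr V' p q v) = tr V' p r v"
    proof (cases "above E p")
      case True
      then have ab: "above E q" "above E r" using above_mono a by blast+
      show ?thesis using Pers_comp[OF V fi[OF True] fi[OF ab(1)] fi[OF ab(2)] fm[OF True a(4)] fm[OF ab(1) a(5)]] a(6) True ab
        by (simp add: fib' tr')
    next
      case False
      have "tr V (flr E q) (flr E r) 0 = 0" if "above E q"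
        using linear_between_0[OF Pers_linear[OF V] Pers_subspace[OF V]] fi[OF that] fi[OF above_mono[OF that a(5)]] fm[OF that a(5)]
        by blast
      then show ?thesis using False by (simp add: tr')
    qed
  qed
  have ptf: "fib V' p = fib V p" if "p \<in> pts E" for p
    using flr_of_pts[OF E that] above_pts[OF that] by (simp add: fib')
  have ptt: "tr V' p q = tr V p q" if "p \<in> pts E" "q \<in> pts E" for p q
    using flr_of_pts[OF E that(1)] flr_of_pts[OF E that(2)] above_pts[OF that(1)] by (simp add: tr')
  have \<eta>': "\<eta> \<in> hom_over P ?R U (pullback f V')"
    using \<eta> fpts ptf ptt unfolding hom_over_def pullback_def by simp
  obtain \<phi> where \<phi>: "\<phi> \<in> Hom V V'" "\<And>p u. p \<in> P \<Longrightarrow> u \<in> fib U p \<Longrightarrow> \<phi> (f p) (\<eta> p u) = \<eta> p u"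
    using univ[OF V' \<eta>'] by (elim bexE conjE) (rule that, assumption, blast)
  define \<epsilon> where "\<epsilon> q v = (if above E q then tr V (flr E q) q v else 0)" for q v
  have \<epsilon>lin: "linear_between (fib V' q) (fib V q) (\<epsilon> q)" if "q \<in> IS" for q
  proof (cases "above E q")
    case True
    have "\<epsilon> q = tr V (flr E q) q" using True by (simp add: \<epsilon>_def fun_eq_iff)
    then show ?thesis using Pers_linear[OF V fi[OF True] that fl[OF True]] True by (simp add: fib')
  next
    case False
    then show ?thesis using subspace_0[OF Pers_subspace[OF V that]] by (simp add: fib' \<epsilon>_def linear_between_def)
  qed
  have \<epsilon>nat: "\<epsilon> q (tr V' p q v) = tr V p q (\<epsilon> p v)" if a: "p \<in> IS" "q \<in> IS" "p \<le> q" "v \<in> fib V' p" for p q v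
  proof (cases "above E p")
    case True
    then have ab: "above E q" using above_mono a by blast
    have v: "v \<in> fib V (flr E p)" using a True by (simp add: fib')
    show ?thesis using True ab Pers_comp[OF V fi[OF True] a(1,2) fl[OF True] a(3) v]
       Pers_comp[OF V fi[OF True] fi[OF ab] a(2) fm[OF True a(3)] fl[OF ab] v]
      by (simp add: \<epsilon>_def tr')
  next
    case False
    have "tr V p q 0 = 0" using linear_between_0[OF Pers_linear[OF V] Pers_subspace[OF V]] a by blast
    moreover have "\<epsilon> q 0 = 0" using linear_between_0[OF \<epsilon>lin[OF a(2)]] Pers_subspace[OF V' a(2)] by blast
    ultimately show ?thesis using False by (simp add: \<epsilon>_def tr')
  qed
  have "(\<lambda>q v. \<epsilon> q (\<phi> q v)) \<in> Hom V V" unfolding Hom_def hom_over_def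
  proof (intro CollectI conjI ballI impI)
    fix p :: "real ^ 'n" assume p: "p \<in> IS"
    have "linear_between (fib V p) (fib V' p) (\<phi> p)" using \<phi>(1) p unfolding Hom_def hom_over_def by blast
    then show "linear_between (fib V p) (fib V p) (\<lambda>v. \<epsilon> p (\<phi> p v))"
      using \<epsilon>lin[OF p] linear_between_comp by blast
  next
    fix p q :: "real ^ 'n" and v assume a: "p \<in> IS" "q \<in> IS" "p \<le> q" "v \<in> fib V p"
    have "\<phi> p v \<in> fib V' p" "\<phi> q (tr V p q v) = tr V' p q (\<phi> p v)"
      using \<phi>(1) a unfolding Hom_def hom_over_def linear_between_def by blast+
    then show "\<epsilon> q (\<phi> q (tr V p q v)) = tr V p q (\<epsilon> p (\<phi> p v))" using \<epsilon>nat a by simp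
  qed
  note comp = this
  have ret: "\<epsilon> (f p) (\<phi> (f p) (\<eta> p u)) = \<eta> p u" if "p \<in> P" "u \<in> fib U p" for p u
  proof -
    have "\<eta> p u \<in> fib V (f p)"
      using \<eta> that unfolding hom_over_def pullback_def by (auto dest!: bspec dest: linear_betweenD(1))
    moreover have "f p \<in> IS" using P(2) that by blast
    ultimately show ?thesis
      using \<phi>(2)[OF that] flr_of_pts[OF E fpts] above_pts[OF fpts] Pers_id[OF V] that by (simp add: \<epsilon>_def)
  qed
  have ident: "(\<lambda>q v. v) \<in> Hom V V" unfolding Hom_def hom_over_def linear_between_def by auto
  have "\<exists>\<kappa>. \<forall>\<phi>' \<in> Hom V V. (\<forall>p\<in>P. \<forall>u\<in>fib U p. \<phi>' (f p) (\<eta> p u) = \<eta> p u) \<longrightarrow>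
               (\<forall>q\<in>IS. \<forall>v\<in>fib V q. \<phi>' q v = \<kappa> q v)"
    using univ[OF V \<eta>] by (elim bexE conjE) (rule exI, assumption)
  then obtain \<kappa> where \<kappa>: "\<forall>\<phi>' \<in> Hom V V. (\<forall>p\<in>P. \<forall>u\<in>fib U p. \<phi>' (f p) (\<eta> p u) = \<eta> p u) \<longrightarrow>
               (\<forall>q\<in>IS. \<forall>v\<in>fib V q. \<phi>' q v = \<kappa> q v)"
    by (rule exE)
  have inv: "\<epsilon> q (\<phi> q v) = v" if "q \<in> IS" "v \<in> fib V q" for q v
    using \<kappa>[rule_format, OF comp ret that] \<kappa>[rule_format, OF ident refl that] by simp
  have "adapted E V"
  proof (rule adapted_if_flr[OF V E])
    fix q :: "real ^ 'n" assume "q \<in> IS" "\<not> above E q"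
    then show "fib V q = {0}" using inv[of q] subspace_0[OF Pers_subspace[OF V]] by (auto simp: \<epsilon>_def)
  next
    fix q :: "real ^ 'n" assume q: "q \<in> IS" "above E q"
    let ?g = "flr E q"
    have g: "?g \<in> IS" "?g \<le> q" "flr E ?g = ?g" "above E ?g"
      using fi fl flr_of_pts[OF E flr_pts[OF E]] above_flr[OF E] q by auto
    have "\<phi> q (tr V ?g q v) = v" if v: "v \<in> fib V ?g" for v
    proof -
      have w: "\<phi> ?g v \<in> fib V' ?g" "\<phi> q (tr V ?g q v) = tr V' ?g q (\<phi> ?g v)"
        using \<phi>(1) g q v unfolding Hom_def hom_over_def linear_between_def by blast+
      then have "\<phi> ?g v \<in> fib V ?g" using g by (simp add: fib')
      then have "\<phi> ?g v = \<epsilon> ?g (\<phi> ?g v)" "tr V' ?g q (\<phi> ?g v) = \<phi> ?g v"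
        using g Pers_id[OF V g(1)] by (simp_all add: \<epsilon>_def tr')
      then show ?thesis using inv[OF g(1) v] w by simp
    qed
    then have "inj_on (tr V ?g q) (fib V ?g)" by (rule inj_on_inverseI)
    moreover have "tr V ?g q ` fib V ?g = fib V q"
    proof
      show "tr V ?g q ` fib V ?g \<subseteq> fib V q" using Pers_tr[OF V g(1) q(1) g(2)] by blast
      show "fib V q \<subseteq> tr V ?g q ` fib V ?g"
      proof
        fix v assume v: "v \<in> fib V q"
        have "\<phi> q v \<in> fib V' q" using \<phi>(1) q v unfolding Hom_def hom_over_def linear_between_def by blast
        then show "v \<in> tr V ?g q ` fib V ?g"
          using inv[OF q(1) v] q imageI[of "\<phi> q v" "fib V ?g" "tr V ?g q"] by (simp add: \<epsilon>_def fib')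
      qed
    qed
    ultimately show "bij_betw (tr V ?g q) (fib V ?g) (fib V q)" by (simp add: bij_betw_def)
  qed
  then show ?thesis using E by blast
qed

text \<open>
  \<open>V\<close> is the left Kan extension of its restriction to the finitely many grid points: a map out of
  \<open>V\<close> can be prescribed there, since each fibre is transported isomorphically from the corner of
  its cell.
\<close>

lemma adapted_imp_fp:
  fixes V :: "(real ^ 'n, 'v) pmod"
  assumes V: "V \<in> Pers" and E: "levels K E" and ad: "adapted E V" shows "V \<in> Pers_fp"
proof -
  obtain g where g: "bij_betw g {..<card (pts E)} (pts E)"
    using ex_bij_betw_nat_finite[OF finite_pts[OF E]] by (auto simp: atLeast0LessThan)
  define P where "P = {..<card (pts E)}"
  define r where "r = {(a, b). a \<in> P \<and> b \<in> P \<and> g a \<le> g b}"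
  let ?R = "\<lambda>p p'. (p, p') \<in> r"
  have gP: "g p \<in> pts E" if "p \<in> P" for p using bij_betwE[OF g] that P_def by blast
  have gI: "g p \<in> IS" if "p \<in> P" for p using pts_index_space[OF E gP[OF that]] .
  have ginj: "a = b" if "a \<in> P" "b \<in> P" "g a = g b" for a b
    using g that unfolding P_def bij_betw_def inj_on_def by blast
  define U where "U = pullback g V"
  have U: "U \<in> pers_over P ?R"
    using V gI unfolding U_def pullback_def pers_over_def Pers_def r_def by auto
  have po: "partial_order_on P r" unfolding order_on_defs refl_on_def trans_def antisym_def r_def
    using ginj by (auto intro: order_antisym order_trans)
  define h where "h q = (SOME p. p \<in> P \<and> g p = flr E q)" for q
  have h: "h q \<in> P \<and> g (h q) = flr E q" if "above E q" for q
    unfolding h_def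
    by (rule someI_ex) (use flr_pts[OF E that] bij_betw_imp_surj_on[OF g] in \<open>force simp: P_def\<close>)
  have hg: "h (g p) = p" if "p \<in> P" for p
    using h[OF above_pts[OF gP[OF that]]] flr_of_pts[OF E gP[OF that]] ginj that by auto
  note fi = flr_index_space[OF E] and fm = flr_mono[OF E] and fl = flr_le[OF E]
  have "is_left_kan_extension P r g U V" unfolding is_left_kan_extension_def
  proof (rule conjI[OF V], rule bexI[of _ "\<lambda>p u. u"], intro ballI)
    show "(\<lambda>p u. u) \<in> hom_over P ?R U (pullback g V)"
      unfolding hom_over_def U_def linear_between_def by auto
  next
    fix W \<psi> assume W: "W \<in> Pers" and \<psi>: "\<psi> \<in> hom_over P ?R U (pullback g W)"
    have \<psi>lin: "linear_between (fib V (g p)) (fib W (g p)) (\<psi> p)" if "p \<in> P" for p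
      using \<psi> that unfolding hom_over_def U_def pullback_def by auto
    have \<psi>nat: "\<psi> b (tr V (g a) (g b) v) = tr W (g a) (g b) (\<psi> a v)"
      if "a \<in> P" "b \<in> P" "g a \<le> g b" "v \<in> fib V (g a)" for a b v
      using \<psi> that unfolding hom_over_def U_def pullback_def r_def by auto
    define iv where "iv q = inv_into (fib V (flr E q)) (tr V (flr E q) q)" for q
    have bij: "bij_betw (tr V (flr E q) q) (fib V (flr E q)) (fib V q)" if "q \<in> IS" "above E q" for q
      using adapted_bij[OF ad fi that(1) fl same_flr[OF E]] that by blast
    have iv: "iv q v \<in> fib V (flr E q)" "tr V (flr E q) q (iv q v) = v"
      if "q \<in> IS" "above E q" "v \<in> fib V q" for q v
      using bij[OF that(1,2)] that(3) unfolding iv_def bij_betw_def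
      by (auto intro: inv_into_into f_inv_into_f)
    have ivi: "iv q (tr V (flr E q) q v) = v" if "q \<in> IS" "above E q" "v \<in> fib V (flr E q)" for q v
      using bij[OF that(1,2)] that(3) unfolding iv_def bij_betw_def by (simp add: inv_into_f_f)
    define \<phi> where "\<phi> q v = (if above E q then tr W (flr E q) q (\<psi> (h q) (iv q v)) else 0)" for q v
    \<comment> \<open>Every element of a fibre comes from a grid point, where the map is prescribed.\<close>
    have \<phi>tr: "\<phi> q (tr V (flr E q) q v) = tr W (flr E q) q (\<psi> (h q) v)"
      if "q \<in> IS" "above E q" "v \<in> fib V (flr E q)" for q v
      using ivi that by (simp add: \<phi>_def)
    have \<phi>lin: "linear_between (fib V q) (fib W q) (\<phi> q)" if q: "q \<in> IS" for q
    proof (cases "above E q")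
      case True
      let ?g = "flr E q"
      have l: "linear_between (fib V ?g) (fib W q) (\<lambda>v. tr W ?g q (\<psi> (h q) v))"
        using linear_between_comp[OF _ Pers_linear[OF W fi[OF True] q fl[OF True]]] \<psi>lin[of "h q"] h[OF True] by metis
      have lv: "linear_between (fib V ?g) (fib V q) (tr V ?g q)"
        using Pers_linear[OF V fi[OF True] q fl[OF True]] .
      have sg: "subspace (fib V ?g)" using Pers_subspace[OF V fi[OF True]] .
      show ?thesis unfolding linear_between_def
      proof (intro conjI ballI allI image_subsetI)
        fix x assume x: "x \<in> fib V q"
        show "\<phi> q x \<in> fib W q"
          using linear_betweenD(1)[OF l iv(1)[OF q True x]] True by (simp add: \<phi>_def)
        fix y assume y: "y \<in> fib V q"
        have "\<phi> q (tr V ?g q (iv q x + iv q y)) = tr W ?g q (\<psi> (h q) (iv q x + iv q y))"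
          using \<phi>tr[OF q True] subspace_add[OF sg] iv[OF q True] x y by blast
        then show "\<phi> q (x + y) = \<phi> q x + \<phi> q y"
          using linear_betweenD(2)[OF l] linear_betweenD(2)[OF lv] iv[OF q True] x y True by (simp add: \<phi>_def)
      next
        fix c x assume x: "x \<in> fib V q"
        have "\<phi> q (tr V ?g q (scale c (iv q x))) = tr W ?g q (\<psi> (h q) (scale c (iv q x)))"
          using \<phi>tr[OF q True] subspace_scale[OF sg] iv[OF q True x] by blast
        then show "\<phi> q (scale c x) = scale c (\<phi> q x)"
          using linear_betweenD(3)[OF l] linear_betweenD(3)[OF lv] iv[OF q True x] True by (simp add: \<phi>_def)
      qed
    next
      case False
      then show ?thesis using adapted_zero[OF ad q] subspace_0[OF Pers_subspace[OF W q]]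
        by (auto simp: \<phi>_def linear_between_def)
    qed
    have \<phi>: "\<phi> \<in> Hom V W" unfolding Hom_def hom_over_def
    proof (intro CollectI conjI ballI impI \<phi>lin)
      fix p q :: "real ^ 'n" and v assume a: "p \<in> IS" "q \<in> IS" "p \<le> q" "v \<in> fib V p"
      show "\<phi> q (tr V p q v) = tr W p q (\<phi> p v)"
      proof (cases "above E p")
        case True
        have ab: "above E q" using above_mono[OF True a(3)] .
        let ?v = "iv p v" and ?a = "flr E p" and ?b = "flr E q"
        have v: "?v \<in> fib V ?a" "tr V ?a p ?v = v" using iv[OF a(1) True a(4)] by auto
        have pv: "\<psi> (h p) ?v \<in> fib W ?a" using linear_betweenD(1)[OF \<psi>lin, of "h p"] h[OF True] v by auto
        have "tr V p q v = tr V ?b q (tr V ?a ?b ?v)"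
          using v Pers_comp[OF V fi[OF True] a(1,2) fl[OF True] a(3) v(1)]
           Pers_comp[OF V fi[OF True] fi[OF ab] a(2) fm[OF True a(3)] fl[OF ab] v(1)] by simp
        then have "\<phi> q (tr V p q v) = tr W ?b q (\<psi> (h q) (tr V ?a ?b ?v))"
          using \<phi>tr[OF a(2) ab] Pers_tr[OF V fi[OF True] fi[OF ab] fm[OF True a(3)] v(1)] by simp
        also have "\<dots> = tr W ?b q (tr W ?a ?b (\<psi> (h p) ?v))"
          using \<psi>nat[of "h p" "h q" ?v] h[OF True] h[OF ab] fm[OF True a(3)] v by simp
        also have "\<dots> = tr W p q (tr W ?a p (\<psi> (h p) ?v))"
          using Pers_comp[OF W fi[OF True] a(1,2) fl[OF True] a(3) pv]
           Pers_comp[OF W fi[OF True] fi[OF ab] a(2) fm[OF True a(3)] fl[OF ab] pv] by simp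
        finally show ?thesis using True by (simp add: \<phi>_def)
      next
        case False
        then have "v = 0" using adapted_zero[OF ad a(1)] a(4) by blast
        moreover have "tr V p q 0 = 0" "tr W p q 0 = 0"
          using linear_between_0[OF Pers_linear[OF V] Pers_subspace[OF V]]
            linear_between_0[OF Pers_linear[OF W] Pers_subspace[OF W]] a by blast+
        ultimately show ?thesis
          using linear_between_0[OF \<phi>lin[OF a(1)] Pers_subspace[OF V a(1)]]
           linear_between_0[OF \<phi>lin[OF a(2)] Pers_subspace[OF V a(2)]] by simp
      qed
    qed
    have \<phi>\<eta>: "\<phi> (g p) u = \<psi> p u" if p: "p \<in> P" and u: "u \<in> fib U p" for p u
    proof -
      have u': "u \<in> fib V (g p)" using u by (simp add: U_def pullback_def)
      have e: "flr E (g p) = g p" "above E (g p)" using flr_of_pts[OF E gP[OF p]] above_pts[OF gP[OF p]] by auto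
      have "\<phi> (g p) (tr V (g p) (g p) u) = tr W (g p) (g p) (\<psi> p u)"
        using \<phi>tr[OF gI[OF p] e(2), of u] e(1) u' hg[OF p] by simp
      then show ?thesis
        using Pers_id[OF V gI[OF p] u'] Pers_id[OF W gI[OF p] linear_betweenD(1)[OF \<psi>lin[OF p] u']] by simp
    qed
    have uniq: "\<phi>' q v = \<phi> q v"
      if \<phi>': "\<phi>' \<in> Hom V W" "\<forall>p\<in>P. \<forall>u\<in>fib U p. \<phi>' (g p) u = \<psi> p u" and q: "q \<in> IS" and v: "v \<in> fib V q" for \<phi>' q v
    proof (cases "above E q")
      case True
      have "\<phi>' q (tr V (flr E q) q (iv q v)) = tr W (flr E q) q (\<phi>' (flr E q) (iv q v))"
        using \<phi>'(1) q fi[OF True] fl[OF True] iv(1)[OF q True v] unfolding Hom_def hom_over_def by auto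
      moreover have "\<phi>' (g (h q)) (iv q v) = \<psi> (h q) (iv q v)"
        using \<phi>'(2)[THEN bspec, of "h q", THEN bspec, of "iv q v"] h[OF True] iv(1)[OF q True v]
        by (simp add: U_def pullback_def)
      ultimately show ?thesis using iv(2)[OF q True v] h[OF True] True by (simp add: \<phi>_def)
    next
      case False
      then have "v = 0" using adapted_zero[OF ad q] v by blast
      moreover have "\<phi>' q 0 = 0"
        using \<phi>'(1) q linear_between_0[OF _ Pers_subspace[OF V q]] unfolding Hom_def hom_over_def by blast
      ultimately show ?thesis using False by (simp add: \<phi>_def)
    qed
    show "\<exists>\<phi>\<in>Hom V W. (\<forall>p\<in>P. \<forall>u\<in>fib U p. \<phi> (g p) u = \<psi> p u) \<and>
        (\<forall>\<phi>'\<in>Hom V W. (\<forall>p\<in>P. \<forall>u\<in>fib U p. \<phi>' (g p) u = \<psi> p u) \<longrightarrow>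
           (\<forall>q\<in>IS. \<forall>v\<in>fib V q. \<phi>' q v = \<phi> q v))"
      by (rule bexI[OF _ \<phi>]) (simp add: \<phi>\<eta> uniq)
  qed
  moreover have "finite P" "g ` P \<subseteq> IS" "\<forall>(p, p')\<in>r. g p \<le> g p'"
    using gI by (auto simp: P_def r_def)
  ultimately show ?thesis unfolding Pers_fp_def using po U
    by (intro CollectI exI[of _ P] exI[of _ r] exI[of _ g] exI[of _ U] conjI)
qed

lemma Pers_fp_iff: "V \<in> Pers_fp \<longleftrightarrow> V \<in> Pers \<and> (\<exists>E. levels K E \<and> adapted E V)"
proof -
  have "V \<in> Pers" if "V \<in> Pers_fp"
    using that unfolding Pers_fp_def is_left_kan_extension_def by (elim CollectE exE conjE)
  then show ?thesis using fp_imp_adapted[of V] adapted_imp_fp[of V] by metis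
qed

lemma fp_Pers: "V \<in> Pers_fp \<Longrightarrow> V \<in> Pers"
  using Pers_fp_iff by blast

end

section \<open>Subobjects and their quotients\<close>

context persistence
begin

definition submod :: "(real ^ 'n, 'v) pmod \<Rightarrow> (real ^ 'n \<Rightarrow> 'v set) \<Rightarrow> bool" where
  "submod T W \<longleftrightarrow> (\<forall>q\<in>IS. subspace (W q) \<and> W q \<subseteq> fib T q) \<and>
     (\<forall>p\<in>IS. \<forall>q\<in>IS. p \<le> q \<longrightarrow> tr T p q ` W p \<subseteq> W q)"

text \<open>A submodule living on the levels \<open>E\<close>; the structure maps of the submodule are restrictions.\<close>

definition fsub :: "('n \<Rightarrow> real set) \<Rightarrow> (real ^ 'n, 'v) pmod \<Rightarrow> (real ^ 'n \<Rightarrow> 'v set) \<Rightarrow> bool" where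
  "fsub E T W \<longleftrightarrow> submod T W \<and> (\<forall>q\<in>IS. \<not> above E q \<longrightarrow> W q = {0}) \<and>
     (\<forall>p\<in>IS. \<forall>q\<in>IS. p \<le> q \<and> same E p q \<longrightarrow> W q \<subseteq> tr T p q ` W p)"

lemma submodD:
  assumes "submod T W"
  shows "q \<in> IS \<Longrightarrow> subspace (W q)" "q \<in> IS \<Longrightarrow> W q \<subseteq> fib T q"
    "p \<in> IS \<Longrightarrow> q \<in> IS \<Longrightarrow> p \<le> q \<Longrightarrow> v \<in> W p \<Longrightarrow> tr T p q v \<in> W q"
  using assms unfolding submod_def by (auto simp: image_subset_iff)

lemma fsubD:
  assumes "fsub E T W"
  shows "submod T W" "q \<in> IS \<Longrightarrow> \<not> above E q \<Longrightarrow> W q = {0}"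
    "p \<in> IS \<Longrightarrow> q \<in> IS \<Longrightarrow> p \<le> q \<Longrightarrow> same E p q \<Longrightarrow> W q = tr T p q ` W p"
proof -
  show s: "submod T W" using assms unfolding fsub_def by simp
  show "q \<in> IS \<Longrightarrow> \<not> above E q \<Longrightarrow> W q = {0}" using assms unfolding fsub_def by simp
  show "p \<in> IS \<Longrightarrow> q \<in> IS \<Longrightarrow> p \<le> q \<Longrightarrow> same E p q \<Longrightarrow> W q = tr T p q ` W p"
    using assms s unfolding fsub_def submod_def by (intro equalityI) simp_all
qed

lemma fsubI:
  fixes T :: "(real ^ 'n, 'v) pmod"
  assumes "submod T W" "\<And>q. q \<in> IS \<Longrightarrow> \<not> above E q \<Longrightarrow> W q \<subseteq> {0}"
    "\<And>p q v. p \<in> IS \<Longrightarrow> q \<in> IS \<Longrightarrow> p \<le> q \<Longrightarrow> same E p q \<Longrightarrow> v \<in> W q \<Longrightarrow> v \<in> tr T p q ` W p"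
  shows "fsub E T W"
  unfolding fsub_def
proof (intro conjI ballI impI assms(1) subsetI)
  fix q :: "real ^ 'n" assume q: "q \<in> IS" "\<not> above E q"
  then show "W q = {0}" using assms(2)[OF q] subspace_0[OF submodD(1)[OF assms(1) q(1)]] by blast
qed (use assms(3) in simp)

lemma fsub_mono:
  fixes T :: "(real ^ 'n, 'v) pmod"
  assumes "fsub E T W" "\<And>i. E i \<subseteq> F i" shows "fsub F T W"
proof (rule fsubI[OF fsubD(1)[OF assms(1)]])
  fix q :: "real ^ 'n" assume "q \<in> IS" "\<not> above F q"
  then show "W q \<subseteq> {0}" using fsubD(2)[OF assms(1)] above_subset[of E q F] assms(2) by auto
next
  fix p q :: "real ^ 'n" and v assume "p \<in> IS" "q \<in> IS" "p \<le> q" "same F p q" "v \<in> W q"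
  then show "v \<in> tr T p q ` W p" using fsubD(3)[OF assms(1)] same_mono[of F p q E] assms(2) by auto
qed

lemma submod_Pers:
  fixes T :: "(real ^ 'n, 'v) pmod"
  assumes T: "T \<in> Pers" and W: "submod T W" shows "T\<lparr>fib := W\<rparr> \<in> Pers"
proof (rule PersI)
  fix q :: "real ^ 'n" assume "q \<in> IS" then show "findim (fib (T\<lparr>fib := W\<rparr>) q)"
    using findim_subset[OF Pers_findim[OF T] submodD(1,2)[OF W]] by simp
next
  fix p q :: "real ^ 'n" assume a: "p \<in> IS" "q \<in> IS" "p \<le> q"
  have "tr T p q ` W p \<subseteq> W q" using W a unfolding submod_def by simp
  then show "linear_between (fib (T\<lparr>fib := W\<rparr>) p) (fib (T\<lparr>fib := W\<rparr>) q) (tr (T\<lparr>fib := W\<rparr>) p q)"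
    using linear_between_mono[OF Pers_linear[OF T a] submodD(2)[OF W a(1)]] by simp
next
  fix p :: "real ^ 'n" and v assume a: "p \<in> IS" "v \<in> fib (T\<lparr>fib := W\<rparr>) p"
  then have "v \<in> fib T p" using submodD(2)[OF W a(1)] by auto
  then show "tr (T\<lparr>fib := W\<rparr>) p p v = v" using Pers_id[OF T a(1)] by simp
next
  fix p q r :: "real ^ 'n" and v assume a: "p \<in> IS" "q \<in> IS" "r \<in> IS" "p \<le> q" "q \<le> r" "v \<in> fib (T\<lparr>fib := W\<rparr>) p"
  then have "v \<in> fib T p" using submodD(2)[OF W a(1)] by auto
  then show "tr (T\<lparr>fib := W\<rparr>) q r (tr (T\<lparr>fib := W\<rparr>) p q v) = tr (T\<lparr>fib := W\<rparr>) p r v"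
    using Pers_comp[OF T a(1-5)] by simp
qed

lemma fsub_adapted:
  fixes T :: "(real ^ 'n, 'v) pmod"
  assumes ad: "adapted E T" and W: "fsub E T W" shows "adapted E (T\<lparr>fib := W\<rparr>)"
  unfolding adapted_def
proof (intro conjI ballI impI)
  fix q :: "real ^ 'n" assume "q \<in> IS" "\<not> above E q"
  then show "fib (T\<lparr>fib := W\<rparr>) q = {0}" using fsubD(2)[OF W] by simp
next
  fix p q :: "real ^ 'n" assume a: "p \<in> IS" "q \<in> IS" "p \<le> q \<and> same E p q"
  have "inj_on (tr T p q) (fib T p)" using adapted_bij[OF ad] a unfolding bij_betw_def by simp
  then have "inj_on (tr T p q) (W p)" using submodD(2)[OF fsubD(1)[OF W] a(1)] inj_on_subset by blast
  then show "bij_betw (tr (T\<lparr>fib := W\<rparr>) p q) (fib (T\<lparr>fib := W\<rparr>) p) (fib (T\<lparr>fib := W\<rparr>) q)"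
    using fsubD(3)[OF W] a unfolding bij_betw_def by simp
qed

lemma submod_of_Pers:
  fixes T :: "(real ^ 'n, 'v) pmod"
  assumes "T\<lparr>fib := W\<rparr> \<in> Pers" "\<And>q. q \<in> IS \<Longrightarrow> W q \<subseteq> fib T q" shows "submod T W"
  unfolding submod_def
proof (intro conjI ballI impI)
  fix q :: "real ^ 'n" assume q: "q \<in> IS"
  show "subspace (W q)" using Pers_subspace[OF assms(1) q] by simp
  show "W q \<subseteq> fib T q" using assms(2) q by simp
next
  fix p q :: "real ^ 'n" assume a: "p \<in> IS" "q \<in> IS" "p \<le> q"
  show "tr T p q ` W p \<subseteq> W q" using Pers_tr[OF assms(1) a] by auto
qed

text \<open>
  Finitely presentable submodules are those living on some levels; the levels of \<open>T\<close> are joined to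
  those of the submodule, so that no relation between the two is required.
\<close>

lemma subobjects_iff:
  fixes T :: "(real ^ 'n, 'v) pmod"
  assumes T: "T \<in> Pers_fp"
  shows "W \<in> subobjects T \<longleftrightarrow> (\<exists>E. levels K E \<and> fsub E T W)"
proof
  assume "W \<in> subobjects T"
  then have W: "T\<lparr>fib := W\<rparr> \<in> Pers_fp" "\<And>q. q \<in> IS \<Longrightarrow> W q \<subseteq> fib T q" unfolding subobjects_def by auto
  then obtain E where E: "levels K E" "adapted E (T\<lparr>fib := W\<rparr>)" using Pers_fp_iff[of "T\<lparr>fib := W\<rparr>"] by metis
  have "fsub E T W"
  proof (rule fsubI[OF submod_of_Pers[OF fp_Pers[OF W(1)] W(2)]])
    fix q :: "real ^ 'n" assume "q \<in> IS" "\<not> above E q" then show "W q \<subseteq> {0}" using adapted_zero[OF E(2)] by simp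
  next
    fix p q :: "real ^ 'n" and v assume a: "p \<in> IS" "q \<in> IS" "p \<le> q" "same E p q" "v \<in> W q"
    then show "v \<in> tr T p q ` W p" using adapted_bij[OF E(2) a(1-4)] unfolding bij_betw_def by auto
  qed
  then show "\<exists>E. levels K E \<and> fsub E T W" using E by metis
next
  assume "\<exists>E. levels K E \<and> fsub E T W"
  then obtain E where E: "levels K E" "fsub E T W" by metis
  obtain F where F: "levels K F" "adapted F T" using T Pers_fp_iff[of T] by metis
  have "adapted (\<lambda>i. E i \<union> F i) T" by (rule adapted_mono[OF F(2)]) blast
  moreover have "fsub (\<lambda>i. E i \<union> F i) T W" by (rule fsub_mono[OF E(2)]) blast
  ultimately have "adapted (\<lambda>i. E i \<union> F i) (T\<lparr>fib := W\<rparr>)" by (rule fsub_adapted)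
  moreover have "levels K (\<lambda>i. E i \<union> F i)" using levels_Un E F by metis
  ultimately have "T\<lparr>fib := W\<rparr> \<in> Pers_fp"
    using Pers_fp_iff[of "T\<lparr>fib := W\<rparr>"] submod_Pers[OF fp_Pers[OF T] fsubD(1)[OF E(2)]] by metis
  then show "W \<in> subobjects T" unfolding subobjects_def using submodD(2)[OF fsubD(1)[OF E(2)]] by simp
qed

lemma fsub_subobject: "T \<in> Pers_fp \<Longrightarrow> levels K E \<Longrightarrow> fsub E T W \<Longrightarrow> W \<in> subobjects T"
  using subobjects_iff by metis

lemma subobject_fp: "W \<in> subobjects T \<Longrightarrow> T\<lparr>fib := W\<rparr> \<in> Pers_fp"
  unfolding subobjects_def by simp

lemma subobject_submod:
  assumes "T \<in> Pers_fp" "W \<in> subobjects T" shows "submod T W"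
  using assms subobjects_iff fsubD(1) by metis

lemma fsub_zero:
  assumes "T \<in> Pers" shows "fsub E T (\<lambda>_. {0})"
proof (rule fsubI)
  have "tr T p q 0 = 0" if "p \<in> IS" "q \<in> IS" "p \<le> q" for p q
    using linear_between_0[OF Pers_linear[OF assms] Pers_subspace[OF assms]] that by metis
  then show "submod T (\<lambda>_. {0})" "\<And>p q v. p \<in> IS \<Longrightarrow> q \<in> IS \<Longrightarrow> p \<le> q \<Longrightarrow> same E p q \<Longrightarrow> v \<in> {0} \<Longrightarrow> v \<in> tr T p q ` {0}"
    unfolding submod_def using subspace_0[OF Pers_subspace[OF assms]] by auto
qed simp

lemma whole_subobject: "T \<in> Pers_fp \<Longrightarrow> fib T \<in> subobjects T"
  unfolding subobjects_def by simp

lemma zero_subobject: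
  assumes "T \<in> Pers_fp" shows "(\<lambda>_. {0}) \<in> subobjects T"
proof -
  have "levels K (\<lambda>_. {})" by (simp add: levels_def)
  then show ?thesis by (rule fsub_subobject[OF assms _ fsub_zero[OF fp_Pers[OF assms]]])
qed

definition plus_sub :: "('q \<Rightarrow> 'v set) \<Rightarrow> ('q \<Rightarrow> 'v set) \<Rightarrow> 'q \<Rightarrow> 'v set" where
  "plus_sub A B = (\<lambda>q. {a + b | a b. a \<in> A q \<and> b \<in> B q})"

lemma plus_sub_upper:
  assumes "submod T A" "submod T B" "q \<in> IS"
  shows "A q \<subseteq> plus_sub A B q" "B q \<subseteq> plus_sub A B q"
proof -
  have "0 \<in> A q" "0 \<in> B q" using subspace_0 submodD(1) assms by metis+
  then show "A q \<subseteq> plus_sub A B q" "B q \<subseteq> plus_sub A B q"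
    unfolding plus_sub_def by (fastforce intro: add_0_right[symmetric] add_0_left[symmetric])+
qed

lemma fsub_plus:
  fixes T :: "(real ^ 'n, 'v) pmod"
  assumes T: "T \<in> Pers" and A: "fsub E T A" and B: "fsub E T B"
  shows "fsub E T (plus_sub A B)"
proof (rule fsubI)
  note sA = fsubD(1)[OF A] and sB = fsubD(1)[OF B]
  have tr: "tr T p q (a + b) = tr T p q a + tr T p q b"
    if "p \<in> IS" "q \<in> IS" "p \<le> q" "a \<in> A p" "b \<in> B p" for p q a b
    using linear_betweenD(2)[OF Pers_linear[OF T that(1-3)]] submodD(2)[OF sA that(1)] submodD(2)[OF sB that(1)] that by auto
  show "submod T (plus_sub A B)" unfolding submod_def
  proof (intro conjI ballI impI)
    fix q :: "real ^ 'n" assume q: "q \<in> IS"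
    show "subspace (plus_sub A B q)" unfolding plus_sub_def
      by (rule subspace_sums[OF submodD(1)[OF sA q] submodD(1)[OF sB q]])
    show "plus_sub A B q \<subseteq> fib T q"
      using submodD(2)[OF sA q] submodD(2)[OF sB q] subspace_add[OF Pers_subspace[OF T q]]
      unfolding plus_sub_def by blast
  next
    fix p q :: "real ^ 'n" assume a: "p \<in> IS" "q \<in> IS" "p \<le> q"
    show "tr T p q ` plus_sub A B p \<subseteq> plus_sub A B q"
    proof
      fix v assume "v \<in> tr T p q ` plus_sub A B p"
      then obtain x y where "v = tr T p q x + tr T p q y" "x \<in> A p" "y \<in> B p"
        unfolding plus_sub_def using tr[OF a] by auto
      then show "v \<in> plus_sub A B q" unfolding plus_sub_def
        using submodD(3)[OF sA a] submodD(3)[OF sB a] by auto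
    qed
  qed
  show "plus_sub A B q \<subseteq> {0}" if "q \<in> IS" "\<not> above E q" for q
    using fsubD(2)[OF A that] fsubD(2)[OF B that] unfolding plus_sub_def by auto
  fix p q :: "real ^ 'n" and v assume a: "p \<in> IS" "q \<in> IS" "p \<le> q" "same E p q" "v \<in> plus_sub A B q"
  then obtain x y where xy: "v = x + y" "x \<in> A q" "y \<in> B q" unfolding plus_sub_def by auto
  obtain x' y' where "x = tr T p q x'" "x' \<in> A p" "y = tr T p q y'" "y' \<in> B p"
    using fsubD(3)[OF A a(1-4)] fsubD(3)[OF B a(1-4)] xy by auto
  then have "v = tr T p q (x' + y')" "x' + y' \<in> plus_sub A B p"
    using tr[OF a(1-3)] xy unfolding plus_sub_def by auto
  then show "v \<in> tr T p q ` plus_sub A B p" by blast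
qed

lemma fsub_inter:
  fixes T :: "(real ^ 'n, 'v) pmod"
  assumes ad: "adapted E T" and A: "fsub E T A" and B: "fsub E T B"
  shows "fsub E T (\<lambda>q. A q \<inter> B q)"
proof (rule fsubI)
  note sA = fsubD(1)[OF A] and sB = fsubD(1)[OF B]
  show "submod T (\<lambda>q. A q \<inter> B q)" unfolding submod_def
    using submodD[OF sA] submodD[OF sB] subspace_inter by (auto simp: image_subset_iff)
  show "A q \<inter> B q \<subseteq> {0}" if "q \<in> IS" "\<not> above E q" for q
    using fsubD(2)[OF A that] by auto
  fix p q :: "real ^ 'n" and v assume a: "p \<in> IS" "q \<in> IS" "p \<le> q" "same E p q" "v \<in> A q \<inter> B q"
  have "v \<in> tr T p q ` A p" "v \<in> tr T p q ` B p"
    using fsubD(3)[OF A a(1-4)] fsubD(3)[OF B a(1-4)] a(5) by auto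
  then obtain x y where xy: "v = tr T p q x" "x \<in> A p" "v = tr T p q y" "y \<in> B p" by blast
  have "inj_on (tr T p q) (fib T p)" using adapted_bij[OF ad a(1-4)] unfolding bij_betw_def by simp
  then have "x = y" using xy submodD(2)[OF sA a(1)] submodD(2)[OF sB a(1)] unfolding inj_on_def by auto
  then show "v \<in> tr T p q ` (A p \<inter> B p)" using xy by blast
qed

lemma common_levels:
  assumes T: "T \<in> Pers_fp" and A: "A \<in> subobjects T" and B: "B \<in> subobjects T"
  obtains E where "levels K E" "adapted E T" "fsub E T A" "fsub E T B"
proof -
  obtain E1 where 1: "levels K E1" "adapted E1 T" using T Pers_fp_iff[of T] by metis
  obtain E2 where 2: "levels K E2" "fsub E2 T A" using A subobjects_iff[OF T] by metis
  obtain E3 where 3: "levels K E3" "fsub E3 T B" using B subobjects_iff[OF T] by metis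
  let ?E = "\<lambda>i. E1 i \<union> (E2 i \<union> E3 i)"
  show thesis
  proof (rule that[of ?E])
    show "levels K ?E" using 1 2 3 levels_Un by metis
    show "adapted ?E T" by (rule adapted_mono[OF 1(2)]) blast
    show "fsub ?E T A" by (rule fsub_mono[OF 2(2)]) blast
    show "fsub ?E T B" by (rule fsub_mono[OF 3(2)]) blast
  qed
qed

lemma subobject_plus:
  assumes T: "T \<in> Pers_fp" and A: "A \<in> subobjects T" and B: "B \<in> subobjects T"
  shows "plus_sub A B \<in> subobjects T"
  using common_levels[OF assms] fsub_plus[OF fp_Pers[OF T]] fsub_subobject[OF T] by metis

lemma subobject_inter:
  assumes T: "T \<in> Pers_fp" and A: "A \<in> subobjects T" and B: "B \<in> subobjects T"
  shows "(\<lambda>q. A q \<inter> B q) \<in> subobjects T"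
  using common_levels[OF assms] fsub_inter fsub_subobject[OF T] by metis

lemma subobject_cong:
  assumes T: "T \<in> Pers_fp" and A: "A \<in> subobjects T" and eq: "\<And>q. q \<in> IS \<Longrightarrow> B q = A q"
  shows "B \<in> subobjects T"
proof -
  obtain E where E: "levels K E" "fsub E T A" using A subobjects_iff[OF T] by metis
  have "fsub E T B" using E(2) eq unfolding fsub_def submod_def by simp
  then show ?thesis using fsub_subobject[OF T E(1)] by metis
qed

text \<open>
  The quotient \<open>B/A\<close> of submodules \<open>A \<subseteq> B\<close> exists with finitely presented value: fibrewise a
  complement of \<open>A\<close> in \<open>B\<close>, with structure maps corrected by the projections.
\<close>

lemma quotient_exists:
  fixes T :: "(real ^ 'n, 'v) pmod"
  assumes T: "T \<in> Pers_fp" and A: "A \<in> subobjects T" and B: "B \<in> subobjects T"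
    and AB: "\<And>q. q \<in> IS \<Longrightarrow> A q \<subseteq> B q"
  obtains C \<pi> where "short_exact (T\<lparr>fib := A\<rparr>) (T\<lparr>fib := B\<rparr>) C (\<lambda>q v. v) \<pi>"
proof -
  obtain E where E: "levels K E" "adapted E T" "fsub E T A" "fsub E T B" using common_levels[OF T A B] .
  have TP: "T \<in> Pers" using fp_Pers[OF T] .
  note sA = fsubD(1)[OF E(3)] and sB = fsubD(1)[OF E(4)]
  have BP: "T\<lparr>fib := B\<rparr> \<in> Pers" using submod_Pers[OF TP sB] .
  have fB: "findim (B q)" if "q \<in> IS" for q using Pers_findim[OF BP that] by simp
  have lin: "linear_between (B p) (B q) (tr T p q)" if "p \<in> IS" "q \<in> IS" "p \<le> q" for p q
    using Pers_linear[OF BP that] by simp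
  define proj where "proj q f \<longleftrightarrow> linear_between (B q) (B q) f \<and> (\<forall>v\<in>B q. f v = 0 \<longleftrightarrow> v \<in> A q) \<and>
      (\<forall>v\<in>B q. v - f v \<in> A q) \<and> (\<forall>v\<in>B q. f (f v) = f v)" for q f
  define \<pi> where "\<pi> q = (SOME f. proj q f)" for q
  have "proj q (\<pi> q)" if q: "q \<in> IS" for q
    using projection_exists[OF fB[OF q] submodD(1)[OF sA q] AB[OF q]]
    unfolding \<pi>_def proj_def by (rule someI_ex)
  then have \<pi>: "\<And>q. q \<in> IS \<Longrightarrow> linear_between (B q) (B q) (\<pi> q)"
    "\<And>q v. q \<in> IS \<Longrightarrow> v \<in> B q \<Longrightarrow> \<pi> q v = 0 \<longleftrightarrow> v \<in> A q"
    "\<And>q v. q \<in> IS \<Longrightarrow> v \<in> B q \<Longrightarrow> v - \<pi> q v \<in> A q"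
    "\<And>q v. q \<in> IS \<Longrightarrow> v \<in> B q \<Longrightarrow> \<pi> q (\<pi> q v) = \<pi> q v"
    unfolding proj_def by simp_all
  define C where "C = \<lparr>fib = \<lambda>q. \<pi> q ` B q, tr = \<lambda>p q v. \<pi> q (tr T p q v)\<rparr>"
  have fC: "fib C q = \<pi> q ` B q" and tC: "tr C p q v = \<pi> q (tr T p q v)" for p q v by (simp_all add: C_def)
  have \<pi>B: "\<pi> q v \<in> B q" if "q \<in> IS" "v \<in> B q" for q v using linear_betweenD(1)[OF \<pi>(1)] that by metis
  have CB: "fib C q \<subseteq> B q" if "q \<in> IS" for q using \<pi>B[OF that] by (auto simp: fC)
  have \<pi>C: "\<pi> q v = v" if "q \<in> IS" "v \<in> fib C q" for q v using that \<pi>(4) by (auto simp: fC)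
  have nat: "tr C p q (\<pi> p v) = \<pi> q (tr T p q v)" if a: "p \<in> IS" "q \<in> IS" "p \<le> q" "v \<in> B p" for p q v
  proof -
    note w = \<pi>B[OF a(1,4)]
    have "tr T p q (v - \<pi> p v) \<in> A q" using submodD(3)[OF sA a(1-3)] \<pi>(3)[OF a(1,4)] by metis
    then have "tr T p q v - tr T p q (\<pi> p v) \<in> A q"
      using linear_between_diff[OF lin[OF a(1-3)] submodD(1)[OF sB a(1)] a(4) w] by simp
    then have "\<pi> q (tr T p q v - tr T p q (\<pi> p v)) = 0"
      using \<pi>(2)[OF a(2)] AB[OF a(2)] by blast
    then show ?thesis
      using linear_between_diff[OF \<pi>(1)[OF a(2)] submodD(1)[OF sB a(2)]] submodD(3)[OF sB a(1-3)] a(4) w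
      by (simp add: tC)
  qed
  have trC: "tr C p q v \<in> fib C q" if "p \<in> IS" "q \<in> IS" "p \<le> q" "v \<in> fib C p" for p q v
    using submodD(3)[OF sB that(1-3)] CB[OF that(1)] that(4) by (auto simp: fC tC)
  have CP: "C \<in> Pers"
  proof (rule PersI)
    fix q :: "real ^ 'n" assume q: "q \<in> IS"
    show "findim (fib C q)" unfolding fC by (rule linear_between_image[OF fB[OF q] \<pi>(1)[OF q]])
  next
    fix p q :: "real ^ 'n" assume a: "p \<in> IS" "q \<in> IS" "p \<le> q"
    have "linear_between (B p) (B q) (\<lambda>v. \<pi> q (tr T p q v))"
      using linear_between_comp[OF lin[OF a] \<pi>(1)[OF a(2)]] .
    then show "linear_between (fib C p) (fib C q) (tr C p q)"
      using linear_between_mono[OF _ CB[OF a(1)]] trC[OF a] by (simp add: C_def image_subset_iff)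
  next
    fix p :: "real ^ 'n" and v assume a: "p \<in> IS" "v \<in> fib C p"
    have "v \<in> fib T p" using CB[OF a(1)] submodD(2)[OF sB a(1)] a(2) by blast
    then show "tr C p p v = v" using Pers_id[OF TP a(1)] \<pi>C[OF a] by (simp add: tC)
  next
    fix p q r :: "real ^ 'n" and v assume a: "p \<in> IS" "q \<in> IS" "r \<in> IS" "p \<le> q" "q \<le> r" "v \<in> fib C p"
    have v: "v \<in> B p" "v \<in> fib T p" using CB[OF a(1)] submodD(2)[OF sB a(1)] a(6) by auto
    have "tr C q r (tr C p q v) = \<pi> r (tr T q r (tr T p q v))"
      using nat[OF a(2,3,5) submodD(3)[OF sB a(1,2,4) v(1)]] by (simp add: tC)
    then show "tr C q r (tr C p q v) = tr C p r v" using Pers_comp[OF TP a(1-5) v(2)] by (simp add: tC)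
  qed
  have "adapted E C" unfolding adapted_def
  proof (intro conjI ballI impI)
    fix q :: "real ^ 'n" assume q: "q \<in> IS" "\<not> above E q"
    have "fib C q \<subseteq> {0}" using CB[OF q(1)] fsubD(2)[OF E(4) q] by simp
    then show "fib C q = {0}" using subspace_0[OF Pers_subspace[OF CP q(1)]] by blast
  next
    fix p q :: "real ^ 'n" assume a: "p \<in> IS" "q \<in> IS" "p \<le> q \<and> same E p q"
    then have pq: "p \<le> q" "same E p q" by auto
    have inj: "inj_on (tr T p q) (fib T p)" using adapted_bij[OF E(2) a(1,2) pq] unfolding bij_betw_def by simp
    have "inj_on (tr C p q) (fib C p)"
    proof (rule inj_onI)
      fix x y assume x: "x \<in> fib C p" and y: "y \<in> fib C p" and eq: "tr C p q x = tr C p q y"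
      have xB: "x \<in> B p" "y \<in> B p" using CB[OF a(1)] x y by auto
      have d: "x - y \<in> B p" using xB submodD(1)[OF sB a(1)] by (simp add: subspace_diff)
      have "\<pi> q (tr T p q (x - y)) = 0"
        using linear_between_diff[OF linear_between_comp[OF lin[OF a(1,2) pq(1)] \<pi>(1)[OF a(2)]] submodD(1)[OF sB a(1)] xB] eq
        by (simp add: tC)
      then have "tr T p q (x - y) \<in> A q" using \<pi>(2)[OF a(2) submodD(3)[OF sB a(1,2) pq(1) d]] by simp
      then obtain z where z: "z \<in> A p" "tr T p q (x - y) = tr T p q z"
        using fsubD(3)[OF E(3) a(1,2) pq] by auto
      have "x - y = z" using inj z d submodD(2)[OF sB a(1)] submodD(2)[OF sA a(1)] unfolding inj_on_def by blast
      then have "\<pi> p (x - y) = 0" using \<pi>(2)[OF a(1) d] z by simp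
      then show "x = y"
        using linear_between_diff[OF \<pi>(1)[OF a(1)] submodD(1)[OF sB a(1)] xB] \<pi>C[OF a(1) x] \<pi>C[OF a(1) y] by simp
    qed
    moreover have "tr C p q ` fib C p = fib C q"
    proof
      show "tr C p q ` fib C p \<subseteq> fib C q" using trC[OF a(1,2) pq(1)] by blast
      show "fib C q \<subseteq> tr C p q ` fib C p"
      proof
        fix v assume "v \<in> fib C q"
        then obtain b where "b \<in> B q" "v = \<pi> q b" by (auto simp: fC)
        then obtain b' where b': "b' \<in> B p" "v = \<pi> q (tr T p q b')"
          using fsubD(3)[OF E(4) a(1,2) pq] by auto
        then have "v = tr C p q (\<pi> p b')" using nat[OF a(1,2) pq(1) b'(1)] by simp
        then show "v \<in> tr C p q ` fib C p" using b' by (auto simp: fC)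
      qed
    qed
    ultimately show "bij_betw (tr C p q) (fib C p) (fib C q)" by (simp add: bij_betw_def)
  qed
  then have Cfp: "C \<in> Pers_fp" using CP E(1) Pers_fp_iff[of C] by metis
  have "short_exact (T\<lparr>fib := A\<rparr>) (T\<lparr>fib := B\<rparr>) C (\<lambda>q v. v) \<pi>"
    unfolding short_exact_def
  proof (intro conjI ballI Cfp subobject_fp[OF A] subobject_fp[OF B])
    show "(\<lambda>q v. v) \<in> Hom (T\<lparr>fib := A\<rparr>) (T\<lparr>fib := B\<rparr>)"
      unfolding Hom_def hom_over_def linear_between_def using AB by simp
    show "\<pi> \<in> Hom (T\<lparr>fib := B\<rparr>) C" unfolding Hom_def hom_over_def
    proof (intro CollectI conjI ballI impI)
      fix p :: "real ^ 'n" assume p: "p \<in> IS"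
      show "linear_between (fib (T\<lparr>fib := B\<rparr>) p) (fib C p) (\<pi> p)"
        using linear_between_mono[OF \<pi>(1)[OF p] order_refl, of "fib C p"] by (simp add: fC)
    next
      fix p q :: "real ^ 'n" and v assume a: "p \<in> IS" "q \<in> IS" "p \<le> q" "v \<in> fib (T\<lparr>fib := B\<rparr>) p"
      then show "\<pi> q (tr (T\<lparr>fib := B\<rparr>) p q v) = tr C p q (\<pi> p v)" using nat[OF a(1-3)] by simp
    qed
    fix q :: "real ^ 'n" assume q: "q \<in> IS"
    show "inj_on (\<lambda>v. v) (fib (T\<lparr>fib := A\<rparr>) q)" by simp
    show "(\<lambda>v. v) ` fib (T\<lparr>fib := A\<rparr>) q = {v \<in> fib (T\<lparr>fib := B\<rparr>) q. \<pi> q v = 0}"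
      using \<pi>(2)[OF q] AB[OF q] by auto
    show "\<pi> q ` fib (T\<lparr>fib := B\<rparr>) q = fib C q" by (simp add: fC)
  qed
  then show thesis using that by metis
qed

end

section \<open>Harder--Narasimhan truncations as largest maximisers\<close>

context persistence
begin

text \<open>
  Additivity holds by construction of the Grothendieck group, the exact sequences being among the
  generators of the relations.
\<close>

lemma K_class_short_exact:
  fixes Z :: "((real ^ 'n, 'v) pmod \<Rightarrow>\<^sub>0 int) set \<Rightarrow> complex"
  assumes Z: "stability_condition Z" and ex: "short_exact A B C \<iota> \<pi>"
  shows "Z (K_class B) = Z (K_class A) + Z (K_class C)"
proof -
  let ?G = "free_Abelian_group (Pers_fp :: (real ^ 'n, 'v) pmod set)"
  let ?R = "{frag_of B - (frag_of A + frag_of C) | A B C. \<exists>\<iota> \<pi>. short_exact A B C \<iota> \<pi>} :: ((real ^ 'n, 'v) pmod \<Rightarrow>\<^sub>0 int) set"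
  interpret G: comm_group ?G by (rule abelian_free_Abelian_group)
  have frag: "frag_of X \<in> carrier ?G" if "X \<in> Pers_fp" for X :: "(real ^ 'n, 'v) pmod" using that by simp
  have mem: "A \<in> Pers_fp" "B \<in> Pers_fp" "C \<in> Pers_fp" using ex unfolding short_exact_def by blast+
  have RG: "?R \<subseteq> carrier ?G"
  proof
    fix r assume "r \<in> ?R"
    then obtain A B C \<iota> \<pi> where r: "r = frag_of B - (frag_of A + frag_of C)" and e: "short_exact A B C \<iota> \<pi>" by blast
    have m: "A \<in> Pers_fp" "B \<in> Pers_fp" "C \<in> Pers_fp" using e unfolding short_exact_def by blast+
    have "r = frag_of B \<otimes>\<^bsub>?G\<^esub> inv\<^bsub>?G\<^esub> (frag_of A \<otimes>\<^bsub>?G\<^esub> frag_of C)"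
      using r m G.m_closed[OF frag[OF m(1)] frag[OF m(3)]] by simp
    then show "r \<in> carrier ?G" using frag m by (metis G.inv_closed G.m_closed)
  qed
  have sub: "subgroup K_relations ?G" unfolding K_relations_def by (rule G.generate_is_subgroup[OF RG])
  interpret N: normal K_relations ?G by (rule G.subgroup_imp_normal[OF sub])
  have r: "frag_of B - (frag_of A + frag_of C) \<in> K_relations"
    unfolding K_relations_def by (rule generate.incl) (use ex in blast)
  have AC: "frag_of A + frag_of C \<in> carrier ?G" using G.m_closed[OF frag[OF mem(1)] frag[OF mem(3)]] by simp
  have "frag_of B \<in> K_relations #>\<^bsub>?G\<^esub> (frag_of A + frag_of C)"
    unfolding r_coset_def using r by force
  then have "K_class B = K_relations #>\<^bsub>?G\<^esub> (frag_of A + frag_of C)"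
    unfolding K_class_def using G.repr_independence[OF _ AC sub] by simp
  also have "\<dots> = K_class A <#>\<^bsub>?G\<^esub> K_class C"
    unfolding K_class_def using N.rcos_sum[OF frag[OF mem(1)] frag[OF mem(3)]] by simp
  also have "\<dots> = K_class A \<otimes>\<^bsub>K_group\<^esub> K_class C" by (simp add: K_group_def FactGroup_def)
  finally have eq: "K_class B = K_class A \<otimes>\<^bsub>K_group\<^esub> K_class C" .
  have car: "K_class X \<in> carrier K_group" if "X \<in> Pers_fp" for X :: "(real ^ 'n, 'v) pmod"
    using frag[OF that] unfolding K_class_def K_group_def FactGroup_def RCOSETS_def by auto
  have hom: "Z \<in> hom K_group \<lparr>carrier = UNIV, monoid.mult = (+), one = 0\<rparr>"
    using Z unfolding stability_condition_def by simp
  show ?thesis using hom_mult[OF hom car[OF mem(1)] car[OF mem(3)]] eq by simp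
qed

lemma stability_pos: "stability_condition Z \<Longrightarrow> V \<in> Pers_fp \<Longrightarrow> \<not> is_zero V \<Longrightarrow> Re (Z (K_class V)) > 0"
  unfolding stability_condition_def by simp

lemma K_class_zero:
  fixes C :: "(real ^ 'n, 'v) pmod"
  assumes Z: "stability_condition Z" and C: "C \<in> Pers_fp" "is_zero C"
  shows "Z (K_class C) = 0"
proof -
  have z: "fib C q = {0}" if "q \<in> IS" for q using C(2) that unfolding is_zero_def by simp
  have "(\<lambda>q v. v) \<in> Hom C C" unfolding Hom_def hom_over_def linear_between_def by auto
  then have "short_exact C C C (\<lambda>q v. v) (\<lambda>q v. v)" unfolding short_exact_def using C z by auto
  then show ?thesis using K_class_short_exact[OF Z] by fastforce
qed

definition charge ::
  "(((real ^ 'n, 'v) pmod \<Rightarrow>\<^sub>0 int) set \<Rightarrow> complex) \<Rightarrow> (real ^ 'n, 'v) pmod \<Rightarrow> (real ^ 'n \<Rightarrow> 'v set) \<Rightarrow> complex" where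
  "charge Z T W = Z (K_class (T\<lparr>fib := W\<rparr>))"

text \<open>The height of a subobject above the line of slope \<open>\<theta>\<close> in the Harder--Narasimhan polygon.\<close>

definition height ::
  "(((real ^ 'n, 'v) pmod \<Rightarrow>\<^sub>0 int) set \<Rightarrow> complex) \<Rightarrow> (real ^ 'n, 'v) pmod \<Rightarrow> real \<Rightarrow> (real ^ 'n \<Rightarrow> 'v set) \<Rightarrow> real" where
  "height Z T \<theta> W = Im (charge Z T W) - \<theta> * Re (charge Z T W)"

text \<open>
  Inclusion is required on the poset only, since fibres elsewhere carry no information.
\<close>

definition largest_max ::
  "(((real ^ 'n, 'v) pmod \<Rightarrow>\<^sub>0 int) set \<Rightarrow> complex) \<Rightarrow> (real ^ 'n, 'v) pmod \<Rightarrow> real \<Rightarrow> (real ^ 'n \<Rightarrow> 'v set) \<Rightarrow> bool" where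
  "largest_max Z T \<theta> M \<longleftrightarrow> M \<in> subobjects T \<and>
     (\<forall>W\<in>subobjects T. height Z T \<theta> W \<le> height Z T \<theta> M \<and>
        (height Z T \<theta> W = height Z T \<theta> M \<longrightarrow> (\<forall>q\<in>IS. W q \<subseteq> M q)))"

end

locale stable_module = persistence scale K
  for scale :: "'f::field \<Rightarrow> 'v::ab_group_add \<Rightarrow> 'v" and K :: "real set" +
  fixes Z :: "((real ^ 'n, 'v) pmod \<Rightarrow>\<^sub>0 int) set \<Rightarrow> complex"
    and T :: "(real ^ 'n, 'v) pmod"
  assumes Z: "stability_condition Z" and T: "T \<in> Pers_fp"
begin

lemma charge_quotient:
  assumes "short_exact (T\<lparr>fib := A\<rparr>) (T\<lparr>fib := B\<rparr>) C \<iota> \<pi>"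
  shows "charge Z T B = charge Z T A + Z (K_class C)"
  unfolding charge_def using K_class_short_exact[OF Z assms] .

lemma short_exact_is_zero:
  assumes "short_exact (T\<lparr>fib := A\<rparr>) (T\<lparr>fib := B\<rparr>) C (\<lambda>q v. v) \<pi>"
  shows "is_zero C \<longleftrightarrow> (\<forall>q\<in>IS. A q = B q)" "\<And>q. q \<in> IS \<Longrightarrow> A q \<subseteq> B q"
    "\<And>q. q \<in> IS \<Longrightarrow> A q = {v \<in> B q. \<pi> q v = 0}" "\<And>q. q \<in> IS \<Longrightarrow> \<pi> q ` B q = fib C q" "C \<in> Pers_fp"
    "\<pi> \<in> Hom (T\<lparr>fib := B\<rparr>) C"
proof -
  show k: "\<And>q. q \<in> IS \<Longrightarrow> A q = {v \<in> B q. \<pi> q v = 0}" and i: "\<And>q. q \<in> IS \<Longrightarrow> \<pi> q ` B q = fib C q"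
    and C: "C \<in> Pers_fp" and H: "\<pi> \<in> Hom (T\<lparr>fib := B\<rparr>) C"
    using assms unfolding short_exact_def by auto
  show "\<And>q. q \<in> IS \<Longrightarrow> A q \<subseteq> B q" using k by auto
  have "fib C q = {0} \<longleftrightarrow> A q = B q" if q: "q \<in> IS" for q
  proof -
    have "0 \<in> \<pi> q ` B q" using i[OF q] subspace_0[OF Pers_subspace[OF fp_Pers[OF C] q]] by simp
    then show ?thesis using k[OF q] i[OF q, symmetric] by auto
  qed
  then show "is_zero C \<longleftrightarrow> (\<forall>q\<in>IS. A q = B q)" unfolding is_zero_def by simp
qed

lemma charge_mono:
  assumes A: "A \<in> subobjects T" and B: "B \<in> subobjects T" and AB: "\<And>q. q \<in> IS \<Longrightarrow> A q \<subseteq> B q"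
  shows "Re (charge Z T A) \<le> Re (charge Z T B)"
    and "Re (charge Z T A) = Re (charge Z T B) \<Longrightarrow> q \<in> IS \<Longrightarrow> A q = B q"
proof -
  obtain C \<pi> where e: "short_exact (T\<lparr>fib := A\<rparr>) (T\<lparr>fib := B\<rparr>) C (\<lambda>q v. v) \<pi>"
    using quotient_exists[OF T A B AB] .
  note z = short_exact_is_zero[OF e] and c = charge_quotient[OF e]
  have "is_zero C \<or> Re (Z (K_class C)) > 0" using stability_pos[OF Z z(5)] by blast
  then show "Re (charge Z T A) \<le> Re (charge Z T B)"
    and "Re (charge Z T A) = Re (charge Z T B) \<Longrightarrow> q \<in> IS \<Longrightarrow> A q = B q"
    using c z(1) K_class_zero[OF Z z(5)] by (auto simp: complex_eq_iff)
qed

lemma charge_cong: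
  assumes A: "A \<in> subobjects T" and AB: "\<And>q. q \<in> IS \<Longrightarrow> A q = B q"
  shows "charge Z T A = charge Z T B"
proof -
  have B: "B \<in> subobjects T" using subobject_cong[OF T A] AB by metis
  obtain C \<pi> where e: "short_exact (T\<lparr>fib := A\<rparr>) (T\<lparr>fib := B\<rparr>) C (\<lambda>q v. v) \<pi>"
    using quotient_exists[OF T A B] AB by blast
  then show ?thesis
    using charge_quotient[OF e] short_exact_is_zero(1,5)[OF e] K_class_zero[OF Z] AB by simp
qed

lemma charge_zero: "charge Z T (\<lambda>_. {0}) = 0"
  unfolding charge_def
  by (rule K_class_zero[OF Z subobject_fp[OF zero_subobject[OF T]]]) (simp add: is_zero_def)

text \<open>
  Modularity is the second isomorphism theorem: \<open>(A + B)/B\<close> is also the quotient \<open>A/(A \<inter> B)\<close>.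
\<close>

lemma charge_modular:
  assumes A: "A \<in> subobjects T" and B: "B \<in> subobjects T"
  shows "charge Z T (plus_sub A B) + charge Z T (\<lambda>q. A q \<inter> B q) = charge Z T A + charge Z T B"
proof -
  note sA = subobject_submod[OF T A] and sB = subobject_submod[OF T B]
  have P: "plus_sub A B \<in> subobjects T" and I: "(\<lambda>q. A q \<inter> B q) \<in> subobjects T"
    using subobject_plus[OF T A B] subobject_inter[OF T A B] .
  note up = plus_sub_upper[OF sA sB]
  obtain C \<pi> where e: "short_exact (T\<lparr>fib := B\<rparr>) (T\<lparr>fib := plus_sub A B\<rparr>) C (\<lambda>q v. v) \<pi>"
    using quotient_exists[OF T B P up(2)] .
  note k = short_exact_is_zero[OF e]
  have lin: "linear_between (plus_sub A B q) (fib C q) (\<pi> q)" if "q \<in> IS" for q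
    using k(6) that unfolding Hom_def hom_over_def by simp
  have "short_exact (T\<lparr>fib := \<lambda>q. A q \<inter> B q\<rparr>) (T\<lparr>fib := A\<rparr>) C (\<lambda>q v. v) \<pi>"
    unfolding short_exact_def
  proof (intro conjI ballI subobject_fp[OF I] subobject_fp[OF A] k(5))
    show "(\<lambda>q v. v) \<in> Hom (T\<lparr>fib := \<lambda>q. A q \<inter> B q\<rparr>) (T\<lparr>fib := A\<rparr>)"
      unfolding Hom_def hom_over_def linear_between_def by simp
    show "\<pi> \<in> Hom (T\<lparr>fib := A\<rparr>) C" unfolding Hom_def hom_over_def
    proof (intro CollectI conjI ballI impI)
      fix p :: "real ^ 'n" assume p: "p \<in> IS"
      show "linear_between (fib (T\<lparr>fib := A\<rparr>) p) (fib C p) (\<pi> p)"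
        using linear_between_mono[OF lin[OF p] up(1)[OF p], of "fib C p"] linear_betweenD(1)[OF lin[OF p]] up(1)[OF p]
        by (simp add: image_subset_iff subset_eq)
    next
      fix p q v assume "p \<in> IS" "q \<in> IS" "p \<le> q" "v \<in> fib (T\<lparr>fib := A\<rparr>) p"
      then show "\<pi> q (tr (T\<lparr>fib := A\<rparr>) p q v) = tr C p q (\<pi> p v)"
        using k(6) up(1)[of p] unfolding Hom_def hom_over_def by (simp add: subset_eq)
    qed
    fix q :: "real ^ 'n" assume q: "q \<in> IS"
    show "inj_on (\<lambda>v. v) (fib (T\<lparr>fib := \<lambda>q. A q \<inter> B q\<rparr>) q)" by simp
    show "(\<lambda>v. v) ` fib (T\<lparr>fib := \<lambda>q. A q \<inter> B q\<rparr>) q = {v \<in> fib (T\<lparr>fib := A\<rparr>) q. \<pi> q v = 0}"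
      using k(3)[OF q] up(1)[OF q] by auto
    have "\<pi> q ` plus_sub A B q \<subseteq> \<pi> q ` A q"
    proof
      fix w assume "w \<in> \<pi> q ` plus_sub A B q"
      then obtain a b where ab: "w = \<pi> q (a + b)" "a \<in> A q" "b \<in> B q" unfolding plus_sub_def by auto
      then have "w = \<pi> q a + \<pi> q b" using linear_betweenD(2)[OF lin[OF q]] up[OF q] by (metis subsetD)
      moreover have "\<pi> q b = 0" using k(3)[OF q] ab by blast
      ultimately show "w \<in> \<pi> q ` A q" using ab by auto
    qed
    then show "\<pi> q ` fib (T\<lparr>fib := A\<rparr>) q = fib C q" using k(4)[OF q] up(1)[OF q] by auto
  qed
  then show ?thesis using charge_quotient[OF e] charge_quotient by fastforce
qed

lemma height_modular:
  assumes "A \<in> subobjects T" "B \<in> subobjects T"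
  shows "height Z T \<theta> (plus_sub A B) + height Z T \<theta> (\<lambda>q. A q \<inter> B q) = height Z T \<theta> A + height Z T \<theta> B"
proof -
  have "Re (charge Z T (plus_sub A B)) + Re (charge Z T (\<lambda>q. A q \<inter> B q)) = Re (charge Z T A) + Re (charge Z T B)"
    "Im (charge Z T (plus_sub A B)) + Im (charge Z T (\<lambda>q. A q \<inter> B q)) = Im (charge Z T A) + Im (charge Z T B)"
    using charge_modular[OF assms] by (metis plus_complex.simps)+
  then have "\<theta> * (Re (charge Z T (plus_sub A B)) + Re (charge Z T (\<lambda>q. A q \<inter> B q))) = \<theta> * (Re (charge Z T A) + Re (charge Z T B))"
    by simp
  then show ?thesis unfolding height_def
    using \<open>Im (charge Z T (plus_sub A B)) + _ = _\<close> by (simp add: algebra_simps)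
qed

lemma height_cong:
  assumes "A \<in> subobjects T" "\<And>q. q \<in> IS \<Longrightarrow> A q = B q" shows "height Z T \<theta> A = height Z T \<theta> B"
  unfolding height_def using charge_cong[OF assms] by simp

text \<open>
  Images and preimages along quotient maps are again finitely presentable, so that subobjects of
  the layers of a filtration can be compared with subobjects of the whole module.
\<close>

lemma image_subobject:
  assumes B: "B \<in> subobjects T" and C: "C \<in> Pers_fp" and \<pi>: "\<pi> \<in> Hom (T\<lparr>fib := B\<rparr>) C"
    and W: "W \<in> subobjects T" and WB: "\<And>q. q \<in> IS \<Longrightarrow> W q \<subseteq> B q"
  shows "(\<lambda>q. \<pi> q ` W q) \<in> subobjects C"
proof -
  obtain E where E: "levels K E" "adapted E T" "fsub E T W" using common_levels[OF T W W] by metis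
  note sW = fsubD(1)[OF E(3)]
  have lin: "linear_between (B q) (fib C q) (\<pi> q)" if "q \<in> IS" for q
    using \<pi> that unfolding Hom_def hom_over_def by simp
  have nat: "\<pi> q (tr T p q v) = tr C p q (\<pi> p v)" if "p \<in> IS" "q \<in> IS" "p \<le> q" "v \<in> W p" for p q v
    using \<pi> that WB[of p] unfolding Hom_def hom_over_def by (simp add: subset_eq)
  have linW: "linear_between (W q) (fib C q) (\<pi> q)" if "q \<in> IS" for q
    using linear_between_mono[OF lin[OF that] WB[OF that], of "fib C q"] linear_betweenD(1)[OF lin[OF that]] WB[OF that]
    by (simp add: image_subset_iff subset_eq)
  have "fsub E C (\<lambda>q. \<pi> q ` W q)"
  proof (rule fsubI)
    show "submod C (\<lambda>q. \<pi> q ` W q)" unfolding submod_def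
    proof (intro conjI ballI impI)
      fix q :: "real ^ 'n" assume q: "q \<in> IS"
      show "subspace (\<pi> q ` W q)" by (rule subspace_linear_image[OF linW[OF q] submodD(1)[OF sW q]])
      show "\<pi> q ` W q \<subseteq> fib C q" using linear_betweenD(1)[OF linW[OF q]] by blast
    next
      fix p q :: "real ^ 'n" assume a: "p \<in> IS" "q \<in> IS" "p \<le> q"
      show "tr C p q ` \<pi> p ` W p \<subseteq> \<pi> q ` W q"
        using nat[OF a, symmetric] submodD(3)[OF sW a] by (auto simp: image_subset_iff)
    qed
    show "\<pi> q ` W q \<subseteq> {0}" if "q \<in> IS" "\<not> above E q" for q
      using fsubD(2)[OF E(3) that] linear_between_0[OF linW[OF that(1)] submodD(1)[OF sW that(1)]] by simp
    fix p q v assume a: "p \<in> IS" "q \<in> IS" "p \<le> q" "same E p q" "v \<in> \<pi> q ` W q"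
    then obtain u where "u \<in> W p" "v = \<pi> q (tr T p q u)" using fsubD(3)[OF E(3) a(1-4)] by auto
    then show "v \<in> tr C p q ` \<pi> p ` W p" using nat[OF a(1-3)] by auto
  qed
  then show ?thesis by (rule fsub_subobject[OF C E(1)])
qed

lemma preimage_subobject:
  assumes B: "B \<in> subobjects T" and C: "C \<in> Pers_fp" and \<pi>: "\<pi> \<in> Hom (T\<lparr>fib := B\<rparr>) C"
    and W: "W \<in> subobjects C"
  shows "(\<lambda>q. {v \<in> B q. \<pi> q v \<in> W q}) \<in> subobjects T"
proof -
  obtain E1 where E1: "levels K E1" "adapted E1 T" "fsub E1 T B" using common_levels[OF T B B] by metis
  obtain E2 where E2: "levels K E2" "adapted E2 C" "fsub E2 C W" using common_levels[OF C W W] by metis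
  let ?E = "\<lambda>i. E1 i \<union> E2 i"
  have E: "levels K ?E" using levels_Un E1 E2 by metis
  have T': "adapted ?E T" by (rule adapted_mono[OF E1(2)]) blast
  have B': "fsub ?E T B" by (rule fsub_mono[OF E1(3)]) blast
  have C': "adapted ?E C" by (rule adapted_mono[OF E2(2)]) blast
  have W': "fsub ?E C W" by (rule fsub_mono[OF E2(3)]) blast
  note sB = fsubD(1)[OF B'] and sW = fsubD(1)[OF W']
  have lin: "linear_between (B q) (fib C q) (\<pi> q)" if "q \<in> IS" for q
    using \<pi> that unfolding Hom_def hom_over_def by simp
  have nat: "\<pi> q (tr T p q v) = tr C p q (\<pi> p v)" if "p \<in> IS" "q \<in> IS" "p \<le> q" "v \<in> B p" for p q v
    using \<pi> that unfolding Hom_def hom_over_def by simp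
  have "fsub ?E T (\<lambda>q. {v \<in> B q. \<pi> q v \<in> W q})"
  proof (rule fsubI)
    show "submod T (\<lambda>q. {v \<in> B q. \<pi> q v \<in> W q})" unfolding submod_def
    proof (intro conjI ballI impI)
      fix q :: "real ^ 'n" assume q: "q \<in> IS"
      show "subspace {v \<in> B q. \<pi> q v \<in> W q}"
        by (rule subspace_linear_preimage[OF lin[OF q] submodD(1)[OF sB q] submodD(1)[OF sW q]])
      show "{v \<in> B q. \<pi> q v \<in> W q} \<subseteq> fib T q" using submodD(2)[OF sB q] by blast
    next
      fix p q :: "real ^ 'n" assume a: "p \<in> IS" "q \<in> IS" "p \<le> q"
      show "tr T p q ` {v \<in> B p. \<pi> p v \<in> W p} \<subseteq> {v \<in> B q. \<pi> q v \<in> W q}"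
        using nat[OF a] submodD(3)[OF sB a] submodD(3)[OF sW a] by auto
    qed
    show "{v \<in> B q. \<pi> q v \<in> W q} \<subseteq> {0}" if "q \<in> IS" "\<not> above ?E q" for q
      using fsubD(2)[OF B' that] by auto
    fix p q v assume a: "p \<in> IS" "q \<in> IS" "p \<le> q" "same ?E p q" "v \<in> {v \<in> B q. \<pi> q v \<in> W q}"
    then obtain u where u: "u \<in> B p" "v = tr T p q u" using fsubD(3)[OF B' a(1-4)] by auto
    obtain w where w: "w \<in> W p" "\<pi> q v = tr C p q w" using fsubD(3)[OF W' a(1-4)] a(5) by auto
    have "inj_on (tr C p q) (fib C p)" using adapted_bij[OF C' a(1-4)] unfolding bij_betw_def by simp
    moreover have "tr C p q (\<pi> p u) = tr C p q w" using nat[OF a(1-3) u(1)] u w by simp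
    ultimately have "\<pi> p u = w"
      using linear_betweenD(1)[OF lin[OF a(1)] u(1)] submodD(2)[OF sW a(1)] w(1) unfolding inj_on_def by blast
    then show "v \<in> tr T p q ` {v \<in> B p. \<pi> p v \<in> W p}" using u w by blast
  qed
  then show ?thesis by (rule fsub_subobject[OF T E])
qed

lemma restricted_short_exact:
  assumes e: "short_exact (T\<lparr>fib := A\<rparr>) (T\<lparr>fib := B\<rparr>) C (\<lambda>q v. v) \<pi>" and B: "B \<in> subobjects T"
    and W: "W \<in> subobjects T" and WB: "\<And>q. q \<in> IS \<Longrightarrow> W q \<subseteq> B q"
    and I: "I \<in> subobjects T" and IW: "\<And>q. q \<in> IS \<Longrightarrow> I q = A q \<inter> W q"
    and J: "J \<in> subobjects C" and JW: "\<And>q. q \<in> IS \<Longrightarrow> J q = \<pi> q ` W q"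
  shows "charge Z T W = charge Z T I + charge Z C J"
proof -
  note k = short_exact_is_zero[OF e]
  have lin: "linear_between (B q) (fib C q) (\<pi> q)" if "q \<in> IS" for q
    using k(6) that unfolding Hom_def hom_over_def by simp
  have "short_exact (T\<lparr>fib := I\<rparr>) (T\<lparr>fib := W\<rparr>) (C\<lparr>fib := J\<rparr>) (\<lambda>q v. v) \<pi>"
    unfolding short_exact_def
  proof (intro conjI ballI subobject_fp[OF I] subobject_fp[OF W] subobject_fp[OF J])
    show "(\<lambda>q v. v) \<in> Hom (T\<lparr>fib := I\<rparr>) (T\<lparr>fib := W\<rparr>)"
      unfolding Hom_def hom_over_def linear_between_def using IW by simp
    show "\<pi> \<in> Hom (T\<lparr>fib := W\<rparr>) (C\<lparr>fib := J\<rparr>)" unfolding Hom_def hom_over_def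
    proof (intro CollectI conjI ballI impI)
      fix p :: "real ^ 'n" assume p: "p \<in> IS"
      show "linear_between (fib (T\<lparr>fib := W\<rparr>) p) (fib (C\<lparr>fib := J\<rparr>) p) (\<pi> p)"
        using linear_between_mono[OF lin[OF p] WB[OF p], of "J p"] JW[OF p] by simp
    next
      fix p q v assume "p \<in> IS" "q \<in> IS" "p \<le> q" "v \<in> fib (T\<lparr>fib := W\<rparr>) p"
      then show "\<pi> q (tr (T\<lparr>fib := W\<rparr>) p q v) = tr (C\<lparr>fib := J\<rparr>) p q (\<pi> p v)"
        using k(6) WB[of p] unfolding Hom_def hom_over_def by (simp add: subset_eq)
    qed
    fix q :: "real ^ 'n" assume q: "q \<in> IS"
    show "inj_on (\<lambda>v. v) (fib (T\<lparr>fib := I\<rparr>) q)" by simp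
    show "(\<lambda>v. v) ` fib (T\<lparr>fib := I\<rparr>) q = {v \<in> fib (T\<lparr>fib := W\<rparr>) q. \<pi> q v = 0}"
      using k(3)[OF q] WB[OF q] IW[OF q] by auto
    show "\<pi> q ` fib (T\<lparr>fib := W\<rparr>) q = fib (C\<lparr>fib := J\<rparr>) q" using JW[OF q] by simp
  qed
  then show ?thesis using charge_quotient[of I W] by (simp add: charge_def)
qed

end

context stable_module
begin

lemma largest_max_unique:
  assumes "largest_max Z T \<theta> A" "largest_max Z T \<theta> B" "q \<in> IS" shows "A q = B q"
  using assms unfolding largest_max_def by (meson order_antisym)

text \<open>
  Intersecting a subobject with a Harder--Narasimhan filtration, each layer is a subobject of a
  semistable quotient and so lies below its slope. Hence the layers of slope at least \<open>\<theta>\<close> gain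
  the most height if taken completely, and the others lose height if taken at all.
\<close>

lemma HN_piece_largest_max:
  assumes HN: "is_HN_filtration Z T l F C" and i: "i \<le> l"
    and lo: "i = 0 \<or> slope Z (C (i - 1)) \<ge> \<theta>" and hi: "i = l \<or> \<theta> > slope Z (C i)"
  shows "largest_max Z T \<theta> (F i)"
proof -
  note HN' = HN[unfolded is_HN_filtration_def]
  note F = HN'[THEN conjunct1, THEN spec, THEN mp]
  note ends = HN'[THEN conjunct2, THEN conjunct1, THEN bspec]
  note step = HN'[THEN conjunct2, THEN conjunct2, THEN conjunct1, THEN spec, THEN mp]
  note dec = HN'[THEN conjunct2, THEN conjunct2, THEN conjunct2, THEN spec, THEN mp]
  note F0 = ends[THEN conjunct1] and Fl = ends[THEN conjunct2]
    and Fm = step[THEN conjunct1, THEN bspec]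
    and ex = step[THEN conjunct2, THEN conjunct2, THEN conjunct1]
    and ss = step[THEN conjunct2, THEN conjunct2, THEN conjunct2]
  have anti: "slope Z (C k) \<le> slope Z (C j)" if "j \<le> k" "k < l" for j k
    using that
  proof (induction k rule: dec_induct)
    case (step n) then show ?case using dec[of n] by simp
  qed simp
  have big: "slope Z (C j) \<ge> \<theta>" if "j < i" for j using lo anti[of j "i - 1"] i that by fastforce
  have small: "slope Z (C j) < \<theta>" if "i \<le> j" "j < l" for j using hi anti[of i j] that by fastforce
  have main: "\<exists>r m R. height Z T \<theta> (\<lambda>q. F (Suc j) q \<inter> W q) - height Z T \<theta> (\<lambda>q. F j q \<inter> W q) = m - \<theta> * r \<and>
     height Z T \<theta> (F (Suc j)) - height Z T \<theta> (F j) = (slope Z (C j) - \<theta>) * R \<and>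
     m \<le> slope Z (C j) * r \<and> 0 \<le> r \<and> r \<le> R \<and> (r = 0 \<longrightarrow> (\<forall>q\<in>IS. F (Suc j) q \<inter> W q \<subseteq> F j q))"
    if W: "W \<in> subobjects T" and j: "j < l" for W j
  proof -
    obtain \<pi> where e: "short_exact (T\<lparr>fib := F j\<rparr>) (T\<lparr>fib := F (Suc j)\<rparr>) (C j) (\<lambda>q v. v) \<pi>" using ex[OF j] by blast
    have j': "j \<le> l" "Suc j \<le> l" using j by auto
    let ?W = "\<lambda>q. F (Suc j) q \<inter> W q" and ?I = "\<lambda>q. F j q \<inter> W q"
    have sW: "?W \<in> subobjects T" and sI: "?I \<in> subobjects T"
      using subobject_inter[OF T F[OF j'(2)] W] subobject_inter[OF T F[OF j'(1)] W] by auto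
    note k = short_exact_is_zero[OF e]
    let ?J = "\<lambda>q. \<pi> q ` ?W q"
    have sJ: "?J \<in> subobjects (C j)" by (rule image_subobject[OF F[OF j'(2)] k(5,6) sW]) blast
    have ch: "charge Z T ?W = charge Z T ?I + charge Z (C j) ?J"
      by (rule restricted_short_exact[OF e F[OF j'(2)] sW _ sI _ sJ]) (use k(2) in blast)+
    interpret C: stable_module scale K Z "C j" by unfold_locales (use Z k(5) in auto)
    define r m R where "r = Re (charge Z (C j) ?J)" and "m = Im (charge Z (C j) ?J)" and "R = Re (Z (K_class (C j)))"
    have nz: "\<not> is_zero (C j)" using ss[OF j] unfolding semistable_def by blast
    have R: "R > 0" unfolding R_def using stability_pos[OF Z k(5) nz] .
    have "Im (Z (K_class (C j))) = slope Z (C j) * R" unfolding slope_def R_def using R R_def by simp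
    moreover have "charge Z T (F (Suc j)) = charge Z T (F j) + Z (K_class (C j))" by (rule charge_quotient[OF e])
    ultimately have hF: "height Z T \<theta> (F (Suc j)) - height Z T \<theta> (F j) = (slope Z (C j) - \<theta>) * R"
      unfolding height_def R_def by (simp add: algebra_simps)
    have hW: "height Z T \<theta> ?W - height Z T \<theta> ?I = m - \<theta> * r"
      unfolding height_def m_def r_def ch by (simp add: algebra_simps)
    have "charge Z (C j) (fib (C j)) = Z (K_class (C j))" by (simp add: charge_def)
    then have rR: "r \<le> R" unfolding r_def R_def
      using C.charge_mono(1)[OF sJ whole_subobject[OF k(5)]] submodD(2)[OF subobject_submod[OF k(5) sJ]] by simp
    have "m \<le> slope Z (C j) * r \<and> 0 \<le> r \<and> (r = 0 \<longrightarrow> (\<forall>q\<in>IS. ?W q \<subseteq> F j q))"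
    proof (cases "is_zero ((C j)\<lparr>fib := ?J\<rparr>)")
      case True
      then have "charge Z (C j) ?J = 0" unfolding charge_def using K_class_zero[OF Z subobject_fp[OF sJ]] by simp
      moreover have "?W q \<subseteq> F j q" if "q \<in> IS" for q
        using True k(3)[OF that] that unfolding is_zero_def by auto
      ultimately show ?thesis unfolding m_def r_def by simp
    next
      case False
      have pos: "r > 0" unfolding r_def charge_def using stability_pos[OF Z subobject_fp[OF sJ] False] .
      have "slope Z ((C j)\<lparr>fib := ?J\<rparr>) \<le> slope Z (C j)" using ss[OF j] sJ False unfolding semistable_def by blast
      then have "m / r \<le> slope Z (C j)" unfolding slope_def[of Z "(C j)\<lparr>fib := ?J\<rparr>"] m_def r_def charge_def .
      then show ?thesis using pos by (simp add: field_simps)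
    qed
    then show ?thesis using hF hW rR by blast
  qed
  have layer: "height Z T \<theta> (\<lambda>q. F (Suc j) q \<inter> W q) - height Z T \<theta> (\<lambda>q. F j q \<inter> W q)
        \<le> height Z T \<theta> (F (Suc j)) - height Z T \<theta> (F j)"
    if W: "W \<in> subobjects T" and j: "j < i" for W j
  proof -
    obtain r m R where *: "height Z T \<theta> (\<lambda>q. F (Suc j) q \<inter> W q) - height Z T \<theta> (\<lambda>q. F j q \<inter> W q) = m - \<theta> * r"
      "height Z T \<theta> (F (Suc j)) - height Z T \<theta> (F j) = (slope Z (C j) - \<theta>) * R"
      "m \<le> slope Z (C j) * r" "r \<le> R" using main[OF W, of j] j i by auto
    have "m - \<theta> * r \<le> (slope Z (C j) - \<theta>) * r" using *(3) by (simp add: algebra_simps)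
    also have "\<dots> \<le> (slope Z (C j) - \<theta>) * R" using big[OF j] *(4) by (intro mult_left_mono) auto
    finally show ?thesis using * by simp
  qed
  have layer0: "height Z T \<theta> (\<lambda>q. F (Suc j) q \<inter> W q) \<le> height Z T \<theta> (\<lambda>q. F j q \<inter> W q) \<and>
      (height Z T \<theta> (\<lambda>q. F (Suc j) q \<inter> W q) = height Z T \<theta> (\<lambda>q. F j q \<inter> W q) \<longrightarrow>
        (\<forall>q\<in>IS. F (Suc j) q \<inter> W q \<subseteq> F j q))"
    if W: "W \<in> subobjects T" and j: "i \<le> j" "j < l" for W j
  proof -
    obtain r m where *: "height Z T \<theta> (\<lambda>q. F (Suc j) q \<inter> W q) - height Z T \<theta> (\<lambda>q. F j q \<inter> W q) = m - \<theta> * r"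
        "m \<le> slope Z (C j) * r" "0 \<le> r" "r = 0 \<longrightarrow> (\<forall>q\<in>IS. F (Suc j) q \<inter> W q \<subseteq> F j q)"
      using main[OF W j(2)] by auto
    have le: "m - \<theta> * r \<le> (slope Z (C j) - \<theta>) * r" using *(2) by (simp add: algebra_simps)
    have neg: "(slope Z (C j) - \<theta>) * r \<le> 0" using small[OF j] *(3) by (simp add: mult_le_0_iff)
    have "r = 0" if "m - \<theta> * r = 0"
    proof -
      have "(slope Z (C j) - \<theta>) * r = 0" using le neg that by simp
      then show ?thesis using small[OF j] by simp
    qed
    then show ?thesis using * le neg by auto
  qed
  show ?thesis unfolding largest_max_def
  proof (rule conjI[OF F[OF i]], rule ballI)
    fix W assume W: "W \<in> subobjects T"
    define h where "h j = height Z T \<theta> (\<lambda>q. F j q \<inter> W q)" for j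
    have sub: "(\<lambda>q. F j q \<inter> W q) \<in> subobjects T" if "j \<le> l" for j using subobject_inter[OF T F[OF that] W] .
    have up: "h j \<le> height Z T \<theta> (F j)" if "j \<le> i" for j
      using that
    proof (induction j)
      case 0
      have "F 0 q = F 0 q \<inter> W q" if "q \<in> IS" for q
        using F0[OF that] subspace_0[OF submodD(1)[OF subobject_submod[OF T W] that]] by auto
      then show ?case using height_cong[OF F, of 0 "\<lambda>q. F 0 q \<inter> W q"] unfolding h_def by simp
    next
      case (Suc j) then show ?case using layer[OF W, of j] unfolding h_def by simp
    qed
    have down: "h k \<le> h j" if "i \<le> j" "j \<le> k" "k \<le> l" for j k
      using that(2,3)
    proof (induction k rule: dec_induct)
      case (step n) then show ?case using layer0[OF W, of n] that(1) unfolding h_def by force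
    qed simp
    have hl: "h l = height Z T \<theta> W"
      unfolding h_def using height_cong[OF W, of "\<lambda>q. F l q \<inter> W q"] Fl submodD(2)[OF subobject_submod[OF T W]] by fastforce
    have le: "height Z T \<theta> W \<le> height Z T \<theta> (F i)" using up[of i] down[of i l] hl i by simp
    have "\<forall>q\<in>IS. W q \<subseteq> F i q" if eq: "height Z T \<theta> W = height Z T \<theta> (F i)"
    proof -
    have const: "h j = h i" if "i \<le> j" "j \<le> l" for j
      using up[of i] down[of i j] down[of j l] hl that eq by simp
    have "F j q \<inter> W q \<subseteq> F i q" if "i \<le> j" "j \<le> l" "q \<in> IS" for j q
      using that(1,2)
    proof (induction j rule: dec_induct)
      case (step n)
      then have "F (Suc n) q \<inter> W q \<subseteq> F n q"
        using layer0[OF W, of n] const[of n] const[of "Suc n"] that(3) unfolding h_def by simp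
      then show ?case using step by auto
    qed simp
    then show ?thesis using i Fl submodD(2)[OF subobject_submod[OF T W]] by fastforce
    qed
    with le show "height Z T \<theta> W \<le> height Z T \<theta> (F i) \<and>
        (height Z T \<theta> W = height Z T \<theta> (F i) \<longrightarrow> (\<forall>q\<in>IS. W q \<subseteq> F i q))" by blast
  qed
qed

text \<open>
  By modularity and maximality of \<open>A\<close>, the intersection with \<open>A\<close> is at least as high as \<open>B\<close> for \<open>\<theta>\<close>, but
  not higher for \<open>\<theta>'\<close>. As a larger slope parameter penalises real part more, nothing can have been
  lost in the intersection.
\<close>

lemma largest_max_antimono:
  assumes A: "largest_max Z T \<theta> A" and B: "largest_max Z T \<theta>' B" and "\<theta> < \<theta>'" and q: "q \<in> IS"
  shows "B q \<subseteq> A q"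
proof -
  have sA: "A \<in> subobjects T" and sB: "B \<in> subobjects T" using A B unfolding largest_max_def by blast+
  let ?I = "\<lambda>q. A q \<inter> B q"
  have sI: "?I \<in> subobjects T" and sP: "plus_sub A B \<in> subobjects T"
    using subobject_inter[OF T sA sB] subobject_plus[OF T sA sB] .
  have "height Z T \<theta> (plus_sub A B) \<le> height Z T \<theta> A" using A sP unfolding largest_max_def by blast
  then have 1: "height Z T \<theta> B \<le> height Z T \<theta> ?I" using height_modular[OF sA sB, of \<theta>] by linarith
  have 2: "height Z T \<theta>' ?I \<le> height Z T \<theta>' B" using B sI unfolding largest_max_def by blast
  have le: "Re (charge Z T ?I) \<le> Re (charge Z T B)" by (rule charge_mono(1)[OF sI sB]) blast
  have "(\<theta>' - \<theta>) * (Re (charge Z T B) - Re (charge Z T ?I)) \<le> 0"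
    using 1 2 unfolding height_def by (simp add: algebra_simps)
  then have "Re (charge Z T ?I) = Re (charge Z T B)" using le assms(3) by (simp add: mult_le_0_iff)
  then show ?thesis using charge_mono(2)[OF sI sB _ _ q] by blast
qed

text \<open>
  Conversely the largest maximisers for varying \<open>\<theta>\<close> form a chain, the vertices of the
  Harder--Narasimhan polygon. A step of the chain has a slope at which both its ends are highest,
  so nothing in between rises above the edge, which is semistability of the quotient.
\<close>

lemma HN_exists:
  assumes max: "\<And>\<theta>. \<exists>M. largest_max Z T \<theta> M" and fin: "finite {charge Z T M | \<theta> M. largest_max Z T \<theta> M}"
    and top: "largest_max Z T \<theta>0 (fib T)"
  shows "\<exists>l F C. is_HN_filtration Z T l F C"
proof -
  define N where "N \<theta> = (\<lambda>q. if q \<in> IS then (SOME M. largest_max Z T \<theta> M) q else {0})" for \<theta>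
  define \<rho> where "\<rho> W = Re (charge Z T W)" for W
  have N: "largest_max Z T \<theta> (N \<theta>)" for \<theta>
  proof -
    let ?M = "SOME M. largest_max Z T \<theta> M"
    have M: "largest_max Z T \<theta> ?M" using someI_ex[OF max[of \<theta>]] .
    then have sM: "?M \<in> subobjects T" unfolding largest_max_def by blast
    have eq: "?M q = N \<theta> q" if "q \<in> IS" for q using that by (simp add: N_def)
    have "N \<theta> \<in> subobjects T" using subobject_cong[OF T sM] eq by metis
    moreover have "height Z T \<theta> ?M = height Z T \<theta> (N \<theta>)" using height_cong[OF sM] eq by metis
    ultimately show ?thesis using M eq unfolding largest_max_def by simp
  qed
  have sN: "N \<theta> \<in> subobjects T" for \<theta> using N unfolding largest_max_def by blast
  have Neq: "A = B" if "A \<in> range N" "B \<in> range N" "\<And>q. q \<in> IS \<Longrightarrow> A q = B q" for A B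
    using that unfolding N_def fun_eq_iff by auto
  have chain: "(\<forall>q\<in>IS. A q \<subseteq> B q) \<or> (\<forall>q\<in>IS. B q \<subseteq> A q)" if AB: "A \<in> range N" "B \<in> range N" for A B
  proof -
    obtain a where a: "A = N a" using AB(1) by (rule rangeE)
    obtain b where b: "B = N b" using AB(2) by (rule rangeE)
    note a b
    then show ?thesis using largest_max_antimono[OF N N] by (cases a b rule: linorder_cases) auto
  qed
  have sub: "A q \<subseteq> B q" if "A \<in> range N" "B \<in> range N" "\<rho> A \<le> \<rho> B" "q \<in> IS" for A B q
  proof (cases "\<forall>q\<in>IS. A q \<subseteq> B q")
    case False
    then have BA: "\<And>q. q \<in> IS \<Longrightarrow> B q \<subseteq> A q" using chain[OF that(1,2)] by blast
    have s: "A \<in> subobjects T" "B \<in> subobjects T" using that(1,2) sN by auto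
    have "\<rho> B = \<rho> A" using charge_mono(1)[OF s(2,1) BA] that(3) unfolding \<rho>_def by simp
    then have "B q = A q" using charge_mono(2)[OF s(2,1) BA _ that(4)] unfolding \<rho>_def by simp
    then show ?thesis by simp
  qed (use that in blast)
  have inj: "inj_on \<rho> (range N)"
  proof (rule inj_onI)
    fix A B assume a: "A \<in> range N" "B \<in> range N" "\<rho> A = \<rho> B"
    then show "A = B" using sub[OF a(1,2)] sub[OF a(2,1)] by (intro Neq) (auto intro!: order_antisym)
  qed
  have "\<rho> ` range N \<subseteq> Re ` {charge Z T M | \<theta> M. largest_max Z T \<theta> M}"
    unfolding \<rho>_def using N by auto
  then have fin\<rho>: "finite (\<rho> ` range N)" using fin finite_subset by blast
  then have finN: "finite (range N)" using inj finite_imageD by blast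
  have zero: "\<exists>A\<in>range N. \<forall>q\<in>IS. A q = {0}"
  proof -
    define \<theta> where "\<theta> = Max ((\<lambda>A. Im (charge Z T A) / \<rho> A) ` range N) + 1"
    have "N \<theta> q = {0}" if q: "q \<in> IS" for q
    proof (rule ccontr)
      assume nz: "N \<theta> q \<noteq> {0}"
      have z0: "{0} \<subseteq> N \<theta> q" if "q \<in> IS" for q
        using subspace_0[OF submodD(1)[OF subobject_submod[OF T sN] that]] by simp
      have "\<rho> (N \<theta>) \<noteq> 0"
        using charge_mono(2)[OF zero_subobject[OF T] sN z0 _ q] nz charge_zero unfolding \<rho>_def by auto
      then have pos: "\<rho> (N \<theta>) > 0"
        using charge_mono(1)[OF zero_subobject[OF T] sN z0] charge_zero unfolding \<rho>_def by simp
      have "Im (charge Z T (N \<theta>)) / \<rho> (N \<theta>) \<le> Max ((\<lambda>A. Im (charge Z T A) / \<rho> A) ` range N)"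
        by (rule Max_ge[OF finite_imageI[OF finN]]) blast
      then have "Im (charge Z T (N \<theta>)) / \<rho> (N \<theta>) < \<theta>" using \<theta>_def by linarith
      then have "height Z T \<theta> (N \<theta>) < 0" unfolding height_def using pos by (simp add: \<rho>_def field_simps)
      moreover have "height Z T \<theta> (\<lambda>_. {0}) \<le> height Z T \<theta> (N \<theta>)"
        using N[of \<theta>] zero_subobject[OF T] unfolding largest_max_def by blast
      ultimately show False using charge_zero unfolding height_def by simp
    qed
    then show ?thesis by blast
  qed
  have whole: "\<forall>q\<in>IS. N \<theta>0 q = fib T q" using largest_max_unique[OF N top] by blast
  define xs where "xs = sorted_list_of_set (\<rho> ` range N)"
  have set_xs: "set xs = \<rho> ` range N" and sorted: "sorted_wrt (<) xs"
    unfolding xs_def using fin\<rho> by (simp_all add: strict_sorted_list_of_set)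
  define l where "l = length xs - 1"
  have len: "length xs = Suc l" using set_xs by (cases xs) (auto simp: l_def)
  define F where "F j = inv_into (range N) \<rho> (xs ! j)" for j
  have F: "F j \<in> range N" "\<rho> (F j) = xs ! j" if "j \<le> l" for j
  proof -
    have "xs ! j \<in> \<rho> ` range N" using set_xs nth_mem[of j xs] len that by simp
    then show "F j \<in> range N" "\<rho> (F j) = xs ! j" unfolding F_def by (rule inv_into_into, rule f_inv_into_f)
  qed
  have sF: "F j \<in> subobjects T" if "j \<le> l" for j using F(1)[OF that] sN by auto
  have less: "\<rho> (F j) < \<rho> (F k)" if "j < k" "k \<le> l" for j k
    using sorted_wrt_nth_less[OF sorted, of j k] F(2) that len by simp
  have idx: "\<exists>j\<le>l. A = F j" if A: "A \<in> range N" for A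
  proof -
    have "\<rho> A \<in> set xs" unfolding set_xs by (rule imageI[OF A])
    then obtain j where "j < length xs" "xs ! j = \<rho> A" unfolding in_set_conv_nth by blast
    then have j: "j \<le> l" "\<rho> (F j) = \<rho> A" using F(2)[of j] len by simp_all
    have "F j = A" by (rule inj_onD[OF inj j(2) F(1)[OF j(1)] A])
    then have "j \<le> l \<and> A = F j" using j(1) by simp
    then show ?thesis by (rule exI)
  qed
  have F0: "F 0 q = {0}" if "q \<in> IS" for q
  proof -
    obtain A where A: "A \<in> range N" "\<forall>q\<in>IS. A q = {0}" using zero by (rule bexE)
    obtain j where "j \<le> l" "A = F j" using idx[OF A(1)] by (elim exE conjE)
    then have "\<rho> (F 0) \<le> \<rho> A" using less[of 0 j] by (cases j) simp_all
    then have "F 0 q \<subseteq> A q" using sub[OF F(1)[OF le0] A(1) _ that] by simp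
    moreover have "0 \<in> F 0 q" using subspace_0[OF submodD(1)[OF subobject_submod[OF T sF[OF le0]] that]] .
    ultimately show ?thesis using A(2) that by auto
  qed
  have Fl: "F l q = fib T q" if "q \<in> IS" for q
  proof -
    obtain j where j: "j \<le> l" "N \<theta>0 = F j" using idx[OF rangeI, of \<theta>0] by (elim exE conjE)
    then have "\<rho> (N \<theta>0) \<le> \<rho> (F l)" using less[of j l] by (cases "j = l") simp_all
    then have "N \<theta>0 q \<subseteq> F l q" using sub[OF rangeI F(1)[OF order_refl] _ that] by simp
    moreover have "F l q \<subseteq> fib T q" using submodD(2)[OF subobject_submod[OF T sF[OF order_refl]] that] .
    ultimately show ?thesis using whole that by simp
  qed
  have Fm: "F j q \<subseteq> F (Suc j) q" if "j < l" "q \<in> IS" for j q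
    using sub[OF F(1) F(1) _ that(2), of j "Suc j"] less[of j "Suc j"] that(1) by simp
  define C where "C j = (SOME D. \<exists>\<pi>. short_exact (T\<lparr>fib := F j\<rparr>) (T\<lparr>fib := F (Suc j)\<rparr>) D (\<lambda>q v. v) \<pi>)" for j
  have C: "\<exists>\<pi>. short_exact (T\<lparr>fib := F j\<rparr>) (T\<lparr>fib := F (Suc j)\<rparr>) (C j) (\<lambda>q v. v) \<pi>" if j: "j < l" for j
  proof -
    have j': "j \<le> l" "Suc j \<le> l" using j by simp_all
    obtain D \<pi> where "short_exact (T\<lparr>fib := F j\<rparr>) (T\<lparr>fib := F (Suc j)\<rparr>) D (\<lambda>q v. v) \<pi>"
      by (rule quotient_exists[OF T sF[OF j'(1)] sF[OF j'(2)] Fm[OF j]])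
    then have "\<exists>D. \<exists>\<pi>. short_exact (T\<lparr>fib := F j\<rparr>) (T\<lparr>fib := F (Suc j)\<rparr>) D (\<lambda>q v. v) \<pi>"
      by (intro exI)
    then show ?thesis unfolding C_def by (rule someI_ex)
  qed
  have cC: "Z (K_class (C j)) = charge Z T (F (Suc j)) - charge Z T (F j)" if j: "j < l" for j
  proof -
    obtain \<pi> where "short_exact (T\<lparr>fib := F j\<rparr>) (T\<lparr>fib := F (Suc j)\<rparr>) (C j) (\<lambda>q v. v) \<pi>"
      using C[OF j] by (rule exE)
    then show ?thesis using charge_quotient by simp
  qed
  have rC: "Re (Z (K_class (C j))) > 0" if "j < l" for j
    using less[of j "Suc j"] that unfolding cC[OF that] \<rho>_def by simp
  have edge: "height Z T (slope Z (C j)) (F (Suc j)) = height Z T (slope Z (C j)) (F j)" if "j < l" for j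
  proof -
    have "Im (Z (K_class (C j))) = slope Z (C j) * Re (Z (K_class (C j)))" unfolding slope_def using rC[OF that] by simp
    then show ?thesis unfolding height_def cC[OF that] by (simp add: algebra_simps)
  qed
  have vertex: "N (slope Z (C j)) = F (Suc j)" if j: "j < l" for j
  proof -
    let ?\<theta> = "slope Z (C j)"
    have j': "j \<le> l" "Suc j \<le> l" using j by simp_all
    obtain s where s0: "F j = N s" using F(1)[OF j'(1)] by (rule rangeE)
    obtain t where t0: "F (Suc j) = N t" using F(1)[OF j'(2)] by (rule rangeE)
    note st = s0 t0
    have r: "\<rho> (F j) < \<rho> (F (Suc j))" using less j by simp
    have sj: "F j \<in> subobjects T" "F (Suc j) \<in> subobjects T" using sF j by auto
    have "height Z T s (F (Suc j)) < height Z T s (F j)"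
    proof (rule ccontr)
      assume "\<not> ?thesis"
      then have "height Z T s (F (Suc j)) = height Z T s (F j)" "height Z T s (F (Suc j)) \<le> height Z T s (F j)"
        using N[of s] sj(2) unfolding largest_max_def st(1)[symmetric] by force+
      then have "\<forall>q\<in>IS. F (Suc j) q \<subseteq> F j q" using N[of s] sj(2) unfolding largest_max_def st(1)[symmetric] by blast
      then have "\<rho> (F (Suc j)) \<le> \<rho> (F j)" using charge_mono(1)[OF sj(2,1)] unfolding \<rho>_def by blast
      then show False using r by simp
    qed
    then have "(s - ?\<theta>) * (\<rho> (F (Suc j)) - \<rho> (F j)) > 0"
      using edge[OF j] unfolding height_def \<rho>_def by (simp add: algebra_simps)
    then have s: "?\<theta> < s" using r by (simp add: zero_less_mult_iff)
    have "height Z T t (F j) \<le> height Z T t (F (Suc j))"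
      using N[of t] sj(1) unfolding largest_max_def st(2)[symmetric] by blast
    then have "(t - ?\<theta>) * (\<rho> (F (Suc j)) - \<rho> (F j)) \<le> 0"
      using edge[OF j] unfolding height_def \<rho>_def by (simp add: algebra_simps)
    then have t: "t \<le> ?\<theta>" using r by (simp add: mult_le_0_iff)
    have A: "N ?\<theta> \<in> range N" by blast
    have "N ?\<theta> q \<subseteq> F (Suc j) q" if "q \<in> IS" for q
      using largest_max_antimono[OF N N _ that, of t ?\<theta>] t st(2) by (cases "t = ?\<theta>") auto
    then have u: "\<rho> (N ?\<theta>) \<le> \<rho> (F (Suc j))" unfolding \<rho>_def by (rule charge_mono(1)[OF sN sj(2)])
    have lowN: "F j q \<subseteq> N ?\<theta> q" if "q \<in> IS" for q
      using largest_max_antimono[OF N N s that] st(1) by simp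
    then have lw: "\<rho> (F j) \<le> \<rho> (N ?\<theta>)" unfolding \<rho>_def by (rule charge_mono(1)[OF sj(1) sN])
    obtain k where k: "k \<le> l" "N ?\<theta> = F k" using idx[OF A] by (elim exE conjE)
    have "j \<le> k" using lw less[of k j] k j by (force simp: not_le[symmetric])
    moreover have "k \<le> Suc j" using u less[of "Suc j" k] k j by (force simp: not_le[symmetric])
    ultimately consider "N ?\<theta> = F (Suc j)" | "N ?\<theta> = F j" using k by (metis le_Suc_eq le_antisym)
    then show ?thesis
    proof cases
      case 2
      have "height Z T ?\<theta> (F (Suc j)) = height Z T ?\<theta> (N ?\<theta>)" using edge[OF j] 2 by simp
      then have "\<forall>q\<in>IS. F (Suc j) q \<subseteq> F j q" using N[of ?\<theta>] sj(2) 2 unfolding largest_max_def by auto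
      then have "\<rho> (F (Suc j)) \<le> \<rho> (F j)" using charge_mono(1)[OF sj(2,1)] unfolding \<rho>_def by blast
      then show ?thesis using r by simp
    qed
  qed
  have "is_HN_filtration Z T l F C" unfolding is_HN_filtration_def
  proof (intro conjI allI ballI impI)
    fix j assume j: "j < l"
    show "\<exists>q\<in>IS. F j q \<noteq> F (Suc j) q"
    proof (rule ccontr)
      assume "\<not> ?thesis"
      then have "charge Z T (F j) = charge Z T (F (Suc j))" using charge_cong[OF sF, of j "F (Suc j)"] j by simp
      then show False using less[of j "Suc j"] j unfolding \<rho>_def by simp
    qed
    obtain \<pi> where e: "short_exact (T\<lparr>fib := F j\<rparr>) (T\<lparr>fib := F (Suc j)\<rparr>) (C j) (\<lambda>q v. v) \<pi>" using C[OF j] by (rule exE)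
    note k = short_exact_is_zero[OF e]
    have sj: "F j \<in> subobjects T" "F (Suc j) \<in> subobjects T" using sF j by auto
    show "semistable Z (C j)" unfolding semistable_def
    proof (intro conjI ballI impI k(5))
      show "\<not> is_zero (C j)" using rC[OF j] K_class_zero[OF Z k(5)] by auto
      fix W assume W: "W \<in> subobjects (C j)" and nz: "\<not> is_zero ((C j)\<lparr>fib := W\<rparr>)"
      let ?P = "\<lambda>q. {v \<in> F (Suc j) q. \<pi> q v \<in> W q}"
      have sP: "?P \<in> subobjects T" by (rule preimage_subobject[OF sj(2) k(5,6) W])
      note sW = subobject_submod[OF k(5) W]
      have ch: "charge Z T ?P = charge Z T (F j) + charge Z (C j) W"
      proof (rule restricted_short_exact[OF e sj(2) sP _ sj(1) _ W])
        fix q :: "real ^ 'n" assume q: "q \<in> IS"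
        show "F j q = F j q \<inter> ?P q" using k(3)[OF q] subspace_0[OF submodD(1)[OF sW q]] by auto
        show "W q = \<pi> q ` ?P q"
        proof (intro equalityI subsetI)
          fix w assume w: "w \<in> W q"
          then have "w \<in> \<pi> q ` F (Suc j) q" using k(4)[OF q] submodD(2)[OF sW q] by (simp add: subset_eq)
          then obtain v where "v \<in> F (Suc j) q" "w = \<pi> q v" by (rule imageE)
          then show "w \<in> \<pi> q ` ?P q" using w by simp
        next
          fix w assume "w \<in> \<pi> q ` ?P q" then show "w \<in> W q" by (elim imageE) simp
        qed
      qed blast
      have pos: "Re (charge Z (C j) W) > 0" unfolding charge_def by (rule stability_pos[OF Z subobject_fp[OF W] nz])
      have "height Z T (slope Z (C j)) ?P \<le> height Z T (slope Z (C j)) (F j)"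
        using N[of "slope Z (C j)"] sP vertex[OF j] edge[OF j] unfolding largest_max_def by simp
      then have "Im (charge Z (C j) W) \<le> slope Z (C j) * Re (charge Z (C j) W)"
        unfolding height_def ch by (simp add: algebra_simps)
      then show "slope Z ((C j)\<lparr>fib := W\<rparr>) \<le> slope Z (C j)"
        using pos unfolding slope_def[of Z "(C j)\<lparr>fib := W\<rparr>"] charge_def by (simp add: field_simps)
    qed
  next
    fix j assume j: "Suc j < l"
    show "slope Z (C (Suc j)) < slope Z (C j)"
    proof (rule ccontr)
      assume "\<not> ?thesis"
      then have sl: "N (slope Z (C (Suc j))) q \<subseteq> N (slope Z (C j)) q" if "q \<in> IS" for q
        using largest_max_antimono[OF N N _ that, of "slope Z (C j)" "slope Z (C (Suc j))"] by (cases "slope Z (C (Suc j)) = slope Z (C j)") auto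
      have "\<rho> (F (Suc (Suc j))) \<le> \<rho> (F (Suc j))"
        using charge_mono(1)[OF sN sN sl] vertex[of j] vertex[of "Suc j"] j unfolding \<rho>_def by simp
      then show False using less[of "Suc j" "Suc (Suc j)"] j by simp
    qed
  qed ((rule sF F0 Fl Fm C; assumption)+)
  then show ?thesis by (intro exI)
qed

end

context stable_module
begin

text \<open>
  The choice in the definition of the truncation is harmless, as every admissible piece of every
  Harder--Narasimhan filtration is the largest maximiser.
\<close>

lemma HN_truncation_largest_max:
  assumes max: "\<And>\<theta>. \<exists>M. largest_max Z T \<theta> M" and fin: "finite {charge Z T M | \<theta> M. largest_max Z T \<theta> M}"
    and top: "largest_max Z T \<theta>0 (fib T)"
  shows "largest_max Z T \<theta> (HN_truncation Z T \<theta>)"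
proof (cases "is_zero T")
  case True
  have z: "W q = {0}" if W: "W \<in> subobjects T" and q: "q \<in> IS" for W q
  proof -
    note s = subobject_submod[OF T W]
    have "W q \<subseteq> {0}" using submodD(2)[OF s q] True q unfolding is_zero_def by simp
    then show ?thesis using subspace_0[OF submodD(1)[OF s q]] by (intro equalityI) simp_all
  qed
  have "largest_max Z T \<theta> (\<lambda>_. {0})" unfolding largest_max_def
  proof (intro conjI ballI impI zero_subobject[OF T])
    fix W assume W: "W \<in> subobjects T"
    show "height Z T \<theta> W \<le> height Z T \<theta> (\<lambda>_. {0})"
      by (rule eq_refl[OF height_cong[OF W z[OF W]]])
    fix q :: "real ^ 'n" assume "q \<in> IS" then show "W q \<subseteq> {0}" using z[OF W] by simp
  qed
  then show ?thesis using True by (simp add: HN_truncation_def)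
next
  case False
  obtain l F C where HN: "is_HN_filtration Z T l F C" using HN_exists[OF max fin top] by (elim exE)
  define i where "i = (LEAST i. i = l \<or> \<theta> > slope Z (C i))"
  have i: "i = l \<or> \<theta> > slope Z (C i)" unfolding i_def by (rule LeastI[of _ l]) simp
  have il: "i \<le> l" unfolding i_def by (rule Least_le) simp
  have "i = 0 \<or> slope Z (C (i - 1)) \<ge> \<theta>"
    using not_less_Least[of "i - 1" "\<lambda>i. i = l \<or> \<theta> > slope Z (C i)"] unfolding i_def[symmetric] by force
  then have "\<exists>W. \<exists>l F C i. is_HN_filtration Z T l F C \<and> i \<le> l \<and> W = F i \<and>
     (i = 0 \<or> slope Z (C (i - 1)) \<ge> \<theta>) \<and> (i = l \<or> \<theta> > slope Z (C i))"
    using HN il i by (intro exI[of _ "F i"] exI[of _ l] exI[of _ F] exI[of _ C] exI[of _ i] conjI refl)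
  from someI_ex[OF this]
  have "\<exists>l F C i. is_HN_filtration Z T l F C \<and> i \<le> l \<and> HN_truncation Z T \<theta> = F i \<and>
     (i = 0 \<or> slope Z (C (i - 1)) \<ge> \<theta>) \<and> (i = l \<or> \<theta> > slope Z (C i))"
    unfolding HN_truncation_def if_not_P[OF False] .
  then obtain l F C i where *: "is_HN_filtration Z T l F C" "i \<le> l" "HN_truncation Z T \<theta> = F i"
      "i = 0 \<or> slope Z (C (i - 1)) \<ge> \<theta>" "i = l \<or> \<theta> > slope Z (C i)"
    by (elim exE conjE)
  show ?thesis unfolding *(3) by (rule HN_piece_largest_max[OF *(1,2,4,5)])
qed

end

section \<open>Integrals of functions living on finitely many levels\<close>

text \<open>
  The end of the cell starting at the level \<open>e\<close>. The topmost cell is unbounded; it is given the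
  conventional end \<open>t\<close>.
\<close>

definition nxt :: "real \<Rightarrow> real set \<Rightarrow> real \<Rightarrow> real" where
  "nxt t S e = Min (insert t {s \<in> S. e < s})"

lemma nxt_cases:
  assumes "finite S" "h \<in> S" "\<forall>s\<in>S. s \<le> h" "h < t" "e \<in> S"
  shows "e = h \<Longrightarrow> nxt t S e = t" and "e < h \<Longrightarrow> nxt t S e \<in> S \<and> e < nxt t S e \<and> nxt t S e \<le> h"
    "s \<in> S \<Longrightarrow> e < s \<Longrightarrow> nxt t S e \<le> s" "e < nxt t S e"
proof -
  let ?A = "insert t {s \<in> S. e < s}"
  have fin: "finite ?A" "?A \<noteq> {}" using assms by auto
  have mem: "nxt t S e \<in> ?A" unfolding nxt_def by (rule Min_in[OF fin])
  have le: "\<And>x. x \<in> ?A \<Longrightarrow> nxt t S e \<le> x" unfolding nxt_def by (rule Min_le[OF fin(1)])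
  show "e = h \<Longrightarrow> nxt t S e = t" using mem assms(3) by fastforce
  show "e < h \<Longrightarrow> nxt t S e \<in> S \<and> e < nxt t S e \<and> nxt t S e \<le> h"
    using mem le[of h] assms(2,4) by auto
  show "s \<in> S \<Longrightarrow> e < s \<Longrightarrow> nxt t S e \<le> s" using le by blast
  have "e \<le> h" using assms(3,5) by blast
  then show "e < nxt t S e" using mem assms(4) by auto
qed

text \<open>
  The share of \<open>[s, t)\<close> in the uniform distribution on \<open>[u, v)\<close>, or in the point mass at \<open>u\<close>
  if \<open>u = v\<close>, where \<open>\<tau> = (u, v)\<close>.
\<close>

definition mass :: "real \<times> real \<Rightarrow> real \<Rightarrow> real \<Rightarrow> real" where
  "mass \<tau> s t = (if fst \<tau> = snd \<tau> then (if s \<le> fst \<tau> \<and> fst \<tau> < t then 1 else 0)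
     else max 0 (min t (snd \<tau>) - max s (fst \<tau>)) / (snd \<tau> - fst \<tau>))"

definition avg :: "real ^ 'n \<Rightarrow> ('n \<Rightarrow> real \<times> real) \<Rightarrow> ('n \<Rightarrow> real set) \<Rightarrow> (real ^ 'n \<Rightarrow> real) \<Rightarrow> real" where
  "avg hi \<tau> E d = (\<Sum>p\<in>pts E. d p * (\<Prod>i\<in>UNIV. mass (\<tau> i) (p $ i) (nxt (hi $ i + 1) (E i) (p $ i))))"

definition cell :: "real set \<Rightarrow> ('n \<Rightarrow> real set) \<Rightarrow> real ^ 'n \<Rightarrow> (real ^ 'n) set" where
  "cell K E p = {q \<in> index_space K. above E q \<and> flr E q = p}"

definition axis_cell :: "real set \<Rightarrow> real set \<Rightarrow> real \<Rightarrow> real set" where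
  "axis_cell K S e = {t \<in> K. e \<le> t \<and> (\<forall>s\<in>S. s \<le> t \<longrightarrow> s \<le> e)}"

lemma cell_product:
  assumes "levels K E" "p \<in> pts E"
  shows "cell K E p = {q. \<forall>i. q $ i \<in> axis_cell K (E i) (p $ i)}"
proof (intro equalityI subsetI)
  fix q assume q: "q \<in> cell K E p"
  then have a: "above E q" "flr E q = p" "q \<in> index_space K" by (auto simp: cell_def)
  show "q \<in> {q. \<forall>i. q $ i \<in> axis_cell K (E i) (p $ i)}"
    using flr_coord[OF assms(1) a(1)] a(2,3) unfolding axis_cell_def index_space_def by auto
next
  fix q assume "q \<in> {q. \<forall>i. q $ i \<in> axis_cell K (E i) (p $ i)}"
  then have q: "\<And>i. q $ i \<in> K" "\<And>i. p $ i \<le> q $ i" "\<And>i s. s \<in> E i \<Longrightarrow> s \<le> q $ i \<Longrightarrow> s \<le> p $ i"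
    unfolding axis_cell_def by auto
  have "p \<le> q" using q(2) by (simp add: less_eq_vec_def)
  then have "above E q" using above_mono[OF above_pts[OF assms(2)]] by blast
  moreover have "same E p q" unfolding same_def using q(2,3) by (meson order_trans)
  then have "flr E q = p" by (rule flr_eqI[OF assms])
  ultimately show "q \<in> cell K E p" using q(1) by (simp add: cell_def index_space_def)
qed

lemma axis_cell_nxt:
  assumes "finite S" "h \<in> S" "\<forall>s\<in>S. s \<le> h" "h < t" "e \<in> S"
  shows "axis_cell K S e = (if e = h then {e..} \<inter> K else {e..<nxt t S e} \<inter> K)"
proof (cases "e = h")
  case True
  then show ?thesis unfolding axis_cell_def using assms(3) by auto
next
  case False
  then have eh: "e < h" using assms(3,5) by force
  note n = nxt_cases[OF assms]
  have *: "(\<forall>s\<in>S. s \<le> x \<longrightarrow> s \<le> e) \<longleftrightarrow> x < nxt t S e" if "e \<le> x" for x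
    using n(2)[OF eh] n(3) by (meson leD leI less_le_trans not_le)
  have "x \<in> axis_cell K S e \<longleftrightarrow> x \<in> {e..<nxt t S e} \<inter> K" for x
    using *[of x] unfolding axis_cell_def mem_Collect_eq by (cases "e \<le> x") auto
  then have "axis_cell K S e = {e..<nxt t S e} \<inter> K" by (intro equalityI subsetI) simp_all
  then show ?thesis using False by simp
qed

lemma sets_cell:
  fixes E :: "'n::finite \<Rightarrow> real set"
  assumes "levels UNIV E" "p \<in> pts E" shows "cell UNIV E p \<in> sets borel"
proof -
  have "cell UNIV E p = (\<Inter>i\<in>UNIV. {q. q $ i \<ge> p $ i} \<inter> (\<Inter>e\<in>{e \<in> E i. p $ i < e}. {q. q $ i < e}))"
    unfolding cell_product[OF assms] axis_cell_def by force
  moreover have "(\<Inter>e\<in>{e \<in> E i. p $ i < e}. {q :: real ^ 'n. q $ i < e}) \<in> sets borel" for i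
  proof -
    have "open (\<Inter>e\<in>{e \<in> E i. p $ i < e}. {q :: real ^ 'n. q $ i < e})"
      by (intro open_INT ballI open_halfspace_component_lt_cart) (use assms(1) in \<open>simp add: levels_def\<close>)
    then show ?thesis by simp
  qed
  moreover have "{q :: real ^ 'n. q $ i \<ge> p $ i} \<in> sets borel" for i
    using closed_halfspace_component_ge_cart[of "p $ i" i] by simp
  ultimately show ?thesis by (auto intro!: sets.finite_INT)
qed

text \<open>Half-open intervals have their length as measure, for Lebesgue and counting measure alike.\<close>

lemma card_Ints_interval:
  assumes "s \<in> \<int>" "t \<in> \<int>" "s \<le> t"
  shows "finite ({s..<t} \<inter> \<int>)" "real (card ({s..<t} \<inter> \<int>)) = t - s"
proof -
  obtain m n where mn: "s = of_int m" "t = of_int n" using assms(1,2) by (auto elim!: Ints_cases)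
  have "{s..<t} \<inter> \<int> = of_int ` {m..<n}" unfolding mn by (auto elim!: Ints_cases)
  then show "finite ({s..<t} \<inter> \<int>)" "real (card ({s..<t} \<inter> \<int>)) = t - s"
    using assms(3) mn by (simp_all add: card_image inj_on_def)
qed

context persistence
begin

text \<open>
  Values are compared along the order only, since isomorphisms between fibres are available only
  there; any two points of a cell are related through its corner.
\<close>

definition step :: "('n \<Rightarrow> real set) \<Rightarrow> (real ^ 'n \<Rightarrow> real) \<Rightarrow> bool" where
  "step E d \<longleftrightarrow> (\<forall>q\<in>IS. \<not> above E q \<longrightarrow> d q = 0) \<and>
     (\<forall>p\<in>IS. \<forall>q\<in>IS. p \<le> q \<and> same E p q \<longrightarrow> d p = d q)"

lemma step_flr:
  assumes "step E d" "levels K E" "q \<in> IS" "above E q" shows "d q = d (flr E q)"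
proof -
  have "flr E q \<in> IS" "flr E q \<le> q" "same E (flr E q) q"
    using flr_index_space[OF assms(2,4)] flr_le[OF assms(2,4)] same_flr[OF assms(2,4)] .
  then show ?thesis using assms(1,3) unfolding step_def by metis
qed

lemma step_expand:
  fixes E :: "'n::finite \<Rightarrow> real set"
  assumes d: "step E d" and E: "levels K E" and q: "q \<in> IS"
  shows "d q = (\<Sum>p\<in>pts E. d p * indicator (cell K E p) q)"
proof (cases "above E q")
  case True
  have "(\<Sum>p\<in>pts E. d p * indicator (cell K E p) q) = (\<Sum>p\<in>pts E. if p = flr E q then d p else 0)"
    using True q by (intro sum.cong) (auto simp: cell_def indicator_def)
  also have "\<dots> = d (flr E q)" using flr_pts[OF E True] finite_pts[OF E] by simp
  finally show ?thesis using step_flr[OF d E q True] by simp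
next
  case False
  then have "d q = 0" using d q unfolding step_def by blast
  moreover have "indicator (cell K E p) q = (0::real)" for p using False by (simp add: cell_def)
  ultimately show ?thesis by simp
qed

text \<open>
  A grid \<open>B\<close> filling the box \<open>[lo, hi]\<close>, and the finer grids \<open>E\<close> in the box. In the case of
  integers \<open>B\<close> contains all of them, so that \<open>E = B\<close>.
\<close>

definition box_levels :: "real ^ 'n \<Rightarrow> real ^ 'n \<Rightarrow> ('n \<Rightarrow> real set) \<Rightarrow> bool" where
  "box_levels lo hi B \<longleftrightarrow> levels K B \<and> (\<forall>i. lo $ i \<in> B i \<and> hi $ i \<in> B i \<and> B i \<subseteq> {lo $ i..hi $ i})"

definition base_levels :: "real ^ 'n \<Rightarrow> real ^ 'n \<Rightarrow> ('n \<Rightarrow> real set) \<Rightarrow> bool" where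
  "base_levels lo hi B \<longleftrightarrow> box_levels lo hi B \<and> (K \<noteq> UNIV \<longrightarrow> (\<forall>i. B i = K \<inter> {lo $ i..hi $ i}))"

lemma box_levelsD:
  assumes "box_levels lo hi E"
  shows "levels K E" "finite (E i)" "lo $ i \<in> E i" "hi $ i \<in> E i" "e \<in> E i \<Longrightarrow> lo $ i \<le> e" "e \<in> E i \<Longrightarrow> e \<le> hi $ i"
    "e \<in> E i \<Longrightarrow> e \<in> K"
  using assms unfolding box_levels_def levels_def by (auto simp: subset_eq)

lemma box_above:
  assumes "box_levels lo hi E" shows "above E q \<longleftrightarrow> lo \<le> q"
  unfolding above_def less_eq_vec_def using box_levelsD[OF assms] by (meson order_trans)

lemma box_nxt:
  assumes E: "box_levels lo hi E" and e: "e \<in> E i"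
  shows "e = hi $ i \<Longrightarrow> nxt (hi $ i + 1) (E i) e = hi $ i + 1"
    "e < hi $ i \<Longrightarrow> nxt (hi $ i + 1) (E i) e \<in> E i \<and> e < nxt (hi $ i + 1) (E i) e \<and> nxt (hi $ i + 1) (E i) e \<le> hi $ i"
    "s \<in> E i \<Longrightarrow> e < s \<Longrightarrow> nxt (hi $ i + 1) (E i) e \<le> s" "e < nxt (hi $ i + 1) (E i) e"
    "axis_cell K (E i) e = (if e = hi $ i then {e..} \<inter> K else {e..<nxt (hi $ i + 1) (E i) e} \<inter> K)"
proof -
  have le: "\<forall>s\<in>E i. s \<le> hi $ i" using box_levelsD(6)[OF E] by blast
  have h: "hi $ i < hi $ i + 1" by simp
  note n = box_levelsD(2)[OF E] box_levelsD(4)[OF E] le h e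
  show "e = hi $ i \<Longrightarrow> nxt (hi $ i + 1) (E i) e = hi $ i + 1"
    "e < hi $ i \<Longrightarrow> nxt (hi $ i + 1) (E i) e \<in> E i \<and> e < nxt (hi $ i + 1) (E i) e \<and> nxt (hi $ i + 1) (E i) e \<le> hi $ i"
    "s \<in> E i \<Longrightarrow> e < s \<Longrightarrow> nxt (hi $ i + 1) (E i) e \<le> s" "e < nxt (hi $ i + 1) (E i) e"
    "axis_cell K (E i) e = (if e = hi $ i then {e..} \<inter> K else {e..<nxt (hi $ i + 1) (E i) e} \<inter> K)"
    using nxt_cases[OF n] axis_cell_nxt[OF n] by blast+
qed

text \<open>
  The averaging direction by direction that belongs to the cell of \<open>B\<close> at \<open>k\<close>. In an unbounded
  direction a module living in the box does not vary, and the average is replaced by the value at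
  the boundary \<open>hi\<close>.
\<close>

definition cell_type :: "real ^ 'n \<Rightarrow> ('n \<Rightarrow> real set) \<Rightarrow> real ^ 'n \<Rightarrow> 'n \<Rightarrow> real \<times> real" where
  "cell_type hi B k i = (if k $ i = hi $ i then (hi $ i, hi $ i) else (k $ i, nxt (hi $ i + 1) (B i) (k $ i)))"

text \<open>
  A cell of the finer grid \<open>E\<close> lies in exactly one cell of \<open>B\<close>, and takes from it the share given by
  the lengths of the bounded sides.
\<close>

lemma cell_type_mass:
  assumes B: "box_levels lo hi B" and E: "box_levels lo hi E" and BE: "\<And>i. B i \<subseteq> E i"
    and p: "p \<in> pts E" and k: "k \<in> pts B"
  shows "k \<noteq> flr B p \<Longrightarrow> (\<Prod>i\<in>UNIV. mass (cell_type hi B k i) (p $ i) (nxt (hi $ i + 1) (E i) (p $ i))) = 0"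
    and "k = flr B p \<Longrightarrow> mass (cell_type hi B k i) (p $ i) (nxt (hi $ i + 1) (E i) (p $ i)) =
      (if k $ i = hi $ i then 1 else (nxt (hi $ i + 1) (E i) (p $ i) - p $ i) / (nxt (hi $ i + 1) (B i) (k $ i) - k $ i))"
    and "k = flr B p \<Longrightarrow> k $ i = hi $ i \<Longrightarrow> p $ i = hi $ i"
    and "k = flr B p \<Longrightarrow> k $ i \<noteq> hi $ i \<Longrightarrow> k $ i \<le> p $ i \<and> p $ i < hi $ i \<and> k $ i < hi $ i \<and>
        nxt (hi $ i + 1) (E i) (p $ i) \<le> nxt (hi $ i + 1) (B i) (k $ i)"
proof -
  have pi: "p $ i \<in> E i" and ki: "k $ i \<in> B i" for i using p k unfolding pts_def by auto
  note nE = box_nxt[OF E pi] and nB = box_nxt[OF B]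
  have lo: "lo \<le> p" unfolding less_eq_vec_def using box_levelsD(5)[OF E pi] by blast
  then have ab: "above B p" using box_above[OF B] by blast
  note fl = flr_coord[OF box_levelsD(1)[OF B] ab]
  have hieq: "p $ i = hi $ i" if "flr B p $ i = hi $ i" for i
    using fl(2)[of i] that box_levelsD(6)[OF E pi[of i]] by simp
  have less: "p $ i < hi $ i" "flr B p $ i < hi $ i" if "flr B p $ i \<noteq> hi $ i" for i
    using fl(3)[OF box_levelsD(4)[OF B], of i] fl(1)[of i] box_levelsD(6)[OF B fl(1)[of i]] box_levelsD(6)[OF E pi[of i]] that
    by fastforce+
  have le: "nxt (hi $ i + 1) (E i) (p $ i) \<le> nxt (hi $ i + 1) (B i) (flr B p $ i)" if "flr B p $ i \<noteq> hi $ i" for i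
  proof -
    have n: "nxt (hi $ i + 1) (B i) (flr B p $ i) \<in> B i" "flr B p $ i < nxt (hi $ i + 1) (B i) (flr B p $ i)"
      using nB(2)[OF fl(1) less(2)[OF that]] by simp_all
    have "p $ i < nxt (hi $ i + 1) (B i) (flr B p $ i)" using fl(3)[OF n(1)] n(2) by (meson leI leD)
    then show ?thesis using nE(3) n(1) BE by blast
  qed
  show "k = flr B p \<Longrightarrow> k $ i = hi $ i \<Longrightarrow> p $ i = hi $ i" using hieq by simp
  show 4: "k = flr B p \<Longrightarrow> k $ i \<noteq> hi $ i \<Longrightarrow> k $ i \<le> p $ i \<and> p $ i < hi $ i \<and> k $ i < hi $ i \<and>
        nxt (hi $ i + 1) (E i) (p $ i) \<le> nxt (hi $ i + 1) (B i) (k $ i)" using less le fl(2) by simp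
  show "k = flr B p \<Longrightarrow> mass (cell_type hi B k i) (p $ i) (nxt (hi $ i + 1) (E i) (p $ i)) =
      (if k $ i = hi $ i then 1 else (nxt (hi $ i + 1) (E i) (p $ i) - p $ i) / (nxt (hi $ i + 1) (B i) (k $ i) - k $ i))"
  proof (cases "k $ i = hi $ i")
    case True
    assume "k = flr B p"
    then have "p $ i = hi $ i" using hieq True by simp
    then show ?thesis using True nE(1) by (simp add: mass_def cell_type_def)
  next
    case False
    assume kf: "k = flr B p"
    have "k $ i < nxt (hi $ i + 1) (B i) (k $ i)" using nB(4)[OF ki] .
    then show ?thesis using 4[OF kf False] False nE(4)[of i] by (simp add: mass_def cell_type_def)
  qed
  assume "k \<noteq> flr B p"
  then obtain i where i: "k $ i \<noteq> flr B p $ i" by (auto simp: vec_eq_iff)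
  have "mass (cell_type hi B k i) (p $ i) (nxt (hi $ i + 1) (E i) (p $ i)) = 0"
  proof (cases "k $ i = hi $ i")
    case True
    then have "flr B p $ i \<noteq> hi $ i" using i by simp
    then have "nxt (hi $ i + 1) (E i) (p $ i) \<le> hi $ i" using nE(2)[OF less(1)] by blast
    then show ?thesis using True by (simp add: mass_def cell_type_def)
  next
    case False
    then have kh: "k $ i < hi $ i" using box_levelsD(6)[OF B ki[of i]] by simp
    let ?v = "nxt (hi $ i + 1) (B i) (k $ i)" and ?t = "nxt (hi $ i + 1) (E i) (p $ i)"
    have kv: "k $ i < ?v" using nB(4)[OF ki] .
    have "min ?t ?v - max (p $ i) (k $ i) \<le> 0"
    proof (cases "k $ i < flr B p $ i")
      case True
      then have "?v \<le> flr B p $ i" using nB(3)[OF ki fl(1)] by blast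
      then show ?thesis using fl(2)[of i] by simp
    next
      case False
      then have lt: "flr B p $ i < k $ i" using i by simp
      then have nh: "flr B p $ i \<noteq> hi $ i" using kh by simp
      have "nxt (hi $ i + 1) (B i) (flr B p $ i) \<le> k $ i" using nB(3)[OF fl(1) ki lt] .
      then show ?thesis using le[OF nh] by simp
    qed
    then show ?thesis using False kv by (simp add: mass_def cell_type_def)
  qed
  then show "(\<Prod>i\<in>UNIV. mass (cell_type hi B k i) (p $ i) (nxt (hi $ i + 1) (E i) (p $ i))) = 0"
    by (intro prod_zero) auto
qed

end

lemma prod_Basis_vec: "(\<Prod>j\<in>(Basis :: (real ^ 'n) set). f j) = (\<Prod>i\<in>UNIV. f (axis i 1))"
proof -
  have B: "(Basis :: (real ^ 'n) set) = (\<lambda>i. axis i 1) ` UNIV" by (auto simp: Basis_vec_def)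
  have inj: "inj_on (\<lambda>i. axis i (1::real) :: real ^ 'n) UNIV" by (auto simp: inj_on_def axis_eq_axis)
  show ?thesis unfolding B prod.reindex[OF inj] o_def by (rule refl)
qed

lemma lborel_integral_scale:
  fixes c t :: "real ^ 'n" and g :: "real ^ 'n \<Rightarrow> real"
  assumes c: "\<And>i. c $ i > 0" and g: "g \<in> borel_measurable borel"
  shows "(\<integral>q. g q \<partial>lborel) = (\<Prod>i\<in>UNIV. c $ i) * (\<integral>q. g (\<chi> i. t $ i + c $ i * q $ i) \<partial>lborel)"
proof -
  let ?T = "\<lambda>q :: real ^ 'n. \<chi> i. t $ i + c $ i * q $ i"
  let ?f = "\<lambda>j :: real ^ 'n. c \<bullet> j"
  have T: "?T = (\<lambda>x. t + (\<Sum>j\<in>Basis. (?f j * (x \<bullet> j)) *\<^sub>R j))"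
  proof
    fix x :: "real ^ 'n"
    show "?T x = t + (\<Sum>j\<in>Basis. (?f j * (x \<bullet> j)) *\<^sub>R j)"
    proof (rule vec_eq_iff[THEN iffD2], rule allI)
      fix i
      have ax: "axis i 1 \<in> (Basis :: (real ^ 'n) set)" by (auto simp: Basis_vec_def)
      have "(t + (\<Sum>j\<in>Basis. (?f j * (x \<bullet> j)) *\<^sub>R j)) \<bullet> axis i 1 = t \<bullet> axis i 1 + ?f (axis i 1) * (x \<bullet> axis i 1)"
        unfolding inner_add_left by (simp only: inner_sum_left_Basis[OF ax])
      then show "?T x $ i = (t + (\<Sum>j\<in>Basis. (?f j * (x \<bullet> j)) *\<^sub>R j)) $ i"
        by (simp only: cart_eq_inner_axis[symmetric] vec_lambda_beta)
    qed
  qed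
  have c0: "?f j \<noteq> 0" if "j \<in> Basis" for j :: "real ^ 'n"
  proof -
    obtain i where "j = axis i 1" using \<open>j \<in> Basis\<close> by (auto simp: Basis_vec_def)
    then show ?thesis using c[of i] by (simp add: cart_eq_inner_axis[symmetric])
  qed
  have cont: "continuous_on UNIV ?T" unfolding T by (intro continuous_intros)
  have mT: "?T \<in> borel \<rightarrow>\<^sub>M borel" by (rule borel_measurable_continuous_onI[OF cont])
  have P: "(\<Prod>j\<in>(Basis :: (real ^ 'n) set). \<bar>?f j\<bar>) = (\<Prod>i\<in>UNIV. c $ i)"
    unfolding prod_Basis_vec using c by (intro prod.cong refl) (simp add: cart_eq_inner_axis[symmetric] less_imp_le)
  have nn: "(\<Prod>i\<in>UNIV. c $ i) \<ge> 0" using c by (intro prod_nonneg) (simp add: less_imp_le)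
  have "(lborel :: (real ^ 'n) measure) = density (distr lborel borel ?T) (\<lambda>_. ennreal (\<Prod>i\<in>UNIV. c $ i))"
    using lborel_affine_euclidean[of ?f t, OF c0] unfolding T[symmetric] P by simp
  then have "(\<integral>q. g q \<partial>lborel) = (\<integral>q. g q \<partial>density (distr lborel borel ?T) (\<lambda>_. ennreal (\<Prod>i\<in>UNIV. c $ i)))" by simp
  also have "\<dots> = (\<integral>q. (\<Prod>i\<in>UNIV. c $ i) *\<^sub>R g q \<partial>distr lborel borel ?T)"
    by (rule integral_density) (use g nn in auto)
  also have "\<dots> = (\<integral>q. (\<Prod>i\<in>UNIV. c $ i) *\<^sub>R g (?T q) \<partial>lborel)"
    by (rule integral_distr) (use g mT in auto)
  finally show ?thesis by simp
qed

context persistence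
begin

text \<open>
  A density for the real part may vary in the unbounded directions of a cell, where it has to decay,
  but not in the bounded ones.
\<close>

definition base_const :: "real ^ 'n \<Rightarrow> ('n \<Rightarrow> real set) \<Rightarrow> (real ^ 'n \<Rightarrow> real) \<Rightarrow> bool" where
  "base_const hi B h \<longleftrightarrow> (\<forall>q\<in>IS. \<forall>q'\<in>IS. above B q \<and> same B q q' \<and> (\<forall>i. hi $ i \<le> q $ i \<longrightarrow> q $ i = q' $ i) \<longrightarrow> h q = h q')"

lemma index_measure_space: "space (index_measure K :: (real ^ 'n) measure) = IS"
  using real_or_int unfolding index_measure_def index_space_def by auto

lemma index_measure_cell:
  assumes "levels K E" "p \<in> pts E" shows "cell K E p \<in> sets (index_measure K)"
proof (cases "K = UNIV")
  case True then show ?thesis using sets_cell[of E p] assms unfolding index_measure_def by simp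
next
  case False then show ?thesis unfolding index_measure_def cell_def by auto
qed

text \<open>
  A function that does not vary within the bounded directions of a cell of \<open>B\<close> has on a smaller
  cell the share of its integral that the lengths of the sides give: the scaling that maps one cell
  to the other leaves the function alone.
\<close>

lemma integral_subcell:
  fixes h :: "real ^ 'n \<Rightarrow> real"
  assumes B: "base_levels lo hi B" and E: "box_levels lo hi E" and BE: "\<And>i. B i \<subseteq> E i"
    and h: "integrable (index_measure K) h" and const: "base_const hi B h" and p: "p \<in> pts E"
  shows "(\<integral>q. h q * indicator (cell K E p) q \<partial>index_measure K) =
     (\<integral>q. h q * indicator (cell K B (flr B p)) q \<partial>index_measure K) *
       (\<Prod>i\<in>UNIV. mass (cell_type hi B (flr B p) i) (p $ i) (nxt (hi $ i + 1) (E i) (p $ i)))"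
proof -
  have bB: "box_levels lo hi B" using B unfolding base_levels_def by simp
  note lB = box_levelsD(1)[OF bB] and lE = box_levelsD(1)[OF E]
  have pi: "p $ i \<in> E i" for i using p unfolding pts_def by simp
  have "lo \<le> p" unfolding less_eq_vec_def using box_levelsD(5)[OF E pi] by blast
  then have ab: "above B p" using box_above[OF bB] by blast
  let ?k = "flr B p" let ?t = "\<lambda>i. nxt (hi $ i + 1) (E i) (p $ i)" and ?v = "\<lambda>i. nxt (hi $ i + 1) (B i) (?k $ i)"
  have k: "?k \<in> pts B" using flr_pts[OF lB ab] .
  have ki: "?k $ i \<in> B i" for i using k unfolding pts_def by simp
  note m = cell_type_mass(2-4)[OF bB E BE p k refl]
  show ?thesis
  proof (cases "K = UNIV")
    case False
    have "B i = E i" for i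
    proof
      show "B i \<subseteq> E i" by (rule BE)
      show "E i \<subseteq> B i" using B False box_levelsD(5-7)[OF E, of _ i] unfolding base_levels_def by (simp add: subset_eq)
    qed
    then have BE': "B = E" by (rule ext)
    note kp = flr_of_pts[OF lE p]
    have "mass (cell_type hi E p i) (p $ i) (?t i) = 1" for i
      using m(1)[of i] box_nxt(4)[OF E pi, of i] unfolding BE' kp by simp
    then show ?thesis unfolding BE' kp by simp
  next
    case True
    define c t where "c = (\<chi> i. if ?k $ i = hi $ i then 1 else (?t i - p $ i) / (?v i - ?k $ i))"
      and "t = (\<chi> i. p $ i - c $ i * ?k $ i)"
    have c: "c $ i > 0" for i
      using box_nxt(4)[OF E pi, of i] box_nxt(4)[OF bB ki, of i] by (simp add: c_def)
    let ?T = "\<lambda>q :: real ^ 'n. \<chi> i. t $ i + c $ i * q $ i"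
    have T: "?T q $ i = p $ i + c $ i * (q $ i - ?k $ i)" for q i by (simp add: t_def algebra_simps)
    have iff: "?T q $ i \<in> axis_cell K (E i) (p $ i) \<longleftrightarrow> q $ i \<in> axis_cell K (B i) (?k $ i)" for q i
    proof (cases "?k $ i = hi $ i")
      case kh: True
      then have "p $ i = hi $ i" "c $ i = 1" using m(2) by (auto simp: c_def)
      then show ?thesis using kh T[of q i] box_nxt(5)[OF E pi, of i] box_nxt(5)[OF bB ki, of i] \<open>K = UNIV\<close> by simp
    next
      case kh: False
      have ph: "p $ i < hi $ i" using m(3)[OF kh] by blast
      have tp: "?t i - p $ i > 0" "?v i - ?k $ i > 0" using box_nxt(4)[OF E pi, of i] box_nxt(4)[OF bB ki, of i] by auto
      have ci: "c $ i * (?v i - ?k $ i) = ?t i - p $ i" using tp kh by (simp add: c_def)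
      have "?T q $ i < ?t i \<longleftrightarrow> c $ i * (q $ i - ?k $ i) < c $ i * (?v i - ?k $ i)" unfolding T ci by auto
      then have 1: "?T q $ i < ?t i \<longleftrightarrow> q $ i < ?v i" using c[of i] by simp
      have 2: "p $ i \<le> ?T q $ i \<longleftrightarrow> ?k $ i \<le> q $ i" unfolding T using c[of i] by (simp add: zero_le_mult_iff)
      show ?thesis using 1 2 kh ph box_nxt(5)[OF E pi, of i] box_nxt(5)[OF bB ki, of i] \<open>K = UNIV\<close> by simp
    qed
    have ind: "?T q \<in> cell K E p \<longleftrightarrow> q \<in> cell K B ?k" for q
      unfolding cell_product[OF lE p] cell_product[OF lB k] mem_Collect_eq using iff[of q] by simp
    have hT: "h (?T q) = h q" if q: "q \<in> cell K B ?k" for q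
    proof -
      have "?T q \<in> cell K E p" using ind q by blast
      then have e: "above E (?T q)" "flr E (?T q) = p" by (auto simp: cell_def)
      have "same E (?T q) p" using same_sym[OF same_flr[OF lE e(1)]] e(2) by simp
      then have s: "same B (?T q) p" by (rule same_mono[OF _ BE])
      have q': "above B q" "flr B q = ?k" using q by (auto simp: cell_def)
      have "same B q ?k" using same_sym[OF same_flr[OF lB q'(1)]] q'(2) by simp
      then have sq: "same B q (?T q)" using same_trans[OF same_trans[OF _ same_flr[OF lB ab]] same_sym[OF s]] by blast
      have fx: "q $ i = ?T q $ i" if "hi $ i \<le> q $ i" for i
      proof -
        have "hi $ i \<le> ?k $ i" using flr_coord(3)[OF lB q'(1) box_levelsD(4)[OF bB] that] q'(2) by simp
        then have "?k $ i = hi $ i" using box_levelsD(6)[OF bB ki[of i]] by simp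
        then show ?thesis using m(2)[of i] T[of q i] by (simp add: c_def)
      qed
      have "q \<in> IS" "?T q \<in> IS" using \<open>K = UNIV\<close> by (auto simp: index_space_def)
      then have "h q = h (?T q)"
        using const[unfolded base_const_def, THEN bspec, THEN bspec, THEN mp] q'(1) sq fx by simp
      then show ?thesis by simp
    qed
    have M: "index_measure K = (lborel :: (real ^ 'n) measure)" using True by (simp add: index_measure_def)
    have "(\<lambda>q. h q * indicator (cell K E p) q) \<in> borel_measurable borel"
      using h index_measure_cell[OF lE p] unfolding M by (intro borel_measurable_times borel_measurable_indicator) auto
    then have "(\<integral>q. h q * indicator (cell K E p) q \<partial>lborel) =
        (\<Prod>i\<in>UNIV. c $ i) * (\<integral>q. h (?T q) * indicator (cell K E p) (?T q) \<partial>lborel)"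
      using lborel_integral_scale[of c "\<lambda>q. h q * indicator (cell K E p) q" t] c by simp
    also have "(\<lambda>q. h (?T q) * indicator (cell K E p) (?T q)) = (\<lambda>q. h q * indicator (cell K B ?k) q)"
    proof
      fix q show "h (?T q) * indicator (cell K E p) (?T q) = h q * indicator (cell K B ?k) q"
        using ind[of q] hT[of q] by (cases "q \<in> cell K B ?k") simp_all
    qed
    also have "(\<Prod>i\<in>UNIV. c $ i) = (\<Prod>i\<in>UNIV. mass (cell_type hi B ?k i) (p $ i) (?t i))"
      using m(1) by (intro prod.cong refl) (simp add: c_def)
    finally show ?thesis unfolding M by (simp add: mult.commute)
  qed
qed

lemma integrable_step:
  fixes E :: "'n::finite \<Rightarrow> real set" and h :: "real ^ 'n \<Rightarrow> real"
  assumes E: "levels K E" and h: "integrable (index_measure K) h" and d: "step E d"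
  shows "integrable (index_measure K) (\<lambda>q. h q * d q)"
    and "(\<integral>q. h q * d q \<partial>index_measure K) = (\<Sum>p\<in>pts E. d p * (\<integral>q. h q * indicator (cell K E p) q \<partial>index_measure K))"
proof -
  let ?M = "index_measure K :: (real ^ 'n) measure"
  have i: "integrable ?M (\<lambda>q. d p * (h q * indicator (cell K E p) q))" if "p \<in> pts E" for p
    using integrable_mult_indicator[OF index_measure_cell[OF E that] h] by (simp add: mult.commute)
  have eq: "h q * d q = (\<Sum>p\<in>pts E. d p * (h q * indicator (cell K E p) q))" if "q \<in> space ?M" for q
    using step_expand[OF d E, of q] that unfolding index_measure_space by (simp add: sum_distrib_left mult_ac)
  have "integrable ?M (\<lambda>q. \<Sum>p\<in>pts E. d p * (h q * indicator (cell K E p) q))"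
    using i by (rule Bochner_Integration.integrable_sum)
  moreover have "integrable ?M (\<lambda>q. h q * d q) \<longleftrightarrow> integrable ?M (\<lambda>q. \<Sum>p\<in>pts E. d p * (h q * indicator (cell K E p) q))"
    by (rule Bochner_Integration.integrable_cong[OF refl eq])
  ultimately show "integrable ?M (\<lambda>q. h q * d q)" by blast
  have "(\<integral>q. h q * d q \<partial>?M) = (\<integral>q. (\<Sum>p\<in>pts E. d p * (h q * indicator (cell K E p) q)) \<partial>?M)"
    by (rule Bochner_Integration.integral_cong[OF refl eq])
  also have "\<dots> = (\<Sum>p\<in>pts E. (\<integral>q. d p * (h q * indicator (cell K E p) q) \<partial>?M))"
    by (rule Bochner_Integration.integral_sum[OF i])
  also have "\<dots> = (\<Sum>p\<in>pts E. d p * (\<integral>q. h q * indicator (cell K E p) q \<partial>?M))" by simp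
  finally show "(\<integral>q. h q * d q \<partial>?M) = (\<Sum>p\<in>pts E. d p * (\<integral>q. h q * indicator (cell K E p) q \<partial>?M))" .
qed

lemma integral_base_const:
  fixes h :: "real ^ 'n \<Rightarrow> real"
  assumes B: "base_levels lo hi B" and E: "box_levels lo hi E" and BE: "\<And>i. B i \<subseteq> E i"
    and h: "integrable (index_measure K) h" and const: "base_const hi B h" and d: "step E d"
  shows "(\<integral>q. h q * d q \<partial>index_measure K) =
     (\<Sum>k\<in>pts B. (\<integral>q. h q * indicator (cell K B k) q \<partial>index_measure K) * avg hi (cell_type hi B k) E d)"
proof -
  have bB: "box_levels lo hi B" using B unfolding base_levels_def by simp
  note lB = box_levelsD(1)[OF bB] and lE = box_levelsD(1)[OF E]
  let ?I = "\<lambda>k. (\<integral>q. h q * indicator (cell K B k) q \<partial>index_measure K)"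
  let ?m = "\<lambda>k p. (\<Prod>i\<in>UNIV. mass (cell_type hi B k i) (p $ i) (nxt (hi $ i + 1) (E i) (p $ i)))"
  have main: "(\<integral>q. h q * indicator (cell K E p) q \<partial>index_measure K) = (\<Sum>k\<in>pts B. ?I k * ?m k p)" if p: "p \<in> pts E" for p
  proof -
    have pi: "p $ i \<in> E i" for i using p unfolding pts_def by simp
    have "lo \<le> p" unfolding less_eq_vec_def using box_levelsD(5)[OF E pi] by blast
    then have k: "flr B p \<in> pts B" using flr_pts[OF lB] box_above[OF bB] by blast
    have "(\<Sum>k\<in>pts B. ?I k * ?m k p) = (\<Sum>k\<in>{flr B p}. ?I k * ?m k p)"
    proof (rule sum.mono_neutral_right)
      show "\<forall>i\<in>pts B - {flr B p}. ?I i * ?m i p = 0" using cell_type_mass(1)[OF bB E BE p] by simp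
    qed (use finite_pts[OF lB] k in simp_all)
    then show ?thesis using integral_subcell[OF B E BE h const p] by simp
  qed
  have "(\<integral>q. h q * d q \<partial>index_measure K) = (\<Sum>p\<in>pts E. d p * (\<Sum>k\<in>pts B. ?I k * ?m k p))"
    unfolding integrable_step(2)[OF lE h d] using main by (intro sum.cong refl) simp
  also have "\<dots> = (\<Sum>p\<in>pts E. \<Sum>k\<in>pts B. ?I k * (d p * ?m k p))"
    by (simp add: sum_distrib_left mult_ac)
  also have "\<dots> = (\<Sum>k\<in>pts B. \<Sum>p\<in>pts E. ?I k * (d p * ?m k p))" by (rule sum.swap)
  also have "\<dots> = (\<Sum>k\<in>pts B. ?I k * avg hi (cell_type hi B k) E d)"
    by (simp add: avg_def sum_distrib_left)
  finally show ?thesis .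
qed

end

context persistence
begin

definition side :: "real \<times> real \<Rightarrow> real set" where
  "side \<tau> = (if fst \<tau> = snd \<tau> then {fst \<tau>} else {fst \<tau>..<snd \<tau>} \<inter> K)"

lemma axis_measure_side:
  assumes uv: "fst \<tau> \<in> K" "snd \<tau> \<in> K" "fst \<tau> \<le> snd \<tau>"
  shows "axis_measure K (side \<tau>) = (if K = UNIV then if fst \<tau> = snd \<tau> then count_space {fst \<tau>} else lborel else count_space K)"
proof (cases "K = UNIV")
  case True
  show ?thesis
  proof (cases "fst \<tau> = snd \<tau>")
    case eq: True
    have "open (top_of_set K interior_of {fst \<tau>})" using openin_interior_of[of "top_of_set K" "{fst \<tau>}"] True by simp
    moreover have "top_of_set K interior_of {fst \<tau>} \<subseteq> {fst \<tau>}" by (rule interior_of_subset)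
    ultimately have "top_of_set K interior_of {fst \<tau>} = {}" using not_open_singleton[of "fst \<tau>"] by (metis subset_singletonD)
    moreover have "side \<tau> = {fst \<tau>}" using eq by (simp add: side_def)
    ultimately have "axis_measure K (side \<tau>) = count_space {fst \<tau>}" unfolding axis_measure_def by simp
    then show ?thesis using True eq by simp
  next
    case False
    have sd: "side \<tau> = {fst \<tau>..<snd \<tau>}" unfolding side_def using False True by simp
    have "openin (top_of_set K) {fst \<tau><..<snd \<tau>}" unfolding True by simp
    then have "{fst \<tau><..<snd \<tau>} \<subseteq> top_of_set K interior_of side \<tau>"
      unfolding sd by (rule interior_of_maximal[rotated]) (rule greaterThanLessThan_subseteq_atLeastLessThan_iff[THEN iffD2], simp)
    moreover have "{fst \<tau><..<snd \<tau>} \<noteq> {}" using False uv by simp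
    ultimately have "top_of_set K interior_of side \<tau> \<noteq> {}" by blast
    then show ?thesis using True False by (simp add: axis_measure_def)
  qed
next
  case False
  then have Z: "K = \<int>" using real_or_int by blast
  have "openin (top_of_set K) {fst \<tau>}"
  proof -
    have "{fst \<tau>} = K \<inter> {fst \<tau> - 1/2<..<fst \<tau> + 1/2}"
    proof (intro equalityI subsetI)
      fix x assume x: "x \<in> K \<inter> {fst \<tau> - 1/2<..<fst \<tau> + 1/2}"
      then obtain m n :: int where "x = of_int m" "fst \<tau> = of_int n" using Z uv by (auto elim!: Ints_cases)
      then have "m = n" using x by auto
      then show "x \<in> {fst \<tau>}" using \<open>x = _\<close> \<open>fst \<tau> = _\<close> by simp
    qed (use uv in simp)
    then show ?thesis unfolding openin_open
      by (intro exI[of _ "{fst \<tau> - 1/2<..<fst \<tau> + 1/2}"] conjI[OF open_greaterThanLessThan])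
  qed
  moreover have "fst \<tau> \<in> side \<tau>" using uv by (simp add: side_def)
  ultimately have "{fst \<tau>} \<subseteq> top_of_set K interior_of side \<tau>" by (intro interior_of_maximal) auto
  then show ?thesis using False by (auto simp: axis_measure_def)
qed

lemma measure_side:
  assumes uv: "fst \<tau> \<in> K" "snd \<tau> \<in> K" "fst \<tau> \<le> snd \<tau>" and uh: "snd \<tau> \<le> h" and s: "s \<in> K" "t \<in> K" "s < t"
    and A: "A = {s..<t} \<inter> K \<or> s = h \<and> t = h + 1 \<and> A = {s..} \<inter> K"
  shows "side \<tau> \<inter> A \<in> sets (axis_measure K (side \<tau>))" "emeasure (axis_measure K (side \<tau>)) (side \<tau> \<inter> A) < \<infinity>"
    and "measure (axis_measure K (side \<tau>)) (side \<tau> \<inter> A) = (if fst \<tau> = snd \<tau> then 1 else snd \<tau> - fst \<tau>) * mass \<tau> s t"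
proof -
  define u v where "u = fst \<tau>" and "v = snd \<tau>"
  note uv' = uv[folded u_def v_def]
  have AA: "side \<tau> \<inter> A = side \<tau> \<inter> {s..<t}"
  proof -
    have "side \<tau> \<subseteq> K" "\<And>x. x \<in> side \<tau> \<Longrightarrow> x \<le> h" using uv uh by (auto simp: side_def split: if_splits)
    then show ?thesis using A by fastforce
  qed
  have sides: "side \<tau> = (if u = v then {u} else {u..<v} \<inter> K)" by (simp add: side_def u_def v_def)
  have m: "mass \<tau> s t = (if u = v then if s \<le> u \<and> u < t then 1 else 0 else max 0 (min t v - max s u) / (v - u))"
    by (simp add: mass_def u_def v_def)
  have M: "axis_measure K (side \<tau>) = (if K = UNIV then if u = v then count_space {u} else lborel else count_space K)"
    using axis_measure_side[OF uv] by (simp add: u_def v_def)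
  have pt: "side \<tau> \<inter> {s..<t} = (if s \<le> u \<and> u < t then {u} else {})" if "u = v" using that by (auto simp: sides)
  have int: "side \<tau> \<inter> {s..<t} = {max s u..<min t v} \<inter> K" if "u \<noteq> v" using that by (auto simp: sides)
  have "side \<tau> \<inter> {s..<t} \<in> sets (axis_measure K (side \<tau>)) \<and> emeasure (axis_measure K (side \<tau>)) (side \<tau> \<inter> {s..<t}) < \<infinity> \<and>
    measure (axis_measure K (side \<tau>)) (side \<tau> \<inter> {s..<t}) = (if u = v then 1 else v - u) * mass \<tau> s t"
  proof (cases "u = v")
    case True
    show ?thesis unfolding pt[OF True] M m using True uv' by (cases "K = UNIV") (simp_all add: measure_count_space)
  next
    case False
    then have vu: "v - u > 0" using uv' by simp
    show ?thesis
    proof (cases "K = UNIV")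
      case UN: True
      show ?thesis unfolding int[OF False] M m using UN False vu
        by (cases "max s u \<le> min t v") (simp_all add: max_def min_def)
    next
      case KZ: False
      then have Z: "K = \<int>" using real_or_int by blast
      have mem: "max s u \<in> \<int>" "min t v \<in> \<int>" using s uv' Z by (auto simp: max_def min_def)
      have f: "finite ({max s u..<min t v} \<inter> \<int>) \<and> real (card ({max s u..<min t v} \<inter> \<int>)) = max 0 (min t v - max s u)"
      proof (cases "max s u \<le> min t v")
        case True then show ?thesis using card_Ints_interval[OF mem True] by simp
      next
        case False
        then have e: "{max s u..<min t v} \<inter> \<int> = {}" and le: "min t v - max s u \<le> 0" by auto
        show ?thesis unfolding e max_absorb1[OF le] by simp
      qed
      have Ks: "{max s u..<min t v} \<inter> K \<subseteq> K" by blast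
      show ?thesis unfolding int[OF False] M m using KZ False vu f
        by (simp add: Z emeasure_count_space measure_count_space of_nat_less_top)
    qed
  qed
  then show "side \<tau> \<inter> A \<in> sets (axis_measure K (side \<tau>))" "emeasure (axis_measure K (side \<tau>)) (side \<tau> \<inter> A) < \<infinity>"
    "measure (axis_measure K (side \<tau>)) (side \<tau> \<inter> A) = (if fst \<tau> = snd \<tau> then 1 else snd \<tau> - fst \<tau>) * mass \<tau> s t"
    unfolding AA by (simp_all add: u_def v_def)
qed

text \<open>Averages over faces are products of one-dimensional averages, hence again weighted sums over cells.\<close>

lemma cube_average_step:
  fixes E :: "'n::finite \<Rightarrow> real set"
  assumes E: "box_levels lo hi E" and \<tau>: "\<And>i. fst (\<tau> i) \<in> E i \<and> snd (\<tau> i) \<in> E i \<and> fst (\<tau> i) \<le> snd (\<tau> i)"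
    and d: "step E d"
  shows "cube_average K {q. \<forall>i. q $ i \<in> side (\<tau> i)} d = avg hi \<tau> E d"
proof -
  let ?c = "{q :: real ^ 'n. \<forall>i. q $ i \<in> side (\<tau> i)}"
  let ?M = "\<lambda>i. axis_measure K (side (\<tau> i))"
  note lE = box_levelsD(1)[OF E]
  have \<tau>K: "fst (\<tau> i) \<in> K" "snd (\<tau> i) \<in> K" "fst (\<tau> i) \<le> snd (\<tau> i)" "snd (\<tau> i) \<le> hi $ i" "lo $ i \<le> fst (\<tau> i)" for i
    using \<tau>[of i] box_levelsD(5-7)[OF E, of _ i] by auto
  have ne: "fst (\<tau> i) \<in> side (\<tau> i)" for i using \<tau>K[of i] by (simp add: side_def)
  have proj: "(\<lambda>q. q $ i) ` ?c = side (\<tau> i)" for i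
  proof (intro equalityI subsetI)
    fix x assume x: "x \<in> side (\<tau> i)"
    let ?q = "\<chi> j. if j = i then x else fst (\<tau> j)"
    have "?q \<in> ?c" "x = ?q $ i" using x ne by auto
    then show "x \<in> (\<lambda>q. q $ i) ` ?c" by blast
  qed auto
  have "countable \<int>" "countable {fst (\<tau> i)}" for i by (auto intro: countable_int)
  then have sf: "sigma_finite_measure (?M i)" for i
    unfolding axis_measure_side[OF \<tau>K(1-3)]
    using real_or_int by (auto intro!: sigma_finite_measure_count_space_countable sigma_finite_lborel)
  interpret product_sigma_finite ?M by (intro product_sigma_finite.intro sf)
  have ci: "cube_integral K ?c h = (\<integral>t. indicator ?c (\<chi> i. t i) * h (\<chi> i. t i) \<partial>(\<Pi>\<^sub>M i\<in>UNIV. ?M i))" for h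
    unfolding cube_integral_def proj ..
  let ?Ax = "\<lambda>p i. axis_cell K (E i) (p $ i)" and ?len = "\<lambda>i. if fst (\<tau> i) = snd (\<tau> i) then 1 else snd (\<tau> i) - fst (\<tau> i)"
  have Ax: "?Ax p i = {p $ i..<nxt (hi $ i + 1) (E i) (p $ i)} \<inter> K \<or>
      p $ i = hi $ i \<and> nxt (hi $ i + 1) (E i) (p $ i) = hi $ i + 1 \<and> ?Ax p i = {p $ i..} \<inter> K"
    and nK: "p $ i \<in> K" "nxt (hi $ i + 1) (E i) (p $ i) \<in> K" "p $ i < nxt (hi $ i + 1) (E i) (p $ i)"
    if p: "p \<in> pts E" for p i
  proof -
    have pi: "p $ i \<in> E i" using p by (simp add: pts_def)
    note n = box_nxt[OF E pi]
    show "?Ax p i = {p $ i..<nxt (hi $ i + 1) (E i) (p $ i)} \<inter> K \<or>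
      p $ i = hi $ i \<and> nxt (hi $ i + 1) (E i) (p $ i) = hi $ i + 1 \<and> ?Ax p i = {p $ i..} \<inter> K"
      using n(1,5) by (cases "p $ i = hi $ i") auto
    show "p $ i \<in> K" using box_levelsD(7)[OF E pi] .
    show "p $ i < nxt (hi $ i + 1) (E i) (p $ i)" by (rule n(4))
    have "p $ i \<le> hi $ i" using box_levelsD(6)[OF E pi] .
    then show "nxt (hi $ i + 1) (E i) (p $ i) \<in> K"
      using n(1,2) box_levelsD(7)[OF E] box_levelsD(7)[OF E box_levelsD(4)[OF E], of i] K_add K_1 by (cases "p $ i = hi $ i") auto
  qed
  have I: "integrable (?M i) (indicator (side (\<tau> i) \<inter> ?Ax p i) :: real \<Rightarrow> real)"
    "(\<integral>x. indicator (side (\<tau> i) \<inter> ?Ax p i) x \<partial>?M i) = ?len i * mass (\<tau> i) (p $ i) (nxt (hi $ i + 1) (E i) (p $ i))"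
    if p: "p \<in> pts E" for p i
  proof -
    note m = measure_side[OF \<tau>K(1-4) nK[OF p] Ax[OF p]]
    show "integrable (?M i) (indicator (side (\<tau> i) \<inter> ?Ax p i) :: real \<Rightarrow> real)" using m(1,2) by (rule integrable_real_indicator)
    have "(\<integral>x. indicator (side (\<tau> i) \<inter> ?Ax p i) x \<partial>?M i) = measure (?M i) (side (\<tau> i) \<inter> ?Ax p i)"
      using m(1) sets.sets_into_space[OF m(1)] by (simp add: Int_absorb1)
    then show "(\<integral>x. indicator (side (\<tau> i) \<inter> ?Ax p i) x \<partial>?M i) = ?len i * mass (\<tau> i) (p $ i) (nxt (hi $ i + 1) (E i) (p $ i))"
      using m(3) by simp
  qed
  let ?f = "\<lambda>p t. \<Prod>i\<in>UNIV. indicator (side (\<tau> i) \<inter> ?Ax p i) (t i) :: real"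
  have prodind: "(\<Prod>i\<in>UNIV. indicator (S i) (t i)) = (if \<forall>i. t i \<in> S i then 1 else (0::real))" for S :: "'n \<Rightarrow> real set" and t
  proof (cases "\<forall>i. t i \<in> S i")
    case False
    then obtain i where "t i \<notin> S i" by blast
    then have "(\<Prod>i\<in>UNIV. indicator (S i) (t i)) = (0::real)" by (intro prod_zero bexI[of _ i]) simp_all
    then show ?thesis using False by simp
  qed simp
  have cIS: "q \<in> IS" if "q \<in> ?c" for q
  proof -
    have "side (\<tau> i) \<subseteq> K" for i using \<tau>K[of i] by (auto simp: side_def)
    then show ?thesis using that unfolding index_space_def by blast
  qed
  have expand: "indicator ?c (\<chi> i. t i) * d (\<chi> i. t i) = (\<Sum>p\<in>pts E. d p * ?f p t)" for t
  proof (cases "(\<chi> i. t i) \<in> ?c")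
    case True
    have "d (\<chi> i. t i) = (\<Sum>p\<in>pts E. d p * indicator (cell K E p) (\<chi> i. t i))" by (rule step_expand[OF d lE cIS[OF True]])
    also have "\<dots> = (\<Sum>p\<in>pts E. d p * ?f p t)"
    proof (rule sum.cong[OF refl])
      fix p assume p: "p \<in> pts E"
      show "d p * indicator (cell K E p) (\<chi> i. t i) = d p * ?f p t"
        unfolding cell_product[OF lE p] prodind using True by (simp add: indicator_def)
    qed
    finally show ?thesis using True by simp
  next
    case False
    then have z: "?f p t = 0" for p unfolding prodind by auto
    have "indicator ?c (\<chi> i. t i) = (0::real)" using False by simp
    then show ?thesis by (simp only: z mult_zero_right mult_zero_left sum.neutral_const)
  qed
  have "cube_integral K ?c d = (\<integral>t. (\<Sum>p\<in>pts E. d p * ?f p t) \<partial>(\<Pi>\<^sub>M i\<in>UNIV. ?M i))"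
    unfolding ci expand ..
  also have "\<dots> = (\<Sum>p\<in>pts E. (\<integral>t. d p * ?f p t \<partial>(\<Pi>\<^sub>M i\<in>UNIV. ?M i)))"
    by (rule Bochner_Integration.integral_sum) (intro integrable_mult_right product_integrable_prod I, simp_all)
  also have "\<dots> = (\<Sum>p\<in>pts E. d p * (\<Prod>i\<in>UNIV. ?len i * mass (\<tau> i) (p $ i) (nxt (hi $ i + 1) (E i) (p $ i))))"
  proof (rule sum.cong[OF refl])
    fix p assume p: "p \<in> pts E"
    have "(\<integral>t. ?f p t \<partial>(\<Pi>\<^sub>M i\<in>UNIV. ?M i)) = (\<Prod>i\<in>UNIV. ?len i * mass (\<tau> i) (p $ i) (nxt (hi $ i + 1) (E i) (p $ i)))"
      by (subst product_integral_prod) (use I[OF p] in simp_all)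
    then show "(\<integral>t. d p * ?f p t \<partial>(\<Pi>\<^sub>M i\<in>UNIV. ?M i)) = d p * (\<Prod>i\<in>UNIV. ?len i * mass (\<tau> i) (p $ i) (nxt (hi $ i + 1) (E i) (p $ i)))"
      by simp
  qed
  also have "\<dots> = (\<Prod>i\<in>UNIV. ?len i) * avg hi \<tau> E d"
    unfolding avg_def prod.distrib by (simp add: sum_distrib_left mult_ac)
  finally have 1: "cube_integral K ?c d = (\<Prod>i\<in>UNIV. ?len i) * avg hi \<tau> E d" .
  have J: "integrable (?M i) (indicator (side (\<tau> i)) :: real \<Rightarrow> real) \<and> (\<integral>x. indicator (side (\<tau> i)) x \<partial>?M i) = ?len i" for i
  proof -
    let ?A = "{fst (\<tau> i)..<(if fst (\<tau> i) = snd (\<tau> i) then snd (\<tau> i) + 1 else snd (\<tau> i))} \<inter> K"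
    have eq: "side (\<tau> i) \<inter> ?A = side (\<tau> i)" using \<tau>K[of i] by (auto simp: side_def)
    have lt: "fst (\<tau> i) < (if fst (\<tau> i) = snd (\<tau> i) then snd (\<tau> i) + 1 else snd (\<tau> i))" using \<tau>K(3)[of i] by auto
    have K': "(if fst (\<tau> i) = snd (\<tau> i) then snd (\<tau> i) + 1 else snd (\<tau> i)) \<in> K" using \<tau>K[of i] K_add K_1 by simp
    note m = measure_side[OF \<tau>K(1-4)[of i] \<tau>K(1)[of i] K' lt disjI1[OF refl], unfolded eq]
    have "mass (\<tau> i) (fst (\<tau> i)) (if fst (\<tau> i) = snd (\<tau> i) then snd (\<tau> i) + 1 else snd (\<tau> i)) = 1"
      using \<tau>K(3)[of i] by (simp add: mass_def)
    moreover have "(\<integral>x. indicator (side (\<tau> i)) x \<partial>?M i) = measure (?M i) (side (\<tau> i))"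
      using m(1) sets.sets_into_space[OF m(1)] by (simp add: Int_absorb1)
    ultimately show ?thesis using m(3) integrable_real_indicator[OF m(1,2)] by simp
  qed
  have "indicator ?c (\<chi> i. t i) = (\<Prod>i\<in>UNIV. indicator (side (\<tau> i)) (t i) :: real)" for t
    unfolding prodind by (simp add: indicator_def)
  then have "cube_integral K ?c (\<lambda>_. 1) = (\<integral>t. (\<Prod>i\<in>UNIV. indicator (side (\<tau> i)) (t i)) \<partial>(\<Pi>\<^sub>M i\<in>UNIV. ?M i))"
    unfolding ci by (simp only: mult_1_right)
  also have "\<dots> = (\<Prod>i\<in>UNIV. \<integral>x. indicator (side (\<tau> i)) x \<partial>?M i)"
    by (rule product_integral_prod) (use J in simp_all)
  also have "\<dots> = (\<Prod>i\<in>UNIV. ?len i)" by (rule prod.cong[OF refl]) (rule J[THEN conjunct2])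
  finally have 2: "cube_integral K ?c (\<lambda>_. 1) = (\<Prod>i\<in>UNIV. ?len i)" .
  have "?len i > 0" for i using \<tau>K(3)[of i] by auto
  then have "(\<Prod>i\<in>UNIV. ?len i) > 0" by (intro prod_pos) blast
  then show ?thesis unfolding cube_average_def 1 2 by simp
qed

lemma cube_average_cong:
  assumes "\<And>q. q \<in> c \<Longrightarrow> h q = h' q" shows "cube_average K c h = cube_average K c h'"
proof -
  have "(\<lambda>t. indicator c (\<chi> i. t i) * h (\<chi> i. t i)) = (\<lambda>t. indicator c (\<chi> i. t i) * h' (\<chi> i. t i))"
    using assms by (auto simp: indicator_def)
  then show ?thesis unfolding cube_average_def cube_integral_def by simp
qed

end

lemma grid_floor_cong:
  assumes "\<And>p. p \<in> grid_dom G \<Longrightarrow> grid_map G p \<le> q \<longleftrightarrow> grid_map G p \<le> q'"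
  shows "grid_floor G q = grid_floor G q'"
proof -
  have "(\<lambda>p. p \<in> grid_dom G \<and> grid_map G p \<le> q) = (\<lambda>p. p \<in> grid_dom G \<and> grid_map G p \<le> q')"
    using assms by blast
  moreover have "(\<exists>p\<in>grid_dom G. grid_map G p \<le> q) \<longleftrightarrow> (\<exists>p\<in>grid_dom G. grid_map G p \<le> q')"
    using assms by blast
  ultimately show ?thesis unfolding grid_floor_def by simp
qed

lemma grid_floor_range:
  fixes G :: "'n::finite grid"
  assumes fin: "finite (grid_dom G)"
  shows "grid_floor G q \<in> insert None (Some ` grid_dom G)"
proof (cases "\<exists>p\<in>grid_dom G. grid_map G p \<le> q")
  case True
  let ?S = "{p \<in> grid_dom G. grid_map G p \<le> q}"
  have fS: "finite ?S" "?S \<noteq> {}" using fin True by auto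
  define m where "m = (\<chi> i. Max ((\<lambda>p. p $ i) ` ?S))"
  have mS: "\<exists>p\<in>?S. m $ i = p $ i" for i
  proof -
    have "m $ i \<in> (\<lambda>p. p $ i) ` ?S" unfolding m_def using Max_in[of "(\<lambda>p. p $ i) ` ?S"] fS by simp
    then show ?thesis by blast
  qed
  have "m \<in> ?S"
  proof -
    have 1: "m $ i \<in> grid_axis G i" for i using mS[of i] by (auto simp: grid_dom_def)
    have 2: "grid_fun G i (m $ i) \<le> q $ i" for i using mS[of i] by (auto simp: grid_map_def less_eq_vec_def)
    show ?thesis using 1 2 by (simp add: grid_dom_def grid_map_def less_eq_vec_def)
  qed
  moreover have "p \<le> m" if "p \<in> ?S" for p
  proof -
    have "p $ i \<le> m $ i" for i
      unfolding m_def vec_lambda_beta by (rule Max_ge[OF finite_imageI[OF fS(1)] imageI[OF that]])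
    then show ?thesis by (simp add: less_eq_vec_def)
  qed
  ultimately have "(GREATEST p. p \<in> grid_dom G \<and> grid_map G p \<le> q) = m"
    by (intro Greatest_equality) auto
  then show ?thesis using True \<open>m \<in> ?S\<close> by (simp add: grid_floor_def)
next
  case False then show ?thesis by (simp add: grid_floor_def)
qed

lemma finite_grid_levels:
  assumes "is_grid K G" shows "finite (grid_fun G i ` grid_axis G i \<inter> {l..h})"
proof -
  have ax: "\<not> bdd_above (grid_axis G i) \<Longrightarrow> filterlim (grid_fun G i) at_top at_top"
    "\<not> bdd_below (grid_axis G i) \<Longrightarrow> filterlim (grid_fun G i) at_bot at_bot"
    using assms[unfolded is_grid_def, THEN spec, of i] by (elim conjE; simp)+
  obtain u where u: "\<And>t. t \<in> grid_axis G i \<Longrightarrow> grid_fun G i t \<le> h \<Longrightarrow> t \<le> u"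
  proof (cases "bdd_above (grid_axis G i)")
    case True
    then obtain u where "\<And>t. t \<in> grid_axis G i \<Longrightarrow> t \<le> u" unfolding bdd_above_def by blast
    then show thesis using that by blast
  next
    case False
    then have "eventually (\<lambda>t. grid_fun G i t > h) at_top" using ax(1) by (simp add: filterlim_at_top_dense)
    then obtain u where "\<And>t. t \<ge> u \<Longrightarrow> grid_fun G i t > h" unfolding eventually_at_top_linorder by blast
    then show thesis using that by (meson leD linear)
  qed
  obtain d where d: "\<And>t. t \<in> grid_axis G i \<Longrightarrow> l \<le> grid_fun G i t \<Longrightarrow> d \<le> t"
  proof (cases "bdd_below (grid_axis G i)")
    case True
    then obtain u where "\<And>t. t \<in> grid_axis G i \<Longrightarrow> u \<le> t" unfolding bdd_below_def by blast
    then show thesis using that by blast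
  next
    case False
    then have "eventually (\<lambda>t. grid_fun G i t < l) at_bot" using ax(2) by (simp add: filterlim_at_bot_dense)
    then obtain u where "\<And>t. t \<le> u \<Longrightarrow> grid_fun G i t < l" unfolding eventually_at_bot_linorder by blast
    then show thesis using that by (meson leD linear)
  qed
  have "grid_fun G i ` grid_axis G i \<inter> {l..h} \<subseteq> grid_fun G i ` {d..u}" using u d by force
  then show ?thesis using finite_surj by blast
qed

context persistence
begin

lemma dim_zero: "dim {0} = 0"
  using dim_le_card[of "{0}" "{}"] by simp

lemma finite_K_interval: "K \<noteq> UNIV \<Longrightarrow> finite (K \<inter> {l..h})"
proof -
  assume "K \<noteq> UNIV"
  then have Z: "K = \<int>" using real_or_int by blast
  have "K \<inter> {l..h} \<subseteq> of_int ` {\<lfloor>l\<rfloor>..\<lceil>h\<rceil>}"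
  proof
    fix x assume x: "x \<in> K \<inter> {l..h}"
    then obtain m :: int where m: "x = of_int m" using Z by (auto elim: Ints_cases)
    then have "\<lfloor>l\<rfloor> \<le> m" "m \<le> \<lceil>h\<rceil>" using x by (simp_all add: floor_le_iff le_ceiling_iff)
    then show "x \<in> of_int ` {\<lfloor>l\<rfloor>..\<lceil>h\<rceil>}" using m by simp
  qed
  then show ?thesis using finite_surj finite_atLeastAtMost_int by blast
qed

lemma dim_step:
  assumes V: "V \<in> Pers" and ad: "adapted E V" shows "step E (\<lambda>q. real (dim_fun V q))"
  unfolding step_def
proof (intro conjI ballI impI)
  fix q assume "q \<in> IS" "\<not> above E q"
  then show "real (dim_fun V q) = 0" using adapted_zero[OF ad] by (simp add: dim_fun_def dim_zero)
next
  fix p q assume a: "p \<in> IS" "q \<in> IS" "p \<le> q \<and> same E p q"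
  then have b: "bij_betw (tr V p q) (fib V p) (fib V q)" using adapted_bij[OF ad] by blast
  have "dim (tr V p q ` fib V p) = dim (fib V p)"
    by (rule dim_linear_image[OF Pers_findim[OF V a(1)] Pers_linear[OF V a(1,2)]]) (use a b in \<open>auto simp: bij_betw_def\<close>)
  then show "real (dim_fun V p) = real (dim_fun V q)" using b by (simp add: dim_fun_def bij_betw_def)
qed

lemma base_const_discretisable:
  fixes B :: "'n::finite \<Rightarrow> real set"
  assumes a: "discretisable_by K G a" and bB: "base_levels lo hi B"
    and lev: "\<And>i. K = UNIV \<Longrightarrow> grid_fun G i ` grid_axis G i \<inter> {lo $ i..hi $ i} \<subseteq> B i"
  shows "base_const hi B a"
  unfolding base_const_def
proof (intro ballI impI)
  fix q q' :: "real ^ 'n"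
  assume q: "q \<in> IS" "q' \<in> IS" and *: "above B q \<and> same B q q' \<and> (\<forall>i. hi $ i \<le> q $ i \<longrightarrow> q $ i = q' $ i)"
  have B: "box_levels lo hi B" using bB unfolding base_levels_def by blast
  have lo: "lo \<le> q" "lo \<le> q'" using box_above[OF B] above_same[of B q q'] * by blast+
  have iff: "e \<in> B i \<Longrightarrow> e \<le> q' $ i \<longleftrightarrow> e \<le> q $ i" for e i using * unfolding same_def by blast
  have hi: "hi $ i \<le> q' $ i \<longleftrightarrow> hi $ i \<le> q $ i" for i using iff[OF box_levelsD(4)[OF B]] .
  have eq: "q $ i = q' $ i" if "hi $ i \<le> q $ i" for i using * that by blast
  have "grid_floor G q = grid_floor G q'"
  proof (cases "K = UNIV")
    case True
    show ?thesis
    proof (rule grid_floor_cong)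
      fix p assume p: "p \<in> grid_dom G"
      have "grid_fun G i (p $ i) \<le> q $ i \<longleftrightarrow> grid_fun G i (p $ i) \<le> q' $ i" for i
      proof (cases "hi $ i \<le> q $ i")
        case True then show ?thesis using eq by simp
      next
        case False
        let ?g = "grid_fun G i (p $ i)"
        consider "?g < lo $ i" | "hi $ i < ?g" | "?g \<in> {lo $ i..hi $ i}" by fastforce
        then show ?thesis
        proof cases
          case 1 then show ?thesis using lo by (simp add: less_eq_vec_def) (meson less_le_trans less_imp_le)
        next
          case 2 then show ?thesis using False hi[of i] by simp
        next
          case 3
          then have "?g \<in> B i" using lev[OF True, of i] p by (auto simp: grid_dom_def)
          then show ?thesis using iff by blast
        qed
      qed
      then show "grid_map G p \<le> q \<longleftrightarrow> grid_map G p \<le> q'" by (simp add: grid_map_def less_eq_vec_def)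
    qed
  next
    case False
    have Bi: "B i = K \<inter> {lo $ i..hi $ i}" for i using bB False unfolding base_levels_def by blast
    have "q $ i = q' $ i" for i
    proof (cases "hi $ i \<le> q $ i")
      case nh: False
      have "q $ i \<in> B i" "q' $ i \<in> B i" using q lo nh hi[of i] unfolding Bi index_space_def less_eq_vec_def by auto
      then show ?thesis using iff[of "q $ i" i] iff[of "q' $ i" i] by simp
    qed (use eq in simp)
    then have "q = q'" by (simp add: vec_eq_iff)
    then show ?thesis by simp
  qed
  moreover obtain a' where "\<forall>q\<in>IS. a q = a' (grid_floor G q)" using a unfolding discretisable_by_def by blast
  ultimately show "a q = a q'" using q by simp
qed

lemma integrable_base_const:
  fixes B :: "'n::finite \<Rightarrow> real set"
  assumes bB: "base_levels lo hi B" and a: "base_const hi B a"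
    and supp: "\<And>q i. q \<in> IS \<Longrightarrow> a q \<noteq> 0 \<Longrightarrow> lo $ i \<le> q $ i \<and> q $ i < hi $ i"
  shows "integrable (index_measure K) a"
proof -
  have B: "box_levels lo hi B" using bB unfolding base_levels_def by blast
  note lB = box_levelsD(1)[OF B]
  define D where "D = {k \<in> pts B. \<forall>i. k $ i < hi $ i}"
  have fD: "finite D" using finite_pts[OF lB] by (simp add: D_def)
  have eq: "a q = (\<Sum>k\<in>D. a k * indicator (cell K B k) q)" if q: "q \<in> IS" for q
  proof (cases "above B q \<and> flr B q \<in> D")
    case True
    let ?k = "flr B q"
    have k: "?k \<in> IS" "same B q ?k" using flr_index_space[OF lB] same_sym[OF same_flr[OF lB]] True by auto
    have "q $ i < hi $ i" for i
      using flr_coord(3)[OF lB _ box_levelsD(4)[OF B], of q i] True by (force simp: D_def not_le[symmetric])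
    then have "a q = a ?k" using a[unfolded base_const_def, THEN bspec, OF q, THEN bspec, OF k(1)] k(2) True
      by (simp add: not_le[symmetric])
    moreover have "(\<Sum>k\<in>D. a k * indicator (cell K B k) q) = (\<Sum>k\<in>D. if k = ?k then a k else 0)"
      using q True by (intro sum.cong refl) (simp add: cell_def indicator_def)
    ultimately show ?thesis using True fD by simp
  next
    case False
    have "a q = 0"
    proof (rule ccontr)
      assume nz: "a q \<noteq> 0"
      have "lo \<le> q" using supp[OF q nz] by (simp add: less_eq_vec_def)
      then have ab: "above B q" using box_above[OF B] by blast
      have "flr B q $ i < hi $ i" for i using flr_coord(2)[OF lB ab, of i] supp[OF q nz, of i] by simp
      then show False using False ab flr_pts[OF lB ab] by (simp add: D_def)
    qed
    moreover have "(\<Sum>k\<in>D. a k * indicator (cell K B k) q) = 0"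
    proof (rule sum.neutral, rule ballI)
      fix k assume "k \<in> D"
      then have "q \<notin> cell K B k" using False by (auto simp: cell_def)
      then show "a k * indicator (cell K B k) q = 0" by simp
    qed
    ultimately show ?thesis by simp
  qed
  have "integrable (index_measure K) (\<lambda>q. a k * indicator (cell K B k) q)" if k: "k \<in> D" for k
  proof -
    have kB: "k \<in> pts B" and kh: "\<And>i. k $ i < hi $ i" using k by (auto simp: D_def)
    have ki: "k $ i \<in> B i" for i using kB by (simp add: pts_def)
    have "cell K B k \<subseteq> {q. \<forall>i. q $ i \<in> K \<and> lo $ i \<le> q $ i \<and> q $ i \<le> hi $ i}"
    proof
      fix q assume "q \<in> cell K B k"
      then have q: "q $ i \<in> axis_cell K (B i) (k $ i)" for i unfolding cell_product[OF lB kB] by blast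
      have "q $ i \<in> K \<and> lo $ i \<le> q $ i \<and> q $ i \<le> hi $ i" for i
        using q[of i] kh[of i] box_nxt(2)[OF B ki kh, of i] box_levelsD(5)[OF B ki[of i]]
        unfolding box_nxt(5)[OF B ki] by (simp split: if_splits)
      then show "q \<in> {q. \<forall>i. q $ i \<in> K \<and> lo $ i \<le> q $ i \<and> q $ i \<le> hi $ i}" by blast
    qed
    note sub = this
    have "emeasure (index_measure K) (cell K B k) < \<infinity>"
    proof (cases "K = UNIV")
      case True
      have "cell K B k \<subseteq> cbox lo hi" using sub by (auto simp: mem_box_cart)
      then have "bounded (cell K B k)" using bounded_subset[OF bounded_cbox] by blast
      then show ?thesis using emeasure_bounded_finite True by (simp add: index_measure_def)
    next
      case False
      have "cell K B k \<subseteq> pts B" using sub bB False unfolding base_levels_def pts_def by auto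
      then have "finite (cell K B k)" using finite_pts[OF lB] finite_subset by blast
      moreover have "cell K B k \<subseteq> IS" by (auto simp: cell_def)
      ultimately show ?thesis using False by (simp add: index_measure_def emeasure_count_space of_nat_less_top)
    qed
    then show ?thesis using integrable_real_indicator[OF index_measure_cell[OF lB kB]] by simp
  qed
  then have "integrable (index_measure K) (\<lambda>q. \<Sum>k\<in>D. a k * indicator (cell K B k) q)"
    by (rule Bochner_Integration.integrable_sum)
  moreover have "integrable (index_measure K) a \<longleftrightarrow> integrable (index_measure K) (\<lambda>q. \<Sum>k\<in>D. a k * indicator (cell K B k) q)"
    by (rule Bochner_Integration.integrable_cong[OF refl]) (use eq in \<open>simp add: index_measure_space\<close>)
  ultimately show ?thesis by blast
qed

end

context persistence
begin

lemma grid_face_side: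
  fixes G :: "'n::finite grid"
  assumes "c \<in> grid_faces G"
  shows "\<exists>\<tau>. (\<forall>i. fst (\<tau> i) \<in> K \<and> snd (\<tau> i) \<in> K \<and> fst (\<tau> i) \<le> snd (\<tau> i)) \<and> c = {q. \<forall>i. q $ i \<in> side (\<tau> i)}"
proof -
  obtain p where "c \<in> faces K (cub K G (Some p))" using assms unfolding grid_faces_def by blast
  then obtain J a b where c: "c = {q. \<forall>i. q $ i \<in> J i}" and ab: "a \<in> IS" "b \<in> IS" "\<And>i. a $ i < b $ i"
    and J: "\<And>i. J i \<in> {{a $ i..<b $ i} \<inter> K, {a $ i}, {b $ i}}"
    unfolding faces_def by blast
  define \<tau> where "\<tau> i = (if J i = {a $ i} then (a $ i, a $ i) else if J i = {b $ i} then (b $ i, b $ i) else (a $ i, b $ i))" for i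
  have "side (\<tau> i) = J i" for i
  proof -
    consider "J i = {a $ i}" | "J i \<noteq> {a $ i}" "J i = {b $ i}" | "J i \<noteq> {a $ i}" "J i \<noteq> {b $ i}" "J i = {a $ i..<b $ i} \<inter> K"
      using J[of i] by blast
    then show ?thesis using ab(3)[of i] by cases (simp_all add: \<tau>_def side_def)
  qed
  moreover have "fst (\<tau> i) \<in> K \<and> snd (\<tau> i) \<in> K \<and> fst (\<tau> i) \<le> snd (\<tau> i)" for i
    using ab(1,2) ab(3)[of i] by (auto simp: \<tau>_def index_space_def less_imp_le)
  ultimately show ?thesis using c by (intro exI[of _ \<tau>]) simp
qed

text \<open>
  The shape of the elements of the space of stability conditions. On modules that live on a fine
  enough grid in a large box, real and imaginary part are combinations of the averages \<open>avg\<close>.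
  Averages that are degenerate (a point mass in some direction) and not on the upper boundary of
  the box only come from faces; they enter the imaginary part alone, with nonnegative weight.
\<close>

definition formula ::
  "(((real ^ 'n, 'v) pmod \<Rightarrow>\<^sub>0 int) set \<Rightarrow> complex) \<Rightarrow> real ^ 'n \<Rightarrow> real ^ 'n \<Rightarrow> ('n \<Rightarrow> real set)
     \<Rightarrow> ('n \<Rightarrow> real \<times> real) set \<Rightarrow> (('n \<Rightarrow> real \<times> real) \<Rightarrow> real) \<Rightarrow> (('n \<Rightarrow> real \<times> real) \<Rightarrow> real) \<Rightarrow> bool" where
  "formula Z lo hi B A r s \<longleftrightarrow> base_levels lo hi B \<and> (\<forall>i. 0 \<in> B i) \<and> finite A \<and>
     (\<forall>\<tau>\<in>A. \<forall>i. fst (\<tau> i) \<in> B i \<and> snd (\<tau> i) \<in> B i \<and> fst (\<tau> i) \<le> snd (\<tau> i)) \<and>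
     (\<forall>\<tau>\<in>A. (\<exists>i. fst (\<tau> i) = snd (\<tau> i) \<and> fst (\<tau> i) < hi $ i) \<longrightarrow> r \<tau> = 0 \<and> s \<tau> \<ge> 0) \<and>
     (\<forall>V\<in>Pers_fp. \<forall>E. box_levels lo hi E \<and> (\<forall>i. B i \<subseteq> E i) \<and> step E (\<lambda>q. real (dim_fun V q)) \<longrightarrow>
        Re (Z (K_class V)) = (\<Sum>\<tau>\<in>A. r \<tau> * avg hi \<tau> E (\<lambda>q. real (dim_fun V q))) \<and>
        Im (Z (K_class V)) = (\<Sum>\<tau>\<in>A. s \<tau> * avg hi \<tau> E (\<lambda>q. real (dim_fun V q))))"

text \<open>
  The corner \<open>lo\<close> lies below and \<open>c\<close> above the bounded support of the imaginary part, while \<open>hi\<close> can be any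
  point beyond \<open>c\<close>. The levels \<open>B\<close> include those of the densities and of the faces inside the box. The averages
  in \<open>A\<close> are those over the cells of \<open>B\<close>, weighted by the integrals of the densities, and those over
  the faces.
\<close>

lemma stability_space_formula:
  fixes Z :: "((real ^ 'n, 'v) pmod \<Rightarrow>\<^sub>0 int) set \<Rightarrow> complex"
  assumes "Z \<in> stability_space"
  obtains lo c where "lo \<in> IS" "c \<in> IS" "lo \<le> 0" "0 \<le> c" "stability_condition Z"
    "\<And>V W. V \<in> Pers_fp \<Longrightarrow> W \<in> Pers_fp \<Longrightarrow> (\<And>q. q \<in> IS \<Longrightarrow> lo \<le> q \<Longrightarrow> q \<le> c \<Longrightarrow> dim_fun V q = dim_fun W q) \<Longrightarrow>
       Im (Z (K_class V)) = Im (Z (K_class W))"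
    "\<And>hi. hi \<in> IS \<Longrightarrow> c \<le> hi \<Longrightarrow> \<exists>B A r s. formula Z lo hi B A r s"
proof -
  obtain G where G: "is_grid K G" "finite (grid_dom G)" and ZG: "Z \<in> grid_stability G"
    using assms unfolding stability_space_def by blast
  have stab: "stability_condition Z" using ZG unfolding grid_stability_def by blast
  obtain Z' w where Z': "Z' \<in> step_stability G" and w: "\<And>c. c \<in> grid_faces G \<Longrightarrow> w c \<ge> 0"
    and ZZ: "\<And>V. V \<in> Pers_fp \<Longrightarrow> Z (K_class V) = Z' (K_class V) +
       \<i> * complex_of_real (\<Sum>c\<in>grid_faces G. w c * cube_average K c (\<lambda>q. real (dim_fun V q)))"
    using ZG unfolding grid_stability_def by blast
  let ?M = "index_measure K :: (real ^ 'n) measure"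
  obtain G' a b where ext: "is_extension K G G'" and da: "discretisable_by K G' a" and db: "discretisable_by K G' b"
    and unb: "\<And>x q. x \<in> insert None (Some ` grid_dom G) \<Longrightarrow> \<not> bounded (cub K G x) \<Longrightarrow> q \<in> cub K G x \<Longrightarrow> a q = 0"
    and bint: "integrable ?M b"
    and Zab: "\<And>V. V \<in> Pers_fp \<Longrightarrow> Z' (K_class V) =
           (\<integral>q. (complex_of_real (b q) + \<i> * complex_of_real (a q)) * of_nat (dim_fun V q) \<partial>?M)"
    using Z' unfolding step_stability_def by blast
  have G': "is_grid K G'" using ext unfolding is_extension_def is_refinement_def by blast
  define Fc where "Fc = (if finite (grid_faces G) then grid_faces G else {})"
  have fFc: "finite Fc" and FcG: "Fc \<subseteq> grid_faces G" by (auto simp: Fc_def)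
  have sumFc: "(\<Sum>c\<in>grid_faces G. g c) = (\<Sum>c\<in>Fc. g c)" for g :: "(real ^ 'n) set \<Rightarrow> real"
    by (simp add: Fc_def)
  have "\<forall>c\<in>Fc. \<exists>\<tau>. (\<forall>i. fst (\<tau> i) \<in> K \<and> snd (\<tau> i) \<in> K \<and> fst (\<tau> i) \<le> snd (\<tau> i)) \<and> c = {q. \<forall>i. q $ i \<in> side (\<tau> i)}"
    using grid_face_side FcG by blast
  then obtain \<tau> where "\<forall>c\<in>Fc. (\<forall>i. fst (\<tau> c i) \<in> K \<and> snd (\<tau> c i) \<in> K \<and> fst (\<tau> c i) \<le> snd (\<tau> c i)) \<and> c = {q. \<forall>i. q $ i \<in> side (\<tau> c i)}"
    by (rule bchoice[THEN exE])
  then have \<tau>: "\<And>c i. c \<in> Fc \<Longrightarrow> fst (\<tau> c i) \<in> K \<and> snd (\<tau> c i) \<in> K \<and> fst (\<tau> c i) \<le> snd (\<tau> c i)"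
    and c\<tau>: "\<And>c. c \<in> Fc \<Longrightarrow> c = {q. \<forall>i. q $ i \<in> side (\<tau> c i)}" by blast+
  have "bounded (\<Union>x\<in>{x \<in> insert None (Some ` grid_dom G). bounded (cub K G x)}. cub K G x)"
    using G(2) by (intro bounded_UN) auto
  then obtain R where R: "\<And>q. q \<in> (\<Union>x\<in>{x \<in> insert None (Some ` grid_dom G). bounded (cub K G x)}. cub K G x) \<Longrightarrow> norm q \<le> R"
    unfolding bounded_iff by blast
  have supp: "norm q \<le> R" if "q \<in> IS" "a q \<noteq> 0" for q
  proof -
    let ?x = "grid_floor G q"
    have q: "q \<in> cub K G ?x" using that by (simp add: cub_def)
    have x: "?x \<in> insert None (Some ` grid_dom G)" by (rule grid_floor_range[OF G(2)])
    then have "bounded (cub K G ?x)" using unb[OF x _ q] that by blast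
    then show ?thesis using R q x by blast
  qed
  define S where "S = insert R (\<Union>c\<in>Fc. \<Union>i\<in>UNIV. {\<bar>fst (\<tau> c i)\<bar>, \<bar>snd (\<tau> c i)\<bar>})"
  have fS: "finite S" using fFc by (simp add: S_def)
  obtain N :: nat where N: "Max S < real N" using reals_Archimedean2 by blast
  have SN: "x < real N" if "x \<in> S" for x using Max_ge[OF fS that] N by simp
  define lo c where "lo = ((\<chi> i. - real N) :: real ^ 'n)" and "c = ((\<chi> i. real N) :: real ^ 'n)"
  have NK: "real N \<in> K" "- real N \<in> K" using real_or_int by auto
  have lc: "lo \<in> IS" "c \<in> IS" "lo \<le> 0" "0 \<le> c" using NK by (simp_all add: lo_def c_def index_space_def less_eq_vec_def)
  have supp': "lo $ i \<le> q $ i \<and> q $ i < c $ i" if "q \<in> IS" "a q \<noteq> 0" for q i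
  proof -
    have "\<bar>q $ i\<bar> \<le> R" using component_le_norm_cart[of q i] supp[OF that] by simp
    moreover have "R < real N" by (rule SN) (simp add: S_def)
    ultimately show ?thesis by (auto simp: lo_def c_def abs_le_iff)
  qed
  have \<tau>N: "\<bar>fst (\<tau> f i)\<bar> < real N" "\<bar>snd (\<tau> f i)\<bar> < real N" if "f \<in> Fc" for f i
    by (rule SN, unfold S_def, use that in blast)+
  have faceN: "q \<in> IS \<and> lo \<le> q \<and> q \<le> c" if f: "f \<in> Fc" and q: "q \<in> f" for f q
  proof -
    have sd: "q $ i \<in> side (\<tau> f i)" for i using q c\<tau>[OF f] by blast
    have "q $ i \<in> K \<and> - real N \<le> q $ i \<and> q $ i \<le> real N" for i
      using sd[of i] \<tau>[OF f, of i] \<tau>N[OF f, of i] by (auto simp: side_def abs_less_iff split: if_splits)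
    then show ?thesis by (simp add: index_space_def less_eq_vec_def lo_def c_def)
  qed
  define BB where "BB hi i = {lo $ i, hi $ i, 0} \<union> (\<Union>f\<in>Fc. {fst (\<tau> f i), snd (\<tau> f i)}) \<union>
     (if K = UNIV then grid_fun G' i ` grid_axis G' i \<inter> {lo $ i..hi $ i} else K \<inter> {lo $ i..hi $ i})" for hi :: "real ^ 'n" and i
  have BB: "base_levels lo hi (BB hi)" if hi: "hi \<in> IS" "c \<le> hi" for hi
  proof -
    have h: "hi $ i \<in> K" "real N \<le> hi $ i" for i using hi by (auto simp: index_space_def c_def less_eq_vec_def)
    have fin: "finite (BB hi i)" for i unfolding BB_def using fFc finite_grid_levels[OF G'] finite_K_interval by simp
    have fK: "fst (\<tau> f i) \<in> K" "snd (\<tau> f i) \<in> K" "- real N \<le> fst (\<tau> f i)" "- real N \<le> snd (\<tau> f i)"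
      "fst (\<tau> f i) \<le> hi $ i" "snd (\<tau> f i) \<le> hi $ i" if "f \<in> Fc" for f i
      using \<tau>[OF that, of i] \<tau>N[OF that, of i] h(2)[of i] by auto
    have sub: "BB hi i \<subseteq> K \<inter> {lo $ i..hi $ i}" for i
      unfolding BB_def using h[of i] NK K_0 fK by (auto simp: lo_def)
    have "box_levels lo hi (BB hi)" unfolding box_levels_def levels_def
      using fin sub by (auto simp: BB_def)
    moreover have "BB hi i = K \<inter> {lo $ i..hi $ i}" if "K \<noteq> UNIV" for i
    proof (rule equalityI[OF sub])
      show "K \<inter> {lo $ i..hi $ i} \<subseteq> BB hi i" unfolding BB_def using that by (simp add: subset_eq)
    qed
    ultimately show ?thesis unfolding base_levels_def by blast
  qed
  have const: "base_const hi (BB hi) h" if hi: "hi \<in> IS" "c \<le> hi" and h: "discretisable_by K G' h" for hi h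
    by (rule base_const_discretisable[OF h BB[OF hi]]) (simp add: BB_def subset_eq)
  have aint: "integrable ?M a"
  proof (rule integrable_base_const[OF BB const[OF _ _ da]])
    show "lo $ i \<le> q $ i \<and> q $ i < c $ i" if "q \<in> IS" "a q \<noteq> 0" for q i by (rule supp'[OF that])
  qed (use lc in auto)
  have ZRI: "Re (Z (K_class V)) = (\<integral>q. b q * real (dim_fun V q) \<partial>?M)"
     "Im (Z (K_class V)) = (\<integral>q. a q * real (dim_fun V q) \<partial>?M) + (\<Sum>f\<in>Fc. w f * cube_average K f (\<lambda>q. real (dim_fun V q)))"
    if V: "V \<in> Pers_fp" for V
  proof -
    obtain E where E: "levels K E" "adapted E V" using fp_imp_adapted[OF V] by metis
    note d = dim_step[OF fp_Pers[OF V] E(2)]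
    let ?d = "\<lambda>q. real (dim_fun V q)"
    have ib: "integrable ?M (\<lambda>q. b q * ?d q)" and ia: "integrable ?M (\<lambda>q. a q * ?d q)"
      using integrable_step(1)[OF E(1) bint d] integrable_step(1)[OF E(1) aint d] .
    have "(\<integral>q. (complex_of_real (b q) + \<i> * complex_of_real (a q)) * of_nat (dim_fun V q) \<partial>?M) =
       (\<integral>q. complex_of_real (b q * ?d q) + \<i> * complex_of_real (a q * ?d q) \<partial>?M)"
      by (rule Bochner_Integration.integral_cong[OF refl]) (simp add: algebra_simps)
    also have "\<dots> = (\<integral>q. complex_of_real (b q * ?d q) \<partial>?M) + (\<integral>q. \<i> * complex_of_real (a q * ?d q) \<partial>?M)"
      by (rule Bochner_Integration.integral_add[OF integrable_of_real[OF ib] integrable_mult_right[OF integrable_of_real[OF ia]]])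
    also have "\<dots> = complex_of_real (\<integral>q. b q * ?d q \<partial>?M) + \<i> * complex_of_real (\<integral>q. a q * ?d q \<partial>?M)"
      by (simp only: integral_mult_right_zero integral_complex_of_real)
    finally have "Z (K_class V) = complex_of_real (\<integral>q. b q * ?d q \<partial>?M) + \<i> * complex_of_real (\<integral>q. a q * ?d q \<partial>?M) +
        \<i> * complex_of_real (\<Sum>f\<in>Fc. w f * cube_average K f ?d)"
      using ZZ[OF V] Zab[OF V] sumFc by simp
    then show "Re (Z (K_class V)) = (\<integral>q. b q * ?d q \<partial>?M)"
     "Im (Z (K_class V)) = (\<integral>q. a q * ?d q \<partial>?M) + (\<Sum>f\<in>Fc. w f * cube_average K f ?d)"
      by simp_all
  qed
  have loc: "Im (Z (K_class V)) = Im (Z (K_class W))"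
    if VW: "V \<in> Pers_fp" "W \<in> Pers_fp" and eq: "\<And>q. q \<in> IS \<Longrightarrow> lo \<le> q \<Longrightarrow> q \<le> c \<Longrightarrow> dim_fun V q = dim_fun W q" for V W
  proof -
    have "(\<integral>q. a q * real (dim_fun V q) \<partial>?M) = (\<integral>q. a q * real (dim_fun W q) \<partial>?M)"
    proof (rule Bochner_Integration.integral_cong[OF refl])
      fix q assume "q \<in> space ?M"
      then have q: "q \<in> IS" by (simp add: index_measure_space)
      show "a q * real (dim_fun V q) = a q * real (dim_fun W q)"
      proof (cases "a q = 0")
        case False
        then have "lo \<le> q" "q \<le> c" using supp'[OF q False] by (simp_all add: less_eq_vec_def less_imp_le)
        then show ?thesis using eq[OF q] by simp
      qed simp
    qed
    moreover have "cube_average K f (\<lambda>q. real (dim_fun V q)) = cube_average K f (\<lambda>q. real (dim_fun W q))" if "f \<in> Fc" for f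
      by (rule cube_average_cong) (use faceN[OF that] eq in simp)
    ultimately show ?thesis using ZRI(2)[OF VW(1)] ZRI(2)[OF VW(2)] by simp
  qed
  have main: "\<exists>B A r s. formula Z lo hi B A r s" if hi: "hi \<in> IS" "c \<le> hi" for hi
  proof -
    let ?B = "BB hi" and ?ct = "cell_type hi (BB hi)"
    have bB: "box_levels lo hi ?B" using BB[OF hi] unfolding base_levels_def by blast
    have fB: "finite (pts ?B)" using finite_pts[OF box_levelsD(1)[OF bB]] .
    let ?I = "\<lambda>h k. (\<integral>q. h q * indicator (cell K ?B k) q \<partial>?M)"
    define A where "A = ?ct ` pts ?B \<union> \<tau> ` Fc"
    define r where "r t = (\<Sum>k\<in>{k \<in> pts ?B. ?ct k = t}. ?I b k)" for t
    define s where "s t = (\<Sum>k\<in>{k \<in> pts ?B. ?ct k = t}. ?I a k) + (\<Sum>f\<in>{f \<in> Fc. \<tau> f = t}. w f)" for t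
    have fA: "finite A" using fB fFc by (simp add: A_def)
    have ctB: "fst (?ct k i) \<in> ?B i \<and> snd (?ct k i) \<in> ?B i \<and> fst (?ct k i) \<le> snd (?ct k i) \<and> (fst (?ct k i) = snd (?ct k i) \<longrightarrow> fst (?ct k i) = hi $ i)"
      if k: "k \<in> pts ?B" for k i
    proof -
      have ki: "k $ i \<in> ?B i" using k by (simp add: pts_def)
      have "k $ i < hi $ i" if "k $ i \<noteq> hi $ i" using box_levelsD(6)[OF bB ki] that by simp
      then show ?thesis using box_nxt(2)[OF bB ki] ki by (auto simp: cell_type_def less_imp_le)
    qed
    have \<tau>B: "fst (\<tau> f i) \<in> ?B i \<and> snd (\<tau> f i) \<in> ?B i \<and> fst (\<tau> f i) \<le> snd (\<tau> f i)" if "f \<in> Fc" for f i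
      using \<tau>[OF that, of i] that by (auto simp: BB_def)
    have group1: "(\<Sum>t\<in>A. (\<Sum>k\<in>{k \<in> pts ?B. ?ct k = t}. h k) * g t) = (\<Sum>k\<in>pts ?B. h k * g (?ct k))"
      for h :: "real ^ 'n \<Rightarrow> real" and g :: "('n \<Rightarrow> real \<times> real) \<Rightarrow> real"
    proof -
      have "(\<Sum>t\<in>A. (\<Sum>k\<in>{k \<in> pts ?B. ?ct k = t}. h k) * g t) = (\<Sum>t\<in>A. \<Sum>k\<in>{k \<in> pts ?B. ?ct k = t}. h k * g (?ct k))"
        by (simp add: sum_distrib_right)
      also have "\<dots> = (\<Sum>k\<in>pts ?B. h k * g (?ct k))" by (rule sum.group[OF fB fA]) (simp add: A_def)
      finally show ?thesis .
    qed
    have group2: "(\<Sum>t\<in>A. (\<Sum>f\<in>{f \<in> Fc. \<tau> f = t}. w f) * g t) = (\<Sum>f\<in>Fc. w f * g (\<tau> f))" for g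
    proof -
      have "(\<Sum>t\<in>A. (\<Sum>f\<in>{f \<in> Fc. \<tau> f = t}. w f) * g t) = (\<Sum>t\<in>A. \<Sum>f\<in>{f \<in> Fc. \<tau> f = t}. w f * g (\<tau> f))"
        by (simp add: sum_distrib_right)
      also have "\<dots> = (\<Sum>f\<in>Fc. w f * g (\<tau> f))" by (rule sum.group[OF fFc fA]) (simp add: A_def)
      finally show ?thesis .
    qed
    have "formula Z lo hi ?B A r s" unfolding formula_def
    proof (intro conjI BB[OF hi] fA allI ballI impI; (elim conjE exE)?)
      show "0 \<in> ?B i" for i by (simp add: BB_def)
      fix t assume t: "t \<in> A"
      show "fst (t i) \<in> ?B i" "snd (t i) \<in> ?B i" "fst (t i) \<le> snd (t i)" for i
        using t ctB[of _ i] \<tau>B[of _ i] unfolding A_def by blast+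
      fix i assume deg: "fst (t i) = snd (t i)" "fst (t i) < hi $ i"
      have no: "{k \<in> pts ?B. ?ct k = t} = {}" using ctB[of _ i] deg by auto
      show "r t = 0" unfolding r_def no by simp
      show "s t \<ge> 0" unfolding s_def no using w FcG by (auto intro!: sum_nonneg)
    next
      fix V E assume V: "V \<in> Pers_fp" and E: "box_levels lo hi E" and BE: "\<forall>i. ?B i \<subseteq> E i" and d: "step E (\<lambda>q. real (dim_fun V q))"
      let ?d = "\<lambda>q. real (dim_fun V q)"
      have BE': "?B i \<subseteq> E i" for i using BE by blast
      show "Re (Z (K_class V)) = (\<Sum>t\<in>A. r t * avg hi t E ?d)"
        unfolding r_def group1 ZRI(1)[OF V] by (rule integral_base_const[OF BB[OF hi] E BE' bint const[OF hi db] d])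
      have "cube_average K f ?d = avg hi (\<tau> f) E ?d" if f: "f \<in> Fc" for f
        by (subst c\<tau>[OF f], rule cube_average_step[OF E _ d]) (use \<tau>B[OF f] BE' in blast)
      then have "Im (Z (K_class V)) = (\<Sum>k\<in>pts ?B. ?I a k * avg hi (?ct k) E ?d) + (\<Sum>f\<in>Fc. w f * avg hi (\<tau> f) E ?d)"
        unfolding ZRI(2)[OF V] using integral_base_const[OF BB[OF hi] E BE' aint const[OF hi da] d] by simp
      then show "Im (Z (K_class V)) = (\<Sum>t\<in>A. s t * avg hi t E ?d)"
        unfolding s_def distrib_right sum.distrib group1 group2 .
    qed
    then show ?thesis by (intro exI)
  qed
  show thesis by (rule that[OF lc stab loc main])
qed

end

section \<open>Maximisers live on the levels of the module and of the stability condition\<close>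

lemma mass_nonneg: "fst \<tau> \<le> snd \<tau> \<Longrightarrow> mass \<tau> s t \<ge> 0"
  by (simp add: mass_def)

text \<open>
  The one-dimensional core of the removal of a level. If neither end of \<open>\<tau>\<close> falls between \<open>e\<close> and
  \<open>e'\<close>, the two parts of this interval have masses in proportion to their lengths, unless \<open>\<tau>\<close> is
  a point mass: placed at \<open>e\<close>, it belongs to the lower part alone.
\<close>

lemma mass_split:
  assumes e: "e < s" "s < e'" and u: "fst \<tau> \<le> e \<or> e' \<le> fst \<tau>" and v: "snd \<tau> \<le> e \<or> e' \<le> snd \<tau>"
    and uv: "fst \<tau> \<le> snd \<tau>" and l: "l = (s - e) / (e' - e)"
  shows "l * mass \<tau> s e' \<le> (1 - l) * mass \<tau> e s"
    and "fst \<tau> \<noteq> snd \<tau> \<or> e < fst \<tau> \<Longrightarrow> l * mass \<tau> s e' = (1 - l) * mass \<tau> e s"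
proof -
  have l': "1 - l = (e' - s) / (e' - e)" using e l by (simp add: field_simps)
  have main: "l * mass \<tau> s e' = (1 - l) * mass \<tau> e s" if "fst \<tau> \<noteq> snd \<tau>"
  proof (cases "fst \<tau> \<le> e \<and> e' \<le> snd \<tau>")
    case True
    then show ?thesis using that e unfolding l' l mass_def by (simp add: field_simps)
  next
    case False
    then have "snd \<tau> \<le> e \<or> e' \<le> fst \<tau>" using u v by blast
    then have "mass \<tau> s e' = 0" "mass \<tau> e s = 0" using that e by (auto simp: mass_def)
    then show ?thesis by simp
  qed
  have deg: "mass \<tau> s e' = 0" "e < fst \<tau> \<Longrightarrow> mass \<tau> e s = 0" if "fst \<tau> = snd \<tau>"
    using that u e by (auto simp: mass_def)
  have "1 - l \<ge> 0" unfolding l' using e by simp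
  then have "0 \<le> (1 - l) * mass \<tau> e s" using mass_nonneg[OF uv] by simp
  then show "l * mass \<tau> s e' \<le> (1 - l) * mass \<tau> e s" using main deg(1) by (cases "fst \<tau> = snd \<tau>") auto
  show "fst \<tau> \<noteq> snd \<tau> \<or> e < fst \<tau> \<Longrightarrow> l * mass \<tau> s e' = (1 - l) * mass \<tau> e s"
    using main deg by (cases "fst \<tau> = snd \<tau>") auto
qed

text \<open>
  Removing a level \<open>s\<close> between neighbouring levels \<open>e\<close> and \<open>e'\<close>, either by pushing it up to \<open>e'\<close>
  (\<open>dm\<close>) or down to \<open>e\<close> (\<open>dp\<close>): the average is affine in the position of the level, except that
  an average concentrated on \<open>e\<close> jumps up when \<open>e\<close> is reached.
\<close>

lemma avg_remove_level:
  fixes d dm dp :: "real ^ 'n \<Rightarrow> real" and e s :: real and i :: 'n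
  defines "up \<equiv> \<lambda>p. \<chi> j. if j = i then s else p $ j" and "down \<equiv> \<lambda>p. \<chi> j. if j = i then e else p $ j"
  assumes F: "levels K F" and eF: "e \<in> F i" and sF: "s \<in> F i" and es: "e < s" "s < e'"
    and nxt: "nxt (hi $ i + 1) (F i) e = s" "nxt (hi $ i + 1) (F i) s = e'"
    and \<tau>: "\<And>j. fst (\<tau> j) \<le> snd (\<tau> j)" and u: "fst (\<tau> i) \<le> e \<or> e' \<le> fst (\<tau> i)" and v: "snd (\<tau> i) \<le> e \<or> e' \<le> snd (\<tau> i)"
    and dm: "\<And>p. p \<in> pts F \<Longrightarrow> dm p = (if p $ i = s then d (down p) else d p)"
    and dp: "\<And>p. p \<in> pts F \<Longrightarrow> dp p = (if p $ i = e then d (up p) else d p)"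
    and mono: "\<And>p. p \<in> pts F \<Longrightarrow> p $ i = e \<Longrightarrow> d p \<le> d (up p)" and l: "l = (s - e) / (e' - e)"
  shows "avg hi \<tau> F d \<le> l * avg hi \<tau> F dm + (1 - l) * avg hi \<tau> F dp"
    and "fst (\<tau> i) \<noteq> snd (\<tau> i) \<or> e < fst (\<tau> i) \<Longrightarrow> avg hi \<tau> F d = l * avg hi \<tau> F dm + (1 - l) * avg hi \<tau> F dp"
proof -
  define m where "m p j = mass (\<tau> j) (p $ j) (nxt (hi $ j + 1) (F j) (p $ j))" for p :: "real ^ 'n" and j
  define M where "M p = (\<Prod>j\<in>UNIV. m p j)" for p
  define Pe Ps where "Pe = {p \<in> pts F. p $ i = e}" and "Ps = {p \<in> pts F. p $ i = s}"
  have fin: "finite (pts F)" by (rule finite_pts[OF F])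
  have bij: "bij_betw up Pe Ps"
    by (rule bij_betwI[of _ _ _ down])
       (use eF sF in \<open>auto simp: up_def down_def Pe_def Ps_def pts_def vec_eq_iff\<close>)
  have du: "down (up p) = p" if "p \<in> Pe" for p using that by (auto simp: up_def down_def Pe_def vec_eq_iff)
  have Mi: "M p = m p i * (\<Prod>j\<in>UNIV - {i}. m p j)" for p unfolding M_def by (rule prod.remove) auto
  have rest: "(\<Prod>j\<in>UNIV - {i}. m (up p) j) = (\<Prod>j\<in>UNIV - {i}. m p j)" for p
    by (intro prod.cong refl) (auto simp: m_def up_def)
  have rest0: "(\<Prod>j\<in>UNIV - {i}. m p j) \<ge> 0" for p
    by (intro prod_nonneg) (auto simp: m_def intro: mass_nonneg[OF \<tau>])
  have mi: "m p i = mass (\<tau> i) e s" "m (up p) i = mass (\<tau> i) s e'" if "p \<in> Pe" for p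
    using that nxt by (simp_all add: m_def Pe_def up_def)
  let ?g = "\<lambda>p. (l * dm p + (1 - l) * dp p - d p) * M p"
  have avg: "avg hi \<tau> F f = (\<Sum>p\<in>pts F. f p * M p)" for f by (simp add: avg_def M_def m_def)
  have "l * avg hi \<tau> F dm + (1 - l) * avg hi \<tau> F dp - avg hi \<tau> F d = (\<Sum>p\<in>pts F. ?g p)"
    unfolding avg by (simp add: sum_distrib_left sum.distrib[symmetric] sum_subtractf[symmetric] algebra_simps)
  also have "\<dots> = (\<Sum>p\<in>Pe \<union> Ps. ?g p)"
  proof (rule sum.mono_neutral_right[OF fin])
    show "\<forall>p\<in>pts F - (Pe \<union> Ps). ?g p = 0" using dm dp by (auto simp: Pe_def Ps_def algebra_simps)
  qed (auto simp: Pe_def Ps_def)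
  also have "\<dots> = (\<Sum>p\<in>Pe. ?g p) + (\<Sum>p\<in>Ps. ?g p)"
    by (rule sum.union_disjoint) (use fin es in \<open>auto simp: Pe_def Ps_def\<close>)
  also have "(\<Sum>p\<in>Ps. ?g p) = (\<Sum>p\<in>Pe. ?g (up p))" by (rule sum.reindex_bij_betw[OF bij, symmetric])
  also have "(\<Sum>p\<in>Pe. ?g p) + (\<Sum>p\<in>Pe. ?g (up p)) =
     (\<Sum>p\<in>Pe. (d (up p) - d p) * ((1 - l) * mass (\<tau> i) e s - l * mass (\<tau> i) s e') * (\<Prod>j\<in>UNIV - {i}. m p j))"
    unfolding sum.distrib[symmetric]
  proof (rule sum.cong[OF refl])
    fix p assume p: "p \<in> Pe"
    have pF: "p \<in> pts F" "up p \<in> pts F" "p $ i = e" "up p $ i = s"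
      using p bij_betwE[OF bij] by (auto simp: Pe_def Ps_def)
    have g: "dm p = d p" "dp p = d (up p)" "dm (up p) = d p" "dp (up p) = d (up p)"
      using dm[OF pF(1)] dp[OF pF(1)] dm[OF pF(2)] dp[OF pF(2)] pF es du[OF p] by simp_all
    show "?g p + ?g (up p) = (d (up p) - d p) * ((1 - l) * mass (\<tau> i) e s - l * mass (\<tau> i) s e') * (\<Prod>j\<in>UNIV - {i}. m p j)"
      unfolding g Mi rest mi[OF p] by (simp add: algebra_simps)
  qed
  finally have D: "l * avg hi \<tau> F dm + (1 - l) * avg hi \<tau> F dp - avg hi \<tau> F d =
     (\<Sum>p\<in>Pe. (d (up p) - d p) * ((1 - l) * mass (\<tau> i) e s - l * mass (\<tau> i) s e') * (\<Prod>j\<in>UNIV - {i}. m p j))" .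
  note ms = mass_split[OF es u v \<tau> l]
  have "0 \<le> (d (up p) - d p) * ((1 - l) * mass (\<tau> i) e s - l * mass (\<tau> i) s e') * (\<Prod>j\<in>UNIV - {i}. m p j)" if "p \<in> Pe" for p
    using mono[of p] that ms(1) rest0[of p] by (intro mult_nonneg_nonneg) (auto simp: Pe_def)
  then have "0 \<le> l * avg hi \<tau> F dm + (1 - l) * avg hi \<tau> F dp - avg hi \<tau> F d" unfolding D by (rule sum_nonneg)
  then show "avg hi \<tau> F d \<le> l * avg hi \<tau> F dm + (1 - l) * avg hi \<tau> F dp" by simp
  assume "fst (\<tau> i) \<noteq> snd (\<tau> i) \<or> e < fst (\<tau> i)"
  then have "l * avg hi \<tau> F dm + (1 - l) * avg hi \<tau> F dp - avg hi \<tau> F d = 0" unfolding D using ms(2) by simp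
  then show "avg hi \<tau> F d = l * avg hi \<tau> F dm + (1 - l) * avg hi \<tau> F dp" by simp
qed

text \<open>
  Above \<open>lo\<close> the module \<open>T\<close> changes only at the levels \<open>E\<close>, which contain those of the formula
  for \<open>Z\<close>. The imaginary part sees only the box \<open>[lo, c]\<close>.
\<close>

locale reduced_module = stable_module scale K Z T
  for scale :: "'f::field \<Rightarrow> 'v::ab_group_add \<Rightarrow> 'v" and K :: "real set"
    and Z :: "((real ^ 'n, 'v) pmod \<Rightarrow>\<^sub>0 int) set \<Rightarrow> complex" and T :: "(real ^ 'n, 'v) pmod" +
  fixes lo c hi :: "real ^ 'n" and B E :: "'n \<Rightarrow> real set" and A :: "('n \<Rightarrow> real \<times> real) set"
    and r s :: "('n \<Rightarrow> real \<times> real) \<Rightarrow> real"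
  assumes form: "formula Z lo hi B A r s" and chi: "c \<le> hi"
    and loc: "\<And>V W. V \<in> Pers_fp \<Longrightarrow> W \<in> Pers_fp \<Longrightarrow>
      (\<And>q. q \<in> IS \<Longrightarrow> lo \<le> q \<Longrightarrow> q \<le> c \<Longrightarrow> dim_fun V q = dim_fun W q) \<Longrightarrow> Im (Z (K_class V)) = Im (Z (K_class W))"
    and E: "box_levels lo hi E" and BE: "\<And>i. B i \<subseteq> E i"
    and Tbij: "\<And>p q. p \<in> IS \<Longrightarrow> q \<in> IS \<Longrightarrow> lo \<le> p \<Longrightarrow> p \<le> q \<Longrightarrow> same E p q \<Longrightarrow> bij_betw (tr T p q) (fib T p) (fib T q)"
begin

definition refines :: "('n \<Rightarrow> real set) \<Rightarrow> bool" where
  "refines F \<longleftrightarrow> box_levels lo hi F \<and> (\<forall>i. E i \<subseteq> F i)"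

lemma refines_E: "refines E"
  using E by (simp add: refines_def)

lemma refinesD: assumes "refines F" shows "box_levels lo hi F" "levels K F" "E i \<subseteq> F i" "above F q \<longleftrightarrow> lo \<le> q"
  using assms box_above box_levelsD(1) unfolding refines_def by blast+

lemma refines_bij:
  assumes "refines F" "p \<in> IS" "q \<in> IS" "lo \<le> p" "p \<le> q" "same F p q"
  shows "bij_betw (tr T p q) (fib T p) (fib T q)"
  by (rule Tbij[OF assms(2-5) same_mono[OF assms(6) refinesD(3)[OF assms(1)]]])

lemma TP: "T \<in> Pers"
  by (rule fp_Pers[OF T])

lemma dim_tr_image:
  assumes W: "submod T W" and F: "refines F" and pq: "p \<in> IS" "q \<in> IS" "lo \<le> p" "p \<le> q" "same F p q"
  shows "dim (tr T p q ` W p) = dim (W p)"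
proof (rule dim_linear_image)
  have sub: "W p \<subseteq> fib T p" using submodD(2)[OF W pq(1)] .
  show "findim (W p)" by (rule findim_subset[OF Pers_findim[OF TP pq(1)] submodD(1)[OF W pq(1)] sub])
  show "linear_between (W p) (fib T q) (tr T p q)"
    by (rule linear_between_mono[OF Pers_linear[OF TP pq(1,2,4)] sub]) (use submodD(2,3)[OF W] pq in blast)
  show "inj_on (tr T p q) (W p)" using refines_bij[OF F pq] sub unfolding bij_betw_def by (blast intro: inj_on_subset)
qed

lemma fsub_step:
  assumes W: "fsub F T W" and F: "refines F" shows "step F (\<lambda>q. real (dim (W q)))"
  unfolding step_def
proof (intro conjI ballI impI)
  fix q :: "real ^ 'n" assume "q \<in> IS" "\<not> above F q"
  then show "real (dim (W q)) = 0" using fsubD(2)[OF W] by (simp add: dim_zero)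
next
  fix p q :: "real ^ 'n" assume a: "p \<in> IS" "q \<in> IS" "p \<le> q \<and> same F p q"
  show "real (dim (W p)) = real (dim (W q))"
  proof (cases "above F p")
    case True
    then have "dim (tr T p q ` W p) = dim (W p)"
      using dim_tr_image[OF fsubD(1)[OF W] F a(1,2)] refinesD(4)[OF F] a(3) by blast
    then show ?thesis using fsubD(3)[OF W a(1,2)] a(3) by simp
  next
    case False
    then have "\<not> above F q" using above_same a(3) by blast
    then show ?thesis using False fsubD(2)[OF W] a by (simp add: dim_zero)
  qed
qed

lemma fsub_charge:
  assumes W: "W \<in> subobjects T" and F: "refines F" and st: "step F (\<lambda>q. real (dim (W q)))"
  shows "Re (charge Z T W) = (\<Sum>\<tau>\<in>A. r \<tau> * avg hi \<tau> F (\<lambda>q. real (dim (W q))))"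
    and "Im (charge Z T W) = (\<Sum>\<tau>\<in>A. s \<tau> * avg hi \<tau> F (\<lambda>q. real (dim (W q))))"
proof -
  have "B i \<subseteq> F i" for i using BE refinesD(3)[OF F] by blast
  then have "box_levels lo hi F \<and> (\<forall>i. B i \<subseteq> F i) \<and> step F (\<lambda>q. real (dim_fun (T\<lparr>fib := W\<rparr>) q))"
    using refinesD(1)[OF F] st by (simp add: dim_fun_def)
  then have "Re (Z (K_class (T\<lparr>fib := W\<rparr>))) = (\<Sum>\<tau>\<in>A. r \<tau> * avg hi \<tau> F (\<lambda>q. real (dim_fun (T\<lparr>fib := W\<rparr>) q))) \<and>
        Im (Z (K_class (T\<lparr>fib := W\<rparr>))) = (\<Sum>\<tau>\<in>A. s \<tau> * avg hi \<tau> F (\<lambda>q. real (dim_fun (T\<lparr>fib := W\<rparr>) q)))"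
    using form subobject_fp[OF W] unfolding formula_def by blast
  then show "Re (charge Z T W) = (\<Sum>\<tau>\<in>A. r \<tau> * avg hi \<tau> F (\<lambda>q. real (dim (W q))))"
    and "Im (charge Z T W) = (\<Sum>\<tau>\<in>A. s \<tau> * avg hi \<tau> F (\<lambda>q. real (dim (W q))))"
    by (simp_all add: charge_def dim_fun_def)
qed

text \<open>
  The largest submodule of \<open>W\<close> that is generated at the points of \<open>F\<close>, if \<open>F\<close> refines the levels of \<open>T\<close>.
\<close>

definition resample :: "('n \<Rightarrow> real set) \<Rightarrow> (real ^ 'n \<Rightarrow> 'v set) \<Rightarrow> real ^ 'n \<Rightarrow> 'v set" where
  "resample F W q = (if lo \<le> q then tr T (flr F q) q ` W (flr F q) else {0})"

lemma resample:
  assumes F: "refines F" and W: "submod T W"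
  shows "fsub F T (resample F W)" "q \<in> IS \<Longrightarrow> resample F W q \<subseteq> W q"
    "q \<in> IS \<Longrightarrow> lo \<le> q \<Longrightarrow> dim (resample F W q) = dim (W (flr F q))"
proof -
  have fl: "flr F q \<in> IS" "flr F q \<le> q" "same F (flr F q) q" "lo \<le> flr F q" if "lo \<le> q" for q
  proof -
    have ab: "above F q" using that refinesD(4)[OF F] by blast
    show "flr F q \<in> IS" "flr F q \<le> q" "same F (flr F q) q"
      using flr_index_space[OF refinesD(2)[OF F] ab] flr_le[OF refinesD(2)[OF F] ab] same_flr[OF refinesD(2)[OF F] ab] .
    show "lo \<le> flr F q" using above_flr[OF refinesD(2)[OF F] ab] refinesD(4)[OF F] by blast
  qed
  have sub: "W q \<subseteq> fib T q" if "q \<in> IS" for q using submodD(2)[OF W that] .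
  have z: "0 \<in> W q" if "q \<in> IS" for q using subspace_0[OF submodD(1)[OF W that]] .
  show le: "resample F W q \<subseteq> W q" if q: "q \<in> IS" for q
    using submodD(3)[OF W fl(1) q fl(2)] z[OF q] by (auto simp: resample_def)
  show "q \<in> IS \<Longrightarrow> lo \<le> q \<Longrightarrow> dim (resample F W q) = dim (W (flr F q))"
    using dim_tr_image[OF W F fl(1) _ fl(4,2,3)] by (simp add: resample_def)
  show "fsub F T (resample F W)"
  proof (rule fsubI)
    show "submod T (resample F W)" unfolding submod_def
    proof (intro conjI ballI impI)
      fix q :: "real ^ 'n" assume q: "q \<in> IS"
      show "resample F W q \<subseteq> fib T q" using le[OF q] sub[OF q] by blast
      show "subspace (resample F W q)"
      proof (cases "lo \<le> q")
        case True
        have "linear_between (W (flr F q)) (W q) (tr T (flr F q) q)"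
          by (rule linear_between_mono[OF Pers_linear[OF TP fl(1)[OF True] q fl(2)[OF True]] sub[OF fl(1)[OF True]]])
             (use submodD(3)[OF W fl(1)[OF True] q fl(2)[OF True]] in blast)
        then show ?thesis using subspace_linear_image submodD(1)[OF W fl(1)[OF True]] True by (simp add: resample_def)
      next
        case False then show ?thesis using subspace_single_0 by (simp add: resample_def)
      qed
    next
      fix p q :: "real ^ 'n" assume a: "p \<in> IS" "q \<in> IS" "p \<le> q"
      show "tr T p q ` resample F W p \<subseteq> resample F W q"
      proof (cases "lo \<le> p")
        case True
        then have lq: "lo \<le> q" using a by simp
        have ab: "above F p" using True refinesD(4)[OF F] by blast
        have m: "flr F p \<le> flr F q" by (rule flr_mono[OF refinesD(2)[OF F] ab a(3)])
        have "tr T p q (tr T (flr F p) p w) \<in> tr T (flr F q) q ` W (flr F q)" if w: "w \<in> W (flr F p)" for w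
        proof -
          have w': "w \<in> fib T (flr F p)" using w sub[OF fl(1)[OF True]] by blast
          have "tr T p q (tr T (flr F p) p w) = tr T (flr F q) q (tr T (flr F p) (flr F q) w)"
            using Pers_comp[OF TP fl(1)[OF True] a(1,2) fl(2)[OF True] a(3) w']
              Pers_comp[OF TP fl(1)[OF True] fl(1)[OF lq] a(2) m fl(2)[OF lq] w'] by simp
          then show ?thesis using submodD(3)[OF W fl(1)[OF True] fl(1)[OF lq] m w] by blast
        qed
        then show ?thesis using True lq by (auto simp: resample_def)
      next
        case False
        have "tr T p q 0 = 0" using linear_between_0[OF Pers_linear[OF TP a] Pers_subspace[OF TP a(1)]] .
        moreover have "0 \<in> resample F W q"
        proof (cases "lo \<le> q")
          case True
          have "tr T (flr F q) q 0 = 0"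
            using linear_between_0[OF Pers_linear[OF TP fl(1)[OF True] a(2) fl(2)[OF True]] Pers_subspace[OF TP fl(1)[OF True]]] .
          then have "0 \<in> tr T (flr F q) q ` W (flr F q)" using z[OF fl(1)[OF True]] by (metis imageI)
          then show ?thesis using True by (simp add: resample_def)
        qed (simp add: resample_def)
        ultimately show ?thesis using False by (simp add: resample_def)
      qed
    qed
    show "resample F W q \<subseteq> {0}" if "q \<in> IS" "\<not> above F q" for q
      using that refinesD(4)[OF F] by (simp add: resample_def)
    fix p q v assume a: "p \<in> IS" "q \<in> IS" "p \<le> q" "same F p q" "v \<in> resample F W q"
    show "v \<in> tr T p q ` resample F W p"
    proof (cases "lo \<le> p")
      case True
      then have lq: "lo \<le> q" using a by simp
      have g: "flr F p = flr F q" by (rule flr_cong[OF a(4)])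
      obtain w where w: "w \<in> W (flr F p)" "v = tr T (flr F p) q w" using a(5) lq by (auto simp: resample_def g)
      have "w \<in> fib T (flr F p)" using w sub[OF fl(1)[OF True]] by blast
      then have "v = tr T p q (tr T (flr F p) p w)"
        using Pers_comp[OF TP fl(1)[OF True] a(1,2) fl(2)[OF True] a(3)] w(2) by simp
      then show ?thesis using w True by (auto simp: resample_def)
    next
      case False
      then have "\<not> lo \<le> q" using above_same[OF a(4)] refinesD(4)[OF F] by blast
      then have "v = 0" using a(5) by (simp add: resample_def)
      moreover have "tr T p q 0 = 0" using linear_between_0[OF Pers_linear[OF TP a(1-3)] Pers_subspace[OF TP a(1)]] .
      ultimately show ?thesis using False by (force simp: resample_def)
    qed
  qed
qed

text \<open>
  Only what happens in the box matters for the imaginary part, so for positive \<open>\<theta>\<close> the part of a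
  subobject that is not generated from there costs height.
\<close>

lemma clip_to_box:
  assumes W: "W \<in> subobjects T" and \<theta>: "\<theta> > 0"
  obtains F W' where "refines F" "fsub F T W'" "height Z T \<theta> W \<le> height Z T \<theta> W'"
    "height Z T \<theta> W = height Z T \<theta> W' \<Longrightarrow> \<forall>q\<in>IS. W q \<subseteq> W' q"
proof -
  obtain F0 where F0: "levels K F0" "fsub F0 T W" using W subobjects_iff[OF T] by metis
  define F where "F i = E i \<union> (F0 i \<inter> {lo $ i..hi $ i})" for i
  have F: "refines F" unfolding refines_def box_levels_def levels_def F_def
    using F0(1) box_levelsD[OF E] by (auto simp: levels_def)
  have sW: "submod T W" using fsubD(1)[OF F0(2)] .
  note R = resample[OF F sW]
  have sR: "resample F W \<in> subobjects T" by (rule fsub_subobject[OF T refinesD(2)[OF F] R(1)])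
  have eq: "resample F W q = W q" if q: "q \<in> IS" "lo \<le> q" "q \<le> c" for q
  proof -
    have ab: "above F q" using q refinesD(4)[OF F] by blast
    note fl = flr_coord[OF refinesD(2)[OF F] ab]
    have "same F0 (flr F q) q" unfolding same_def
    proof (intro allI ballI iffI)
      fix i x assume x: "x \<in> F0 i" "x \<le> q $ i"
      have "q $ i \<le> hi $ i" using q(3) chi order_trans unfolding less_eq_vec_def by metis
      show "x \<le> flr F q $ i"
      proof (cases "x < lo $ i")
        case True
        have "lo $ i \<le> flr F q $ i" using box_levelsD(5)[OF refinesD(1)[OF F] fl(1)] .
        then show ?thesis using True by simp
      next
        case False
        then have "x \<in> F i" using x \<open>q $ i \<le> hi $ i\<close> by (simp add: F_def)
        then show ?thesis using fl(3) x by blast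
      qed
    next
      fix i x assume "x \<in> F0 i" "x \<le> flr F q $ i" then show "x \<le> q $ i" using fl(2)[of i] by simp
    qed
    then have "W q = tr T (flr F q) q ` W (flr F q)"
      using fsubD(3)[OF F0(2) flr_index_space[OF refinesD(2)[OF F] ab] q(1) flr_le[OF refinesD(2)[OF F] ab]] by blast
    then show ?thesis using q by (simp add: resample_def)
  qed
  have "Im (charge Z T (resample F W)) = Im (charge Z T W)" unfolding charge_def
    by (rule loc[OF subobject_fp[OF sR] subobject_fp[OF W]]) (use eq in \<open>simp add: dim_fun_def\<close>)
  then have h: "height Z T \<theta> (resample F W) - height Z T \<theta> W = \<theta> * (Re (charge Z T W) - Re (charge Z T (resample F W)))"
    unfolding height_def by (simp add: algebra_simps)
  note cm = charge_mono[OF sR W R(2)]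
  show thesis
  proof (rule that[OF F R(1)])
    have "0 \<le> \<theta> * (Re (charge Z T W) - Re (charge Z T (resample F W)))" using cm(1) \<theta> by simp
    then show "height Z T \<theta> W \<le> height Z T \<theta> (resample F W)" using h by linarith
    assume "height Z T \<theta> W = height Z T \<theta> (resample F W)"
    then have "Re (charge Z T (resample F W)) = Re (charge Z T W)" using h \<theta> by simp
    then show "\<forall>q\<in>IS. W q \<subseteq> resample F W q" using cm(2) by blast
  qed
qed

end

context reduced_module
begin

text \<open>
  \<open>Wm\<close> has the level \<open>x\<close> moved up to the next one and \<open>Wp\<close> has it moved down. Point masses at the lower
  neighbour only enter the imaginary part, with nonnegative weight, which gives the inequality
  between heights its direction. Only \<open>Wp\<close> is sure to contain \<open>W\<close>, hence the strict bound on \<open>l\<close>: at a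
  maximiser \<open>W\<close> the submodule \<open>Wp\<close> is a maximiser as well.
\<close>

lemma remove_level:
  assumes F: "refines F" and W: "fsub F T W" and xF: "x \<in> F i" and xE: "x \<notin> E i"
  obtains Wm Wp l where "refines (F(i := F i - {x}))" "fsub (F(i := F i - {x})) T Wm" "fsub (F(i := F i - {x})) T Wp"
    "\<And>q. q \<in> IS \<Longrightarrow> W q \<subseteq> Wp q" "0 \<le> l" "l < 1"
    "\<And>\<theta>. height Z T \<theta> W \<le> l * height Z T \<theta> Wm + (1 - l) * height Z T \<theta> Wp"
proof -
  define F' where "F' = F(i := F i - {x})"
  note bF = refinesD(1)[OF F] and lF = refinesD(2)[OF F] and EF = refinesD(3)[OF F]
  have F'F: "F' j \<subseteq> F j" and F'i: "F' i = F i - {x}" and F'j: "j \<noteq> i \<Longrightarrow> F' j = F j" for j by (auto simp: F'_def)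
  have EF': "E j \<subseteq> F' j" for j using EF[of j] xE by (auto simp: F'_def)
  have F': "refines F'"
    unfolding refines_def box_levels_def levels_def
  proof (intro conjI allI EF')
    fix j
    show "finite (F' j)" by (rule finite_subset[OF F'F box_levelsD(2)[OF bF]])
    show "F' j \<subseteq> K" using F'F[of j] box_levelsD(7)[OF bF] by blast
    show "lo $ j \<in> F' j" "hi $ j \<in> F' j" using EF'[of j] box_levelsD(3,4)[OF E] by blast+
    show "F' j \<subseteq> {lo $ j..hi $ j}" using F'F[of j] box_levelsD(5,6)[OF bF] by (simp add: subset_eq)
  qed
  have lox: "lo $ i < x" "x < hi $ i"
    using box_levelsD(5,6)[OF bF xF] box_levelsD(3,4)[OF E, of i] xE by (auto simp: less_le)
  define e e' where "e = Max {y \<in> F i. y < x}" and "e' = nxt (hi $ i + 1) (F i) x"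
  have finF: "finite {y \<in> F i. y < x}" "{y \<in> F i. y < x} \<noteq> {}"
    using box_levelsD(2)[OF bF] box_levelsD(3)[OF bF, of i] lox by auto
  have e: "e \<in> F i" "e < x" using Max_in[OF finF] by (auto simp: e_def)
  have eM: "y \<le> e" if "y \<in> F i" "y < x" for y unfolding e_def by (rule Max_ge[OF finF(1)]) (use that in simp)
  note nx = box_nxt[OF bF xF] and ne = box_nxt[OF bF e(1)]
  have e': "x < e'" "e' \<le> hi $ i" using nx(2)[OF lox(2)] by (simp_all add: e'_def)
  have nxte: "nxt (hi $ i + 1) (F i) e = x"
  proof -
    have "nxt (hi $ i + 1) (F i) e \<in> F i" "e < nxt (hi $ i + 1) (F i) e" using ne(2) e(2) lox(2) by auto
    then show ?thesis using ne(3)[OF xF e(2)] eM by force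
  qed
  have gap: "y \<le> e \<or> e' \<le> y" if "y \<in> F' i" for y
    using that eM[of y] nx(3)[of y] by (cases y x rule: linorder_cases) (auto simp: F'i e'_def)
  define l where "l = (x - e) / (e' - e)"
  have l: "0 \<le> l" "l < 1" using e e' by (simp_all add: l_def field_simps)
  define up down where "up = (\<lambda>p :: real ^ 'n. \<chi> j. if j = i then x else p $ j)"
    and "down = (\<lambda>p :: real ^ 'n. \<chi> j. if j = i then e else p $ j)"
  define \<sigma> where "\<sigma> q = (\<chi> j. if j = i \<and> e \<le> q $ i \<and> q $ i < x then x else q $ j)" for q :: "real ^ 'n"
  have \<sigma>i: "\<sigma> q $ i = (if e \<le> q $ i \<and> q $ i < x then x else q $ i)" and \<sigma>j: "j \<noteq> i \<Longrightarrow> \<sigma> q $ j = q $ j" for q j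
    by (simp_all add: \<sigma>_def)
  have \<sigma>IS: "\<sigma> q \<in> IS" if "q \<in> IS" for q
    using that box_levelsD(7)[OF bF xF] by (auto simp: index_space_def \<sigma>_def)
  have q\<sigma>: "q \<le> \<sigma> q" for q by (auto simp: less_eq_vec_def \<sigma>_def)
  have \<sigma>mono: "\<sigma> p \<le> \<sigma> q" if "p \<le> q" for p q
    unfolding less_eq_vec_def
  proof
    fix j show "\<sigma> p $ j \<le> \<sigma> q $ j"
      using that \<sigma>i[of p] \<sigma>i[of q] \<sigma>j[of j] unfolding less_eq_vec_def by (cases "j = i") (auto split: if_splits, (meson order_trans not_le less_imp_le)+)
  qed
  have same': "same F' q (\<sigma> q)" for q
    unfolding same_def
  proof (intro allI ballI)
    fix j y assume y: "y \<in> F' j"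
    show "y \<le> \<sigma> q $ j \<longleftrightarrow> y \<le> q $ j"
    proof (cases "j = i")
      case True
      then show ?thesis using gap[of y] y \<sigma>i[of q] e(2) e' by (auto simp: not_less)
    qed (use \<sigma>j in simp)
  qed
  have sameF: "same F (\<sigma> p) (\<sigma> q)" if pq: "same F' p q" for p q
    unfolding same_def
  proof (intro allI ballI)
    fix j y assume y: "y \<in> F j"
    have eF': "e \<in> F' i" using e by (simp add: F'i)
    show "y \<le> \<sigma> q $ j \<longleftrightarrow> y \<le> \<sigma> p $ j"
    proof (cases "j = i \<and> y = x")
      case True
      have "e \<le> q $ i \<longleftrightarrow> e \<le> p $ i" using pq eF' unfolding same_def by blast
      then show ?thesis using True \<sigma>i[of p] \<sigma>i[of q] e(2) by auto
    next
      case False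
      then have "y \<in> F' j" using y by (auto simp: F'_def)
      then show ?thesis using same'[of p] same'[of q] pq unfolding same_def by blast
    qed
  qed
  note sW = fsubD(1)[OF W]
  define Wp where "Wp q = (if lo \<le> q then {v \<in> fib T q. tr T q (\<sigma> q) v \<in> W (\<sigma> q)} else {0})" for q
  have lin: "linear_between (fib T q) (fib T (\<sigma> q)) (tr T q (\<sigma> q))" if "q \<in> IS" for q
    by (rule Pers_linear[OF TP that \<sigma>IS[OF that] q\<sigma>])
  have bij: "bij_betw (tr T q (\<sigma> q)) (fib T q) (fib T (\<sigma> q))" if "q \<in> IS" "lo \<le> q" for q
    by (rule refines_bij[OF F' that(1) \<sigma>IS[OF that(1)] that(2) q\<sigma> same'])
  have WWp: "W q \<subseteq> Wp q" if q: "q \<in> IS" for q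
  proof (cases "lo \<le> q")
    case True
    then show ?thesis using submodD(2)[OF sW q] submodD(3)[OF sW q \<sigma>IS[OF q] q\<sigma>] by (auto simp: Wp_def)
  next
    case False
    then show ?thesis using fsubD(2)[OF W q] refinesD(4)[OF F] by (simp add: Wp_def)
  qed
  have Wp: "fsub F' T Wp"
  proof (rule fsubI)
    show sWp: "submod T Wp" unfolding submod_def
    proof (intro conjI ballI impI)
      fix q :: "real ^ 'n" assume q: "q \<in> IS"
      show "Wp q \<subseteq> fib T q" using subspace_0[OF Pers_subspace[OF TP q]] by (auto simp: Wp_def)
      show "subspace (Wp q)"
        using subspace_linear_preimage[OF lin[OF q] Pers_subspace[OF TP q] submodD(1)[OF sW \<sigma>IS[OF q]]] subspace_single_0
        by (simp add: Wp_def)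
    next
      fix p q :: "real ^ 'n" assume a: "p \<in> IS" "q \<in> IS" "p \<le> q"
      show "tr T p q ` Wp p \<subseteq> Wp q"
      proof (cases "lo \<le> p")
        case True
        then have lq: "lo \<le> q" using a by simp
        have "tr T p q v \<in> Wp q" if v: "v \<in> fib T p" "tr T p (\<sigma> p) v \<in> W (\<sigma> p)" for v
        proof -
          have "tr T q (\<sigma> q) (tr T p q v) = tr T (\<sigma> p) (\<sigma> q) (tr T p (\<sigma> p) v)"
            using Pers_comp[OF TP a(1,2) \<sigma>IS[OF a(2)] a(3) q\<sigma> v(1)]
              Pers_comp[OF TP a(1) \<sigma>IS[OF a(1)] \<sigma>IS[OF a(2)] q\<sigma> \<sigma>mono[OF a(3)] v(1)] by simp
          then show ?thesis
            using submodD(3)[OF sW \<sigma>IS[OF a(1)] \<sigma>IS[OF a(2)] \<sigma>mono[OF a(3)] v(2)] Pers_tr[OF TP a v(1)] lq by (simp add: Wp_def)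
        qed
        then show ?thesis using True by (auto simp: Wp_def)
      next
        case False
        have "tr T p q 0 = 0" using linear_between_0[OF Pers_linear[OF TP a] Pers_subspace[OF TP a(1)]] .
        moreover have "0 \<in> Wp q" using WWp[OF a(2)] subspace_0[OF submodD(1)[OF sW a(2)]] by blast
        ultimately show ?thesis using False by (simp add: Wp_def)
      qed
    qed
    show "Wp q \<subseteq> {0}" if "q \<in> IS" "\<not> above F' q" for q
      using that refinesD(4)[OF F'] by (simp add: Wp_def)
    fix p q v assume a: "p \<in> IS" "q \<in> IS" "p \<le> q" "same F' p q" "v \<in> Wp q"
    show "v \<in> tr T p q ` Wp p"
    proof (cases "lo \<le> p")
      case True
      then have lq: "lo \<le> q" using a by simp
      have l\<sigma>: "lo \<le> \<sigma> p" using True q\<sigma> order_trans by blast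
      have v: "v \<in> fib T q" "tr T q (\<sigma> q) v \<in> W (\<sigma> q)" using a(5) lq by (auto simp: Wp_def)
      obtain u where u: "u \<in> fib T p" "v = tr T p q u"
        using refines_bij[OF F' a(1,2) True a(3,4)] v(1) unfolding bij_betw_def by auto
      obtain w where w: "w \<in> W (\<sigma> p)" "tr T q (\<sigma> q) v = tr T (\<sigma> p) (\<sigma> q) w"
        using fsubD(3)[OF W \<sigma>IS[OF a(1)] \<sigma>IS[OF a(2)] \<sigma>mono[OF a(3)] sameF[OF a(4)]] v(2) by auto
      have "tr T (\<sigma> p) (\<sigma> q) (tr T p (\<sigma> p) u) = tr T (\<sigma> p) (\<sigma> q) w"
        using Pers_comp[OF TP a(1,2) \<sigma>IS[OF a(2)] a(3) q\<sigma> u(1)]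
          Pers_comp[OF TP a(1) \<sigma>IS[OF a(1)] \<sigma>IS[OF a(2)] q\<sigma> \<sigma>mono[OF a(3)] u(1)] u(2) w(2) by simp
      then have "tr T p (\<sigma> p) u = w"
        using refines_bij[OF F \<sigma>IS[OF a(1)] \<sigma>IS[OF a(2)] l\<sigma> \<sigma>mono[OF a(3)] sameF[OF a(4)]]
          Pers_tr[OF TP a(1) \<sigma>IS[OF a(1)] q\<sigma> u(1)] w(1) submodD(2)[OF sW \<sigma>IS[OF a(1)]]
        unfolding bij_betw_def inj_on_def by blast
      then show ?thesis using u w(1) True by (auto simp: Wp_def)
    next
      case False
      then have "\<not> lo \<le> q" using above_same[OF a(4)] refinesD(4)[OF F'] by blast
      then have "v = 0" using a(5) by (simp add: Wp_def)
      moreover have "tr T p q 0 = 0" using linear_between_0[OF Pers_linear[OF TP a(1-3)] Pers_subspace[OF TP a(1)]] .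
      ultimately show ?thesis using False by (force simp: Wp_def)
    qed
  qed
  define Wm where "Wm = resample F' W"
  note R = resample[OF F' sW, folded Wm_def]
  have sub: "W \<in> subobjects T" "Wm \<in> subobjects T" "Wp \<in> subobjects T"
    using fsub_subobject[OF T lF W] fsub_subobject[OF T refinesD(2)[OF F']] R(1) Wp by blast+
  define d dm dp where "d q = real (dim (W q))" and "dm q = real (dim (Wm q))" and "dp q = real (dim (Wp q))" for q
  have dWp: "dp q = d (\<sigma> q)" if q: "q \<in> IS" "lo \<le> q" for q
  proof -
    have "W (\<sigma> q) = tr T q (\<sigma> q) ` Wp q"
      using bij[OF q] submodD(2)[OF sW \<sigma>IS[OF q(1)]] q(2) unfolding bij_betw_def Wp_def by auto
    then show ?thesis using dim_tr_image[OF fsubD(1)[OF Wp] F' q(1) \<sigma>IS[OF q(1)] q(2) q\<sigma> same'] by (simp add: d_def dp_def)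
  qed
  have st: "step F d" "step F dm" "step F dp"
    unfolding d_def dm_def dp_def
    using fsub_step[OF W F] fsub_step[OF fsub_mono[OF R(1) F'F] F] fsub_step[OF fsub_mono[OF Wp F'F] F] .
  have ptIS: "p \<in> IS" "lo \<le> p" if "p \<in> pts F" for p
    using pts_index_space[OF lF that] above_pts[OF that] refinesD(4)[OF F] by blast+
  have \<sigma>p: "\<sigma> p = (if p $ i = e then up p else p)" if "p \<in> pts F" for p
  proof -
    have "p $ i \<in> F i" using that by (simp add: pts_def)
    then have "e \<le> p $ i \<and> p $ i < x \<longleftrightarrow> p $ i = e" using eM[of "p $ i"] e(2) by auto
    then show ?thesis unfolding \<sigma>_def up_def by (auto simp: vec_eq_iff)
  qed
  have dpp: "dp p = (if p $ i = e then d (up p) else d p)" if "p \<in> pts F" for p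
    using dWp[OF ptIS[OF that]] \<sigma>p[OF that] by simp
  have dmp: "dm p = (if p $ i = x then d (down p) else d p)" if p: "p \<in> pts F" for p
  proof -
    have "flr F' p = (if p $ i = x then down p else p)"
    proof (cases "p $ i = x")
      case True
      have "down p \<in> pts F'" using p e F'j by (auto simp: pts_def down_def F'i)
      moreover have "same F' (down p) p" unfolding same_def
      proof (intro allI ballI)
        fix j y assume y: "y \<in> F' j"
        show "y \<le> p $ j \<longleftrightarrow> y \<le> down p $ j"
        proof (cases "j = i")
          case ji: True
          then show ?thesis using True gap[of y] y e e' by (auto simp: down_def)
        qed (simp add: down_def)
      qed
      ultimately show ?thesis using flr_eqI[OF refinesD(2)[OF F']] True by simp
    next
      case False
      have "p \<in> pts F'" unfolding pts_def
      proof (intro CollectI allI)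
        fix j show "p $ j \<in> F' j" using p False F'j[of j] F'i by (cases "j = i") (auto simp: pts_def)
      qed
      then show ?thesis using flr_of_pts[OF refinesD(2)[OF F']] False by simp
    qed
    then show ?thesis using R(3)[OF ptIS[OF p]] by (simp add: dm_def d_def)
  qed
  have mono: "d p \<le> d (up p)" if p: "p \<in> pts F" "p $ i = e" for p
  proof -
    have "findim (Wp p)" by (rule findim_subset[OF Pers_findim[OF TP ptIS(1)[OF p(1)]] submodD(1,2)[OF fsubD(1)[OF Wp] ptIS(1)[OF p(1)]]])
    then have "d p \<le> dp p" unfolding d_def dp_def using dim_mono_findim WWp[OF ptIS(1)[OF p(1)]] by simp
    then show ?thesis using dpp[OF p(1)] p(2) by simp
  qed
  have A: "fst (\<tau> j) \<le> snd (\<tau> j)" "fst (\<tau> j) \<in> F' j" "snd (\<tau> j) \<in> F' j"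
    "fst (\<tau> j) = snd (\<tau> j) \<Longrightarrow> fst (\<tau> j) < hi $ j \<Longrightarrow> r \<tau> = 0 \<and> s \<tau> \<ge> 0" if "\<tau> \<in> A" for \<tau> j
    using form that BE EF' unfolding formula_def by blast+
  have av: "avg hi \<tau> F d \<le> l * avg hi \<tau> F dm + (1 - l) * avg hi \<tau> F dp"
    "fst (\<tau> i) \<noteq> snd (\<tau> i) \<or> e < fst (\<tau> i) \<Longrightarrow> avg hi \<tau> F d = l * avg hi \<tau> F dm + (1 - l) * avg hi \<tau> F dp"
    if \<tau>: "\<tau> \<in> A" for \<tau>
  proof -
    note av = avg_remove_level[where \<tau>=\<tau> and d=d and dm=dm and dp=dp and i=i and e=e and s=x and e'=e' and hi=hi and F=F and l=l, OF lF e(1) xF e(2) e'(1) nxte e'_def[symmetric] A(1)[OF \<tau>] gap[OF A(2)[OF \<tau>]] gap[OF A(3)[OF \<tau>]]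
      dmp[unfolded down_def] dpp[unfolded up_def] mono[unfolded up_def] l_def]
    show "avg hi \<tau> F d \<le> l * avg hi \<tau> F dm + (1 - l) * avg hi \<tau> F dp" by (rule av(1); assumption)
    show "fst (\<tau> i) \<noteq> snd (\<tau> i) \<or> e < fst (\<tau> i) \<Longrightarrow> avg hi \<tau> F d = l * avg hi \<tau> F dm + (1 - l) * avg hi \<tau> F dp"
      by (rule av(2); assumption)
  qed
  note ch = fsub_charge[OF sub(1) F, folded d_def, OF st(1)] fsub_charge[OF sub(2) F, folded dm_def, OF st(2)]
    fsub_charge[OF sub(3) F, folded dp_def, OF st(3)]
  have "(\<Sum>\<tau>\<in>A. r \<tau> * avg hi \<tau> F d) = (\<Sum>\<tau>\<in>A. l * (r \<tau> * avg hi \<tau> F dm) + (1 - l) * (r \<tau> * avg hi \<tau> F dp))"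
  proof (rule sum.cong[OF refl])
    fix \<tau> assume \<tau>: "\<tau> \<in> A"
    show "r \<tau> * avg hi \<tau> F d = l * (r \<tau> * avg hi \<tau> F dm) + (1 - l) * (r \<tau> * avg hi \<tau> F dp)"
    proof (cases "fst (\<tau> i) \<noteq> snd (\<tau> i) \<or> e < fst (\<tau> i)")
      case True
      show ?thesis unfolding av(2)[OF \<tau> True] by (simp add: algebra_simps)
    next
      case False
      then show ?thesis using A(4)[OF \<tau>, of i] e lox by simp
    qed
  qed
  then have Re: "Re (charge Z T W) = l * Re (charge Z T Wm) + (1 - l) * Re (charge Z T Wp)"
    unfolding ch by (simp add: sum.distrib sum_distrib_left)
  have "(\<Sum>\<tau>\<in>A. s \<tau> * avg hi \<tau> F d) \<le> (\<Sum>\<tau>\<in>A. l * (s \<tau> * avg hi \<tau> F dm) + (1 - l) * (s \<tau> * avg hi \<tau> F dp))"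
  proof (rule sum_mono)
    fix \<tau> assume \<tau>: "\<tau> \<in> A"
    show "s \<tau> * avg hi \<tau> F d \<le> l * (s \<tau> * avg hi \<tau> F dm) + (1 - l) * (s \<tau> * avg hi \<tau> F dp)"
    proof (cases "fst (\<tau> i) \<noteq> snd (\<tau> i) \<or> e < fst (\<tau> i)")
      case True
      show ?thesis unfolding av(2)[OF \<tau> True] by (simp add: algebra_simps)
    next
      case False
      then have "s \<tau> \<ge> 0" using A(4)[OF \<tau>, of i] e lox by simp
      then have "s \<tau> * avg hi \<tau> F d \<le> s \<tau> * (l * avg hi \<tau> F dm + (1 - l) * avg hi \<tau> F dp)"
        using av(1)[OF \<tau>] by (intro mult_left_mono)
      then show ?thesis by (simp add: algebra_simps)
    qed
  qed
  then have Im: "Im (charge Z T W) \<le> l * Im (charge Z T Wm) + (1 - l) * Im (charge Z T Wp)"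
    unfolding ch by (simp add: sum.distrib sum_distrib_left)
  show thesis
  proof (rule that[OF F'[unfolded F'_def] R(1)[unfolded F'_def] Wp[unfolded F'_def] WWp l])
    fix \<theta>
    show "height Z T \<theta> W \<le> l * height Z T \<theta> Wm + (1 - l) * height Z T \<theta> Wp"
      using Im unfolding height_def Re by (simp add: algebra_simps)
  qed
qed

text \<open>
  The better of the two modifications is kept, until no superfluous level is left. That maximisers only
  grow is needed to find the largest one among the submodules living on \<open>E\<close>.
\<close>

lemma reduce_levels:
  assumes "refines F" "fsub F T W"
  shows "\<exists>W'. fsub E T W' \<and> height Z T \<theta> W \<le> height Z T \<theta> W' \<and>
     ((\<forall>U\<in>subobjects T. height Z T \<theta> U \<le> height Z T \<theta> W) \<longrightarrow> (\<forall>q\<in>IS. W q \<subseteq> W' q))"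
  using assms
proof (induction "\<Sum>i\<in>UNIV. card (F i - E i)" arbitrary: F W rule: less_induct)
  case less
  note F = less.prems(1) and W = less.prems(2)
  show ?case
  proof (cases "\<forall>i. F i \<subseteq> E i")
    case True
    then have "F = E" using refinesD(3)[OF F] by (intro ext) blast
    then show ?thesis using W by (intro exI[of _ W]) simp
  next
    case False
    then obtain i x where x: "x \<in> F i" "x \<notin> E i" by blast
    let ?F = "F(i := F i - {x})"
    obtain Wm Wp l where R: "refines ?F" "fsub ?F T Wm" "fsub ?F T Wp"
      and WWp: "\<And>q. q \<in> IS \<Longrightarrow> W q \<subseteq> Wp q" and l: "0 \<le> l" "l < 1"
      and h: "\<And>\<theta>. height Z T \<theta> W \<le> l * height Z T \<theta> Wm + (1 - l) * height Z T \<theta> Wp"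
      using remove_level[OF F W x] by metis
    have fin: "finite (F i)" using refinesD(2)[OF F] by (simp add: levels_def)
    have "(\<Sum>j\<in>UNIV. card (?F j - E j)) < (\<Sum>j\<in>UNIV. card (F j - E j))"
    proof (rule sum_strict_mono_ex1)
      have "?F i - E i \<subset> F i - E i" using x by auto
      then have "card (?F i - E i) < card (F i - E i)" using fin by (intro psubset_card_mono) auto
      then show "\<exists>j\<in>UNIV. card (?F j - E j) < card (F j - E j)" by blast
      show "\<forall>j\<in>UNIV. card (?F j - E j) \<le> card (F j - E j)" using fin by (auto intro!: card_mono)
    qed simp
    note IH = less.hyps[OF this R(1)]
    have sub: "Wm \<in> subobjects T" "Wp \<in> subobjects T"
      using fsub_subobject[OF T refinesD(2)[OF R(1)]] R(2,3) by blast+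
    let ?h = "height Z T \<theta>"
    show ?thesis
    proof (cases "?h W \<le> ?h Wp")
      case True
      obtain W' where W': "fsub E T W'" "?h Wp \<le> ?h W'" "(\<forall>U\<in>subobjects T. ?h U \<le> ?h Wp) \<longrightarrow> (\<forall>q\<in>IS. Wp q \<subseteq> W' q)"
        using IH[OF R(3)] by blast
      have "\<forall>q\<in>IS. W q \<subseteq> W' q" if "\<forall>U\<in>subobjects T. ?h U \<le> ?h W"
      proof -
        have "\<forall>U\<in>subobjects T. ?h U \<le> ?h Wp" using that True order_trans by blast
        then show ?thesis using W'(3) WWp by blast
      qed
      then show ?thesis using W'(1,2) True by (intro exI[of _ W']) auto
    next
      case False
      then have Wm: "?h W < ?h Wm"
      proof -
        have "(1 - l) * ?h Wp < (1 - l) * ?h W" using False l by simp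
        then have "l * ?h W < l * ?h Wm" using h[of \<theta>] by (simp add: algebra_simps)
        then show ?thesis using l(1) by (simp add: mult_less_cancel_left)
      qed
      obtain W' where W': "fsub E T W'" "?h Wm \<le> ?h W'" using IH[OF R(2)] by blast
      have "\<not> (\<forall>U\<in>subobjects T. ?h U \<le> ?h W)" using Wm sub(1) by (meson not_le)
      then show ?thesis using W' Wm by (intro exI[of _ W']) auto
    qed
  qed
qed

lemma reduce_to_levels:
  assumes W: "W \<in> subobjects T" and \<theta>: "\<theta> > 0"
  shows "\<exists>W'. fsub E T W' \<and> height Z T \<theta> W \<le> height Z T \<theta> W' \<and>
     ((\<forall>U\<in>subobjects T. height Z T \<theta> U \<le> height Z T \<theta> W) \<longrightarrow> (\<forall>q\<in>IS. W q \<subseteq> W' q))"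
proof -
  let ?h = "height Z T \<theta>"
  obtain F U where F: "refines F" "fsub F T U" and h: "?h W \<le> ?h U" "?h W = ?h U \<Longrightarrow> \<forall>q\<in>IS. W q \<subseteq> U q"
    using clip_to_box[OF W \<theta>] by metis
  have sU: "U \<in> subobjects T" by (rule fsub_subobject[OF T refinesD(2)[OF F(1)] F(2)])
  obtain W' where W': "fsub E T W'" "?h U \<le> ?h W'" "(\<forall>S\<in>subobjects T. ?h S \<le> ?h U) \<longrightarrow> (\<forall>q\<in>IS. U q \<subseteq> W' q)"
    using reduce_levels[OF F] by blast
  have "\<forall>q\<in>IS. W q \<subseteq> W' q" if m: "\<forall>S\<in>subobjects T. ?h S \<le> ?h W"
  proof -
    have eq: "?h W = ?h U" using h(1) m sU by (simp add: order_antisym)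
    then have "\<forall>S\<in>subobjects T. ?h S \<le> ?h U" using m by simp
    then show ?thesis using W'(3) h(2)[OF eq] by blast
  qed
  then show ?thesis using W' h(1) by (intro exI[of _ W']) auto
qed

text \<open>
  On fixed levels the charge only depends on the dimensions at the grid points, which are bounded by
  those of \<open>T\<close>.
\<close>

lemma finite_charges: "finite {charge Z T W | W. fsub E T W}"
proof -
  let ?X = "{W. fsub E T W}" let ?f = "\<lambda>W. restrict (\<lambda>p. dim (W p)) (pts E)"
  note lE = box_levelsD(1)[OF E]
  have "?f ` ?X \<subseteq> PiE (pts E) (\<lambda>p. {..dim (fib T p)})"
  proof (rule image_subsetI)
    fix W assume W: "W \<in> ?X"
    have "dim (W p) \<le> dim (fib T p)" if "p \<in> pts E" for p
    proof -
      have pI: "p \<in> IS" by (rule pts_index_space[OF lE that])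
      have fW: "fsub E T W" using W by simp
      show ?thesis by (rule dim_mono_findim[OF Pers_findim[OF TP pI] submodD(2)[OF fsubD(1)[OF fW] pI]])
    qed
    then show "?f W \<in> PiE (pts E) (\<lambda>p. {..dim (fib T p)})" by auto
  qed
  moreover have "finite (PiE (pts E) (\<lambda>p. {..dim (fib T p)}))" using finite_pts[OF lE] by (intro finite_PiE) auto
  ultimately have fin: "finite (?f ` ?X)" using finite_subset by blast
  have det: "charge Z T W = charge Z T W'" if W: "W \<in> ?X" and W': "W' \<in> ?X" and eq: "?f W = ?f W'" for W W'
  proof -
    have "avg hi \<tau> E (\<lambda>q. real (dim (W q))) = avg hi \<tau> E (\<lambda>q. real (dim (W' q)))" for \<tau>
      unfolding avg_def
    proof (rule sum.cong[OF refl])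
      fix p assume p: "p \<in> pts E"
      have "dim (W p) = dim (W' p)" using fun_cong[OF eq, of p] p by simp
      then show "real (dim (W p)) * (\<Prod>i\<in>UNIV. mass (\<tau> i) (p $ i) (nxt (hi $ i + 1) (E i) (p $ i))) =
         real (dim (W' p)) * (\<Prod>i\<in>UNIV. mass (\<tau> i) (p $ i) (nxt (hi $ i + 1) (E i) (p $ i)))" by simp
    qed
    moreover have "W \<in> subobjects T" "W' \<in> subobjects T" using fsub_subobject[OF T lE] W W' by auto
    moreover have "fsub E T W" "fsub E T W'" using W W' by simp_all
    ultimately show ?thesis
      by (intro complex_eqI) (simp_all add: fsub_charge[OF _ refines_E fsub_step[OF _ refines_E]])
  qed
  have "charge Z T ` ?X \<subseteq> (\<lambda>k. charge Z T (inv_into ?X ?f k)) ` (?f ` ?X)"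
  proof (rule image_subsetI)
    fix W assume W: "W \<in> ?X"
    have "charge Z T W = charge Z T (inv_into ?X ?f (?f W))"
      by (rule det[OF W inv_into_into[OF imageI[OF W]] f_inv_into_f[OF imageI[OF W], symmetric]])
    then show "charge Z T W \<in> (\<lambda>k. charge Z T (inv_into ?X ?f k)) ` (?f ` ?X)"
      by (rule image_eqI[where x="?f W"]) (rule imageI[OF W])
  qed
  then have "finite (charge Z T ` ?X)" using fin finite_subset by blast
  moreover have "{charge Z T W | W. fsub E T W} = charge Z T ` ?X" by blast
  ultimately show ?thesis by simp
qed

end

context stable_module
begin

text \<open>
  If every subobject can be replaced by one on the levels \<open>E\<close>, which has only finitely many
  possible charges, the supremum of the height is attained; by modularity the maximisers are
  closed under sums, so one of largest real part contains all others.
\<close>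

lemma largest_max_on_levels:
  assumes E: "levels K E" and fin: "finite {charge Z T W | W. fsub E T W}"
    and red: "\<And>W. W \<in> subobjects T \<Longrightarrow> \<exists>W'. fsub E T W' \<and> height Z T \<theta> W \<le> height Z T \<theta> W' \<and>
     ((\<forall>U\<in>subobjects T. height Z T \<theta> U \<le> height Z T \<theta> W) \<longrightarrow> (\<forall>q\<in>IS. W q \<subseteq> W' q))"
  shows "\<exists>M. largest_max Z T \<theta> M \<and> fsub E T M"
proof -
  let ?h = "height Z T \<theta>" let ?X = "{W. fsub E T W}"
  have TP: "T \<in> Pers" by (rule fp_Pers[OF T])
  have sX: "W \<in> subobjects T" if "fsub E T W" for W by (rule fsub_subobject[OF T E that])
  have fc: "finite (charge Z T ` ?X)"
  proof -
    have "{charge Z T W | W. fsub E T W} = charge Z T ` ?X" by blast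
    then show ?thesis using fin by simp
  qed
  have "?h ` ?X = (\<lambda>z. Im z - \<theta> * Re z) ` charge Z T ` ?X" by (simp add: image_image height_def)
  then have fh: "finite (?h ` ?X)" using fc by simp
  have ne: "?X \<noteq> {}" using fsub_zero[OF TP] by blast
  define m where "m = Max (?h ` ?X)"
  have m: "m \<in> ?h ` ?X" "\<And>W. fsub E T W \<Longrightarrow> ?h W \<le> m"
    unfolding m_def using Max_in[OF fh] Max_ge[OF fh] ne by auto
  let ?Y = "{W. fsub E T W \<and> ?h W = m}"
  have "(\<lambda>W. Re (charge Z T W)) ` ?Y \<subseteq> Re ` charge Z T ` ?X" by auto
  then have fr: "finite ((\<lambda>W. Re (charge Z T W)) ` ?Y)" using fc finite_subset by blast
  have neY: "?Y \<noteq> {}" using m(1) by auto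
  have "Max ((\<lambda>W. Re (charge Z T W)) ` ?Y) \<in> (\<lambda>W. Re (charge Z T W)) ` ?Y" using Max_in[OF fr] neY by simp
  then obtain M where M: "fsub E T M" "?h M = m" "Re (charge Z T M) = Max ((\<lambda>W. Re (charge Z T W)) ` ?Y)" by auto
  have Mr: "Re (charge Z T W) \<le> Re (charge Z T M)" if "fsub E T W" "?h W = m" for W
    unfolding M(3) by (rule Max_ge[OF fr]) (use that in auto)
  have all: "?h W \<le> m" if W: "W \<in> subobjects T" for W
  proof -
    obtain W' where "fsub E T W'" "?h W \<le> ?h W'" using red[OF W] by blast
    then show ?thesis using m(2)[of W'] by linarith
  qed
  have "largest_max Z T \<theta> M" unfolding largest_max_def
  proof (intro conjI ballI impI sX[OF M(1)])
    fix W assume W: "W \<in> subobjects T"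
    show "?h W \<le> ?h M" using all[OF W] M(2) by simp
    fix q :: "real ^ 'n" assume eq: "?h W = ?h M" and q: "q \<in> IS"
    obtain W' where W': "fsub E T W'" "?h W \<le> ?h W'" "\<forall>q\<in>IS. W q \<subseteq> W' q"
      using red[OF W] all eq M(2) by auto
    have hW': "?h W' = m" using W'(2) eq M(2) m(2)[OF W'(1)] by simp
    have P: "fsub E T (plus_sub M W')" by (rule fsub_plus[OF TP M(1) W'(1)])
    have "?h (\<lambda>q. M q \<inter> W' q) \<le> m" by (rule all[OF subobject_inter[OF T sX[OF M(1)] sX[OF W'(1)]]])
    then have hP: "?h (plus_sub M W') = m"
      using height_modular[OF sX[OF M(1)] sX[OF W'(1)], of \<theta>] M(2) hW' m(2)[OF P] by linarith
    note up = plus_sub_upper[OF fsubD(1)[OF M(1)] fsubD(1)[OF W'(1)]]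
    have "Re (charge Z T M) = Re (charge Z T (plus_sub M W'))"
      using charge_mono(1)[OF sX[OF M(1)] sX[OF P] up(1)] Mr[OF P hP] by simp
    then have "M q = plus_sub M W' q" using charge_mono(2)[OF sX[OF M(1)] sX[OF P] up(1) _ q] by simp
    then show "W q \<subseteq> M q" using up(2)[OF q] W'(3) q by blast
  qed
  then show ?thesis using M(1) by blast
qed

text \<open>
  A quotient has nonnegative imaginary and real part, so that for \<open>\<theta> \<le> 0\<close> enlarging a subobject does
  not lower it.
\<close>

lemma whole_largest_max:
  assumes pos: "\<And>W. W \<in> Pers_fp \<Longrightarrow> Im (Z (K_class W)) \<ge> 0" and \<theta>: "\<theta> \<le> 0"
  shows "largest_max Z T \<theta> (fib T)"
  unfolding largest_max_def
proof (intro conjI ballI impI whole_subobject[OF T])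
  fix W assume W: "W \<in> subobjects T"
  note sub = submodD(2)[OF subobject_submod[OF T W]]
  obtain C \<pi> where e: "short_exact (T\<lparr>fib := W\<rparr>) (T\<lparr>fib := fib T\<rparr>) C (\<lambda>q v. v) \<pi>"
    using quotient_exists[OF T W whole_subobject[OF T] sub] .
  have "Im (charge Z T (fib T)) \<ge> Im (charge Z T W)"
    using charge_quotient[OF e] pos[OF short_exact_is_zero(5)[OF e]] by simp
  moreover have "\<theta> * Re (charge Z T (fib T)) \<le> \<theta> * Re (charge Z T W)"
    using charge_mono(1)[OF W whole_subobject[OF T] sub] \<theta> by (rule mult_left_mono_neg)
  ultimately show "height Z T \<theta> W \<le> height Z T \<theta> (fib T)" unfolding height_def by linarith
  show "W q \<subseteq> fib T q" if "q \<in> IS" for q by (rule sub[OF that])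
qed

end

section \<open>The translates of a module\<close>

context stable_module
begin

lemma truncation_on_levels:
  assumes E: "levels K E" and fin: "finite {charge Z T W | W. fsub E T W}"
    and pos: "\<And>\<theta>. \<theta> > 0 \<Longrightarrow> \<exists>M. largest_max Z T \<theta> M \<and> fsub E T M"
    and nonpos: "\<And>\<theta>. \<theta> \<le> 0 \<Longrightarrow> largest_max Z T \<theta> (fib T)"
  shows "largest_max Z T \<theta> (HN_truncation Z T \<theta>)"
proof (rule HN_truncation_largest_max[OF _ _ nonpos[OF order_refl]])
  show ex: "\<exists>M. largest_max Z T \<theta> M" for \<theta> using pos[of \<theta>] nonpos[of \<theta>] by (cases "\<theta> > 0") auto
  have "{charge Z T M | \<theta> M. largest_max Z T \<theta> M} \<subseteq> insert (charge Z T (fib T)) {charge Z T W | W. fsub E T W}"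
  proof (rule subsetI)
    fix z assume "z \<in> {charge Z T M | \<theta> M. largest_max Z T \<theta> M}"
    then obtain \<theta> M where z: "z = charge Z T M" and M: "largest_max Z T \<theta> M" by auto
    have sM: "M \<in> subobjects T" using M by (simp add: largest_max_def)
    show "z \<in> insert (charge Z T (fib T)) {charge Z T W | W. fsub E T W}"
    proof (cases "\<theta> > 0")
      case True
      then obtain N where N: "largest_max Z T \<theta> N" "fsub E T N" using pos by blast
      have "charge Z T M = charge Z T N" by (rule charge_cong[OF sM largest_max_unique[OF M N(1)]])
      then show ?thesis using N(2) z by auto
    next
      case False
      then have N: "largest_max Z T \<theta> (fib T)" by (intro nonpos) simp
      have "charge Z T M = charge Z T (fib T)" by (rule charge_cong[OF sM largest_max_unique[OF M N]])
      then show ?thesis using z by simp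
    qed
  qed
  then show "finite {charge Z T M | \<theta> M. largest_max Z T \<theta> M}" using fin finite_subset by blast
qed

end

text \<open>
  The setting of all translates \<open>T x\<close> of the module \<open>V\<close>, which lives on the levels \<open>H\<close>. The corner
  \<open>hi\<close> is chosen so far out that either all levels of \<open>T x\<close> are below \<open>hi\<close>, or \<open>T x\<close> vanishes
  on the region \<open>q \<le> c\<close> that the imaginary part depends on.
\<close>

locale translates = persistence scale K
  for scale :: "'f::field \<Rightarrow> 'v::ab_group_add \<Rightarrow> 'v" and K :: "real set" +
  fixes Z :: "((real ^ 'n, 'v) pmod \<Rightarrow>\<^sub>0 int) set \<Rightarrow> complex" and V :: "(real ^ 'n, 'v) pmod"
    and H :: "'n \<Rightarrow> real set" and lo c hi :: "real ^ 'n" and B :: "'n \<Rightarrow> real set"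
    and A :: "('n \<Rightarrow> real \<times> real) set" and r s :: "('n \<Rightarrow> real \<times> real) \<Rightarrow> real"
  assumes Z: "stability_condition Z" and V: "V \<in> Pers_fp" and H: "levels K H" and ad: "adapted H V"
    and loI: "lo \<in> IS" and cI: "c \<in> IS" and hiI: "hi \<in> IS" and lo0: "lo \<le> 0" and c0: "0 \<le> c" and chi: "c \<le> hi"
    and loc: "\<And>V W. V \<in> Pers_fp \<Longrightarrow> W \<in> Pers_fp \<Longrightarrow>
      (\<And>q. q \<in> IS \<Longrightarrow> lo \<le> q \<Longrightarrow> q \<le> c \<Longrightarrow> dim_fun V q = dim_fun W q) \<Longrightarrow> Im (Z (K_class V)) = Im (Z (K_class W))"
    and form: "formula Z lo hi B A r s"
    and gap: "\<And>i h h'. h \<in> H i \<Longrightarrow> h' \<in> H i \<Longrightarrow> c $ i + (h - h') \<le> hi $ i"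
    and nonneg: "\<And>W. W \<in> Pers_fp \<Longrightarrow> Im (Z (K_class W)) \<ge> 0"
begin

abbreviation T :: "real ^ 'n \<Rightarrow> (real ^ 'n, 'v) pmod" where "T x \<equiv> pullback (\<lambda>z. x + z) V"

abbreviation reaches :: "real ^ 'n \<Rightarrow> bool" where "reaches x \<equiv> above H (x + c)"

text \<open>
  The levels of \<open>T x\<close> outside the box are left out. Those below \<open>lo\<close> are replaced by \<open>lo\<close>, and if \<open>T x\<close>
  reaches down to \<open>c\<close>, there are none above \<open>hi\<close>.
\<close>

definition levT :: "real ^ 'n \<Rightarrow> 'n \<Rightarrow> real set" where
  "levT x i = B i \<union> {h - x $ i | h. h \<in> H i \<and> lo $ i \<le> h - x $ i \<and> h - x $ i \<le> hi $ i}"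

lemma VP: "V \<in> Pers"
  by (rule fp_Pers[OF V])

lemma fib_T: "fib (T x) q = fib V (x + q)" and tr_T: "tr (T x) p q = tr V (x + p) (x + q)"
  by (simp_all add: pullback_def)

lemma T_fp: assumes x: "x \<in> IS" shows "T x \<in> Pers_fp"
proof (rule adapted_imp_fp[where E="\<lambda>i. (\<lambda>h. h - x $ i) ` H i"])
  have le: "x + p \<le> x + q" if "p \<le> q" for p q :: "real ^ 'n" using that by (rule add_left_mono)
  show "T x \<in> Pers"
  proof (rule PersI)
    show "findim (fib (T x) q)" if q: "q \<in> IS" for q
      unfolding fib_T by (rule Pers_findim[OF VP IS_add[OF x q]])
    show "linear_between (fib (T x) p) (fib (T x) q) (tr (T x) p q)" if p: "p \<in> IS" and q: "q \<in> IS" and pq: "p \<le> q" for p q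
      unfolding fib_T tr_T by (rule Pers_linear[OF VP IS_add[OF x p] IS_add[OF x q] le[OF pq]])
    show "tr (T x) p p v = v" if p: "p \<in> IS" and v: "v \<in> fib (T x) p" for p v
      using v unfolding fib_T tr_T by (rule Pers_id[OF VP IS_add[OF x p]])
    show "tr (T x) q r (tr (T x) p q v) = tr (T x) p r v"
      if p: "p \<in> IS" and q: "q \<in> IS" and r: "r \<in> IS" and pq: "p \<le> q" and qr: "q \<le> r" and v: "v \<in> fib (T x) p" for p q r v
      using v unfolding fib_T tr_T by (rule Pers_comp[OF VP IS_add[OF x p] IS_add[OF x q] IS_add[OF x r] le[OF pq] le[OF qr]])
  qed
  show "levels K (\<lambda>i. (\<lambda>h. h - x $ i) ` H i)"
    unfolding levels_def
  proof (intro allI conjI)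
    fix i
    show "finite ((\<lambda>h. h - x $ i) ` H i)" using levels_finite[OF H] by simp
    show "(\<lambda>h. h - x $ i) ` H i \<subseteq> K"
    proof (rule image_subsetI)
      fix h assume "h \<in> H i"
      then have "h \<in> K" by (rule levels_subset[OF H])
      moreover have "x $ i \<in> K" using x by (simp add: index_space_def)
      ultimately show "h - x $ i \<in> K" by (rule K_diff)
    qed
  qed
  show "adapted (\<lambda>i. (\<lambda>h. h - x $ i) ` H i) (T x)"
    unfolding adapted_def fib_T tr_T
  proof (intro conjI ballI impI)
    fix q :: "real ^ 'n" assume q: "q \<in> IS" and na: "\<not> above (\<lambda>i. (\<lambda>h. h - x $ i) ` H i) q"
    have "\<not> above H (x + q)" using na unfolding above_def by (auto simp: algebra_simps)
    then show "fib V (x + q) = {0}" by (rule adapted_zero[OF ad IS_add[OF x q]])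
  next
    fix p q :: "real ^ 'n" assume p: "p \<in> IS" and q: "q \<in> IS" and a: "p \<le> q \<and> same (\<lambda>i. (\<lambda>h. h - x $ i) ` H i) p q"
    have "same H (x + p) (x + q)" using a unfolding same_def by (auto simp: algebra_simps)
    then show "bij_betw (tr V (x + p) (x + q)) (fib V (x + p)) (fib V (x + q))"
      using a by (intro adapted_bij[OF ad IS_add[OF x p] IS_add[OF x q]] le) simp_all
  qed
qed

lemma stable_T: "x \<in> IS \<Longrightarrow> stable_module scale K Z (T x)"
  by unfold_locales (rule Z, rule T_fp)

lemma form_levels: "base_levels lo hi B" "box_levels lo hi B" "0 \<in> B i" "finite A"
  using form unfolding formula_def base_levels_def by auto

lemma levels_B: "levels K B"
  by (rule box_levelsD(1)[OF form_levels(2)])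

lemma reaches_le:
  assumes "reaches x" "h \<in> H i" shows "h - x $ i \<le> hi $ i"
proof -
  obtain h' where h': "h' \<in> H i" "h' \<le> (x + c) $ i" using assms(1) unfolding above_def by blast
  then show ?thesis using gap[OF assms(2) h'(1)] by simp
qed

lemma levT_box: assumes x: "x \<in> IS" shows "box_levels lo hi (levT x)"
proof -
  note b = box_levelsD[OF form_levels(2)]
  have xi: "x $ i \<in> K" for i using x by (simp add: index_space_def)
  have "levT x i \<subseteq> B i \<union> (\<lambda>h. h - x $ i) ` H i" for i unfolding levT_def by auto
  then have fin: "finite (levT x i)" for i by (rule finite_subset) (simp add: b(2) levels_finite[OF H])
  have sub: "levT x i \<subseteq> K" for i
  proof (rule subsetI)
    fix e assume "e \<in> levT x i"
    then consider "e \<in> B i" | h where "h \<in> H i" "e = h - x $ i" unfolding levT_def by auto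
    then show "e \<in> K" by cases (simp_all add: b(7) K_diff[OF levels_subset[OF H] xi])
  qed
  have box: "levT x i \<subseteq> {lo $ i..hi $ i}" for i
  proof (rule subsetI)
    fix e assume "e \<in> levT x i"
    then consider "e \<in> B i" | "lo $ i \<le> e" "e \<le> hi $ i" unfolding levT_def by auto
    then show "e \<in> {lo $ i..hi $ i}" by cases (simp_all add: b(5,6))
  qed
  have "lo $ i \<in> levT x i" "hi $ i \<in> levT x i" for i unfolding levT_def by (simp_all add: b(3,4))
  then show ?thesis unfolding box_levels_def levels_def using fin sub box by simp
qed

text \<open>
  A level of \<open>T x\<close> below \<open>lo\<close> cannot separate points above \<open>lo\<close>, and there are none above \<open>hi\<close>.
\<close>

lemma levT_same:
  assumes re: "reaches x" and lo: "lo \<le> p" "p \<le> q" and sm: "same (levT x) p q" shows "same H (x + p) (x + q)"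
  unfolding same_def
proof (intro allI ballI)
  fix i h assume h: "h \<in> H i"
  have pq: "lo $ i \<le> p $ i" "p $ i \<le> q $ i" using lo by (simp_all add: less_eq_vec_def)
  show "h \<le> (x + q) $ i \<longleftrightarrow> h \<le> (x + p) $ i"
  proof (cases "lo $ i \<le> h - x $ i")
    case True
    then have "h - x $ i \<in> levT x i" using reaches_le[OF re h] h unfolding levT_def by auto
    then have "h - x $ i \<le> q $ i \<longleftrightarrow> h - x $ i \<le> p $ i" using sm unfolding same_def by blast
    then show ?thesis by (simp add: algebra_simps)
  next
    case False
    then show ?thesis using pq by simp
  qed
qed

lemma reduced_T:
  assumes x: "x \<in> IS" and re: "reaches x" shows "reduced_module scale K Z (T x) lo c hi B (levT x) A r s"
proof -
  interpret stable_module scale K Z "T x" by (rule stable_T[OF x])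
  show ?thesis
  proof unfold_locales
    show "formula Z lo hi B A r s" by (rule form)
    show "c \<le> hi" by (rule chi)
    show "box_levels lo hi (levT x)" by (rule levT_box[OF x])
    show "B i \<subseteq> levT x i" for i unfolding levT_def by blast
    show "Im (Z (K_class V)) = Im (Z (K_class W))" if "V \<in> Pers_fp" "W \<in> Pers_fp"
      "\<And>q. q \<in> IS \<Longrightarrow> lo \<le> q \<Longrightarrow> q \<le> c \<Longrightarrow> dim_fun V q = dim_fun W q" for V W by (rule loc[OF that])
    show "bij_betw (tr (T x) p q) (fib (T x) p) (fib (T x) q)"
      if p: "p \<in> IS" and q: "q \<in> IS" and l: "lo \<le> p" and pq: "p \<le> q" and sm: "same (levT x) p q" for p q
      unfolding fib_T tr_T
      by (rule adapted_bij[OF ad IS_add[OF x p] IS_add[OF x q] add_left_mono[OF pq] levT_same[OF re l pq sm]])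
  qed
qed

lemma max_nonpos: "x \<in> IS \<Longrightarrow> \<theta> \<le> 0 \<Longrightarrow> largest_max Z (T x) \<theta> (fib (T x))"
  by (rule stable_module.whole_largest_max[OF stable_T nonneg])

lemma max_reaches:
  assumes x: "x \<in> IS" and re: "reaches x"
  shows "\<theta> > 0 \<Longrightarrow> \<exists>M. largest_max Z (T x) \<theta> M \<and> fsub (levT x) (T x) M"
    and "largest_max Z (T x) \<theta> (HN_truncation Z (T x) \<theta>)"
proof -
  interpret reduced_module scale K Z "T x" lo c hi B "levT x" A r s by (rule reduced_T[OF x re])
  note lE = box_levelsD(1)[OF levT_box[OF x]]
  show pos: "\<exists>M. largest_max Z (T x) \<theta> M \<and> fsub (levT x) (T x) M" if \<theta>: "\<theta> > 0" for \<theta>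
    by (rule largest_max_on_levels[OF lE finite_charges reduce_to_levels]) (use \<theta> in auto)
  show "largest_max Z (T x) \<theta> (HN_truncation Z (T x) \<theta>)"
    by (rule truncation_on_levels[OF lE finite_charges pos max_nonpos[OF x]])
qed

text \<open>
  If \<open>T x\<close> vanishes below \<open>c\<close>, every subobject has imaginary part zero, so that there are no
  positive slopes and the zero submodule, which lives on the empty set of levels, is the maximiser.
\<close>

lemma max_not_reaches:
  assumes x: "x \<in> IS" and re: "\<not> reaches x"
  shows "\<theta> > 0 \<Longrightarrow> \<exists>M. largest_max Z (T x) \<theta> M \<and> fsub (\<lambda>_. {}) (T x) M"
    and "largest_max Z (T x) \<theta> (HN_truncation Z (T x) \<theta>)"
proof -
  interpret stable_module scale K Z "T x" by (rule stable_T[OF x])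
  have lE: "levels K (\<lambda>_. {})" by (simp add: levels_def)
  have TP: "T x \<in> Pers" by (rule fp_Pers[OF T_fp[OF x]])
  have zero: "W q = {0}" if W: "fsub (\<lambda>_. {}) (T x) W" and q: "q \<in> IS" for W q
    by (rule fsubD(2)[OF W q]) (simp add: above_def)
  have "charge Z (T x) W = charge Z (T x) (\<lambda>_. {0})" if W: "fsub (\<lambda>_. {}) (T x) W" for W
    by (rule charge_cong[OF fsub_subobject[OF T_fp[OF x] lE W]]) (rule zero[OF W])
  then have "{charge Z (T x) W | W. fsub (\<lambda>_. {}) (T x) W} \<subseteq> {charge Z (T x) (\<lambda>_. {0})}" by auto
  then have fin: "finite {charge Z (T x) W | W. fsub (\<lambda>_. {}) (T x) W}" by (rule finite_subset) simp
  have im: "Im (charge Z (T x) W) = 0" if W: "W \<in> subobjects (T x)" for W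
  proof -
    have "Im (charge Z (T x) W) = Im (charge Z (T x) (\<lambda>_. {0}))"
      unfolding charge_def
    proof (rule loc)
      show "T x\<lparr>fib := W\<rparr> \<in> Pers_fp" by (rule subobject_fp[OF W])
      show "T x\<lparr>fib := \<lambda>_. {0}\<rparr> \<in> Pers_fp" by (rule subobject_fp[OF zero_subobject[OF T_fp[OF x]]])
      fix q :: "real ^ 'n" assume q: "q \<in> IS" "q \<le> c"
      have sm: "submod (T x) W" by (rule subobject_submod[OF T_fp[OF x] W])
      have "\<not> above H (x + q)" using re above_mono[OF _ add_left_mono[OF q(2)]] by blast
      then have "fib (T x) q = {0}" unfolding fib_T by (rule adapted_zero[OF ad IS_add[OF x q(1)]])
      then have "W q \<subseteq> {0}" using submodD(2)[OF sm q(1)] by simp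
      moreover have "0 \<in> W q" by (rule subspace_0[OF submodD(1)[OF sm q(1)]])
      ultimately have "W q = {0}" by blast
      then show "dim_fun (T x\<lparr>fib := W\<rparr>) q = dim_fun (T x\<lparr>fib := \<lambda>_. {0}\<rparr>) q" by (simp add: dim_fun_def)
    qed
    then show ?thesis by (simp add: charge_zero)
  qed
  have re0: "Re (charge Z (T x) W) \<ge> 0" if W: "W \<in> subobjects (T x)" for W
  proof -
    have sm: "submod (T x) W" by (rule subobject_submod[OF T_fp[OF x] W])
    have "Re (charge Z (T x) (\<lambda>_. {0})) \<le> Re (charge Z (T x) W)"
      by (rule charge_mono(1)[OF zero_subobject[OF T_fp[OF x]] W]) (simp add: subspace_0[OF submodD(1)[OF sm]])
    then show ?thesis by (simp add: charge_zero)
  qed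
  have ex: "\<exists>M. largest_max Z (T x) \<theta> M \<and> fsub (\<lambda>_. {}) (T x) M" if \<theta>: "\<theta> > 0" for \<theta>
  proof (intro exI[of _ "\<lambda>_. {0}"] conjI fsub_zero[OF TP])
    show "largest_max Z (T x) \<theta> (\<lambda>_. {0})"
      unfolding largest_max_def
    proof (intro conjI ballI impI zero_subobject[OF T_fp[OF x]])
      fix W assume W: "W \<in> subobjects (T x)"
      show "height Z (T x) \<theta> W \<le> height Z (T x) \<theta> (\<lambda>_. {0})"
        unfolding height_def im[OF W] charge_zero using re0[OF W] \<theta> by simp
      fix q :: "real ^ 'n" assume eq: "height Z (T x) \<theta> W = height Z (T x) \<theta> (\<lambda>_. {0})" and q: "q \<in> IS"
      have "Re (charge Z (T x) (\<lambda>_. {0})) = Re (charge Z (T x) W)"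
        using eq \<theta> unfolding height_def im[OF W] charge_zero by simp
      moreover have "{0} \<subseteq> W q" if "q \<in> IS" for q
        using subspace_0[OF submodD(1)[OF subobject_submod[OF T_fp[OF x] W] that]] by simp
      ultimately show "W q \<subseteq> {0}"
        using charge_mono(2)[OF zero_subobject[OF T_fp[OF x]] W _ _ q] by simp
    qed
  qed
  then show "\<theta> > 0 \<Longrightarrow> \<exists>M. largest_max Z (T x) \<theta> M \<and> fsub (\<lambda>_. {}) (T x) M" .
  show "largest_max Z (T x) \<theta> (HN_truncation Z (T x) \<theta>)"
    by (rule truncation_on_levels[OF lE fin ex max_nonpos[OF x]])
qed

lemma HN_rank_max:
  assumes x: "x \<in> IS" and M: "largest_max Z (T x) \<theta> M"
  shows "HN_rank Z V x y \<theta> = dim (tr V x y ` M 0)"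
proof -
  interpret stable_module scale K Z "T x" by (rule stable_T[OF x])
  have "largest_max Z (T x) \<theta> (HN_truncation Z (T x) \<theta>)"
    using max_reaches(2)[OF x] max_not_reaches(2)[OF x] by (cases "reaches x") simp_all
  then have "HN_truncation Z (T x) \<theta> 0 = M 0" by (rule largest_max_unique[OF _ M IS_0])
  then show ?thesis unfolding HN_rank_def Let_def by (simp add: tr_T)
qed

text \<open>
  Maps to points of the same cell are isomorphic, as both factor through the corner of the cell, from
  which the fibres are transported isomorphically. The points \<open>y\<close> and \<open>y'\<close> themselves need not be
  comparable.
\<close>

lemma dim_tr_same:
  assumes x: "x \<in> IS" and y: "y \<in> IS" "y' \<in> IS" and xy: "x \<le> y" "x \<le> y'" and sm: "same H y y'" and a: "above H x"
    and D: "subspace D" "D \<subseteq> fib V x"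
  shows "dim (tr V x y ` D) = dim (tr V x y' ` D)"
proof -
  have *: "dim (tr V x y ` D) = dim (tr V (flr H x) (flr H y) ` {v \<in> fib V (flr H x). tr V (flr H x) x v \<in> D})"
    if y: "y \<in> IS" and xy: "x \<le> y" for y
  proof -
    let ?h = "flr H x" let ?g = "flr H y"
    let ?D = "{v \<in> fib V ?h. tr V ?h x v \<in> D}"
    have ay: "above H y" by (rule above_mono[OF a xy])
    note h = flr_index_space[OF H a] flr_le[OF H a] and g = flr_index_space[OF H ay] flr_le[OF H ay]
    have hg: "?h \<le> ?g" by (rule flr_mono[OF H a xy])
    have bx: "bij_betw (tr V ?h x) (fib V ?h) (fib V x)" by (rule adapted_bij[OF ad h(1) x h(2) same_flr[OF H a]])
    have "by": "bij_betw (tr V ?g y) (fib V ?g) (fib V y)" by (rule adapted_bij[OF ad g(1) y g(2) same_flr[OF H ay]])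
    have lin: "linear_between (fib V ?h) (fib V x) (tr V ?h x)" by (rule Pers_linear[OF VP h(1) x h(2)])
    have sD: "subspace ?D" by (rule subspace_linear_preimage[OF lin Pers_subspace[OF VP h(1)] D(1)])
    have ling: "linear_between (fib V ?h) (fib V ?g) (tr V ?h ?g)" by (rule Pers_linear[OF VP h(1) g(1) hg])
    have fD: "findim (tr V ?h ?g ` ?D)" by (rule findim_image_of_subspace[OF ling Pers_findim[OF VP h(1)] sD]) simp
    have sub: "tr V ?h ?g ` ?D \<subseteq> fib V ?g" using linear_betweenD(1)[OF ling] by auto
    have Dim: "D = tr V ?h x ` ?D"
    proof (intro equalityI subsetI)
      fix v assume v: "v \<in> D"
      then have "v \<in> tr V ?h x ` fib V ?h" using D(2) bij_betw_imp_surj_on[OF bx] by auto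
      then obtain u where "u \<in> fib V ?h" "v = tr V ?h x u" by (elim imageE)
      then show "v \<in> tr V ?h x ` ?D" using v by simp
    qed auto
    have "tr V x y ` D = (\<lambda>v. tr V x y (tr V ?h x v)) ` ?D" by (subst Dim) (simp add: image_image)
    also have "\<dots> = (\<lambda>v. tr V ?g y (tr V ?h ?g v)) ` ?D"
      using Pers_comp[OF VP h(1) x y h(2) xy] Pers_comp[OF VP h(1) g(1) y hg g(2)] by (intro image_cong) simp_all
    also have "\<dots> = tr V ?g y ` tr V ?h ?g ` ?D" by (simp add: image_image)
    finally have "tr V x y ` D = tr V ?g y ` tr V ?h ?g ` ?D" .
    moreover have "linear_between (tr V ?h ?g ` ?D) (fib V y) (tr V ?g y)"
      using linear_between_mono[OF Pers_linear[OF VP g(1) y g(2)] sub] sub bij_betw_imp_surj_on[OF "by"] by blast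
    ultimately show ?thesis
      using dim_linear_image[OF fD _ inj_on_subset[OF bij_betw_imp_inj_on[OF "by"] sub]] by simp
  qed
  show ?thesis unfolding *[OF y(1) xy(1)] *[OF y(2) xy(2)] flr_cong[OF sm] ..
qed

end

section \<open>Families of submodules over varying translates\<close>

context translates
begin

text \<open>
  The submodules of \<open>T x\<close> on the levels of \<open>B\<close> and of the translate of \<open>H\<close> are indexed by data
  attached to the pairs \<open>(k, h)\<close> for which the cell of \<open>k\<close> meets the translated cell of \<open>h\<close>; the
  cells then meet in the cell with this corner. Which data occur depends only on the set of these
  pairs.
\<close>

definition corner :: "real ^ 'n \<Rightarrow> real ^ 'n \<Rightarrow> real ^ 'n \<Rightarrow> real ^ 'n" where
  "corner x k h = (\<chi> i. max (k $ i) (h $ i - x $ i))"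

definition act :: "real ^ 'n \<Rightarrow> ((real ^ 'n) \<times> (real ^ 'n)) set" where
  "act x = {(k, h). k \<in> pts B \<and> h \<in> pts H \<and> same B k (corner x k h) \<and> same H h (x + corner x k h)}"

text \<open>
  The submodule of \<open>T x\<close> with given data over the meeting cells; the data are subspaces of the fibres
  of \<open>V\<close> at the corners \<open>h\<close>, from where they are transported. Its inverse \<open>fam\<close> reads off the data of a
  submodule at the corners of the meeting cells.
\<close>

definition realise :: "real ^ 'n \<Rightarrow> (real ^ 'n \<Rightarrow> real ^ 'n \<Rightarrow> 'v set) \<Rightarrow> real ^ 'n \<Rightarrow> 'v set" where
  "realise x D q = (if lo \<le> q \<and> above H (x + q) then tr V (flr H (x + q)) (x + q) ` D (flr B q) (flr H (x + q)) else {0})"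

definition fam :: "real ^ 'n \<Rightarrow> (real ^ 'n \<Rightarrow> 'v set) \<Rightarrow> real ^ 'n \<Rightarrow> real ^ 'n \<Rightarrow> 'v set" where
  "fam x W k h = {v \<in> fib V h. tr V h (x + corner x k h) v \<in> W (corner x k h)}"

text \<open>
  The data of submodules. The condition depends on \<open>x\<close> only through the set \<open>P\<close> of meeting pairs, so
  that data of one translate can be realised in another.
\<close>

definition adm :: "((real ^ 'n) \<times> (real ^ 'n)) set \<Rightarrow> (real ^ 'n \<Rightarrow> real ^ 'n \<Rightarrow> 'v set) \<Rightarrow> bool" where
  "adm P D \<longleftrightarrow> (\<forall>k h. (k, h) \<in> P \<longrightarrow> subspace (D k h) \<and> D k h \<subseteq> fib V h \<and>
     (\<forall>k' h'. (k', h') \<in> P \<and> k \<le> k' \<and> h \<le> h' \<longrightarrow> tr V h h' ` D k h \<subseteq> D k' h'))"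

text \<open>
  What one dimension over the cell of \<open>(k, h)\<close> contributes to the height.
\<close>

definition cw :: "real ^ 'n \<Rightarrow> real \<Rightarrow> real ^ 'n \<Rightarrow> real ^ 'n \<Rightarrow> real" where
  "cw x \<theta> k h = (\<Sum>\<tau>\<in>A. (s \<tau> - \<theta> * r \<tau>) * (\<Prod>i\<in>UNIV. mass (\<tau> i) (corner x k h $ i)
     (nxt (hi $ i + 1) (levT x i) (corner x k h $ i))))"

lemma corner_mono: "k \<le> k' \<Longrightarrow> h \<le> h' \<Longrightarrow> corner x k h \<le> corner x k' h'"
  unfolding corner_def less_eq_vec_def by (simp add: max.coboundedI1 max.coboundedI2)

lemma corner_least: "k \<le> q \<Longrightarrow> h \<le> x + q \<Longrightarrow> corner x k h \<le> q"
  unfolding corner_def less_eq_vec_def by (simp add: algebra_simps)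

lemma corner_upper: "k \<le> corner x k h" "h \<le> x + corner x k h"
  unfolding corner_def less_eq_vec_def by (simp_all add: max_def)

lemma same_between: "same E p q \<Longrightarrow> p \<le> m \<Longrightarrow> m \<le> q \<Longrightarrow> same E p m"
  unfolding same_def less_eq_vec_def by (meson order_trans)

lemma actD:
  assumes x: "x \<in> IS" and a: "(k, h) \<in> act x"
  shows "corner x k h \<in> IS" "lo \<le> corner x k h" "above H (x + corner x k h)"
    "flr B (corner x k h) = k" "flr H (x + corner x k h) = h" "k \<in> pts B" "h \<in> pts H" "h \<in> IS"
proof -
  have kh: "k \<in> pts B" "h \<in> pts H" "same B k (corner x k h)" "same H h (x + corner x k h)"
    using a unfolding act_def by auto
  show hI: "h \<in> IS" by (rule pts_index_space[OF H kh(2)])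
  have kI: "k \<in> IS" by (rule pts_index_space[OF levels_B kh(1)])
  show "corner x k h \<in> IS" unfolding corner_def index_space_def
    using kI K_diff hI x by (auto simp: index_space_def max_def)
  have "lo \<le> k" using kh(1) box_levelsD(5)[OF form_levels(2)] by (simp add: pts_def less_eq_vec_def)
  then show "lo \<le> corner x k h" using corner_upper(1) by (rule order_trans)
  show "above H (x + corner x k h)" by (rule above_mono[OF above_pts[OF kh(2)] corner_upper(2)])
  show "flr B (corner x k h) = k" by (rule flr_eqI[OF levels_B kh(1,3)])
  show "flr H (x + corner x k h) = h" by (rule flr_eqI[OF H kh(2,4)])
  show "k \<in> pts B" "h \<in> pts H" by (rule kh)+
qed

lemma above_B: "above B q \<longleftrightarrow> lo \<le> q"
  by (rule box_above[OF form_levels(2)])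

lemma actI:
  assumes q: "q \<in> IS" "lo \<le> q" "above H (x + q)"
  shows "(flr B q, flr H (x + q)) \<in> act x" "corner x (flr B q) (flr H (x + q)) \<le> q"
proof -
  have aB: "above B q" using q(2) by (simp add: above_B)
  note b = flr_pts[OF levels_B aB] flr_le[OF levels_B aB] same_flr[OF levels_B aB]
  note h = flr_pts[OF H q(3)] flr_le[OF H q(3)] same_flr[OF H q(3)]
  show le: "corner x (flr B q) (flr H (x + q)) \<le> q" by (rule corner_least[OF b(2) h(2)])
  have "same B (flr B q) (corner x (flr B q) (flr H (x + q)))" by (rule same_between[OF b(3) corner_upper(1) le])
  moreover have "same H (flr H (x + q)) (x + corner x (flr B q) (flr H (x + q)))"
    by (rule same_between[OF h(3) corner_upper(2) add_left_mono[OF le]])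
  ultimately show "(flr B q, flr H (x + q)) \<in> act x" using b(1) h(1) unfolding act_def by simp
qed

lemma corner_pts:
  assumes re: "reaches x" and a: "(k, h) \<in> act x" shows "corner x k h \<in> pts (levT x)"
  unfolding pts_def
proof (intro CollectI allI)
  fix i
  have kh: "k $ i \<in> B i" "h $ i \<in> H i" using a unfolding act_def pts_def by auto
  show "corner x k h $ i \<in> levT x i"
  proof (cases "h $ i - x $ i \<le> k $ i")
    case True then show ?thesis using kh(1) unfolding corner_def levT_def by (simp add: max_absorb1)
  next
    case False
    then have "lo $ i \<le> h $ i - x $ i" using box_levelsD(5)[OF form_levels(2) kh(1)] by simp
    then show ?thesis using False reaches_le[OF re kh(2)] kh(2) unfolding corner_def levT_def by auto
  qed
qed

lemma corner_flr:
  assumes x: "x \<in> IS" and re: "reaches x" and q: "q \<in> IS" "lo \<le> q" "above H (x + q)"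
  shows "flr (levT x) q = corner x (flr B q) (flr H (x + q))"
proof (rule flr_eqI[OF box_levelsD(1)[OF levT_box[OF x]] corner_pts[OF re actI(1)[OF q]]])
  have aB: "above B q" using q(2) by (simp add: above_B)
  show "same (levT x) (corner x (flr B q) (flr H (x + q))) q"
    unfolding same_def
  proof (intro allI ballI iffI)
    fix i e assume e: "e \<in> levT x i" and le: "e \<le> q $ i"
    consider "e \<in> B i" | h where "h \<in> H i" "e = h - x $ i" using e unfolding levT_def by auto
    then show "e \<le> corner x (flr B q) (flr H (x + q)) $ i"
    proof cases
      case 1
      then show ?thesis using flr_coord(3)[OF levels_B aB 1 le] by (simp add: corner_def max.coboundedI1)
    next
      case 2
      have "h \<le> flr H (x + q) $ i" using flr_coord(3)[OF H q(3) 2(1)] 2(2) le by simp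
      then show ?thesis using 2(2) by (simp add: corner_def max.coboundedI2)
    qed
  next
    fix i e assume "e \<le> corner x (flr B q) (flr H (x + q)) $ i"
    moreover have "corner x (flr B q) (flr H (x + q)) $ i \<le> q $ i" using actI(2)[OF q] by (simp add: less_eq_vec_def)
    ultimately show "e \<le> q $ i" by simp
  qed
qed

lemma fam_adm:
  assumes x: "x \<in> IS" and W: "submod (T x) W" shows "adm (act x) (fam x W)"
  unfolding adm_def
proof (intro allI impI conjI)
  fix k h assume a: "(k, h) \<in> act x"
  note d = actD[OF x a]
  have xp: "x + corner x k h \<in> IS" by (rule IS_add[OF x d(1)])
  have lin: "linear_between (fib V h) (fib V (x + corner x k h)) (tr V h (x + corner x k h))"
    by (rule Pers_linear[OF VP d(8) xp corner_upper(2)])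
  show "subspace (fam x W k h)" unfolding fam_def
    by (rule subspace_linear_preimage[OF lin Pers_subspace[OF VP d(8)] submodD(1)[OF W d(1)]])
  show "fam x W k h \<subseteq> fib V h" unfolding fam_def by auto
  fix k' h' assume b: "(k', h') \<in> act x \<and> k \<le> k' \<and> h \<le> h'"
  have a': "(k', h') \<in> act x" using b by simp
  note d' = actD[OF x a']
  have le: "corner x k h \<le> corner x k' h'" using b by (intro corner_mono) simp_all
  have hh: "h \<le> h'" using b by simp
  have xp': "x + corner x k' h' \<in> IS" by (rule IS_add[OF x d'(1)])
  show "tr V h h' ` fam x W k h \<subseteq> fam x W k' h'"
  proof (rule image_subsetI)
    fix v assume "v \<in> fam x W k h"
    then have v: "v \<in> fib V h" "tr V h (x + corner x k h) v \<in> W (corner x k h)" by (simp_all add: fam_def)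
    have "tr V h' (x + corner x k' h') (tr V h h' v) = tr V h (x + corner x k' h') v"
      by (rule Pers_comp[OF VP d(8) d'(8) xp' hh corner_upper(2) v(1)])
    also have "\<dots> = tr V (x + corner x k h) (x + corner x k' h') (tr V h (x + corner x k h) v)"
      by (rule Pers_comp[OF VP d(8) xp xp' corner_upper(2) add_left_mono[OF le] v(1), symmetric])
    also have "\<dots> \<in> W (corner x k' h')" using submodD(3)[OF W d(1) d'(1) le v(2)] by (simp add: tr_T)
    finally show "tr V h h' v \<in> fam x W k' h'" using Pers_tr[OF VP d(8) d'(8) hh v(1)] by (simp add: fam_def)
  qed
qed

lemma realise_fam:
  assumes x: "x \<in> IS" and re: "reaches x" and W: "fsub (levT x) (T x) W" and q: "q \<in> IS"
  shows "realise x (fam x W) q = W q"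
proof -
  have W0: "0 \<in> W q" by (rule subspace_0[OF submodD(1)[OF fsubD(1)[OF W] q]])
  consider "\<not> lo \<le> q" | "lo \<le> q" "\<not> above H (x + q)" | "lo \<le> q" "above H (x + q)" by blast
  then show ?thesis
  proof cases
    case 1
    then have "\<not> above (levT x) q" using box_above[OF levT_box[OF x]] by simp
    then show ?thesis using 1 fsubD(2)[OF W q] by (simp add: realise_def)
  next
    case 2
    have "fib V (x + q) = {0}" by (rule adapted_zero[OF ad IS_add[OF x q] 2(2)])
    then have "W q \<subseteq> {0}" using submodD(2)[OF fsubD(1)[OF W] q] by (simp add: fib_T)
    then have "W q = {0}" using W0 by blast
    then show ?thesis using 2 by (simp add: realise_def)
  next
    case 3
    let ?h = "flr H (x + q)" let ?k = "flr B q" let ?p = "corner x ?k ?h"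
    note a = actI(1)[OF q 3]
    note d = actD[OF x a]
    have xp: "x + ?p \<in> IS" and xq: "x + q \<in> IS" by (rule IS_add[OF x d(1)], rule IS_add[OF x q])
    have pq: "?p \<le> q" by (rule actI(2)[OF q 3])
    have aL: "above (levT x) q" using 3(1) box_above[OF levT_box[OF x]] by simp
    have "same (levT x) (flr (levT x) q) q" by (rule same_flr[OF box_levelsD(1)[OF levT_box[OF x]] aL])
    then have sm: "same (levT x) ?p q" by (simp add: corner_flr[OF x re q 3])
    have Wq: "W q = tr V (x + ?p) (x + q) ` W ?p" using fsubD(3)[OF W d(1) q pq sm] by (simp add: tr_T)
    have "same H ?h (x + ?p)" using a unfolding act_def by simp
    then have bij: "bij_betw (tr V ?h (x + ?p)) (fib V ?h) (fib V (x + ?p))"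
      by (rule adapted_bij[OF ad d(8) xp corner_upper(2)])
    have Wp: "W ?p = tr V ?h (x + ?p) ` fam x W ?k ?h"
    proof (intro equalityI subsetI)
      fix v assume v: "v \<in> W ?p"
      then have "v \<in> fib V (x + ?p)" using submodD(2)[OF fsubD(1)[OF W] d(1)] by (auto simp: fib_T)
      then have "v \<in> tr V ?h (x + ?p) ` fib V ?h" by (simp only: bij_betw_imp_surj_on[OF bij])
      then obtain u where u: "v = tr V ?h (x + ?p) u" "u \<in> fib V ?h" by (elim imageE)
      show "v \<in> tr V ?h (x + ?p) ` fam x W ?k ?h"
        using u(1) by (rule image_eqI) (use u v in \<open>simp add: fam_def\<close>)
    next
      fix v assume "v \<in> tr V ?h (x + ?p) ` fam x W ?k ?h"
      then obtain u where "v = tr V ?h (x + ?p) u" "u \<in> fam x W ?k ?h" by (elim imageE)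
      then show "v \<in> W ?p" by (simp add: fam_def)
    qed
    have "W q = (\<lambda>v. tr V (x + ?p) (x + q) (tr V ?h (x + ?p) v)) ` fam x W ?k ?h"
      unfolding Wq by (subst Wp) (simp add: image_image)
    also have "\<dots> = tr V ?h (x + q) ` fam x W ?k ?h"
      by (intro image_cong refl Pers_comp[OF VP d(8) xp xq corner_upper(2) add_left_mono[OF pq]]) (simp add: fam_def)
    finally show ?thesis using 3 by (simp add: realise_def)
  qed
qed

text \<open>
  Moving up in the poset moves up both coordinates of the pair, and all structure maps of \<open>T x\<close> are maps of
  \<open>V\<close> between corners \<open>h\<close> up to isomorphism. Hence compatibility of the data along the order on pairs
  suffices.
\<close>

lemma realise_fsub:
  assumes x: "x \<in> IS" and re: "reaches x" and D: "adm (act x) D"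
  shows "fsub (levT x) (T x) (realise x D)"
proof -
  have Dd: "subspace (D k h)" "D k h \<subseteq> fib V h" if "(k, h) \<in> act x" for k h using D that unfolding adm_def by simp_all
  have Dm: "tr V h h' v \<in> D k' h'"
    if "(k, h) \<in> act x" "(k', h') \<in> act x" "k \<le> k'" "h \<le> h'" "v \<in> D k h" for k h k' h' v
  proof -
    have "tr V h h' ` D k h \<subseteq> D k' h'" using D that(1-4) unfolding adm_def by simp
    then show ?thesis using that(5) by (simp add: image_subset_iff)
  qed
  have fl: "flr H (x + q) \<in> IS" "flr H (x + q) \<le> x + q" if "above H (x + q)" for q
    by (rule flr_index_space[OF H that], rule flr_le[OF H that])
  have lin: "linear_between (fib V (flr H (x + q))) (fib V (x + q)) (tr V (flr H (x + q)) (x + q))"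
    if "q \<in> IS" "above H (x + q)" for q
    by (rule Pers_linear[OF VP fl(1)[OF that(2)] IS_add[OF x that(1)] fl(2)[OF that(2)]])
  have fibsub: "subspace (fib V (x + q))" if "q \<in> IS" for q by (rule Pers_subspace[OF VP IS_add[OF x that]])
  have sub: "subspace (realise x D q)" "realise x D q \<subseteq> fib V (x + q)" if q: "q \<in> IS" for q
  proof -
    have "subspace (realise x D q) \<and> realise x D q \<subseteq> fib V (x + q)"
    proof (cases "lo \<le> q \<and> above H (x + q)")
      case True
      note d = Dd[OF actI(1)[OF q]]
      have im: "tr V (flr H (x + q)) (x + q) ` D (flr B q) (flr H (x + q)) \<subseteq> fib V (x + q)"
        using linear_betweenD(1)[OF lin[OF q]] d(2) True by blast
      have "linear_between (D (flr B q) (flr H (x + q))) (fib V (x + q)) (tr V (flr H (x + q)) (x + q))"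
        by (rule linear_between_mono[OF lin[OF q] d(2) im]) (use True in simp_all)
      then have "subspace (tr V (flr H (x + q)) (x + q) ` D (flr B q) (flr H (x + q)))"
        by (rule subspace_linear_image[OF _ d(1)]) (use True in simp_all)
      then show ?thesis using im True by (simp add: realise_def)
    next
      case False
      have "{0} \<subseteq> fib V (x + q)" using subspace_0[OF fibsub[OF q]] by simp
      then show ?thesis unfolding realise_def if_not_P[OF False] by (simp add: subspace_single_0)
    qed
    then show "subspace (realise x D q)" "realise x D q \<subseteq> fib V (x + q)" by simp_all
  qed
  have tr0: "tr V (x + p) (x + q) 0 = 0" if "p \<in> IS" "q \<in> IS" "p \<le> q" for p q
    by (rule linear_between_0[OF Pers_linear[OF VP IS_add[OF x that(1)] IS_add[OF x that(2)] add_left_mono[OF that(3)]] fibsub[OF that(1)]])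
  have sm: "submod (T x) (realise x D)"
    unfolding submod_def fib_T tr_T
  proof (intro conjI ballI impI)
    show "subspace (realise x D q)" "realise x D q \<subseteq> fib V (x + q)" if "q \<in> IS" for q by (rule sub[OF that])+
    fix p q :: "real ^ 'n" assume p: "p \<in> IS" and q: "q \<in> IS" and pq: "p \<le> q"
    show "tr V (x + p) (x + q) ` realise x D p \<subseteq> realise x D q"
    proof (rule image_subsetI)
      fix v assume v: "v \<in> realise x D p"
      show "tr V (x + p) (x + q) v \<in> realise x D q"
      proof (cases "lo \<le> p \<and> above H (x + p)")
        case True
        let ?h = "flr H (x + p)" let ?h' = "flr H (x + q)"
        have lq: "lo \<le> q" using True pq by (meson order_trans)
        have aq: "above H (x + q)" using above_mono[OF _ add_left_mono[OF pq]] True by blast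
        have ap: "above H (x + p)" "lo \<le> p" using True by simp_all
        have hh: "?h \<le> ?h'" by (rule flr_mono[OF H ap(1) add_left_mono[OF pq]])
        have kk: "flr B p \<le> flr B q" by (rule flr_mono[OF levels_B _ pq]) (simp add: above_B ap)
        have "v \<in> tr V ?h (x + p) ` D (flr B p) ?h" using v True by (simp add: realise_def)
        then obtain u where u: "v = tr V ?h (x + p) u" "u \<in> D (flr B p) ?h" by (elim imageE)
        have uf: "u \<in> fib V ?h" using Dd(2)[OF actI(1)[OF p ap(2,1)]] u(2) by (rule subsetD)
        have "tr V (x + p) (x + q) v = tr V ?h (x + q) u"
          unfolding u(1) by (rule Pers_comp[OF VP fl(1)[OF ap(1)] IS_add[OF x p] IS_add[OF x q] fl(2)[OF ap(1)] add_left_mono[OF pq] uf])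
        also have "\<dots> = tr V ?h' (x + q) (tr V ?h ?h' u)"
          by (rule Pers_comp[OF VP fl(1)[OF ap(1)] fl(1)[OF aq] IS_add[OF x q] hh fl(2)[OF aq] uf, symmetric])
        also have "\<dots> \<in> realise x D q"
        proof -
          have "tr V ?h ?h' u \<in> D (flr B q) ?h'"
            by (rule Dm[OF actI(1)[OF p ap(2,1)] actI(1)[OF q lq aq] kk hh u(2)])
          then show ?thesis using lq aq by (simp add: realise_def)
        qed
        finally show ?thesis .
      next
        case False
        then have "v = 0" using v unfolding realise_def if_not_P[OF False] by simp
        then show ?thesis using tr0[OF p q pq] subspace_0[OF sub(1)[OF q]] by simp
      qed
    qed
  qed
  note aL = box_above[OF levT_box[OF x]]
  show ?thesis
  proof (rule fsubI[OF sm])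
    show "realise x D q \<subseteq> {0}" if "q \<in> IS" "\<not> above (levT x) q" for q
      using that(2) unfolding aL realise_def by simp
    fix p q :: "real ^ 'n" and v
    assume p: "p \<in> IS" and q: "q \<in> IS" and pq: "p \<le> q" and sm: "same (levT x) p q" and v: "v \<in> realise x D q"
    show "v \<in> tr (T x) p q ` realise x D p"
    proof (cases "lo \<le> q \<and> above H (x + q)")
      case True
      have lp: "lo \<le> p" using above_same[OF sm] True unfolding aL by simp
      have sH: "same H (x + p) (x + q)" by (rule levT_same[OF re lp pq sm])
      have ap: "above H (x + p)" using above_same[OF sH] True by simp
      have eh: "flr H (x + q) = flr H (x + p)" by (rule flr_cong[OF same_sym[OF sH]])
      have "same B p q" by (rule same_mono[OF sm]) (simp add: levT_def)
      then have ek: "flr B q = flr B p" by (rule flr_cong[OF same_sym])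
      have "v \<in> tr V (flr H (x + p)) (x + q) ` D (flr B p) (flr H (x + p))" using v True by (simp add: realise_def eh ek)
      then obtain u where u: "v = tr V (flr H (x + p)) (x + q) u" "u \<in> D (flr B p) (flr H (x + p))" by (elim imageE)
      have uf: "u \<in> fib V (flr H (x + p))" using Dd(2)[OF actI(1)[OF p lp ap]] u(2) by (rule subsetD)
      have "v = tr (T x) p q (tr V (flr H (x + p)) (x + p) u)"
        unfolding u(1) tr_T by (rule Pers_comp[OF VP fl(1)[OF ap] IS_add[OF x p] IS_add[OF x q] fl(2)[OF ap] add_left_mono[OF pq] uf, symmetric])
      moreover have "tr V (flr H (x + p)) (x + p) u \<in> realise x D p" using u(2) lp ap by (simp add: realise_def)
      ultimately show ?thesis by (rule image_eqI)
    next
      case False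
      then have "v = tr (T x) p q 0" using v tr0[OF p q pq] unfolding realise_def if_not_P[OF False] tr_T by simp
      then show ?thesis by (rule image_eqI) (rule subspace_0[OF sub(1)[OF p]])
    qed
  qed
qed

lemma realise_dim:
  assumes x: "x \<in> IS" and D: "adm (act x) D" and a: "(k, h) \<in> act x"
  shows "dim (realise x D (corner x k h)) = dim (D k h)"
proof -
  note d = actD[OF x a]
  let ?p = "corner x k h"
  have xp: "x + ?p \<in> IS" by (rule IS_add[OF x d(1)])
  have Dd: "subspace (D k h)" "D k h \<subseteq> fib V h" using D a unfolding adm_def by simp_all
  have "same H h (x + ?p)" using a unfolding act_def by simp
  then have bij: "bij_betw (tr V h (x + ?p)) (fib V h) (fib V (x + ?p))"
    by (rule adapted_bij[OF ad d(8) xp corner_upper(2)])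
  have im: "tr V h (x + ?p) ` D k h \<subseteq> fib V (x + ?p)" using image_mono[OF Dd(2)] bij_betw_imp_surj_on[OF bij] by metis
  have "linear_between (D k h) (fib V (x + ?p)) (tr V h (x + ?p))"
    by (rule linear_between_mono[OF Pers_linear[OF VP d(8) xp corner_upper(2)] Dd(2) im])
  then have "dim (tr V h (x + ?p) ` D k h) = dim (D k h)"
    by (rule dim_linear_image[OF findim_subset[OF Pers_findim[OF VP d(8)] Dd] _ inj_on_subset[OF bij_betw_imp_inj_on[OF bij] Dd(2)]])
  then show ?thesis using d by (simp add: realise_def)
qed

lemma realise_avg:
  assumes x: "x \<in> IS" and re: "reaches x" and D: "adm (act x) D"
  shows "avg hi \<tau> (levT x) (\<lambda>q. real (dim (realise x D q))) =
    (\<Sum>(k, h)\<in>act x. real (dim (D k h)) * (\<Prod>i\<in>UNIV. mass (\<tau> i) (corner x k h $ i)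
       (nxt (hi $ i + 1) (levT x i) (corner x k h $ i))))"
proof -
  let ?m = "\<lambda>p. \<Prod>i\<in>UNIV. mass (\<tau> i) (p $ i) (nxt (hi $ i + 1) (levT x i) (p $ i))"
  let ?P = "{p \<in> pts (levT x). above H (x + p)}"
  note lE = box_levelsD(1)[OF levT_box[OF x]]
  have "avg hi \<tau> (levT x) (\<lambda>q. real (dim (realise x D q))) = (\<Sum>p\<in>?P. real (dim (realise x D p)) * ?m p)"
    unfolding avg_def
  proof (rule sum.mono_neutral_right[OF finite_pts[OF lE]])
    show "?P \<subseteq> pts (levT x)" by auto
    show "\<forall>p\<in>pts (levT x) - ?P. real (dim (realise x D p)) * ?m p = 0" by (simp add: realise_def dim_zero)
  qed
  also have "\<dots> = (\<Sum>(k, h)\<in>act x. real (dim (D k h)) * ?m (corner x k h))"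
  proof (rule sum.reindex_bij_witness[where i="\<lambda>(k, h). corner x k h" and j="\<lambda>p. (flr B p, flr H (x + p))"])
    fix p assume p: "p \<in> ?P"
    have pI: "p \<in> IS" by (rule pts_index_space[OF lE]) (use p in simp)
    have ap: "above H (x + p)" using p by simp
    have lp: "lo \<le> p" using above_pts[of p "levT x"] p box_above[OF levT_box[OF x]] by simp
    have fp: "flr (levT x) p = p" by (rule flr_of_pts[OF lE]) (use p in simp)
    have cp: "corner x (flr B p) (flr H (x + p)) = p" using corner_flr[OF x re pI lp ap] fp by simp
    then show "(case (flr B p, flr H (x + p)) of (k, h) \<Rightarrow> corner x k h) = p" by simp
    show "(flr B p, flr H (x + p)) \<in> act x" by (rule actI(1)[OF pI lp ap])
    show "(case (flr B p, flr H (x + p)) of (k, h) \<Rightarrow> real (dim (D k h)) * ?m (corner x k h)) = real (dim (realise x D p)) * ?m p"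
      using realise_dim[OF x D actI(1)[OF pI lp ap]] by (simp add: cp)
  next
    fix a assume a: "a \<in> act x"
    obtain k h where kh: "a = (k, h)" by (cases a)
    have a': "(k, h) \<in> act x" using a kh by simp
    show "(case a of (k, h) \<Rightarrow> corner x k h) \<in> ?P"
      using corner_pts[OF re a'] actD(3)[OF x a'] by (simp add: kh)
    show "(flr B (case a of (k, h) \<Rightarrow> corner x k h), flr H (x + (case a of (k, h) \<Rightarrow> corner x k h))) = a"
      using actD(4,5)[OF x a'] by (simp add: kh)
  qed
  finally show ?thesis .
qed

lemma realise_height:
  assumes x: "x \<in> IS" and re: "reaches x" and D: "adm (act x) D"
  shows "height Z (T x) \<theta> (realise x D) = (\<Sum>(k, h)\<in>act x. real (dim (D k h)) * cw x \<theta> k h)"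
proof -
  interpret reduced_module scale K Z "T x" lo c hi B "levT x" A r s by (rule reduced_T[OF x re])
  let ?w = "\<lambda>\<tau> k h. \<Prod>i\<in>UNIV. mass (\<tau> i) (corner x k h $ i) (nxt (hi $ i + 1) (levT x i) (corner x k h $ i))"
  let ?a = "\<lambda>\<tau>. \<Sum>(k, h)\<in>act x. real (dim (D k h)) * ?w \<tau> k h"
  have fs: "fsub (levT x) (T x) (realise x D)" by (rule realise_fsub[OF x re D])
  note ch = fsub_charge[OF fsub_subobject[OF T_fp[OF x] box_levelsD(1)[OF levT_box[OF x]] fs] refines_E fsub_step[OF fs refines_E]]
  have "height Z (T x) \<theta> (realise x D) = (\<Sum>\<tau>\<in>A. (s \<tau> - \<theta> * r \<tau>) * ?a \<tau>)"
    unfolding height_def ch realise_avg[OF x re D]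
    by (simp add: algebra_simps sum_subtractf sum_distrib_left)
  also have "\<dots> = (\<Sum>\<tau>\<in>A. \<Sum>(k, h)\<in>act x. real (dim (D k h)) * ((s \<tau> - \<theta> * r \<tau>) * ?w \<tau> k h))"
    by (intro sum.cong refl) (simp add: sum_distrib_left case_prod_unfold algebra_simps)
  also have "\<dots> = (\<Sum>(k, h)\<in>act x. real (dim (D k h)) * cw x \<theta> k h)"
    unfolding cw_def by (subst sum.swap) (simp add: sum_distrib_left case_prod_unfold)
  finally show ?thesis .
qed

end

section \<open>The rank is determined by finitely many polynomial conditions\<close>

context translates
begin

text \<open>
  The family of the maximiser of \<open>T x\<close> competes over \<open>x'\<close>, and vice versa; if all comparisons of
  heights between families have the same outcome over \<open>x\<close> and \<open>x'\<close>, the maximisers agree.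
\<close>

lemma fam_le:
  assumes x: "x \<in> IS" "reaches x" and x': "x' \<in> IS" "reaches x'" and act: "act x' = act x"
    and M: "largest_max Z (T x) \<theta> M" "fsub (levT x) (T x) M"
    and M': "largest_max Z (T x') \<theta>' M'" "fsub (levT x') (T x') M'"
    and sg: "\<And>D D'. adm (act x) D \<Longrightarrow> adm (act x) D' \<Longrightarrow>
      (\<Sum>(k, h)\<in>act x. real (dim (D' k h)) * cw x \<theta> k h) \<le> (\<Sum>(k, h)\<in>act x. real (dim (D k h)) * cw x \<theta> k h) \<longleftrightarrow>
      (\<Sum>(k, h)\<in>act x. real (dim (D' k h)) * cw x' \<theta>' k h) \<le> (\<Sum>(k, h)\<in>act x. real (dim (D k h)) * cw x' \<theta>' k h)"
    and a: "(k, h) \<in> act x"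
  shows "fam x M k h \<subseteq> fam x' M' k h"
proof -
  interpret X: stable_module scale K Z "T x" by (rule stable_T[OF x(1)])
  interpret X': stable_module scale K Z "T x'" by (rule stable_T[OF x'(1)])
  let ?D = "fam x M" and ?D' = "fam x' M'"
  have D: "adm (act x) ?D" by (rule fam_adm[OF x(1) fsubD(1)[OF M(2)]])
  have D': "adm (act x) ?D'" using fam_adm[OF x'(1) fsubD(1)[OF M'(2)]] by (simp add: act)
  have Dx': "adm (act x') ?D" "adm (act x') ?D'" using D D' by (simp_all add: act)
  have sub: "realise x ?D \<in> subobjects (T x)" "realise x ?D' \<in> subobjects (T x)"
    by (rule fsub_subobject[OF T_fp[OF x(1)] box_levelsD(1)[OF levT_box[OF x(1)]] realise_fsub[OF x]], rule D D')+
  have sub': "realise x' ?D \<in> subobjects (T x')" "realise x' ?D' \<in> subobjects (T x')"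
    by (rule fsub_subobject[OF T_fp[OF x'(1)] box_levelsD(1)[OF levT_box[OF x'(1)]] realise_fsub[OF x']], rule Dx')+
  have hM: "height Z (T x) \<theta> (realise x ?D) = height Z (T x) \<theta> M"
    by (rule X.height_cong[OF sub(1) realise_fam[OF x M(2)]])
  have hM': "height Z (T x') \<theta>' (realise x' ?D') = height Z (T x') \<theta>' M'"
    by (rule X'.height_cong[OF sub'(2) realise_fam[OF x' M'(2)]])
  have "height Z (T x) \<theta> (realise x ?D') \<le> height Z (T x) \<theta> (realise x ?D)"
    using M(1) sub(2) unfolding hM largest_max_def by simp
  then have "height Z (T x') \<theta>' (realise x' ?D') \<le> height Z (T x') \<theta>' (realise x' ?D)"
    using sg[OF D D'] unfolding realise_height[OF x D] realise_height[OF x D'] realise_height[OF x' Dx'(1)]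
      realise_height[OF x' Dx'(2)] act by simp
  then have "height Z (T x') \<theta>' (realise x' ?D) = height Z (T x') \<theta>' M'"
    using M'(1) sub'(1) unfolding hM' largest_max_def by (simp add: order_antisym)
  then have le: "realise x' ?D q \<subseteq> M' q" if "q \<in> IS" for q
    using M'(1) sub'(1) that unfolding largest_max_def by simp
  have a': "(k, h) \<in> act x'" using a by (simp add: act)
  note d = actD[OF x'(1) a']
  show ?thesis
  proof (rule subsetI)
    fix v assume v: "v \<in> fam x M k h"
    have "tr V h (x' + corner x' k h) v \<in> realise x' ?D (corner x' k h)" using v d by (simp add: realise_def)
    then have "tr V h (x' + corner x' k h) v \<in> M' (corner x' k h)" using le[OF d(1)] by (rule subsetD[rotated])
    moreover have "v \<in> fib V h" using v by (simp add: fam_def)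
    ultimately show "v \<in> fam x' M' k h" by (simp add: fam_def)
  qed
qed

lemma max_exists:
  assumes x: "x \<in> IS" obtains M where "largest_max Z (T x) \<theta> M"
  using that max_reaches(2)[OF x] max_not_reaches(2)[OF x] by (cases "reaches x") blast+

lemma rank_trivial:
  assumes x: "x \<in> IS" and y: "y \<in> IS" and xy: "x \<le> y" and M: "largest_max Z (T x) \<theta> M" and M0: "M 0 \<subseteq> {0}"
  shows "HN_rank Z V x y \<theta> = 0"
proof -
  have sub: "submod (T x) M" by (rule subobject_submod[OF T_fp[OF x]]) (use M in \<open>simp add: largest_max_def\<close>)
  have "M 0 = {0}" using M0 subspace_0[OF submodD(1)[OF sub IS_0]] by auto
  moreover have "tr V x y 0 = 0" by (rule linear_between_0[OF Pers_linear[OF VP x y xy] Pers_subspace[OF VP x]])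
  ultimately show ?thesis using HN_rank_max[OF x M, of y] by (simp add: dim_zero)
qed

lemma rank_not_above:
  assumes x: "x \<in> IS" and y: "y \<in> IS" and xy: "x \<le> y" and a: "\<not> above H x" shows "HN_rank Z V x y \<theta> = 0"
proof -
  obtain M where M: "largest_max Z (T x) \<theta> M" using max_exists[OF x] .
  have sub: "submod (T x) M" by (rule subobject_submod[OF T_fp[OF x]]) (use M in \<open>simp add: largest_max_def\<close>)
  have "M 0 \<subseteq> fib V (x + 0)" using submodD(2)[OF sub IS_0] by (simp only: fib_T)
  then have "M 0 \<subseteq> {0}" using adapted_zero[OF ad x a] by simp
  then show ?thesis by (rule rank_trivial[OF x y xy M])
qed

lemma rank_not_reaches:
  assumes x: "x \<in> IS" and y: "y \<in> IS" and xy: "x \<le> y" and re: "\<not> reaches x" and \<theta>: "\<theta> > 0"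
  shows "HN_rank Z V x y \<theta> = 0"
proof -
  obtain M where M: "largest_max Z (T x) \<theta> M" "fsub (\<lambda>_. {}) (T x) M" using max_not_reaches(1)[OF x re \<theta>] by blast
  have "M 0 = {0}" by (rule fsubD(2)[OF M(2) IS_0]) (simp add: above_def)
  then show ?thesis by (intro rank_trivial[OF x y xy M(1)]) simp
qed

lemma rank_nonpos:
  assumes x: "x \<in> IS" and y: "y \<in> IS" and xy: "x \<le> y" and \<theta>: "\<theta> \<le> 0" and a: "above H x"
  shows "HN_rank Z V x y \<theta> = dim (tr V (flr H x) y ` fib V (flr H x))"
proof -
  note h = flr_index_space[OF H a] flr_le[OF H a]
  have im: "tr V (flr H x) x ` fib V (flr H x) = fib V x"
    by (rule bij_betw_imp_surj_on[OF adapted_bij[OF ad h(1) x h(2) same_flr[OF H a]]])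
  have "HN_rank Z V x y \<theta> = dim (tr V x y ` fib V x)"
    using HN_rank_max[OF x max_nonpos[OF x \<theta>]] by (simp add: fib_T)
  also have "tr V x y ` fib V x = (\<lambda>v. tr V x y (tr V (flr H x) x v)) ` fib V (flr H x)"
    by (subst im[symmetric]) (simp add: image_image)
  also have "\<dots> = tr V (flr H x) y ` fib V (flr H x)"
    by (rule image_cong[OF refl Pers_comp[OF VP h(1) x y h(2) xy]])
  finally show ?thesis .
qed

lemma rank_pos:
  assumes x: "x \<in> IS" and y: "y \<in> IS" and xy: "x \<le> y" and a: "above H x" and re: "reaches x"
    and M: "largest_max Z (T x) \<theta> M" "fsub (levT x) (T x) M"
  shows "HN_rank Z V x y \<theta> = dim (tr V (flr H x) y ` fam x M 0 (flr H x))"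
    and "(0, flr H x) \<in> act x" and "subspace (fam x M 0 (flr H x))" "fam x M 0 (flr H x) \<subseteq> fib V (flr H x)"
proof -
  note h = flr_index_space[OF H a] flr_le[OF H a]
  have f0: "flr B 0 = 0" by (rule flr_of_pts[OF levels_B]) (simp add: pts_def form_levels(3))
  have a0: "above H (x + 0)" using a by simp
  show act: "(0, flr H x) \<in> act x" using actI(1)[OF IS_0 lo0 a0] by (simp add: f0)
  have adm: "adm (act x) (fam x M)" by (rule fam_adm[OF x fsubD(1)[OF M(2)]])
  show "subspace (fam x M 0 (flr H x))" and sub: "fam x M 0 (flr H x) \<subseteq> fib V (flr H x)"
    using adm act unfolding adm_def by simp_all
  have "M 0 = realise x (fam x M) 0" by (rule realise_fam[OF x re M(2) IS_0, symmetric])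
  also have "\<dots> = tr V (flr H x) x ` fam x M 0 (flr H x)" using lo0 a by (simp add: realise_def f0)
  finally have M0: "M 0 = tr V (flr H x) x ` fam x M 0 (flr H x)" .
  have "HN_rank Z V x y \<theta> = dim (tr V x y ` M 0)" by (rule HN_rank_max[OF x M(1)])
  also have "tr V x y ` M 0 = (\<lambda>v. tr V x y (tr V (flr H x) x v)) ` fam x M 0 (flr H x)"
    unfolding M0 by (simp add: image_image)
  also have "\<dots> = tr V (flr H x) y ` fam x M 0 (flr H x)"
    by (rule image_cong[OF refl Pers_comp[OF VP h(1) x y h(2) xy subsetD[OF sub]]])
  finally show "HN_rank Z V x y \<theta> = dim (tr V (flr H x) y ` fam x M 0 (flr H x))" .
qed

text \<open>
  At the origin the largest maximiser is given by the value of its family at the pair of \<open>0\<close> and the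
  corner of the cell of \<open>x\<close>. So the rank is that of a map of \<open>V\<close> on a subspace that does not change
  as long as the outcomes of all comparisons of heights do not change.
\<close>

lemma rank_cong:
  assumes x: "x \<in> IS" "x' \<in> IS" and y: "y \<in> IS" "y' \<in> IS" and xy: "x \<le> y" "x' \<le> y'"
    and sx: "same H x x'" and sy: "same H y y'" and sc: "same H (x + c) (x' + c)" and s\<theta>: "\<theta> > 0 \<longleftrightarrow> \<theta>' > 0"
    and act: "act x' = act x"
    and sg: "\<And>D D'. reaches x \<Longrightarrow> reaches x' \<Longrightarrow> adm (act x) D \<Longrightarrow> adm (act x) D' \<Longrightarrow>
      (\<Sum>(k, h)\<in>act x. real (dim (D' k h)) * cw x \<theta> k h) \<le> (\<Sum>(k, h)\<in>act x. real (dim (D k h)) * cw x \<theta> k h) \<longleftrightarrow>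
      (\<Sum>(k, h)\<in>act x. real (dim (D' k h)) * cw x' \<theta>' k h) \<le> (\<Sum>(k, h)\<in>act x. real (dim (D k h)) * cw x' \<theta>' k h)"
  shows "HN_rank Z V x y \<theta> = HN_rank Z V x' y' \<theta>'"
proof (cases "above H x")
  case False
  then show ?thesis
    using rank_not_above[OF x(1) y(1) xy(1)] rank_not_above[OF x(2) y(2) xy(2)] above_same[OF sx] by simp
next
  case a: True
  have a': "above H x'" using a above_same[OF sx] by simp
  note h = flr_index_space[OF H a] flr_le[OF H a]
  have hx: "flr H x' = flr H x" by (rule flr_cong[OF same_sym[OF sx]])
  have hy: "flr H x \<le> y" "flr H x \<le> y'"
    using order_trans[OF h(2) xy(1)] order_trans[OF flr_le[OF H a'] xy(2)] by (simp_all add: hx)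
  have dim_eq: "dim (tr V (flr H x) y ` D) = dim (tr V (flr H x) y' ` D)"
    if D: "subspace D" "D \<subseteq> fib V (flr H x)" for D
    by (rule dim_tr_same[OF h(1) y hy sy above_flr[OF H a] D])
  show ?thesis
  proof (cases "\<theta> > 0")
    case False
    then have t: "\<theta> \<le> 0" "\<theta>' \<le> 0" using s\<theta> by simp_all
    show ?thesis
      unfolding rank_nonpos[OF x(1) y(1) xy(1) t(1) a] rank_nonpos[OF x(2) y(2) xy(2) t(2) a'] hx
      by (rule dim_eq[OF Pers_subspace[OF VP h(1)] order_refl])
  next
    case True
    then have t: "\<theta> > 0" "\<theta>' > 0" using s\<theta> by simp_all
    show ?thesis
    proof (cases "reaches x")
      case False
      then have "\<not> reaches x'" using above_same[OF sc] by simp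
      then show ?thesis
        using rank_not_reaches[OF x(1) y(1) xy(1) False t(1)] rank_not_reaches[OF x(2) y(2) xy(2) _ t(2)] by simp
    next
      case re: True
      then have re': "reaches x'" using above_same[OF sc] by simp
      obtain M where M: "largest_max Z (T x) \<theta> M" "fsub (levT x) (T x) M" using max_reaches(1)[OF x(1) re t(1)] by blast
      obtain M' where M': "largest_max Z (T x') \<theta>' M'" "fsub (levT x') (T x') M'"
        using max_reaches(1)[OF x(2) re' t(2)] by blast
      note R = rank_pos[OF x(1) y(1) xy(1) a re M] and R' = rank_pos[OF x(2) y(2) xy(2) a' re' M']
      have "fam x M 0 (flr H x) \<subseteq> fam x' M' 0 (flr H x)"
        by (rule fam_le[OF x(1) re x(2) re' act M M' sg[OF re re'] R(2)])
      moreover have "fam x' M' 0 (flr H x) \<subseteq> fam x M 0 (flr H x)"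
        by (rule fam_le[OF x(2) re' x(1) re act[symmetric] M' M]) (use sg[OF re re'] R(2) act in simp_all)
      ultimately have eq: "fam x' M' 0 (flr H x) = fam x M 0 (flr H x)" by (rule equalityI[rotated])
      show ?thesis unfolding R(1) R'(1) hx eq by (rule dim_eq[OF R(3,4)])
    qed
  qed
qed

end

section \<open>Semialgebraicity of the conditions\<close>

lemma semialgebraic_Collect_conj:
  "semialgebraic {z. P z} \<Longrightarrow> semialgebraic {z. Q z} \<Longrightarrow> semialgebraic {z. P z \<and> Q z}"
  unfolding Collect_conj_eq by (rule semialgebraic.inter)

lemma semialgebraic_level_iff:
  assumes "piecewise_polynomial g" shows "semialgebraic {z. e \<le> g z \<longleftrightarrow> b}"
proof (cases b)
  case True
  then show ?thesis using semialgebraic_le[OF piecewise_polynomial_const assms] by simp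
next
  case False
  then show ?thesis using semialgebraic_less[OF assms piecewise_polynomial_const] by (simp add: not_le)
qed

lemma piecewise_polynomial_mass:
  assumes "piecewise_polynomial g" "piecewise_polynomial h"
  shows "piecewise_polynomial (\<lambda>z. mass \<tau> (g z) (h z))"
proof (cases "fst \<tau> = snd \<tau>")
  case True
  have "piecewise_polynomial (\<lambda>z. if g z \<le> fst \<tau> \<and> fst \<tau> < h z then 1 else 0)"
    by (intro piecewise_polynomial_if piecewise_polynomial_const semialgebraic_Collect_conj
        semialgebraic_le semialgebraic_less assms)
  then show ?thesis using True by (simp add: mass_def)
next
  case False
  have "piecewise_polynomial (\<lambda>z. max 0 (min (h z) (snd \<tau>) - max (g z) (fst \<tau>)) * (1 / (snd \<tau> - fst \<tau>)))"
    by (intro piecewise_polynomial_mult piecewise_polynomial_max piecewise_polynomial_min piecewise_polynomial_diff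
        piecewise_polynomial_const assms)
  then show ?thesis using False by (simp add: mass_def)
qed

context translates
begin

text \<open>
  The next level of \<open>T x\<close> above \<open>p\<close>, as a minimum over an index set that does not depend on \<open>x\<close>.
\<close>

definition nextT :: "real ^ 'n \<Rightarrow> 'n \<Rightarrow> real \<Rightarrow> real" where
  "nextT x i p = Min ((\<lambda>j. if p < (case j of Inl b \<Rightarrow> b | Inr h \<Rightarrow> h - x $ i)
     then (case j of Inl b \<Rightarrow> b | Inr h \<Rightarrow> h - x $ i) else hi $ i + 1) ` (B i <+> H i))"

lemma nextT:
  assumes re: "reaches x" and p: "lo $ i \<le> p" shows "nxt (hi $ i + 1) (levT x i) p = nextT x i p"
proof -
  let ?g = "\<lambda>j. case j of Inl b \<Rightarrow> b | Inr h \<Rightarrow> h - x $ i"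
  let ?f = "\<lambda>j. if p < ?g j then ?g j else hi $ i + 1"
  have "insert (hi $ i + 1) {e \<in> levT x i. p < e} = ?f ` (B i <+> H i)"
  proof (intro equalityI subsetI)
    fix e assume "e \<in> insert (hi $ i + 1) {e \<in> levT x i. p < e}"
    then consider "e = hi $ i + 1" | "e \<in> B i" "p < e" | h where "h \<in> H i" "e = h - x $ i" "p < e"
      unfolding levT_def by auto
    then show "e \<in> ?f ` (B i <+> H i)"
    proof cases
      case 1
      show ?thesis by (rule image_eqI[where x="Inl (lo $ i)"])
        (use 1 p box_levelsD(3)[OF form_levels(2)] in \<open>simp_all add: InlI\<close>)
    next
      case 2 show ?thesis by (rule image_eqI[where x="Inl e"]) (use 2 in \<open>simp_all add: InlI\<close>)
    next
      case 3 show ?thesis by (rule image_eqI[where x="Inr h"]) (use 3 in \<open>simp_all add: InrI\<close>)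
    qed
  next
    fix e assume "e \<in> ?f ` (B i <+> H i)"
    then obtain j where j: "e = ?f j" "j \<in> B i <+> H i" by (elim imageE)
    have "?g j \<in> levT x i" if "p < ?g j"
      using j(2)
    proof (elim PlusE)
      fix b assume "b \<in> B i" "j = Inl b" then show ?thesis by (simp add: levT_def)
    next
      fix h assume h: "h \<in> H i" "j = Inr h"
      then show ?thesis using that p reaches_le[OF re h(1)] unfolding levT_def by auto
    qed
    then show "e \<in> insert (hi $ i + 1) {e \<in> levT x i. p < e}" unfolding j(1) by (cases "p < ?g j") simp_all
  qed
  then show ?thesis unfolding nxt_def nextT_def by (rule arg_cong)
qed

text \<open>
  The weight with the next levels in their uniform description; it agrees with \<open>cw\<close> only for
  \<open>x\<close> reaching \<open>c\<close>, but is piecewise polynomial everywhere.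
\<close>

definition cw' :: "real ^ 'n \<Rightarrow> real \<Rightarrow> real ^ 'n \<Rightarrow> real ^ 'n \<Rightarrow> real" where
  "cw' x \<theta> k h = (\<Sum>\<tau>\<in>A. (s \<tau> - \<theta> * r \<tau>) * (\<Prod>i\<in>UNIV. mass (\<tau> i) (corner x k h $ i)
     (nextT x i (corner x k h $ i))))"

lemma cw'_eq:
  assumes "x \<in> IS" "reaches x" "(k, h) \<in> act x" shows "cw x \<theta> k h = cw' x \<theta> k h"
proof -
  have "lo $ i \<le> corner x k h $ i" for i using actD(2)[OF assms(1,3)] by (simp add: less_eq_vec_def)
  then show ?thesis unfolding cw_def cw'_def by (simp add: nextT[OF assms(2)])
qed

lemma pp_coordinates:
  "piecewise_polynomial (\<lambda>z :: (real ^ 'n) \<times> (real ^ 'n) \<times> real. fst z $ i)"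
  "piecewise_polynomial (\<lambda>z :: (real ^ 'n) \<times> (real ^ 'n) \<times> real. fst (snd z) $ i)"
  "piecewise_polynomial (\<lambda>z :: (real ^ 'n) \<times> (real ^ 'n) \<times> real. snd (snd z))"
  by (intro piecewise_polynomial_linear bounded_linear_compose[OF bounded_linear_vec_nth]
      bounded_linear_fst bounded_linear_compose[OF bounded_linear_fst bounded_linear_snd]
      bounded_linear_compose[OF bounded_linear_snd bounded_linear_snd])+

lemma pp_corner: "piecewise_polynomial (\<lambda>z :: (real ^ 'n) \<times> (real ^ 'n) \<times> real. corner (fst z) k h $ i)"
proof -
  have "piecewise_polynomial (\<lambda>z :: (real ^ 'n) \<times> (real ^ 'n) \<times> real. max (k $ i) (h $ i - fst z $ i))"
    by (intro piecewise_polynomial_max piecewise_polynomial_diff piecewise_polynomial_const pp_coordinates)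
  then show ?thesis by (simp add: corner_def)
qed

lemma pp_nextT:
  assumes p: "piecewise_polynomial p"
  shows "piecewise_polynomial (\<lambda>z :: (real ^ 'n) \<times> (real ^ 'n) \<times> real. nextT (fst z) i (p z))"
  unfolding nextT_def
proof (rule piecewise_polynomial_Min)
  show "finite (B i <+> H i)" using levels_finite[OF levels_B] levels_finite[OF H] by (rule finite_Plus)
  show "B i <+> H i \<noteq> {}" using form_levels(3)[of i] by blast
  fix j
  have g: "piecewise_polynomial (\<lambda>z :: (real ^ 'n) \<times> (real ^ 'n) \<times> real. case j of Inl b \<Rightarrow> b | Inr h \<Rightarrow> h - fst z $ i)"
    by (cases j) (simp_all add: piecewise_polynomial_const piecewise_polynomial_diff pp_coordinates)
  show "piecewise_polynomial (\<lambda>z :: (real ^ 'n) \<times> (real ^ 'n) \<times> real.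
     if p z < (case j of Inl b \<Rightarrow> b | Inr h \<Rightarrow> h - fst z $ i)
     then (case j of Inl b \<Rightarrow> b | Inr h \<Rightarrow> h - fst z $ i) else hi $ i + 1)"
    by (intro piecewise_polynomial_if g piecewise_polynomial_const semialgebraic_less p)
qed

lemma pp_cw': "piecewise_polynomial (\<lambda>z :: (real ^ 'n) \<times> (real ^ 'n) \<times> real. cw' (fst z) (snd (snd z)) k h)"
  unfolding cw'_def
  by (intro piecewise_polynomial_sum piecewise_polynomial_mult piecewise_polynomial_diff piecewise_polynomial_prod
      piecewise_polynomial_mass pp_corner pp_nextT piecewise_polynomial_const pp_coordinates form_levels(4) finite)

lemma semialgebraic_act: "semialgebraic {z :: (real ^ 'n) \<times> (real ^ 'n) \<times> real. (k, h) \<in> act (fst z)}"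
proof (cases "k \<in> pts B \<and> h \<in> pts H")
  case True
  have "semialgebraic {z :: (real ^ 'n) \<times> (real ^ 'n) \<times> real.
     (\<forall>i\<in>UNIV. \<forall>e\<in>B i. e \<le> corner (fst z) k h $ i \<longleftrightarrow> e \<le> k $ i) \<and>
     (\<forall>i\<in>UNIV. \<forall>e\<in>H i. e \<le> fst z $ i + corner (fst z) k h $ i \<longleftrightarrow> e \<le> h $ i)}"
    by (intro semialgebraic_Collect_conj semialgebraic_Collect_ball semialgebraic_level_iff
        piecewise_polynomial_add pp_coordinates pp_corner finite levels_finite[OF H] levels_finite[OF levels_B])
  then show ?thesis using True by (simp add: act_def same_def)
next
  case False
  have "semialgebraic (- UNIV :: ((real ^ 'n) \<times> (real ^ 'n) \<times> real) set)"
    by (rule semialgebraic.compl[OF semialgebraic_UNIV])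
  moreover have "{z :: (real ^ 'n) \<times> (real ^ 'n) \<times> real. (k, h) \<in> act (fst z)} = - UNIV"
    using False by (auto simp: act_def)
  ultimately show ?thesis by simp
qed

text \<open>
  The difference of the heights of two families, in terms of the differences \<open>\<delta>\<close> of their
  dimensions. There are only finitely many possible \<open>\<delta>\<close>.
\<close>

definition gain :: "((real ^ 'n) \<times> (real ^ 'n) \<Rightarrow> int) \<Rightarrow> (real ^ 'n) \<times> (real ^ 'n) \<times> real \<Rightarrow> real" where
  "gain \<delta> z = (\<Sum>a\<in>pts B \<times> pts H. if a \<in> act (fst z)
     then cw' (fst z) (snd (snd z)) (fst a) (snd a) * real_of_int (\<delta> a) else 0)"

definition gains :: "((real ^ 'n) \<times> (real ^ 'n) \<Rightarrow> int) set" where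
  "gains = PiE (pts B \<times> pts H) (\<lambda>a. {- int (dim (fib V (snd a)))..int (dim (fib V (snd a)))})"

lemma finite_pairs: "finite (pts B \<times> pts H)"
  using finite_pts[OF levels_B] finite_pts[OF H] by (rule finite_cartesian_product)

lemma pp_gain: "piecewise_polynomial (gain \<delta>)"
proof -
  have s: "semialgebraic {z :: (real ^ 'n) \<times> (real ^ 'n) \<times> real. a \<in> act (fst z)}" for a
    using semialgebraic_act[of "fst a" "snd a"] by simp
  have "piecewise_polynomial (\<lambda>z. gain \<delta> z)"
    unfolding gain_def
    by (intro piecewise_polynomial_sum finite_pairs piecewise_polynomial_if piecewise_polynomial_mult pp_cw'
        piecewise_polynomial_const s)
  then show ?thesis .
qed

lemma gain_compare:
  assumes D: "adm P D" and D': "adm P D'" and P: "P \<subseteq> pts B \<times> pts H"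
  obtains \<delta> where "\<delta> \<in> gains" "\<And>x y \<theta>. x \<in> IS \<Longrightarrow> reaches x \<Longrightarrow> act x = P \<Longrightarrow>
    (\<Sum>(k, h)\<in>P. real (dim (D' k h)) * cw x \<theta> k h) \<le> (\<Sum>(k, h)\<in>P. real (dim (D k h)) * cw x \<theta> k h) \<longleftrightarrow>
    \<not> gain \<delta> (x, y, \<theta>) > 0"
proof -
  define \<delta> where "\<delta> = restrict (\<lambda>a. if a \<in> P then int (dim (D' (fst a) (snd a))) - int (dim (D (fst a) (snd a))) else 0)
    (pts B \<times> pts H)"
  have le: "dim (C k h) \<le> dim (fib V h)" if C: "adm P C" and a: "(k, h) \<in> P" for C k h
  proof -
    have "C k h \<subseteq> fib V h" using C a unfolding adm_def by simp
    moreover have "h \<in> pts H" using P a by blast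
    ultimately show ?thesis using dim_mono_findim[OF Pers_findim[OF VP pts_index_space[OF H]]] by blast
  qed
  have "\<delta> \<in> gains" unfolding gains_def
  proof (rule PiE_I)
    fix a assume a: "a \<in> pts B \<times> pts H"
    show "\<delta> a \<in> {- int (dim (fib V (snd a)))..int (dim (fib V (snd a)))}"
    proof (cases "a \<in> P")
      case True
      then have "dim (D' (fst a) (snd a)) \<le> dim (fib V (snd a))" "dim (D (fst a) (snd a)) \<le> dim (fib V (snd a))"
        using le[OF D', of "fst a" "snd a"] le[OF D, of "fst a" "snd a"] by simp_all
      then show ?thesis using True a by (simp add: \<delta>_def)
    next
      case False then show ?thesis using a by (simp add: \<delta>_def)
    qed
  qed (simp add: \<delta>_def)
  moreover have "(\<Sum>(k, h)\<in>P. real (dim (D' k h)) * cw x \<theta> k h) \<le> (\<Sum>(k, h)\<in>P. real (dim (D k h)) * cw x \<theta> k h) \<longleftrightarrow>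
    \<not> gain \<delta> (x, y, \<theta>) > 0" if x: "x \<in> IS" and re: "reaches x" and act: "act x = P" for x y \<theta>
  proof -
    have "gain \<delta> (x, y, \<theta>) = (\<Sum>a\<in>P. cw' x \<theta> (fst a) (snd a) * real_of_int (\<delta> a))"
      unfolding gain_def by (rule sum.mono_neutral_cong_right[OF finite_pairs P]) (simp_all add: act)
    also have "\<dots> = (\<Sum>a\<in>P. real (dim (D' (fst a) (snd a))) * cw x \<theta> (fst a) (snd a) -
       real (dim (D (fst a) (snd a))) * cw x \<theta> (fst a) (snd a))"
    proof (rule sum.cong[OF refl])
      fix a assume a: "a \<in> P"
      have "a \<in> pts B \<times> pts H" using a P by (rule subsetD[rotated])
      moreover have "cw x \<theta> (fst a) (snd a) = cw' x \<theta> (fst a) (snd a)" by (rule cw'_eq[OF x re]) (simp add: act a)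
      ultimately show "cw' x \<theta> (fst a) (snd a) * real_of_int (\<delta> a) =
         real (dim (D' (fst a) (snd a))) * cw x \<theta> (fst a) (snd a) - real (dim (D (fst a) (snd a))) * cw x \<theta> (fst a) (snd a)"
        using a by (simp add: \<delta>_def algebra_simps)
    qed
    also have "\<dots> = (\<Sum>(k, h)\<in>P. real (dim (D' k h)) * cw x \<theta> k h) - (\<Sum>(k, h)\<in>P. real (dim (D k h)) * cw x \<theta> k h)"
      by (simp add: sum_subtractf case_prod_unfold)
    finally show ?thesis by linarith
  qed
  ultimately show ?thesis by (rule that)
qed

definition conditions :: "((real ^ 'n) \<times> (real ^ 'n) \<times> real) set set" where
  "conditions = {{z. 0 < snd (snd z)}} \<union> (\<lambda>(i, h). {z. h \<le> fst z $ i}) ` Sigma UNIV H \<union>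
     (\<lambda>(i, h). {z. h \<le> fst (snd z) $ i}) ` Sigma UNIV H \<union> (\<lambda>(i, h). {z. h \<le> fst z $ i + c $ i}) ` Sigma UNIV H \<union>
     (\<lambda>a. {z. a \<in> act (fst z)}) ` (pts B \<times> pts H) \<union> (\<lambda>\<delta>. {z. gain \<delta> z > 0}) ` gains"

lemma finite_conditions: "finite conditions"
proof -
  have "finite (Sigma UNIV H)" by (rule finite_SigmaI) (simp_all add: levels_finite[OF H])
  moreover have "finite gains" unfolding gains_def by (rule finite_PiE[OF finite_pairs]) simp
  ultimately show ?thesis unfolding conditions_def using finite_pairs by simp
qed

lemma semialgebraic_conditions: "S \<in> conditions \<Longrightarrow> semialgebraic S"
  unfolding conditions_def
proof (elim UnE imageE)
  show "semialgebraic S" if "S \<in> {{z. 0 < snd (snd z)}}"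
    using that semialgebraic_pos[OF pp_coordinates(3)] by simp
  show "semialgebraic S" if S: "S = (case a of (i, h) \<Rightarrow> {z. h \<le> fst z $ i})" for a
    unfolding S by (cases a) (simp add: semialgebraic_le piecewise_polynomial_const pp_coordinates)
  show "semialgebraic S" if S: "S = (case a of (i, h) \<Rightarrow> {z. h \<le> fst (snd z) $ i})" for a
    unfolding S by (cases a) (simp add: semialgebraic_le piecewise_polynomial_const pp_coordinates)
  show "semialgebraic S" if S: "S = (case a of (i, h) \<Rightarrow> {z. h \<le> fst z $ i + c $ i})" for a
    unfolding S by (cases a) (simp add: semialgebraic_le piecewise_polynomial_const piecewise_polynomial_add pp_coordinates)
  show "semialgebraic S" if S: "S = {z. a \<in> act (fst z)}" for a
    unfolding S using semialgebraic_act[of "fst a" "snd a"] by simp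
  show "semialgebraic S" if S: "S = {z. gain \<delta> z > 0}" for \<delta>
    unfolding S by (rule semialgebraic_pos[OF pp_gain])
qed

lemma rank_constructible:
  "semialgebraically_constructible {(x, y, \<theta>). x \<in> IS \<and> y \<in> IS \<and> x \<le> y}
     (\<lambda>(x, y, \<theta>). int (HN_rank Z V x y \<theta>))"
proof (rule constructible_if_determined[OF finite_conditions semialgebraic_conditions])
  fix z z' :: "(real ^ 'n) \<times> (real ^ 'n) \<times> real"
  assume zX: "z \<in> {(x, y, \<theta>). x \<in> IS \<and> y \<in> IS \<and> x \<le> y}" and zX': "z' \<in> {(x, y, \<theta>). x \<in> IS \<and> y \<in> IS \<and> x \<le> y}"
    and eq: "\<And>S. S \<in> conditions \<Longrightarrow> z \<in> S \<longleftrightarrow> z' \<in> S"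
  obtain x y \<theta> where z: "z = (x, y, \<theta>)" by (cases z)
  obtain x' y' \<theta>' where z': "z' = (x', y', \<theta>')" by (cases z')
  have X: "x \<in> IS" "y \<in> IS" "x \<le> y" and X': "x' \<in> IS" "y' \<in> IS" "x' \<le> y'" using zX zX' by (simp_all add: z z')
  have mem: "{z. h \<le> fst z $ i} \<in> conditions" "{z. h \<le> fst (snd z) $ i} \<in> conditions"
    "{z. h \<le> fst z $ i + c $ i} \<in> conditions" if h: "h \<in> H i" for i h
    unfolding conditions_def
      apply (rule UnI1, rule UnI1, rule UnI1, rule UnI1, rule UnI2, rule image_eqI[where x="(i, h)"]; simp add: h)
     apply (rule UnI1, rule UnI1, rule UnI1, rule UnI2, rule image_eqI[where x="(i, h)"]; simp add: h)
    by (rule UnI1, rule UnI1, rule UnI2, rule image_eqI[where x="(i, h)"]; simp add: h)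
  have sx: "same H x x'" and sy: "same H y y'" and sc: "same H (x + c) (x' + c)"
    unfolding same_def using eq[OF mem(1)] eq[OF mem(2)] eq[OF mem(3)] by (simp_all add: z z')
  have "{z. 0 < snd (snd z)} \<in> conditions" by (simp add: conditions_def)
  from eq[OF this] have s\<theta>: "\<theta> > 0 \<longleftrightarrow> \<theta>' > 0" by (simp add: z z')
  have sub: "act x \<subseteq> pts B \<times> pts H" for x unfolding act_def by auto
  have "a \<in> act x \<longleftrightarrow> a \<in> act x'" if a: "a \<in> pts B \<times> pts H" for a
  proof -
    have "{z. a \<in> act (fst z)} \<in> conditions" unfolding conditions_def
      by (rule UnI1, rule UnI2, rule image_eqI[OF refl a])
    from eq[OF this] show ?thesis by (simp add: z z')
  qed
  then have act: "act x' = act x" using sub[of x] sub[of x'] by (intro equalityI subsetI) auto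
  have "HN_rank Z V x y \<theta> = HN_rank Z V x' y' \<theta>'"
  proof (rule rank_cong[OF X(1) X'(1) X(2) X'(2) X(3) X'(3) sx sy sc s\<theta> act])
    fix D D' assume re: "reaches x" "reaches x'" and D: "adm (act x) D" "adm (act x) D'"
    obtain \<delta> where d: "\<delta> \<in> gains" "\<And>u y \<theta>. u \<in> IS \<Longrightarrow> reaches u \<Longrightarrow> act u = act x \<Longrightarrow>
      (\<Sum>(k, h)\<in>act x. real (dim (D' k h)) * cw u \<theta> k h) \<le> (\<Sum>(k, h)\<in>act x. real (dim (D k h)) * cw u \<theta> k h) \<longleftrightarrow>
      \<not> gain \<delta> (u, y, \<theta>) > 0" using gain_compare[OF D sub] by blast
    have "{z. gain \<delta> z > 0} \<in> conditions" unfolding conditions_def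
      by (rule UnI2, rule image_eqI[OF refl d(1)])
    from eq[OF this] have "gain \<delta> (x, y, \<theta>) > 0 \<longleftrightarrow> gain \<delta> (x', y', \<theta>') > 0" by (simp add: z z')
    then show "(\<Sum>(k, h)\<in>act x. real (dim (D' k h)) * cw x \<theta> k h) \<le> (\<Sum>(k, h)\<in>act x. real (dim (D k h)) * cw x \<theta> k h) \<longleftrightarrow>
      (\<Sum>(k, h)\<in>act x. real (dim (D' k h)) * cw x' \<theta>' k h) \<le> (\<Sum>(k, h)\<in>act x. real (dim (D k h)) * cw x' \<theta>' k h)"
      unfolding d(2)[OF X(1) re(1) refl, of _ y] d(2)[OF X'(1) re(2) act, of _ y'] by simp
  qed
  then show "(case z of (x, y, \<theta>) \<Rightarrow> int (HN_rank Z V x y \<theta>)) = (case z' of (x, y, \<theta>) \<Rightarrow> int (HN_rank Z V x y \<theta>))"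
    by (simp add: z z')
qed

end

text \<open>
  Adding the largest difference of levels of \<open>V\<close> to \<open>c\<close> ensures that a translate with some level
  below \<open>c\<close> has all its levels below \<open>hi\<close>.
\<close>

lemma (in persistence) far_corner:
  fixes c :: "real ^ 'n"
  assumes H: "levels K H" and c: "c \<in> IS"
  obtains hi where "hi \<in> IS" "c \<le> hi" "\<And>i h h'. h \<in> H i \<Longrightarrow> h' \<in> H i \<Longrightarrow> c $ i + (h - h') \<le> hi $ i"
proof -
  let ?G = "\<lambda>i. insert 0 ((\<lambda>(h, h'). h - h') ` (H i \<times> H i))"
  let ?hi = "(\<chi> i. c $ i + Max (?G i)) :: real ^ 'n"
  have fin: "finite (?G i)" for i using levels_finite[OF H] by simp
  have "Max (?G i) \<in> ?G i" for i using Max_in[OF fin] by simp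
  moreover have "?G i \<subseteq> K" for i
    using K_0 K_diff levels_subset[OF H] by (auto simp: insert_subset)
  ultimately have "Max (?G i) \<in> K" for i by (rule subsetD[rotated])
  then have 1: "?hi \<in> IS" using c K_add by (simp add: index_space_def)
  have ge: "g \<in> ?G i \<Longrightarrow> g \<le> Max (?G i)" for g i by (rule Max_ge[OF fin])
  have 2: "c \<le> ?hi" using ge[of 0] by (simp add: less_eq_vec_def)
  have 3: "c $ i + (h - h') \<le> ?hi $ i" if "h \<in> H i" "h' \<in> H i" for i h h'
  proof -
    have "(h, h') \<in> H i \<times> H i" using that by simp
    then have "h - h' \<in> ?G i" by (intro insertI2 image_eqI[where x="(h, h')"]) simp_all
    then show ?thesis using ge by simp
  qed
  show ?thesis by (rule that[OF 1 2 3])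
qed

theorem propositionA5:
  fixes scale :: "'f::field \<Rightarrow> 'v::ab_group_add \<Rightarrow> 'v"
    and K :: "real set"
    and V :: "(real ^ 'n, 'v) pmod"
    and Z :: "((real ^ 'n, 'v) pmod \<Rightarrow>\<^sub>0 int) set \<Rightarrow> complex"
  assumes "persistence scale K"
    and "V \<in> persistence.Pers_fp scale K"
    and "Z \<in> persistence.stability_space scale K"
    and "\<forall>W \<in> persistence.Pers_fp scale K. Im (Z (persistence.K_class scale K W)) \<ge> 0"
  shows "semialgebraically_constructible
           {(x, y, \<theta>). x \<in> index_space K \<and> y \<in> index_space K \<and> x \<le> y}
           (\<lambda>(x, y, \<theta>). int (persistence.HN_rank scale K Z V x y \<theta>))"
proof -
  interpret persistence scale K by (rule assms(1))
  show ?thesis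
  proof (rule stability_space_formula[OF assms(3)])
    fix lo c :: "real ^ 'n"
    assume lc: "lo \<in> IS" "c \<in> IS" "lo \<le> 0" "0 \<le> c" and Z: "stability_condition Z"
      and loc: "\<And>V W. V \<in> Pers_fp \<Longrightarrow> W \<in> Pers_fp \<Longrightarrow> (\<And>q. q \<in> IS \<Longrightarrow> lo \<le> q \<Longrightarrow> q \<le> c \<Longrightarrow> dim_fun V q = dim_fun W q) \<Longrightarrow>
         Im (Z (K_class V)) = Im (Z (K_class W))"
      and f: "\<And>hi. hi \<in> IS \<Longrightarrow> c \<le> hi \<Longrightarrow> \<exists>B A r s. formula Z lo hi B A r s"
    obtain H where H: "levels K H" "adapted H V" using fp_imp_adapted[OF assms(2)] by (elim exE conjE)
    obtain hi where hi: "hi \<in> IS" "c \<le> hi" and gap: "\<And>i h h'. h \<in> H i \<Longrightarrow> h' \<in> H i \<Longrightarrow> c $ i + (h - h') \<le> hi $ i"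
      by (rule far_corner[OF H(1) lc(2)]) (rule that)
    obtain B A r s where form: "formula Z lo hi B A r s" using f[OF hi] by (elim exE)
    interpret translates scale K Z V H lo c hi B A r s
    proof unfold_locales
      show "Im (Z (K_class W)) \<ge> 0" if "W \<in> Pers_fp" for W using assms(4) that by simp
      show "c $ i + (h - h') \<le> hi $ i" if "h \<in> H i" "h' \<in> H i" for i h h' by (rule gap[OF that])
      show "Im (Z (K_class V)) = Im (Z (K_class W))" if "V \<in> Pers_fp" "W \<in> Pers_fp"
        "\<And>q. q \<in> IS \<Longrightarrow> lo \<le> q \<Longrightarrow> q \<le> c \<Longrightarrow> dim_fun V q = dim_fun W q" for V W by (rule loc[OF that])
    qed (rule Z assms(2) H lc hi form)+
    show ?thesis by (rule rank_constructible)
  qed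
qed

end
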